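(* For every integer $k\ge2$ we have $\tilde\gamma_k\le\beta_k\le\gamma_k$.
   Context: A logarithmic random set is a random $\mathbf{A}\subseteq\mathbb{N}$ with each $i$ included independently with probability $1/i$. $\beta_k$ is the supremum of all $c<1$ such that, with probability tending to $1$ as $D\to\infty$, there exist distinct $A_1,\dots,A_k\subseteq\mathbf{A}\cap[D^c,D]$ with $\sum_{a\in A_1}a=\cdots=\sum_{a\in A_k}a$. Let $\mathbf{1}=(1,\dots,1)\in\mathbb{Q}^k$. An $r$-step flag is a nested sequence $\mathscr{V}:\langle\mathbf{1}\rangle=V_0\le V_1\le\cdots\le V_r\le\mathbb{Q}^k$ of subspaces (inclusions need not be strict). A system $(\mathscr{V},\mathbf{c},\boldsymbol{\mu})$ consists of: an $r$-step flag $\mathscr{V}$ ($r\ge1$) whose members $V_j$ are distinct and spanned by elements of $\{0,1\}^k$, and which is nondegenerate, i.e. $V_r$ is not contained in any hyperplane $\{x\in\mathbb{Q}^k:x_i=x_j\}$, $i\ne j$; a vector $\mathbf{c}=(c_1,\dots,c_{r+1})$ with $1\ge c_1\ge\cdots\ge c_{r+1}\ge0$; and probability measures $\boldsymbol{\mu}=(\mu_1,\dots,\mu_r)$ with $\mathrm{Supp}(\mu_i)\subseteq V_i\cap\{0,1\}^k$. For a finitely supported probability measure $\nu$ on $\mathbb{Q}^k$ and a subspace $W$, $\mathbb{H}_\nu(W):=-\sum_x\nu(x)\log\nu(W+x)$. A subflag $\mathscr{V}'\le\mathscr{V}$ is a flag $\langle\mathbf{1}\rangle=V_0'\le V_1'\le\cdots\le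 V_r'$ with $V_i'\le V_i$ for all $i$; it is proper if $\mathscr{V}'\ne\mathscr{V}$. Define \[e(\mathscr{V}',\mathbf{c},\boldsymbol{\mu}):=\sum_{j=1}^r(c_j-c_{j+1})\mathbb{H}_{\mu_j}(V_j')+\sum_{j=1}^r c_j\dim(V_j'/V_{j-1}').\] The system satisfies the entropy condition if $e(\mathscr{V}',\mathbf{c},\boldsymbol{\mu})\ge e(\mathscr{V},\mathbf{c},\boldsymbol{\mu})$ for all subflags $\mathscr{V}'$, and the strict entropy condition if $e(\mathscr{V}',\mathbf{c},\boldsymbol{\mu})>e(\mathscr{V},\mathbf{c},\boldsymbol{\mu})$ for all proper subflags $\mathscr{V}'$. $\gamma_k$ (resp. $\tilde\gamma_k$) is the supremum of all $c$ for which there is a system (of any number of steps $r$) with $c_{r+1}=c$ satisfying the entropy condition (resp. the strict entropy condition). *)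

theory Defs
  imports "HOL-Probability.Probability"
begin

definition log_random_measure :: "(nat \<Rightarrow> bool) measure" where
  "log_random_measure = PiM {1..} (\<lambda>i. measure_pmf (bernoulli_pmf (1 / real i)))"

definition random_set :: "(nat \<Rightarrow> bool) \<Rightarrow> nat set" where
  "random_set \<omega> = {i \<in> {1..}. \<omega> i}"

definition has_equal_sums :: "nat \<Rightarrow> nat set \<Rightarrow> bool" where
  "has_equal_sums k S \<longleftrightarrow>
     (\<exists>A :: nat \<Rightarrow> nat set. inj_on A {1..k} \<and> (\<forall>i\<in>{1..k}. A i \<subseteq> S) \<and>
        (\<forall>i\<in>{1..k}. \<forall>j\<in>{1..k}. \<Sum>(A i) = \<Sum>(A j)))"

definition equal_sums_event :: "nat \<Rightarrow> real \<Rightarrow> real \<Rightarrow> (nat \<Rightarrow> bool) set" where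
  "equal_sums_event k c D =
     {\<omega> \<in> space log_random_measure.
        has_equal_sums k {a \<in> random_set \<omega>. D powr c \<le> real a \<and> real a \<le> D}}"

lemma equal_sums_event_measurable: "equal_sums_event k c D \<in> sets log_random_measure"
proof -
  define N where "N = {a::nat. 1 \<le> a \<and> D powr c \<le> real a \<and> real a \<le> D}"
  have fin: "finite N"
    by (rule finite_subset[of _ "{..nat \<lfloor>D\<rfloor>}"]) (auto simp: N_def le_nat_floor)
  have eq: "{a \<in> random_set \<omega>. D powr c \<le> real a \<and> real a \<le> D} = {a \<in> N. \<omega> a}" for \<omega>
    by (auto simp: random_set_def N_def)
  have "equal_sums_event k c D =
      {\<omega> \<in> space log_random_measure.
         \<exists>F\<in>{F \<in> Pow N. has_equal_sums k F}. \<forall>a\<in>N. \<omega> a \<longleftrightarrow> a \<in> F}"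
    unfolding equal_sums_event_def eq
  proof (rule Collect_cong, rule conj_cong[OF refl], rule iffI)
    fix \<omega> assume "has_equal_sums k {a \<in> N. \<omega> a}"
    then show "\<exists>F\<in>{F \<in> Pow N. has_equal_sums k F}. \<forall>a\<in>N. \<omega> a \<longleftrightarrow> a \<in> F"
      by (intro bexI[of _ "{a \<in> N. \<omega> a}"]) auto
  next
    fix \<omega> assume "\<exists>F\<in>{F \<in> Pow N. has_equal_sums k F}. \<forall>a\<in>N. \<omega> a \<longleftrightarrow> a \<in> F"
    then obtain F where F: "F \<subseteq> N" "has_equal_sums k F" "\<forall>a\<in>N. \<omega> a \<longleftrightarrow> a \<in> F"
      by auto
    then have "{a \<in> N. \<omega> a} = F" by auto
    with F show "has_equal_sums k {a \<in> N. \<omega> a}" by simp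
  qed
  also have "\<dots> \<in> sets log_random_measure"
  proof (intro sets.sets_Collect_finite_Ex sets.sets_Collect_finite_All sets.sets_Collect)
    fix F a assume "a \<in> N"
    then have a: "a \<in> {1..}" by (auto simp: N_def)
    have "(\<lambda>\<omega>. \<omega> a) \<in> log_random_measure \<rightarrow>\<^sub>M count_space UNIV"
      unfolding log_random_measure_def
      using measurable_component_singleton[OF a, of "\<lambda>i. measure_pmf (bernoulli_pmf (1 / real i))"]
      by (simp cong: measurable_cong_sets)
    then show "{\<omega> \<in> space log_random_measure. \<omega> a = (a \<in> F)} \<in> sets log_random_measure"
      by measurable
  qed (use fin in auto)
  finally show ?thesis .
qed

text \<open>
  The suprema below are taken in the extended reals, so that no convention for the real
  supremum of an empty set enters.
\<close>

definition beta :: "nat \<Rightarrow> ereal" where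
  "beta k = Sup (ereal ` {c. c < 1 \<and>
     ((\<lambda>D. measure log_random_measure (equal_sums_event k c D)) \<longlongrightarrow> 1) at_top})"

text \<open>
  The space of rational column vectors of length \<open>k = CARD('k)\<close> is \<^typ>\<open>rat ^ 'k\<close>.
  Flags, the parameters \<open>c\<close> and the measures \<open>\<mu>\<close> are indexed by natural numbers; only the
  indices \<open>0..r\<close>, \<open>1..r+1\<close> and \<open>1..r\<close>, respectively, are ever looked at.
\<close>

definition cube :: "(rat ^ 'k) set" where
  "cube = {x. \<forall>i. x $ i \<in> {0, 1}}"

definition flag :: "nat \<Rightarrow> (nat \<Rightarrow> (rat ^ 'k) set) \<Rightarrow> bool" where
  "flag r V \<longleftrightarrow> V 0 = vec.span {\<chi> i. 1} \<and> (\<forall>j\<le>r. vec.subspace (V j)) \<and>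
     (\<forall>j<r. V j \<subseteq> V (Suc j))"

definition nondegenerate :: "nat \<Rightarrow> (nat \<Rightarrow> (rat ^ 'k) set) \<Rightarrow> bool" where
  "nondegenerate r V \<longleftrightarrow> (\<forall>i i'. i \<noteq> i' \<longrightarrow> \<not> V r \<subseteq> {x. x $ i = x $ i'})"

definition system ::
  "nat \<Rightarrow> (nat \<Rightarrow> (rat ^ 'k) set) \<Rightarrow> (nat \<Rightarrow> real) \<Rightarrow> (nat \<Rightarrow> (rat ^ 'k) pmf) \<Rightarrow> bool" where
  "system r V c \<mu> \<longleftrightarrow>
     1 \<le> r \<and> flag r V \<and> inj_on V {0..r} \<and>
     (\<forall>j\<le>r. \<exists>S. S \<subseteq> cube \<and> V j = vec.span S) \<and> nondegenerate r V \<and>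
     c 1 \<le> 1 \<and> (\<forall>j\<in>{1..r}. c (j + 1) \<le> c j) \<and> 0 \<le> c (r + 1) \<and>
     (\<forall>j\<in>{1..r}. set_pmf (\<mu> j) \<subseteq> V j \<inter> cube)"

definition coset_entropy :: "(rat ^ 'k) pmf \<Rightarrow> (rat ^ 'k) set \<Rightarrow> real" where
  "coset_entropy \<nu> W =
     - (\<Sum>x\<in>set_pmf \<nu>. pmf \<nu> x * ln (measure_pmf.prob \<nu> ((\<lambda>w. w + x) ` W)))"

definition subflag ::
  "nat \<Rightarrow> (nat \<Rightarrow> (rat ^ 'k) set) \<Rightarrow> (nat \<Rightarrow> (rat ^ 'k) set) \<Rightarrow> bool" where
  "subflag r V' V \<longleftrightarrow> flag r V' \<and> (\<forall>j\<le>r. V' j \<subseteq> V j)"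

definition proper_subflag ::
  "nat \<Rightarrow> (nat \<Rightarrow> (rat ^ 'k) set) \<Rightarrow> (nat \<Rightarrow> (rat ^ 'k) set) \<Rightarrow> bool" where
  "proper_subflag r V' V \<longleftrightarrow> subflag r V' V \<and> (\<exists>j\<le>r. V' j \<noteq> V j)"

text \<open>Dimension of the quotient \<open>U/W\<close>, for subspaces \<open>W \<subseteq> U\<close>.\<close>

definition quotient_dim :: "(rat ^ 'k) set \<Rightarrow> (rat ^ 'k) set \<Rightarrow> real" where
  "quotient_dim U W = real (vec.dim U) - real (vec.dim W)"

definition flag_entropy ::
  "nat \<Rightarrow> (nat \<Rightarrow> (rat ^ 'k) set) \<Rightarrow> (nat \<Rightarrow> real) \<Rightarrow> (nat \<Rightarrow> (rat ^ 'k) pmf) \<Rightarrow> real" where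
  "flag_entropy r V' c \<mu> =
     (\<Sum>j=1..r. (c j - c (j + 1)) * coset_entropy (\<mu> j) (V' j)) +
     (\<Sum>j=1..r. c j * quotient_dim (V' j) (V' (j - 1)))"

definition entropy_condition ::
  "nat \<Rightarrow> (nat \<Rightarrow> (rat ^ 'k) set) \<Rightarrow> (nat \<Rightarrow> real) \<Rightarrow> (nat \<Rightarrow> (rat ^ 'k) pmf) \<Rightarrow> bool" where
  "entropy_condition r V c \<mu> \<longleftrightarrow>
     (\<forall>V'. subflag r V' V \<longrightarrow> flag_entropy r V' c \<mu> \<ge> flag_entropy r V c \<mu>)"

definition strict_entropy_condition ::
  "nat \<Rightarrow> (nat \<Rightarrow> (rat ^ 'k) set) \<Rightarrow> (nat \<Rightarrow> real) \<Rightarrow> (nat \<Rightarrow> (rat ^ 'k) pmf) \<Rightarrow> bool" where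
  "strict_entropy_condition r V c \<mu> \<longleftrightarrow>
     (\<forall>V'. proper_subflag r V' V \<longrightarrow> flag_entropy r V' c \<mu> > flag_entropy r V c \<mu>)"

text \<open>The argument \<open>TYPE('k)\<close> of the next two constants carries \<open>k = CARD('k)\<close>.\<close>

definition gamma :: "'k::finite itself \<Rightarrow> ereal" where
  "gamma t = Sup (ereal ` {c (r + 1) | r (V :: nat \<Rightarrow> (rat ^ 'k) set) c \<mu>.
     system r V c \<mu> \<and> entropy_condition r V c \<mu>})"

definition gamma_tilde :: "'k::finite itself \<Rightarrow> ereal" where
  "gamma_tilde t = Sup (ereal ` {c (r + 1) | r (V :: nat \<Rightarrow> (rat ^ 'k) set) c \<mu>.
     system r V c \<mu> \<and> strict_entropy_condition r V c \<mu>})"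

end

theory Submission imports Defs begin

text \<open>
  Distinct subsets with equal sums amount to an assignment of vectors \<open>\<omega>\<^sub>a \<in> {0,1}\<^sup>k\<close> to the elements
  \<open>a\<close> of the random set with \<open>\<Sum> a \<omega>\<^sub>a \<in> \<langle>\<one>\<rangle>\<close> that separates the coordinates.

  Lower bound. For a strict system, restrict the assignment on the scale between \<open>D\<close> to the power
  \<open>c\<^sub>j\<^sub>+\<^sub>1\<close> and \<open>D\<close> to the power \<open>c\<^sub>j\<close> to typical sequences for \<open>\<mu>\<^sub>j\<close>. Two independent such assignments
  have equal sums modulo \<open>\<langle>\<one>\<rangle>\<close> with probability governed by the subflags that they can generate, and the
  strict entropy condition makes the full flag dominant; by the Cauchy--Schwarz inequality the number of
  distinct sums is within a constant factor of the largest possible one. A few fresh elements of a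
  bounded multiplicative range then complete one of the sums to a solution with probability bounded
  below, and this trial can be repeated many times on nested regions.

  Upper bound. If no system with \<open>c\<^sub>r\<^sub>+\<^sub>1 = c\<close> satisfies the entropy condition, compactness yields a uniform
  gap: every system has a subflag whose entropy is smaller by a fixed amount. A solution has pivots, the
  largest elements at which the span of the vectors seen so far grows; they determine a system, and
  counting the solutions modulo the subflag of that system (type classes for the cosets of the vectors,
  linear functionals for the pivots) gives a first moment that decays like a power of \<open>D\<close>.
\<close>

section \<open>Common tools: the random set as a finite weighted sum over subsets\<close>

section \<open>Finite random subsets\<close>

text \<open>The two halves tolerate very different losses. The upper bound has a gap that is a power
  of D, so factors polynomial in log D are free: logarithms of pivots are rounded to integers, ranks
  and counts are guessed by union bounds. The lower bound has no such room, since a trial succeeds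
  with a probability comparable to the proportion of possible sums that is really reached; their
  number must be known up to a constant. Each scale is therefore cut into windows of fixed
  logarithmic length, proportional to a large constant \<open>T\<close> independent of D. All errors
  (atypical tuples, windows with too few elements, the loss \<open>eps\<close> in entropy) are
  charged to the positions where the space generated by a pair of assignments has not yet reached
  the flag. Each such position gains \<open>T * eps\<^sub>0 / 2\<close> net from the strict gap, so
  the sum over all configurations is a convergent geometric series. Both halves rely on the fact
  that only finitely many subspaces matter, those spanned by vectors with entries in {-1, 0, 1},
  because entropies of measures on the cube see no others.\<close>

definition wt :: "nat set => nat set => real" where
 "wt G A = (\<Prod>a\<in>G. if a \<in> A then 1 / real a else 1 - 1 / real a)"

text \<open>Explicit weights make every probability below a finite sum, so that no measurability
  arises; \<open>measure_cylinder\<close> transfers the results to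
  \<open>log_random_measure\<close>. For a = 0 the two factors are 0 and 1, so the weights still
  form a probability vector.\<close>

definition expect :: "nat set => (nat set => real) => real" where
 "expect G f = (\<Sum>A\<in>Pow G. wt G A * f A)"

lemma wt_nonneg: "0 <= wt G A"
 unfolding wt_def
proof (rule prod_nonneg)
 fix a show "0 <= (if a \<in> A then 1 / real a else 1 - 1 / real a)"
  by (cases a) (auto simp: field_simps)
qed

lemma expect_empty [simp]: "expect {} f = f {}"
 by (simp add: expect_def wt_def)

lemma expect_insert:
 assumes "finite G" "a \<notin> G"
 shows "expect (insert a G) f =
  (1 / real a) * expect G (%A. f (insert a A)) + (1 - 1 / real a) * expect G f"
proof -
 have w1: "wt (insert a G) (insert a A) = (1 / real a) * wt G A" if "A \<in> Pow G" for A
 proof -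
  have "(\<Prod>x\<in>G. if x \<in> insert a A then 1 / real x else 1 - 1 / real x) = wt G A"
   unfolding wt_def using assms(2) by (intro prod.cong) auto
  then show ?thesis using assms by (simp add: wt_def)
 qed
 have w2: "wt (insert a G) A = (1 - 1 / real a) * wt G A" if "A \<in> Pow G" for A
  using assms that by (auto simp: wt_def)
 have "expect (insert a G) f = (\<Sum>A\<in>Pow G. wt (insert a G) A * f A)
   + (\<Sum>A\<in>insert a ` Pow G. wt (insert a G) A * f A)"
  unfolding expect_def Pow_insert using assms
  by (intro sum.union_disjoint) auto
 also have "(\<Sum>A\<in>insert a ` Pow G. wt (insert a G) A * f A)
   = (\<Sum>A\<in>Pow G. wt (insert a G) (insert a A) * f (insert a A))"
  using assms by (subst sum.reindex) (auto intro!: inj_onI simp: o_def)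
 also have "... = (1 / real a) * expect G (%A. f (insert a A))"
  unfolding expect_def sum_distrib_left by (intro sum.cong refl) (simp only: w1 mult.assoc)
 also have "(\<Sum>A\<in>Pow G. wt (insert a G) A * f A) = (1 - 1 / real a) * expect G f"
  unfolding expect_def sum_distrib_left by (intro sum.cong refl) (simp only: w2 mult.assoc)
 finally show ?thesis by simp
qed

lemma expect_Un:
 assumes "finite G" "finite H" "G \<inter> H = {}"
 shows "expect (G \<union> H) f = expect G (%A. expect H (%B. f (A \<union> B)))"
 using assms
proof (induction G arbitrary: f rule: finite_induct)
 case (insert a G)
 have "expect (insert a G \<union> H) f = expect (insert a (G \<union> H)) f" by simp
 also have "... = (1 / real a) * expect (G \<union> H) (%A. f (insert a A))
   + (1 - 1 / real a) * expect (G \<union> H) f"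
  using insert by (intro expect_insert) auto
 finally show ?case
  using insert by (simp add: expect_insert)
qed auto

lemma expect_cong: "(!!A. A \<subseteq> G ==> f A = g A) ==> expect G f = expect G g"
 unfolding expect_def by (intro sum.cong) auto

lemma expect_mono: "(!!A. A \<subseteq> G ==> f A <= g A) ==> expect G f <= expect G g"
 unfolding expect_def by (intro sum_mono mult_left_mono wt_nonneg) auto

lemma expect_nonneg: "(!!A. A \<subseteq> G ==> 0 <= f A) ==> 0 <= expect G f"
 unfolding expect_def by (intro sum_nonneg mult_nonneg_nonneg wt_nonneg) auto

lemma expect_add: "expect G (%A. f A + g A) = expect G f + expect G g"
 unfolding expect_def by (simp add: algebra_simps sum.distrib)

lemma expect_cmult: "expect G (%A. c * f A) = c * expect G f"
 unfolding expect_def sum_distrib_left by (intro sum.cong) auto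

lemma expect_diff: "expect G (%A. f A - g A) = expect G f - expect G g"
 unfolding expect_def by (simp add: algebra_simps sum_subtractf)

lemma expect_sum: "expect G (%A. \<Sum>i\<in>I. f i A) = (\<Sum>i\<in>I. expect G (f i))"
 unfolding expect_def by (simp add: sum_distrib_left) (rule sum.swap)

lemma expect_const [simp]: "finite G ==> expect G (%_. c) = c"
 by (induction G rule: finite_induct) (auto simp: expect_insert algebra_simps)

lemma expect_Int:
 assumes "finite G" "H \<subseteq> G"
 shows "expect G (%A. f (A \<inter> H)) = expect H f"
proof -
 have fin: "finite H" "finite (G - H)" using assms finite_subset by auto
 have "expect G (%A. f (A \<inter> H)) = expect (H \<union> (G - H)) (%A. f (A \<inter> H))"
  using assms by (simp add: Un_absorb1)
 also have "... = expect H (%A. expect (G - H) (%B. f ((A \<union> B) \<inter> H)))"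
  using fin by (intro expect_Un) auto
 also have "... = expect H (%A. expect (G - H) (%B. f A))"
  by (intro expect_cong) (smt (verit) Diff_disjoint Int_Un_distrib2 Int_absorb2 Un_empty_right
    disjoint_iff subset_iff inf.orderE Int_commute)
 finally show ?thesis using fin by simp
qed

lemma expect_cmult_right: "expect G (%A. f A * c) = expect G f * c"
 unfolding expect_def sum_distrib_right by (intro sum.cong) auto

lemma expect_prod_Int:
 fixes I :: "'i => nat set"
 assumes "finite L" "!!l. l \<in> L ==> finite (I l)"
  and "!!l l'. l \<in> L ==> l' \<in> L ==> l ~= l' ==> I l \<inter> I l' = {}"
 shows "expect (\<Union>l\<in>L. I l) (%A. \<Prod>l\<in>L. f l (A \<inter> I l)) = (\<Prod>l\<in>L. expect (I l) (f l))"
 using assms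
proof (induction L rule: finite_induct)
 case (insert l L)
 let ?G = "\<Union>l\<in>L. I l"
 have dis: "I l \<inter> ?G = {}" using insert.hyps insert.prems by auto
 have "expect (\<Union>l\<in>insert l L. I l) (%A. \<Prod>l\<in>insert l L. f l (A \<inter> I l))
  = expect (I l) (%A. expect ?G (%B. \<Prod>l\<in>insert l L. f l ((A \<union> B) \<inter> I l)))"
  using insert dis by (simp only: UN_insert) (rule expect_Un, auto)
 also have "... = expect (I l) (%A. expect ?G (%B. f l A * (\<Prod>l\<in>L. f l (B \<inter> I l))))"
 proof (intro expect_cong)
  fix A B assume AB: "A \<subseteq> I l" "B \<subseteq> ?G"
  have "(A \<union> B) \<inter> I l = A" using AB dis by auto
  moreover have "(A \<union> B) \<inter> I l' = B \<inter> I l'" if "l' \<in> L" for l'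
   using AB dis that insert.hyps by auto
  ultimately show "(\<Prod>l\<in>insert l L. f l ((A \<union> B) \<inter> I l)) = f l A * (\<Prod>l\<in>L. f l (B \<inter> I l))"
   using insert.hyps by simp
 qed
 also have "... = expect (I l) (f l) * (\<Prod>l\<in>L. expect (I l) (f l))"
  using insert by (simp add: expect_cmult expect_cmult_right)
 finally show ?case using insert.hyps by simp
qed auto

abbreviation prb :: "nat set => (nat set => bool) => real" where
 "prb G P \<equiv> expect G (%A. of_bool (P A))"

lemma prb_mono: "(!!A. A \<subseteq> G ==> P A ==> Q A) ==> prb G P <= prb G Q"
 by (intro expect_mono) auto

lemma prb_compl: "finite G ==> prb G (%A. \<not> P A) = 1 - prb G P"
 using expect_diff[of G "%_. 1" "%A. of_bool (P A)"] by (simp add: of_bool_not_iff)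

lemma prb_disj: "prb G (%A. P A \<or> Q A) <= prb G P + prb G Q"
 unfolding expect_add[symmetric] by (intro expect_mono) auto

lemma prb_Bex: "finite I ==> prb G (%A. \<exists>i\<in>I. P i A) <= (\<Sum>i\<in>I. prb G (P i))"
 unfolding expect_sum[symmetric]
proof (intro expect_mono)
 fix A assume fin: "finite I"
 show "of_bool (\<exists>i\<in>I. P i A) <= (\<Sum>i\<in>I. of_bool (P i A) :: real)"
 proof (cases "\<exists>i\<in>I. P i A")
  case True
  then obtain i where i: "i \<in> I" "P i A" by auto
  have "of_bool (P i A) <= (\<Sum>i\<in>I. of_bool (P i A) :: real)"
   by (rule member_le_sum) (use i fin in auto)
  then show ?thesis using i by auto
 qed (auto intro!: sum_nonneg)
qed

lemma prb_markov:
 assumes "!!A. A \<subseteq> G ==> 0 <= f A" "0 < t"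
 shows "prb G (%A. t <= f A) <= expect G f / t"
proof -
 have "t * prb G (%A. t <= f A) <= expect G f"
  unfolding expect_cmult[symmetric] using assms by (intro expect_mono) auto
 then show ?thesis using assms by (simp add: field_simps)
qed

text \<open>Inclusion of K is independent of the rest of the set, whence this Mecke-type formula. It
  turns the probability that the random set contains some admissible set of pivots into a weighted
  count of such sets.\<close>

lemma expect_superset:
 assumes "finite G" "K \<subseteq> G"
 shows "expect G (%A. of_bool (K \<subseteq> A) * f (A - K)) = (\<Prod>a\<in>K. 1 / real a) * expect G (%B. f (B - K))"
proof -
 have fin: "finite K" "finite (G - K)" using assms finite_subset by auto
 have G: "G = K \<union> (G - K)" using assms by auto
 have inner: "f (A \<union> B - K) = f B" if "A \<subseteq> K" "B \<subseteq> G - K" for A B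
  using that by (intro arg_cong[of _ _ f]) auto
 have "expect G (%A. of_bool (K \<subseteq> A) * f (A - K))
  = expect K (%A. expect (G - K) (%B. of_bool (K \<subseteq> A \<union> B) * f (A \<union> B - K)))"
  by (subst G, subst expect_Un) (use fin in auto)
 also have "... = expect K (%A. of_bool (A = K) * expect (G - K) f)"
  unfolding expect_cmult[symmetric]
 proof (intro expect_cong)
  fix A B assume "A \<subseteq> K" "B \<subseteq> G - K"
  then show "of_bool (K \<subseteq> A \<union> B) * f (A \<union> B - K) = of_bool (A = K) * f B"
   by (subst inner) (auto simp: of_bool_def)
 qed
 also have "... = (\<Prod>a\<in>K. 1 / real a) * expect (G - K) f"
 proof -
  have "expect K (%A. of_bool (A = K)) = (\<Sum>A\<in>{K}. wt K A * of_bool (A = K))"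
   unfolding expect_def using fin by (intro sum.mono_neutral_right) auto
  also have "... = (\<Prod>a\<in>K. 1 / real a)" by (simp add: wt_def)
  finally show ?thesis by (simp add: expect_cmult_right)
 qed
 also have "expect (G - K) f = expect G (%B. f (B - K))"
 proof -
  have "expect G (%B. f (B - K)) = expect G (%B. f (B \<inter> (G - K)))"
   by (intro expect_cong arg_cong[of _ _ f]) auto
  then show ?thesis using expect_Int[of G "G - K" f] assms by simp
 qed
 finally show ?thesis .
qed

subsection \<open>Moments of the cardinality\<close>

definition hsum :: "nat set => real" where
 "hsum G = (\<Sum>a\<in>G. 1 / real a)"

lemma expect_card: "finite G ==> expect G (%A. real (card A)) = hsum G"
proof (induction G rule: finite_induct)
 case (insert a G)
 have "expect G (%A. real (card (insert a A))) = expect G (%A. 1 + real (card A))"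
  using insert by (intro expect_cong) (auto simp: finite_subset subset_iff card_insert_if)
 then show ?case using insert by (simp add: expect_insert expect_add hsum_def algebra_simps)
qed (simp add: hsum_def)

text \<open>An independent indicator of mean h adds the variance h (1 - h) <= h; the cross term
  vanishes because \<open>real (card A) - hsum G\<close> has mean 0.\<close>

lemma expect_card_variance:
 "finite G ==> expect G (%A. (real (card A) - hsum G)\<^sup>2) <= hsum G"
proof (induction G rule: finite_induct)
 case (insert a G)
 define h where "h = 1 / real a"
 have h: "0 <= h" "h <= 1" unfolding h_def by (cases a; simp add: field_simps)+
 have hs: "hsum (insert a G) = h + hsum G" using insert by (simp add: hsum_def h_def)
 let ?m = "hsum G"
 let ?E1 = "expect G (%A. (real (card A) - ?m)\<^sup>2)"
 have lin: "expect G (%A. real (card A) - ?m) = 0"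
  using insert by (simp add: expect_diff expect_card)
 have *: "expect G (%A. (real (card A) - ?m + d)\<^sup>2) = ?E1 + d\<^sup>2" for d
 proof -
  have "expect G (%A. (real (card A) - ?m + d)\<^sup>2)
   = expect G (%A. ((real (card A) - ?m)\<^sup>2 + (2 * d) * (real (card A) - ?m)) + d\<^sup>2)"
   by (simp add: power2_eq_square algebra_simps)
  also have "... = ?E1 + (2 * d) * expect G (%A. real (card A) - ?m) + d\<^sup>2"
   using insert by (simp only: expect_add expect_cmult expect_const)
  finally show ?thesis using lin by simp
 qed
 have "expect (insert a G) (%A. (real (card A) - hsum (insert a G))\<^sup>2)
  = h * expect G (%A. (real (card (insert a A)) - (h + ?m))\<^sup>2)
   + (1 - h) * expect G (%A. (real (card A) - (h + ?m))\<^sup>2)"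
  using insert by (simp add: expect_insert hs h_def)
 also have "expect G (%A. (real (card (insert a A)) - (h + ?m))\<^sup>2)
   = expect G (%A. (real (card A) - ?m + (1 - h))\<^sup>2)"
  using insert by (intro expect_cong) (auto simp: finite_subset subset_iff card_insert_if algebra_simps)
 also have "expect G (%A. (real (card A) - (h + ?m))\<^sup>2) = expect G (%A. (real (card A) - ?m + (- h))\<^sup>2)"
  by (simp add: algebra_simps)
 also have "h * expect G (%A. (real (card A) - ?m + (1 - h))\<^sup>2)
   + (1 - h) * expect G (%A. (real (card A) - ?m + (- h))\<^sup>2) = ?E1 + h * (1 - h)"
  unfolding * by (simp add: power2_eq_square algebra_simps)
 also have "... <= ?m + h"
  using insert.IH h by (intro add_mono) (auto simp: mult_left_le)
 finally show ?case using hs by simp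
qed (simp add: hsum_def)

lemma prb_card_deviation:
 assumes "finite G" "0 < t"
 shows "prb G (%A. t <= \<bar>real (card A) - hsum G\<bar>) <= hsum G / t\<^sup>2"
proof -
 have "prb G (%A. t <= \<bar>real (card A) - hsum G\<bar>) = prb G (%A. t\<^sup>2 <= (real (card A) - hsum G)\<^sup>2)"
  using assms by (intro expect_cong) (auto simp: abs_le_square_iff[symmetric] power2_abs)
 also have "... <= expect G (%A. (real (card A) - hsum G)\<^sup>2) / t\<^sup>2"
  using assms by (intro prb_markov) auto
 also have "... <= hsum G / t\<^sup>2"
  using assms by (intro divide_right_mono expect_card_variance) auto
 finally show ?thesis .
qed

text \<open>Half-open, so that adjacent windows on the logarithmic scale are disjoint. The omitted
  left end has to be restored by hand in \<open>card_level\<close>.\<close>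

definition expint :: "real => real => nat set" where
 "expint x y = {a. exp x < real a & real a <= exp y}"

lemma finite_expint [simp]: "finite (expint x y)"
 by (rule finite_subset[of _ "{..nat \<lfloor>exp y\<rfloor>}"]) (auto simp: expint_def le_nat_floor)

lemma expint_eq: "expint x y = {nat \<lfloor>exp x\<rfloor><..nat \<lfloor>exp y\<rfloor>}"
proof (intro set_eqI iffI)
 fix a assume "a \<in> expint x y"
 then have a: "exp x < real a" "real a <= exp y" by (auto simp: expint_def)
 have "real (nat \<lfloor>exp x\<rfloor>) <= exp x" by simp
 then have "nat \<lfloor>exp x\<rfloor> < a" using a(1) by linarith
 then show "a \<in> {nat \<lfloor>exp x\<rfloor><..nat \<lfloor>exp y\<rfloor>}" using a by (auto simp: le_nat_floor)
next
 fix a assume "a \<in> {nat \<lfloor>exp x\<rfloor><..nat \<lfloor>exp y\<rfloor>}"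
 then have a: "nat \<lfloor>exp x\<rfloor> < a" "a <= nat \<lfloor>exp y\<rfloor>" by auto
 have "real a <= real (nat \<lfloor>exp y\<rfloor>)" using a by simp
 also have "... <= exp y" by simp
 finally have "real a <= exp y" .
 moreover have "exp x < real a" using a(1) by linarith
 ultimately show "a \<in> expint x y" by (auto simp: expint_def)
qed

lemma hsum_telescope_upper:
 assumes "1 <= m" "m <= n"
 shows "(\<Sum>a\<in>{m<..n}. 1 / real a) <= ln (real n) - ln (real m)"
 using assms(2,1)
proof (induction n rule: dec_induct)
 case (step n)
 have "{m<..Suc n} = insert (Suc n) {m<..n}" using step by auto
 moreover have "1 / real (Suc n) <= ln (real (Suc n)) - ln (real n)"
 proof -
  have n: "0 < real n" using step by simp
  have "- (1 / real (Suc n)) \<ge> ln (1 - 1 / real (Suc n))"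
   using ln_le_minus_one[of "1 - 1 / real (Suc n)"] n by (simp add: field_simps)
  moreover have "1 - 1 / real (Suc n) = real n / real (Suc n)" by (simp add: field_simps)
  ultimately show ?thesis using n by (simp add: ln_div)
 qed
 ultimately show ?case using step by auto
qed auto

lemma hsum_telescope_lower:
 assumes "m <= n"
 shows "ln (real (Suc n)) - ln (real (Suc m)) <= (\<Sum>a\<in>{m<..n}. 1 / real a)"
 using assms
proof (induction n rule: dec_induct)
 case (step n)
 have "{m<..Suc n} = insert (Suc n) {m<..n}" using step by auto
 moreover have "ln (real (Suc (Suc n))) - ln (real (Suc n)) <= 1 / real (Suc n)"
 proof -
  have "ln (real (Suc (Suc n)) / real (Suc n)) <= real (Suc (Suc n)) / real (Suc n) - 1"
   by (intro ln_le_minus_one) auto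
  moreover have "real (Suc (Suc n)) / real (Suc n) - 1 = 1 / real (Suc n)"
   by (simp add: field_simps)
  ultimately show ?thesis by (simp add: ln_div del: of_nat_Suc)
 qed
 ultimately show ?case using step by auto
qed auto

text \<open>The telescoping bounds involve logarithms of integers. Rounding exp x changes it by at
  most a factor 2, because exp x >= 1, and ln 2 < 1 explains the error term.\<close>

lemma hsum_expint_le:
 assumes "0 <= x" "x <= y" shows "hsum (expint x y) <= y - x + 1"
proof -
 let ?m = "nat \<lfloor>exp x\<rfloor>" and ?n = "nat \<lfloor>exp y\<rfloor>"
 have mn: "1 <= ?m" "?m <= ?n" using assms by (auto simp: le_nat_floor nat_mono floor_mono)
 have "exp x <= 2 * real ?m"
 proof -
  have "exp x < real ?m + 1" by linarith
  then show ?thesis using mn by linarith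
 qed
 then have "x <= ln (2 * real ?m)" using mn assms by (subst ln_ge_iff) auto
 moreover have "0 < real ?m" using mn(1) by linarith
 then have "ln (2 * real ?m) = ln 2 + ln (real ?m)" by (intro ln_mult_pos) simp_all
 ultimately have "x <= ln 2 + ln (real ?m)" by simp
 moreover have "ln 2 <= (1::real)" using ln_2_less_1 by linarith
 moreover have "ln (real ?n) <= ln (exp y)" using mn assms by (intro ln_mono) auto
 ultimately show ?thesis
  using hsum_telescope_upper[OF mn] unfolding hsum_def expint_eq by simp
qed

lemma hsum_expint_ge:
 assumes "0 <= x" "x <= y" shows "y - x - 1 <= hsum (expint x y)"
proof -
 let ?m = "nat \<lfloor>exp x\<rfloor>" and ?n = "nat \<lfloor>exp y\<rfloor>"
 have mn: "1 <= ?m" "?m <= ?n" using assms by (auto simp: le_nat_floor nat_mono floor_mono)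
 have "exp y <= real (Suc ?n)" by linarith
 then have "ln (exp y) <= ln (real (Suc ?n))" by (intro ln_mono) auto
 moreover have "ln (real (Suc ?m)) <= ln (2 * exp x)"
 proof (intro ln_mono)
  have "real ?m <= exp x" by simp
  moreover have "1 <= exp x" using assms by simp
  ultimately have "1 + real ?m <= 2 * exp x" by linarith
  then show "real (Suc ?m) <= 2 * exp x" by (simp only: of_nat_Suc)
  show "0 < real (Suc ?m)" by (simp only: of_nat_0_less_iff zero_less_Suc)
 qed
 moreover have "ln (2 * exp x) = ln 2 + x" by (simp add: ln_mult)
 moreover have "ln 2 <= (1::real)" using ln_2_less_1 by linarith
 ultimately show ?thesis
  using hsum_telescope_lower[OF mn(2)] unfolding hsum_def expint_eq by simp
qed

subsection \<open>Cylinder events of the logarithmic random set\<close>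

interpretation lrm: product_prob_space "%i. measure_pmf (bernoulli_pmf (1 / real i))" "{1..}"
 by (intro product_prob_space.intro product_sigma_finite.intro product_prob_space_axioms.intro)
   (auto intro: prob_space_imp_sigma_finite measure_pmf.prob_space_axioms)

lemma measure_cylinder:
 assumes "finite G" "G \<subseteq> {1..}"
 shows "{om \<in> space log_random_measure. P (random_set om \<inter> G)} \<in> sets log_random_measure"
  and "measure log_random_measure {om \<in> space log_random_measure. P (random_set om \<inter> G)} = prb G P"
proof -
 let ?M = log_random_measure
 define C where "C F = {om \<in> space ?M. random_set om \<inter> G = F}" for F
 have Ceq: "C F = prod_emb {1..} (%i. measure_pmf (bernoulli_pmf (1 / real i))) G
   (Pi\<^sub>E G (%i. {i \<in> F}))" if "F \<subseteq> G" for F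
  unfolding C_def prod_emb_def log_random_measure_def random_set_def
  using that assms by (auto simp: space_PiM PiE_def Pi_def extensional_def restrict_def)
 have sets: "C F \<in> sets ?M" if "F \<subseteq> G" for F
  unfolding Ceq[OF that] log_random_measure_def using assms
  by (intro sets_PiM_I) auto
 have meas: "measure ?M (C F) = wt G F" if "F \<subseteq> G" for F
 proof -
  have "measure ?M (C F) = (\<Prod>i\<in>G. measure (measure_pmf (bernoulli_pmf (1 / real i))) {i \<in> F})"
   unfolding Ceq[OF that] log_random_measure_def using assms
   by (intro lrm.measure_PiM_emb) auto
  also have "... = wt G F" unfolding wt_def
  proof (intro prod.cong refl)
   fix i assume "i \<in> G"
   then have "1 <= real i" using assms by auto
   then show "measure (measure_pmf (bernoulli_pmf (1 / real i))) {i \<in> F}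
     = (if i \<in> F then 1 / real i else 1 - 1 / real i)"
    by (auto simp: measure_pmf_single)
  qed
  finally show ?thesis .
 qed
 have eq: "{om \<in> space ?M. P (random_set om \<inter> G)} = (\<Union>F\<in>{F\<in>Pow G. P F}. C F)"
  by (auto simp: C_def)
 have fin: "finite {F\<in>Pow G. P F}" using assms by auto
 show "{om \<in> space ?M. P (random_set om \<inter> G)} \<in> sets ?M"
  unfolding eq using fin sets by (intro sets.finite_UN) auto
 interpret prob_space ?M unfolding log_random_measure_def by (rule lrm.prob_space_axioms)
 have "measure ?M (\<Union>F\<in>{F\<in>Pow G. P F}. C F) = (\<Sum>F\<in>{F\<in>Pow G. P F}. measure ?M (C F))"
  using fin sets by (intro finite_measure_finite_Union) (auto simp: disjoint_family_on_def C_def)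
 also have "... = (\<Sum>F\<in>{F\<in>Pow G. P F}. wt G F)"
  using meas by (intro sum.cong) auto
 also have "... = prb G P" unfolding expect_def using assms
  by (intro sum.mono_neutral_cong_left) auto
 finally show "measure ?M {om \<in> space ?M. P (random_set om \<inter> G)} = prb G P" by (simp add: eq)
qed

lemma measure_equal_sums_event:
 "measure log_random_measure (equal_sums_event k c D)
  = prb {a. 1 <= a & D powr c <= real a & real a <= D} (has_equal_sums k)"
proof -
 let ?N = "{a::nat. 1 <= a & D powr c <= real a & real a <= D}"
 have fin: "finite ?N"
  by (rule finite_subset[of _ "{..nat \<lfloor>D\<rfloor>}"]) (auto simp: le_nat_floor)
 have "{a \<in> random_set om. D powr c <= real a & real a <= D} = random_set om \<inter> ?N" for om
  by (auto simp: random_set_def)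
 then show ?thesis
  using measure_cylinder(2)[of ?N "has_equal_sums k"] fin by (auto simp: equal_sums_event_def)
qed

section \<open>Common tools: cube vectors, the finite family of subspaces, entropy of cosets\<close>

section \<open>Subspaces spanned by differences of cube vectors\<close>

lemma finite_vectors_over:
 fixes S :: "rat set"
 assumes "finite S" shows "finite {x :: rat ^ 'k::finite. \<forall>i. x $ i \<in> S}"
proof -
 have "finite (Pi\<^sub>E (UNIV :: 'k set) (%_. S))" using assms by (intro finite_PiE) auto
 then have "finite ((%f. (\<chi> i. f i) :: rat ^ 'k) ` (Pi\<^sub>E UNIV (%_. S)))" by (rule finite_imageI)
 then show ?thesis
 proof (rule rev_finite_subset, safe)
  fix x :: "rat ^ 'k" assume "\<forall>i. x $ i \<in> S"
  then show "x \<in> (%f. (\<chi> i. f i) :: rat ^ 'k) ` (Pi\<^sub>E UNIV (%_. S))"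
   by (intro image_eqI[of _ _ "%i. x $ i"]) (auto simp: vec_eq_iff)
 qed
qed

lemma finite_cube [simp]: "finite (cube :: (rat ^ 'k::finite) set)"
 unfolding cube_def by (rule finite_vectors_over) auto

abbreviation ones :: "rat ^ 'k::finite" where "ones \<equiv> (\<chi> i. 1)"

definition dcube :: "(rat ^ 'k::finite) set" where
 "dcube = {x. \<forall>i. x $ i \<in> {-1, 0, 1}}"

lemma finite_dcube [simp]: "finite (dcube :: (rat ^ 'k::finite) set)"
 unfolding dcube_def by (rule finite_vectors_over) auto

lemma cube_subset_dcube: "cube \<subseteq> dcube"
 by (auto simp: cube_def dcube_def)

lemma diff_in_dcube:
 assumes "x \<in> cube" "y \<in> cube" shows "x - y \<in> dcube"
proof -
 have "x $ i - y $ i \<in> {-1, 0, 1}" for i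
 proof -
  have "x $ i \<in> {0, 1}" "y $ i \<in> {0, 1}" using assms by (auto simp: cube_def)
  then show ?thesis by auto
 qed
 then show ?thesis by (auto simp: dcube_def)
qed

lemma ones_in_cube: "ones \<in> cube" by (simp add: cube_def)

lemma ones_minus_in_cube:
 assumes "f \<in> cube" shows "ones - f \<in> cube"
proof -
 have "1 - f $ i \<in> {0, 1}" for i
 proof -
  have "f $ i \<in> {0, 1}" using assms by (auto simp: cube_def)
  then show ?thesis by auto
 qed
 then show ?thesis by (auto simp: cube_def)
qed

text \<open>Every subspace that occurs can be taken from this finite family: flags spanned by cube
  vectors, spaces generated by differences of two assignments, and subflags after
  \<open>subflag_dspans\<close>. Finiteness yields the union bounds, the minimal entropy gap and
  uniformly bounded functionals.\<close>

definition dspans :: "(rat ^ 'k::finite) set set" where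
 "dspans = vec.span ` Pow dcube"

lemma finite_dspans [simp]: "finite (dspans :: (rat ^ 'k::finite) set set)"
 by (simp add: dspans_def)

lemma subspace_dspans: "U \<in> dspans ==> vec.subspace U"
 by (auto simp: dspans_def)

lemma span_in_dspans: "S \<subseteq> dcube ==> vec.span S \<in> dspans"
 by (auto simp: dspans_def)

lemma ones_neq_0: "(ones :: rat ^ 'k::finite) ~= 0" by (simp add: vec_eq_iff)

lemma dim_span_ones: "vec.dim (vec.span {ones :: rat ^ 'k::finite}) = 1"
proof -
 have "vec.dim {ones :: rat ^ 'k} = 1"
  by (subst vec.dim_insert) (use ones_neq_0 in auto)
 then show ?thesis by (simp only: vec.dim_span)
qed

lemma span_ones_iff: "x \<in> vec.span {ones :: rat ^ 'k::finite} \<longleftrightarrow> (\<forall>i i'. x $ i = x $ i')"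
proof
 assume "x \<in> vec.span {ones :: rat ^ 'k}"
 then obtain t where "x = t *s ones" by (auto simp: vec.span_singleton)
 then show "\<forall>i i'. x $ i = x $ i'" by simp
next
 assume h: "\<forall>i i'. x $ i = x $ i'"
 obtain i0 :: 'k where True by simp
 have "x = (x $ i0) *s ones"
  unfolding vec_eq_iff using h by simp
 moreover have "(x $ i0) *s ones \<in> vec.span {ones :: rat ^ 'k}"
  by (intro vec.span_scale vec.span_base) simp
 ultimately show "x \<in> vec.span {ones}" by simp
qed

subsection \<open>Equal sums as zero sums of cube vectors\<close>

text \<open>The vector om a is the incidence vector of a: its coordinate i is 1 iff a belongs to the
  i-th set. The i-th coordinate of the weighted sum is then the sum of the i-th set, so lying on the
  line of \<open>ones\<close> means equal sums, and separated coordinates mean distinct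
  sets.\<close>

lemma has_equal_sumsI:
 fixes om :: "nat => rat ^ 'k::finite"
 assumes E: "finite E" "E \<subseteq> S" and cube: "!!a. a \<in> E ==> om a \<in> cube"
  and bal: "(\<Sum>a\<in>E. of_nat a *s om a) \<in> vec.span {ones}"
  and sep: "!!i i'. i ~= i' ==> \<exists>a\<in>E. om a $ i ~= om a $ i'"
 shows "has_equal_sums CARD('k) S"
proof -
 obtain g :: "nat => 'k" where g: "bij_betw g {1..CARD('k)} UNIV"
  using ex_bij_betw_nat_finite_1[of "UNIV :: 'k set"] by auto
 define A where "A n = {a\<in>E. om a $ g n = 1}" for n
 have sum: "rat_of_nat (\<Sum>(A n)) = (\<Sum>a\<in>E. of_nat a *s om a) $ g n" for n
 proof -
  have "rat_of_nat (\<Sum>(A n)) = (\<Sum>a\<in>E. if om a $ g n = 1 then of_nat a else 0)"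
   unfolding A_def using E by (simp add: sum.inter_filter) (intro sum.cong, auto)
  also have "... = (\<Sum>a\<in>E. of_nat a * om a $ g n)"
  proof (intro sum.cong refl)
   fix a assume "a \<in> E"
   then have "om a $ g n \<in> {0, 1}" using cube by (auto simp: cube_def)
   then show "(if om a $ g n = 1 then of_nat a else 0) = rat_of_nat a * om a $ g n" by auto
  qed
  also have "... = (\<Sum>a\<in>E. of_nat a *s om a) $ g n" by (simp add: sum_component)
  finally show ?thesis .
 qed
 have "inj_on A {1..CARD('k)}"
 proof (rule inj_onI, rule ccontr)
  fix n m assume nm: "n \<in> {1..CARD('k)}" "m \<in> {1..CARD('k)}" "A n = A m" "n ~= m"
  have "g n ~= g m" using g nm(1,2,4) by (meson bij_betw_def inj_onD)
  then obtain a where a: "a \<in> E" "om a $ g n ~= om a $ g m" using sep by blast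
  have "om a $ g n \<in> {0, 1}" "om a $ g m \<in> {0, 1}" using cube a by (auto simp: cube_def)
  then have "(a \<in> A n) ~= (a \<in> A m)" using a by (auto simp: A_def)
  then show False using nm by simp
 qed
 moreover have "\<Sum>(A n) = \<Sum>(A m)" for n m
 proof -
  have "rat_of_nat (\<Sum>(A n)) = rat_of_nat (\<Sum>(A m))"
   unfolding sum using bal span_ones_iff by blast
  then show ?thesis by (simp only: of_nat_eq_iff)
 qed
 moreover have "A n \<subseteq> S" for n using E by (auto simp: A_def)
 ultimately show ?thesis unfolding has_equal_sums_def by (intro exI[of _ A]) blast
qed

lemma has_equal_sumsE:
 assumes "has_equal_sums CARD('k::finite) S" "finite S"
 obtains om :: "nat => rat ^ 'k" where "!!a. om a \<in> cube"
  "(\<Sum>a\<in>S. of_nat a *s om a) \<in> vec.span {ones}"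
  "!!i i'. i ~= i' ==> \<exists>a\<in>S. om a $ i ~= om a $ i'"
proof -
 obtain A where A: "inj_on A {1..CARD('k)}" "!!i. i \<in> {1..CARD('k)} ==> A i \<subseteq> S"
  "!!i j. i \<in> {1..CARD('k)} ==> j \<in> {1..CARD('k)} ==> \<Sum>(A i) = \<Sum>(A j)"
  using assms(1) unfolding has_equal_sums_def by blast
 obtain h :: "nat => 'k" where "bij_betw h {1..CARD('k)} UNIV"
  using ex_bij_betw_nat_finite_1[of "UNIV :: 'k set"] by auto
 then obtain g :: "'k => nat" where g: "bij_betw g UNIV {1..CARD('k)}"
  using bij_betw_inv by metis
 then have gi: "g i \<in> {1..CARD('k)}" for i by (auto simp: bij_betw_def)
 define om :: "nat => rat ^ 'k" where "om a = (\<chi> i. of_bool (a \<in> A (g i)))" for a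
 have sum: "(\<Sum>a\<in>S. of_nat a *s om a) $ i = rat_of_nat (\<Sum>(A (g i)))" for i
 proof -
  have "(\<Sum>a\<in>S. of_nat a *s om a) $ i = (\<Sum>a\<in>S. if a \<in> A (g i) then rat_of_nat a else 0)"
   by (simp add: sum_component om_def) (intro sum.cong, auto)
  also have "... = (\<Sum>a\<in>S \<inter> A (g i). rat_of_nat a)"
   using assms(2) by (simp add: sum.inter_restrict)
  also have "S \<inter> A (g i) = A (g i)" using A(2) gi by blast
  finally show ?thesis by simp
 qed
 show ?thesis
 proof (rule that[of om])
  show "om a \<in> cube" for a by (auto simp: om_def cube_def)
  have *: "\<Sum>(A (g i)) = \<Sum>(A (g i'))" for i i' using A(3) gi by blast
  then show "(\<Sum>a\<in>S. of_nat a *s om a) \<in> vec.span {ones}"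
   unfolding span_ones_iff unfolding sum of_nat_eq_iff using * by blast
  fix i i' :: 'k assume "i ~= i'"
  then have "g i ~= g i'" using g by (auto simp: bij_betw_def inj_on_def)
  then have "A (g i) ~= A (g i')" using inj_on_eq_iff[OF A(1) gi gi] by blast
  then obtain a where "(a \<in> A (g i)) ~= (a \<in> A (g i'))" by blast
  moreover then have "a \<in> S" using A(2) gi by blast
  ultimately show "\<exists>a\<in>S. om a $ i ~= om a $ i'" by (intro bexI[of _ a]) (auto simp: om_def)
 qed
qed

lemma has_equal_sums_mono: "has_equal_sums k S ==> S \<subseteq> S' ==> has_equal_sums k S'"
 unfolding has_equal_sums_def by blast

subsection \<open>Entropy of cosets\<close>

lemma coset_eq: "(%w. w + x) ` W = {y :: rat ^ 'k::finite. y - x \<in> W}"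
proof (intro set_eqI iffI)
 fix y assume "y \<in> {y. y - x \<in> W}"
 then show "y \<in> (%w. w + x) ` W" by (intro image_eqI[of _ _ "y - x"]) auto
qed auto

lemma coset_entropy_alt:
 "coset_entropy \<nu> W = - (\<Sum>x\<in>set_pmf \<nu>. pmf \<nu> x * ln (measure_pmf.prob \<nu> {y. y - x \<in> W}))"
 by (simp add: coset_entropy_def coset_eq)

lemma coset_prob_ge:
 assumes "vec.subspace W"
 shows "pmf \<nu> x <= measure_pmf.prob \<nu> {y :: rat ^ 'k::finite. y - x \<in> W}"
proof -
 have "measure_pmf.prob \<nu> {x} <= measure_pmf.prob \<nu> {y. y - x \<in> W}"
  using assms by (intro measure_pmf.finite_measure_mono) (auto simp: vec.subspace_0)
 then show ?thesis by (simp add: measure_pmf_single)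
qed

lemma coset_prob_pos:
 assumes "vec.subspace W" "x \<in> set_pmf \<nu>"
 shows "0 < measure_pmf.prob \<nu> {y :: rat ^ 'k::finite. y - x \<in> W}"
 using coset_prob_ge[OF assms(1), of \<nu> x] pmf_positive[OF assms(2)] by linarith

lemma coset_entropy_nonneg:
 assumes "vec.subspace W" shows "0 <= coset_entropy \<nu> (W :: (rat ^ 'k::finite) set)"
proof -
 have "pmf \<nu> x * ln (measure_pmf.prob \<nu> {y. y - x \<in> W}) <= 0" if "x \<in> set_pmf \<nu>" for x
  using coset_prob_pos[OF assms that]
  by (intro mult_nonneg_nonpos) (simp_all add: ln_le_zero_iff)
 then show ?thesis unfolding coset_entropy_alt
  by (simp add: sum_nonpos)
qed

lemma minus_x_ln_x_le_1:
 assumes "0 < t" "t <= (1::real)" shows "t * (- ln t) <= 1"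
proof -
 have "ln (1 / t) <= 1 / t - 1" using assms by (intro ln_le_minus_one) auto
 then have "- ln t <= 1 / t - 1" using assms by (simp add: ln_div)
 then have "t * (- ln t) <= t * (1 / t - 1)" using assms by (intro mult_left_mono) auto
 then show ?thesis using assms by (simp add: algebra_simps)
qed

lemma coset_entropy_le:
 assumes "vec.subspace W" "set_pmf \<nu> \<subseteq> cube"
 shows "coset_entropy \<nu> (W :: (rat ^ 'k::finite) set) <= card (cube :: (rat ^ 'k) set)"
proof -
 have fin: "finite (set_pmf \<nu>)" by (rule finite_subset[OF assms(2)]) simp
 have "coset_entropy \<nu> W = (\<Sum>x\<in>set_pmf \<nu>. pmf \<nu> x * (- ln (measure_pmf.prob \<nu> {y. y - x \<in> W})))"
  unfolding coset_entropy_alt by (simp add: sum_negf)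
 also have "... <= (\<Sum>x\<in>set_pmf \<nu>. 1)"
 proof (intro sum_mono)
  fix x assume x: "x \<in> set_pmf \<nu>"
  have "pmf \<nu> x * (- ln (measure_pmf.prob \<nu> {y. y - x \<in> W})) <= pmf \<nu> x * (- ln (pmf \<nu> x))"
   using coset_prob_ge[OF assms(1), of \<nu> x] pmf_positive[OF x]
   by (intro mult_left_mono) auto
  also have "... <= 1" using pmf_positive[OF x] pmf_le_1 by (rule minus_x_ln_x_le_1)
  finally show "pmf \<nu> x * (- ln (measure_pmf.prob \<nu> {y. y - x \<in> W})) <= 1" .
 qed
 also have "... <= card (cube :: (rat ^ 'k) set)"
  using assms(2) by (simp add: card_mono)
 finally show ?thesis .
qed

lemma coset_entropy_zero:
 assumes "vec.subspace W" "set_pmf \<nu> \<subseteq> W"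
 shows "coset_entropy \<nu> (W :: (rat ^ 'k::finite) set) = 0"
proof -
 have "measure_pmf.prob \<nu> {y. y - x \<in> W} = 1" if "x \<in> set_pmf \<nu>" for x
  using assms that by (intro measure_pmf.prob_eq_1[THEN iffD2])
   (auto simp: AE_measure_pmf_iff intro!: vec.subspace_diff)
 then show ?thesis unfolding coset_entropy_alt by simp
qed

text \<open>For x and y in the cube the difference y - x lies in \<open>dcube\<close>, so the cosets
  met by the measure depend only on the trace of W on \<open>dcube\<close>.\<close>

lemma coset_entropy_cong:
 assumes "set_pmf \<nu> \<subseteq> cube" "!!d. d \<in> dcube ==> d \<in> W \<longleftrightarrow> d \<in> W'"
 shows "coset_entropy \<nu> (W :: (rat ^ 'k::finite) set) = coset_entropy \<nu> W'"
proof -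
 have "measure_pmf.prob \<nu> {y. y - x \<in> W} = measure_pmf.prob \<nu> {y. y - x \<in> W'}"
  if "x \<in> set_pmf \<nu>" for x
 proof (intro measure_pmf.finite_measure_eq_AE)
  have "y - x \<in> W \<longleftrightarrow> y - x \<in> W'" if "y \<in> set_pmf \<nu>" for y
   using assms(2)[OF diff_in_dcube] that \<open>x \<in> set_pmf \<nu>\<close> assms(1) by blast
  then show "AE y in measure_pmf \<nu>. (y \<in> {y. y - x \<in> W}) = (y \<in> {y. y - x \<in> W'})"
   by (simp add: AE_measure_pmf_iff)
 qed auto
 then show ?thesis unfolding coset_entropy_alt by simp
qed

text \<open>Abel summation moves the coefficients from the quotients to the spaces: V j carries the
  weight c j - c (j + 1), which is nonnegative for a system. In this form the effect of changing a
  single space, or of lowering dimensions, can be read off.\<close>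

lemma flag_entropy_alt:
 "flag_entropy r V c \<mu> =
  (\<Sum>j=1..r. (c j - c (j + 1)) * (coset_entropy (\<mu> j) (V j) + real (vec.dim (V j))))
  + c (r + 1) * real (vec.dim (V r)) - c 1 * real (vec.dim (V 0 :: (rat ^ 'k::finite) set))"
proof (induction r)
 case (Suc r)
 have "flag_entropy (Suc r) V c \<mu> = flag_entropy r V c \<mu>
  + (c (Suc r) - c (Suc r + 1)) * coset_entropy (\<mu> (Suc r)) (V (Suc r))
  + c (Suc r) * quotient_dim (V (Suc r)) (V r)"
  by (simp add: flag_entropy_def)
 then show ?case unfolding Suc.IH by (simp add: quotient_dim_def algebra_simps)
qed (simp add: flag_entropy_def)

lemma flag_mono:
 assumes "flag r V" "i <= j" "j <= r" shows "V i \<subseteq> V j"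
 using assms(2,3)
proof (induction j rule: dec_induct)
 case (step n)
 then show ?case using assms(1) unfolding flag_def by (metis Suc_le_lessD Suc_leD order_trans)
qed auto

lemma flag_subspace: "flag r V ==> j <= r ==> vec.subspace (V j)"
 by (simp add: flag_def)

lemma flag_ones: "flag r V ==> j <= r ==> ones \<in> V j"
 using flag_mono[of r V 0 j] unfolding flag_def by (auto intro: vec.span_base)

text \<open>Replacing V' j by the span of its trace on \<open>dcube\<close> keeps all entropies and
  V' 0 and cannot raise a dimension; in the Abel-summed form the other dimensions have nonnegative
  weights. Hence the entropy condition has to be tested on finitely many subflags only.\<close>

lemma subflag_dspans:
 fixes V :: "nat => (rat ^ 'k::finite) set"
 assumes sys: "system r V c \<mu>" and sub: "subflag r V' V"
 defines "V'' \<equiv> %j. vec.span (V' j \<inter> dcube)"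
 shows "subflag r V'' V" "flag_entropy r V'' c \<mu> <= flag_entropy r V' c \<mu>" "V'' j \<in> dspans"
proof -
 have fl: "flag r V'" and le: "!!j. j <= r ==> V' j \<subseteq> V j" using sub by (auto simp: subflag_def)
 have incl: "V'' j \<subseteq> V' j" if "j <= r" for j
  unfolding V''_def using flag_subspace[OF fl that] by (intro vec.span_minimal) auto
 have V0: "V' 0 = vec.span {ones}" using fl by (simp add: flag_def)
 have z: "V'' 0 = vec.span {ones}"
 proof
  show "V'' 0 \<subseteq> vec.span {ones}" using incl[of 0] V0 by auto
  have "ones \<in> V' 0 \<inter> dcube" using V0 ones_in_cube cube_subset_dcube
   by (auto intro: vec.span_base)
  then show "vec.span {ones} \<subseteq> V'' 0" unfolding V''_def by (intro vec.span_mono) auto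
 qed
 have "flag r V''" unfolding flag_def
 proof (intro conjI allI impI)
  show "V'' j \<subseteq> V'' (Suc j)" if "j < r" for j
   using fl that unfolding V''_def flag_def by (intro vec.span_mono) auto
  show "V'' 0 = vec.span {\<chi> i. 1}" by (rule z)
 qed (simp add: V''_def)
 then show "subflag r V'' V" using incl le by (auto simp: subflag_def)
 show "V'' j \<in> dspans" by (auto simp: V''_def intro: span_in_dspans)
 have H: "coset_entropy (\<mu> j) (V'' j) = coset_entropy (\<mu> j) (V' j)" if "j \<in> {1..r}" for j
 proof (rule coset_entropy_cong)
  show "set_pmf (\<mu> j) \<subseteq> cube" using sys that by (auto simp: system_def)
  fix d :: "rat ^ 'k" assume "d \<in> dcube"
  then show "d \<in> V'' j \<longleftrightarrow> d \<in> V' j"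
   using incl[of j] that by (auto simp: V''_def intro: vec.span_base)
 qed
 have c: "0 <= c j - c (j + 1)" if "j \<in> {1..r}" for j using sys that by (auto simp: system_def)
 have cr: "0 <= c (r + 1)" using sys by (auto simp: system_def)
 have "(\<Sum>j=1..r. (c j - c (j + 1)) * (coset_entropy (\<mu> j) (V'' j) + real (vec.dim (V'' j))))
  <= (\<Sum>j=1..r. (c j - c (j + 1)) * (coset_entropy (\<mu> j) (V' j) + real (vec.dim (V' j))))"
  using H c incl by (intro sum_mono mult_left_mono) (auto intro!: vec.dim_subset)
 moreover have "c (r + 1) * real (vec.dim (V'' r)) <= c (r + 1) * real (vec.dim (V' r))"
  using cr incl by (intro mult_left_mono) (auto intro!: vec.dim_subset)
 ultimately show "flag_entropy r V'' c \<mu> <= flag_entropy r V' c \<mu>"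
  unfolding flag_entropy_alt z V0 by linarith
qed

section \<open>Lower bound: probability that two assignments have equal sums modulo the line of
  ones\<close>

section \<open>Probability of a linear relation\<close>

lemma sum_in_span:
 "(!!i. i \<in> I ==> v i \<in> S) ==> (\<Sum>i\<in>I. c i *s v i) \<in> vec.span (S :: (rat ^ 'k::finite) set)"
 by (intro vec.span_sum vec.span_scale vec.span_base)

text \<open>Induction from the last entry. Modulo the span W of U and the earlier vectors, the last
  entry x must satisfy x v = y for the last vector v; if v lies outside W, at most one x does so,
  otherwise all of I is allowed. Each new dimension thus saves a factor X. The arbitrary shift y
  absorbs the last term.\<close>

lemma list_relation_count:
 fixes v :: "nat => rat ^ 'k::finite"
 assumes I: "finite I" "real (card I) <= X" "1 <= X" and U: "vec.subspace U"
 shows "finite {xs. length xs = Q & set xs \<subseteq> I & (\<Sum>i<Q. of_nat (xs ! i) *s v i) - y \<in> U} &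
  real (card {xs. length xs = Q & set xs \<subseteq> I & (\<Sum>i<Q. of_nat (xs ! i) *s v i) - y \<in> U})
   * X ^ (vec.dim (vec.span (U \<union> v ` {..<Q})) - vec.dim U) <= X ^ Q"
proof (induction Q arbitrary: y)
 case 0
 have "{xs :: nat list. length xs = 0 & set xs \<subseteq> I & (\<Sum>i<0. of_nat (xs ! i) *s v i) - y \<in> U} \<subseteq> {[]}"
  by auto
 then have fin: "finite {xs :: nat list. length xs = 0 & set xs \<subseteq> I & (\<Sum>i<0. of_nat (xs ! i) *s v i) - y \<in> U}"
  and "card {xs :: nat list. length xs = 0 & set xs \<subseteq> I & (\<Sum>i<0. of_nat (xs ! i) *s v i) - y \<in> U} <= card {[] :: nat list}"
  by (auto intro: finite_subset card_mono simp del: card.insert card_1_singleton_iff)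
 then show ?case by simp
next
 case (Suc Q)
 let ?S = "%Q y. {xs. length xs = Q & set xs \<subseteq> I & (\<Sum>i<Q. of_nat (xs ! i) *s v i) - y \<in> U}"
 let ?W = "vec.span (U \<union> v ` {..<Q})"
 let ?d = "vec.dim ?W - vec.dim U"
 define J where "J = {x\<in>I. of_nat x *s v Q - y \<in> ?W}"
 have finJ: "finite J" using I by (simp add: J_def)
 have sub: "?S (Suc Q) y \<subseteq> (\<Union>x\<in>J. (%xs. xs @ [x]) ` ?S Q (y - of_nat x *s v Q))"
 proof
  fix zs assume zs: "zs \<in> ?S (Suc Q) y"
  define xs where "xs = butlast zs"
  define x where "x = last zs"
  have z: "zs = xs @ [x]" and len: "length xs = Q"
   using zs by (auto simp: xs_def x_def intro!: append_butlast_last_id[symmetric])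
  have s: "(\<Sum>i<Suc Q. of_nat (zs ! i) *s v i) = (\<Sum>i<Q. of_nat (xs ! i) *s v i) + of_nat x *s v Q"
  proof -
   have "(\<Sum>i<Q. of_nat (zs ! i) *s v i) = (\<Sum>i<Q. of_nat (xs ! i) *s v i)"
    using len by (intro sum.cong refl) (simp add: z nth_append)
   then show ?thesis using len by (simp add: z nth_append)
  qed
  have mem: "xs \<in> ?S Q (y - of_nat x *s v Q)"
   using zs len s by (auto simp: z algebra_simps)
  have "of_nat x *s v Q - y \<in> ?W"
  proof -
   have "(\<Sum>i<Q. of_nat (xs ! i) *s v i) \<in> ?W" by (intro sum_in_span) auto
   moreover have "(\<Sum>i<Suc Q. of_nat (zs ! i) *s v i) - y \<in> ?W"
    using zs by (intro vec.span_base) auto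
   ultimately have "((\<Sum>i<Suc Q. of_nat (zs ! i) *s v i) - y) - (\<Sum>i<Q. of_nat (xs ! i) *s v i) \<in> ?W"
    by (rule vec.span_diff[rotated])
   then show ?thesis unfolding s by (simp add: algebra_simps)
  qed
  then have "x \<in> J" using zs by (auto simp: J_def z)
  then show "zs \<in> (\<Union>x\<in>J. (%xs. xs @ [x]) ` ?S Q (y - of_nat x *s v Q))"
   using mem z by blast
 qed
 have fin: "finite (\<Union>x\<in>J. (%xs. xs @ [x]) ` ?S Q (y - of_nat x *s v Q))"
  using finJ Suc.IH by blast
 have "card (?S (Suc Q) y) <= card (\<Union>x\<in>J. (%xs. xs @ [x]) ` ?S Q (y - of_nat x *s v Q))"
  using sub fin by (intro card_mono)
 also have "... <= (\<Sum>x\<in>J. card ((%xs. xs @ [x]) ` ?S Q (y - of_nat x *s v Q)))"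
  using finJ by (rule card_UN_le)
 also have "... <= (\<Sum>x\<in>J. card (?S Q (y - of_nat x *s v Q)))"
  using Suc.IH by (intro sum_mono card_image_le) blast
 finally have c: "real (card (?S (Suc Q) y)) <= (\<Sum>x\<in>J. real (card (?S Q (y - of_nat x *s v Q))))"
  by (simp only: of_nat_le_iff of_nat_sum flip: of_nat_sum)
 have c': "real (card (?S (Suc Q) y)) * X ^ ?d <= real (card J) * X ^ Q"
 proof -
  have "real (card (?S (Suc Q) y)) * X ^ ?d <= (\<Sum>x\<in>J. real (card (?S Q (y - of_nat x *s v Q)))) * X ^ ?d"
   using c I by (intro mult_right_mono) auto
  also have "... <= (\<Sum>x\<in>J. X ^ Q)"
   unfolding sum_distrib_right using Suc.IH by (intro sum_mono) blast
  finally show ?thesis by simp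
 qed
 have un: "U \<union> v ` {..<Suc Q} = insert (v Q) (U \<union> v ` {..<Q})" by (auto simp: lessThan_Suc)
 have dimU: "vec.dim U <= vec.dim ?W" by (intro vec.dim_subset) (auto intro: vec.span_base)
 show ?case
 proof (intro conjI)
  show "finite (?S (Suc Q) y)" using sub fin by (rule finite_subset)
  show "real (card (?S (Suc Q) y)) * X ^ (vec.dim (vec.span (U \<union> v ` {..<Suc Q})) - vec.dim U) <= X ^ Suc Q"
  proof (cases "v Q \<in> ?W")
   case True
   then have "vec.dim (vec.span (U \<union> v ` {..<Suc Q})) = vec.dim ?W"
    unfolding un by (simp add: vec.dim_insert)
   moreover have "real (card J) <= X"
    using I card_mono[of I J] by (auto simp: J_def)
   then have "real (card J) * X ^ Q <= X * X ^ Q" using I by (intro mult_right_mono) auto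
   ultimately show ?thesis using c' by simp
  next
   case False
   then have "vec.dim (vec.span (U \<union> v ` {..<Suc Q})) = Suc (vec.dim ?W)"
    unfolding un by (simp add: vec.dim_insert)
   then have d: "vec.dim (vec.span (U \<union> v ` {..<Suc Q})) - vec.dim U = Suc ?d" using dimU by simp
   have "x = x'" if "x \<in> J" "x' \<in> J" for x x'
   proof (rule ccontr)
    assume ne: "x ~= x'"
    have "(of_nat x *s v Q - y) - (of_nat x' *s v Q - y) \<in> ?W"
     using that by (intro vec.span_diff[of "of_nat x *s v Q - y"]) (simp_all add: J_def)
    then have "(of_nat x - of_nat x') *s v Q \<in> ?W" by (simp add: vec.scale_left_diff_distrib)
    then have "inverse (of_nat x - of_nat x') *s ((of_nat x - of_nat x') *s v Q) \<in> ?W"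
     by (rule vec.span_scale)
    moreover have "inverse (of_nat x - of_nat x') * (of_nat x - of_nat x') = (1 :: rat)"
     using ne by simp
    ultimately have "v Q \<in> ?W" by (simp only: vec.scale_scale vec.scale_one)
    then show False using False by simp
   qed
   then have "card J <= 1" using finJ by (simp add: card_le_Suc0_iff_eq)
   then have "real (card J) * X ^ Q <= 1 * X ^ Q" using I by (intro mult_right_mono) auto
   then have "real (card (?S (Suc Q) y)) * X ^ ?d <= X ^ Q" using c' by linarith
   then have "real (card (?S (Suc Q) y)) * X ^ ?d * X <= X ^ Q * X"
    using I by (intro mult_right_mono) simp_all
   then show ?thesis unfolding d by (simp add: mult_ac)
  qed
 qed
qed

lemma prb_superset:
 assumes "finite G" "K \<subseteq> G" shows "prb G (%A. K \<subseteq> A) = (\<Prod>a\<in>K. 1 / real a)"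
 using expect_superset[OF assms, of "%_. 1"] assms by simp

text \<open>Only the Q smallest elements of a window carry vectors
  (\<open>sorted_list_of_set\<close> is increasing), which fixes the number of vectors although the
  number of elements is random.\<close>

definition lsum :: "nat => (nat => rat ^ 'k::finite) => nat set => rat ^ 'k" where
 "lsum Q v A = (\<Sum>i<Q. of_nat (sorted_list_of_set A ! i) *s v i)"

text \<open>Each list of Q distinct elements has probability at most h^(-Q), and there are at most
  X^(Q - d) solutions. The ratio X / h depends only on the length of the window, so a constant K
  absorbs (X / h)^Q; its factor 2 pays for keeping \<open>prb I (%A. Q <= card A)\<close> on the
  right. That factor is kept because summing it over all patterns of filled windows later gives a
  total of at most 1.\<close>

lemma window_relation_prob:
 fixes v :: "nat => rat ^ 'k::finite"
 assumes I: "finite I" "real (card I) <= X" "1 <= X" "!!a. a \<in> I ==> h <= real a" "0 < h" "h <= X"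
  and U: "vec.subspace U"
  and half: "1 / 2 <= prb I (%A. Q <= card A)" and K: "2 * (X / h) ^ Q <= K"
 shows "prb I (%A. Q <= card A & lsum Q v A - y \<in> U)
  <= prb I (%A. Q <= card A) * (K / X) ^ (vec.dim (vec.span (U \<union> v ` {..<Q})) - vec.dim U)"
proof -
 define d where "d = vec.dim (vec.span (U \<union> v ` {..<Q})) - vec.dim U"
 let ?S = "{xs. length xs = Q & set xs \<subseteq> I & (\<Sum>i<Q. of_nat (xs ! i) *s v i) - y \<in> U}"
 have S: "finite ?S" "real (card ?S) * X ^ d <= X ^ Q"
  using list_relation_count[OF I(1-3) U, of Q v y] unfolding d_def by auto
 have X: "0 < X" using I by simp
 show ?thesis
 proof (cases "d = 0")
  case True
  then show ?thesis unfolding d_def[symmetric] by simp (rule prb_mono, simp)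
 next
  case False
  have "prb I (%A. Q <= card A & lsum Q v A - y \<in> U)
   <= prb I (%A. \<exists>xs\<in>{xs\<in>?S. distinct xs}. set xs \<subseteq> A)"
  proof (rule prb_mono)
   fix A assume A: "A \<subseteq> I" "Q <= card A & lsum Q v A - y \<in> U"
   have fA: "finite A" using A I finite_subset by auto
   let ?xs = "take Q (sorted_list_of_set A)"
   have len: "length ?xs = Q" using A by simp
   have sub: "set ?xs \<subseteq> A" using set_take_subset[of Q "sorted_list_of_set A"] fA by simp
   have "(\<Sum>i<Q. of_nat (?xs ! i) *s v i) = lsum Q v A"
    unfolding lsum_def by (intro sum.cong) auto
   then have "?xs \<in> ?S" using len sub A by auto
   moreover have "distinct ?xs" by (simp add: distinct_take)
   ultimately show "\<exists>xs\<in>{xs\<in>?S. distinct xs}. set xs \<subseteq> A" using sub by blast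
  qed
  also have "... <= (\<Sum>xs\<in>{xs\<in>?S. distinct xs}. prb I (%A. set xs \<subseteq> A))"
   by (intro prb_Bex finite_subset[OF _ S(1)]) auto
  also have "... <= (\<Sum>xs\<in>{xs\<in>?S. distinct xs}. (1 / h) ^ Q)"
  proof (intro sum_mono)
   fix xs assume xs: "xs \<in> {xs\<in>?S. distinct xs}"
   have "prb I (%A. set xs \<subseteq> A) = (\<Prod>a\<in>set xs. 1 / real a)"
    using xs I by (intro prb_superset) auto
   also have "... <= (\<Prod>a\<in>set xs. 1 / h)"
    using xs I by (intro prod_mono) (auto intro!: divide_left_mono simp: subset_iff, fastforce)
   also have "... = (1 / h) ^ Q" using xs by (simp add: distinct_card)
   finally show "prb I (%A. set xs \<subseteq> A) <= (1 / h) ^ Q" .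
  qed
  also have "... = real (card {xs\<in>?S. distinct xs}) * (1 / h) ^ Q" by simp
  also have "... <= real (card ?S) * (1 / h) ^ Q"
   using I by (intro mult_right_mono of_nat_mono card_mono[OF S(1)]) auto
  also have "... <= (X ^ Q / X ^ d) * (1 / h) ^ Q"
   using S X I by (intro mult_right_mono) (auto simp: field_simps)
  also have "... = (X / h) ^ Q / X ^ d" by (simp add: power_divide)
  finally have main: "prb I (%A. Q <= card A & lsum Q v A - y \<in> U) <= (X / h) ^ Q / X ^ d" .
  have one: "1 <= (X / h) ^ Q" using I by (intro one_le_power) auto
  then have K1: "1 <= K" using K by linarith
  have "(X / h) ^ Q <= (1 / 2) * K" using K by simp
  also have "... <= prb I (%A. Q <= card A) * K" using half K1 by (intro mult_right_mono) auto
  also have "... <= prb I (%A. Q <= card A) * K ^ d"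
   using half K1 False by (intro mult_left_mono self_le_power) auto
  finally have "(X / h) ^ Q / X ^ d <= prb I (%A. Q <= card A) * K ^ d / X ^ d"
   using X by (intro divide_right_mono) auto
  then show ?thesis using main unfolding d_def[symmetric] by (simp add: power_divide)
 qed
qed

text \<open>Here g is the set of windows with enough elements, the only ones that carry vectors.
  Windows will be numbered from the largest elements downwards, so the chain grows as smaller
  elements are read.\<close>

definition dspan :: "nat set => (nat => nat) => (nat => nat => rat ^ 'k::finite) => nat => (rat ^ 'k) set" where
 "dspan g Q v l = vec.span (insert ones (\<Union>l'\<in>g \<inter> {..<l}. v l' ` {..<Q l'}))"

lemma dspan_0: "dspan g Q v 0 = vec.span {ones}"
 by (simp add: dspan_def)

lemma dspan_mono: "l <= l' ==> dspan g Q v l \<subseteq> dspan g Q v l'"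
 unfolding dspan_def by (intro vec.span_mono) fastforce

lemma dspan_Suc_good:
 assumes "l \<in> g"
 shows "dspan g Q v (Suc l) = vec.span (dspan g Q v l \<union> v l ` {..<Q l})"
proof -
 have *: "insert ones (\<Union>l'\<in>g \<inter> {..<Suc l}. v l' ` {..<Q l'})
  = insert ones (\<Union>l'\<in>g \<inter> {..<l}. v l' ` {..<Q l'}) \<union> v l ` {..<Q l}"
 proof -
  have "g \<inter> {..<Suc l} = insert l (g \<inter> {..<l})" using assms by (auto simp: less_Suc_eq)
  then show ?thesis by (simp add: Un_commute)
 qed
 show ?thesis unfolding dspan_def *
  by (simp only: vec.span_Un vec.span_span)
qed

lemma dspan_Suc_bad: "l \<notin> g ==> dspan g Q v (Suc l) = dspan g Q v l"
proof -
 assume "l \<notin> g"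
 then have "g \<inter> {..<Suc l} = g \<inter> {..<l}" by (auto simp: less_Suc_eq)
 then show ?thesis by (simp add: dspan_def)
qed

text \<open>The last window is peeled off. All earlier windows contribute a vector of
  \<open>dspan g Q v B\<close>, so the last one alone must solve the relation modulo this space, at
  a cost of K / X for every dimension that it adds. Given its elements, the earlier windows face a
  shifted relation, whence the induction over arbitrary y.\<close>

lemma relation_prob:
 fixes v :: "nat => nat => rat ^ 'k::finite" and I :: "nat => nat set"
 assumes "!!l. l < B ==> finite (I l)" "!!l. l < B ==> real (card (I l)) <= X l"
  "!!l. l < B ==> 1 <= X l" "!!l a. l < B ==> a \<in> I l ==> h l <= real a"
  "!!l. l < B ==> 0 < h l" "!!l. l < B ==> h l <= X l"
  and "!!l. l < B ==> 1 / 2 <= prb (I l) (%A. Q l <= card A)"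
  and "!!l. l < B ==> 2 * (X l / h l) ^ Q l <= K l"
  and "!!l l'. l < B ==> l' < B ==> l ~= l' ==> I l \<inter> I l' = {}"
 shows "prb (\<Union>l<B. I l) (%A. (\<forall>l<B. (Q l <= card (A \<inter> I l)) = (l \<in> g)) &
   (\<Sum>l\<in>g \<inter> {..<B}. lsum (Q l) (v l) (A \<inter> I l)) - y \<in> vec.span {ones})
  <= (\<Prod>l<B. prb (I l) (%A. (Q l <= card A) = (l \<in> g)) *
    (K l / X l) ^ (vec.dim (dspan g Q v (Suc l)) - vec.dim (dspan g Q v l)))"
 using assms
proof (induction B arbitrary: y)
 case 0
 show ?case by simp
next
 case (Suc B)
 let ?G = "\<Union>l<B. I l"
 let ?b = "%l. prb (I l) (%A. (Q l <= card A) = (l \<in> g)) *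
    (K l / X l) ^ (vec.dim (dspan g Q v (Suc l)) - vec.dim (dspan g Q v l))"
 let ?st = "%A. \<forall>l<B. (Q l <= card (A \<inter> I l)) = (l \<in> g)"
 let ?sm = "%B A. \<Sum>l\<in>g \<inter> {..<B}. lsum (Q l) (v l) (A \<inter> I l)"
 let ?s = "%A. if B \<in> g then lsum (Q B) (v B) A else 0"
 have IH: "prb ?G (%A. ?st A & ?sm B A - y' \<in> vec.span {ones}) <= (\<Prod>l<B. ?b l)" for y'
  by (rule Suc.IH; rule Suc.prems; simp)
 have b0: "0 <= (\<Prod>l<B. ?b l)" by (rule order_trans[OF expect_nonneg IH]) auto
 have dis: "I B \<inter> ?G = {}" using Suc.prems(9)[of B] by (force simp: disjoint_iff)
 have fin: "finite (I B)" "finite ?G" using Suc.prems(1) by auto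
 have "prb (\<Union>l<Suc B. I l) (%A. (\<forall>l<Suc B. (Q l <= card (A \<inter> I l)) = (l \<in> g)) &
   ?sm (Suc B) A - y \<in> vec.span {ones})
  = expect (I B) (%A. expect ?G (%C. of_bool ((\<forall>l<Suc B. (Q l <= card ((A \<union> C) \<inter> I l)) = (l \<in> g)) &
   ?sm (Suc B) (A \<union> C) - y \<in> vec.span {ones})))"
  using expect_Un[OF fin dis] by (simp add: lessThan_Suc)
 also have "... <= expect (I B) (%A. of_bool ((Q B <= card A) = (B \<in> g) & ?s A - y \<in> dspan g Q v B)
   * (\<Prod>l<B. ?b l))"
 proof (rule expect_mono)
  fix A assume A: "A \<subseteq> I B"
  have AC: "(A \<union> C) \<inter> I B = A" "!!l. l < B ==> (A \<union> C) \<inter> I l = C \<inter> I l" if "C \<subseteq> ?G" for C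
   using A dis that by auto
  have smS: "?sm (Suc B) (A \<union> C) = ?sm B C + ?s A" if C: "C \<subseteq> ?G" for C
  proof -
   have "?sm B (A \<union> C) = ?sm B C" using AC[OF C] by (intro sum.cong) auto
   moreover have "g \<inter> {..<Suc B} = (if B \<in> g then insert B (g \<inter> {..<B}) else g \<inter> {..<B})"
    by (auto simp: less_Suc_eq)
   ultimately show ?thesis using AC[OF C] by (simp add: add.commute)
  qed
  show "expect ?G (%C. of_bool ((\<forall>l<Suc B. (Q l <= card ((A \<union> C) \<inter> I l)) = (l \<in> g)) &
   ?sm (Suc B) (A \<union> C) - y \<in> vec.span {ones}))
   <= of_bool ((Q B <= card A) = (B \<in> g) & ?s A - y \<in> dspan g Q v B) * (\<Prod>l<B. ?b l)"
  proof (cases "(Q B <= card A) = (B \<in> g) & ?s A - y \<in> dspan g Q v B")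
   case True
   have "prb ?G (%C. (\<forall>l<Suc B. (Q l <= card ((A \<union> C) \<inter> I l)) = (l \<in> g)) &
     ?sm (Suc B) (A \<union> C) - y \<in> vec.span {ones})
    <= prb ?G (%C. ?st C & ?sm B C - (y - ?s A) \<in> vec.span {ones})"
   proof (rule prb_mono)
    fix C assume C: "C \<subseteq> ?G" and h: "(\<forall>l<Suc B. (Q l <= card ((A \<union> C) \<inter> I l)) = (l \<in> g)) &
     ?sm (Suc B) (A \<union> C) - y \<in> vec.span {ones}"
    have "?st C" using h AC[OF C] by (metis less_Suc_eq)
    moreover have "?sm B C - (y - ?s A) = ?sm (Suc B) (A \<union> C) - y"
     unfolding smS[OF C] by (simp only: algebra_simps)
    ultimately show "?st C & ?sm B C - (y - ?s A) \<in> vec.span {ones}" using h by metis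
   qed
   also have "... <= (\<Prod>l<B. ?b l)" by (rule IH)
   finally show ?thesis using True by simp
  next
   case False
   have "\<not> ((\<forall>l<Suc B. (Q l <= card ((A \<union> C) \<inter> I l)) = (l \<in> g)) &
     ?sm (Suc B) (A \<union> C) - y \<in> vec.span {ones})" if C: "C \<subseteq> ?G" for C
   proof
    assume h: "(\<forall>l<Suc B. (Q l <= card ((A \<union> C) \<inter> I l)) = (l \<in> g)) &
     ?sm (Suc B) (A \<union> C) - y \<in> vec.span {ones}"
    have "?sm B C \<in> dspan g Q v B"
     unfolding dspan_def lsum_def
     by (intro vec.span_sum vec.span_scale vec.span_base) auto
    moreover have "?sm (Suc B) (A \<union> C) - y \<in> dspan g Q v B"
     using h dspan_mono[of 0 B g Q v] by (auto simp: dspan_0)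
    ultimately have "?sm (Suc B) (A \<union> C) - y - ?sm B C \<in> dspan g Q v B"
     unfolding dspan_def by (rule vec.span_diff[rotated])
    then have "?s A - y \<in> dspan g Q v B" unfolding smS[OF C] by (simp add: algebra_simps)
    moreover have "(Q B <= card A) = (B \<in> g)" using h AC[OF C] by (metis lessI)
    ultimately show False using False by blast
   qed
   then have "prb ?G (%C. (\<forall>l<Suc B. (Q l <= card ((A \<union> C) \<inter> I l)) = (l \<in> g)) &
     ?sm (Suc B) (A \<union> C) - y \<in> vec.span {ones}) <= expect ?G (%C. 0)"
    by (intro expect_mono) auto
   then have "prb ?G (%C. (\<forall>l<Suc B. (Q l <= card ((A \<union> C) \<inter> I l)) = (l \<in> g)) &
     ?sm (Suc B) (A \<union> C) - y \<in> vec.span {ones}) <= 0"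
    using fin by (simp only: expect_const)
   moreover have "0 <= of_bool ((Q B <= card A) = (B \<in> g) & ?s A - y \<in> dspan g Q v B) * (\<Prod>l<B. ?b l)"
    using b0 by (intro mult_nonneg_nonneg) simp_all
   ultimately show ?thesis by (rule order_trans)
  qed
 qed
 also have "... = prb (I B) (%A. (Q B <= card A) = (B \<in> g) & ?s A - y \<in> dspan g Q v B) * (\<Prod>l<B. ?b l)"
  by (rule expect_cmult_right)
 also have "... <= ?b B * (\<Prod>l<B. ?b l)"
 proof (intro mult_right_mono b0)
  show "prb (I B) (%A. (Q B <= card A) = (B \<in> g) & ?s A - y \<in> dspan g Q v B) <= ?b B"
  proof (cases "B \<in> g")
   case True
   have "prb (I B) (%A. Q B <= card A & lsum (Q B) (v B) A - y \<in> dspan g Q v B)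
    <= prb (I B) (%A. Q B <= card A) * (K B / X B) ^
     (vec.dim (vec.span (dspan g Q v B \<union> v B ` {..<Q B})) - vec.dim (dspan g Q v B))"
    by (rule window_relation_prob[of _ _ "h B"]) (use Suc.prems in \<open>auto simp: dspan_def\<close>)
   then show ?thesis using True by (simp add: dspan_Suc_good)
  next
   case False
   then show ?thesis by (simp add: dspan_Suc_bad) (rule prb_mono, simp)
  qed
 qed
 finally show ?case by (simp add: mult.commute)
qed

section \<open>Typical sequences\<close>

lemma exp_le_quadratic:
 fixes y :: real assumes "\<bar>y\<bar> <= 1" shows "exp y <= 1 + y + y\<^sup>2"
proof (cases "0 <= y")
 case True then show ?thesis using assms exp_bound[of y] by simp
next
 case False
 let ?z = "- y"
 have z: "0 <= ?z" "?z <= 1" using False assms by auto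
 have "1 + y + y\<^sup>2 = (y + 1 / 2)\<^sup>2 + 3 / 4" by (simp add: power2_eq_square algebra_simps)
 then have pos: "0 < 1 + y + y\<^sup>2" by (simp add: add_nonneg_pos)
 have "1 <= (1 + ?z) * (1 + y + y\<^sup>2)"
 proof -
  have "(1 + ?z) * (1 + y + y\<^sup>2) = 1 + ?z ^ 3" by (simp add: power2_eq_square power3_eq_cube algebra_simps)
  then show ?thesis using z by simp
 qed
 also have "... <= exp ?z * (1 + y + y\<^sup>2)"
  using pos by (intro mult_right_mono exp_ge_add_one_self) auto
 finally show ?thesis by (simp add: exp_minus field_simps)
qed

definition tuples :: "nat => (rat ^ 'k::finite) pmf => (nat => rat ^ 'k) set" where
 "tuples Q \<mu> = Pi\<^sub>E {..<Q} (%_. set_pmf \<mu>)"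

lemma finite_tuples: "finite (set_pmf \<mu>) ==> finite (tuples Q \<mu>)"
 unfolding tuples_def by (intro finite_PiE) auto

lemma sum_tuples_prod:
 fixes f :: "nat => rat ^ 'k::finite => real"
 assumes "finite (set_pmf \<mu>)"
 shows "(\<Sum>om\<in>tuples Q \<mu>. \<Prod>i<Q. f i (om i)) = (\<Prod>i<Q. \<Sum>x\<in>set_pmf \<mu>. f i x)"
 unfolding tuples_def using assms by (subst prod_sum_PiE) auto

lemma upper_tail_tuples:
 fixes g :: "rat ^ 'k::finite => real" and \<mu> :: "(rat ^ 'k) pmf"
 assumes fin: "finite (set_pmf \<mu>)" and mean: "(\<Sum>x\<in>set_pmf \<mu>. pmf \<mu> x * g x) = 0"
  and eps: "0 < eps" and \<eta>: "0 < \<eta>"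
 shows "eventually (%Q. (\<Sum>om\<in>tuples Q \<mu>. of_bool (real Q * eps < (\<Sum>i<Q. g (om i))) * (\<Prod>i<Q. pmf \<mu> (om i))) <= \<eta>) sequentially"
proof -
 define G where "G = Max (insert 1 ((%x. \<bar>g x\<bar>) ` set_pmf \<mu>))"
 have G1: "1 <= G" and Gb: "\<bar>g x\<bar> <= G" if "x \<in> set_pmf \<mu>" for x
  unfolding G_def using fin that by auto
 have G1: "1 <= G" unfolding G_def using fin by auto
 \<comment> \<open>The Chernoff parameter: t G <= 1 validates exp y <= 1 + y + y^2, and t G^2 <= eps
   / 2 lets the quadratic term use only half of the exponent t eps.\<close>
 define t where "t = min (1 / G) (eps / (2 * G\<^sup>2))"
 have t: "0 < t" "t * G <= 1" "t * G\<^sup>2 <= eps / 2"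
 proof -
  show "0 < t" using G1 eps by (auto simp: t_def)
  have "t * G <= (1 / G) * G" using G1 by (intro mult_right_mono) (auto simp: t_def)
  then show "t * G <= 1" using G1 by simp
  have "t * G\<^sup>2 <= (eps / (2 * G\<^sup>2)) * G\<^sup>2" using G1 by (intro mult_right_mono) (auto simp: t_def)
  then show "t * G\<^sup>2 <= eps / 2" using G1 by simp
 qed
 have mgf: "(\<Sum>x\<in>set_pmf \<mu>. pmf \<mu> x * exp (t * g x)) <= exp (t * eps / 2)"
 proof -
  have "(\<Sum>x\<in>set_pmf \<mu>. pmf \<mu> x * exp (t * g x)) <= (\<Sum>x\<in>set_pmf \<mu>. pmf \<mu> x * (1 + t * g x + t * (eps / 2)))"
  proof (intro sum_mono mult_left_mono)
   fix x assume x: "x \<in> set_pmf \<mu>"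
   have "\<bar>t * g x\<bar> <= t * G" using Gb[OF x] t by (simp add: abs_mult)
   then have "exp (t * g x) <= 1 + t * g x + (t * g x)\<^sup>2" using t by (intro exp_le_quadratic) linarith
   moreover have "(t * g x)\<^sup>2 <= (t * G)\<^sup>2"
    using \<open>\<bar>t * g x\<bar> <= t * G\<close> by (rule power2_le_iff_abs_le[THEN iffD2, rotated]) (use t G1 in auto)
   moreover have "(t * G)\<^sup>2 = t * (t * G\<^sup>2)" by (simp add: power2_eq_square)
   moreover have "t * (t * G\<^sup>2) <= t * (eps / 2)" using t by (intro mult_left_mono) auto
   ultimately show "exp (t * g x) <= 1 + t * g x + t * (eps / 2)" by linarith
  qed auto
  also have "... = (\<Sum>x\<in>set_pmf \<mu>. pmf \<mu> x) * (1 + t * (eps / 2)) + t * (\<Sum>x\<in>set_pmf \<mu>. pmf \<mu> x * g x)"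
   unfolding sum_distrib_left sum_distrib_right sum.distrib[symmetric]
   by (intro sum.cong refl) (simp add: algebra_simps)
  also have "... = 1 + t * eps / 2"
   using mean sum_pmf_eq_1[OF fin order_refl] by simp
  also have "... <= exp (t * eps / 2)" by (rule exp_ge_add_one_self)
  finally show ?thesis .
 qed
 have bound: "(\<Sum>om\<in>tuples Q \<mu>. of_bool (real Q * eps < (\<Sum>i<Q. g (om i))) * (\<Prod>i<Q. pmf \<mu> (om i)))
  <= exp (- (t * eps / 2)) ^ Q" for Q
 proof -
  have "(\<Sum>om\<in>tuples Q \<mu>. of_bool (real Q * eps < (\<Sum>i<Q. g (om i))) * (\<Prod>i<Q. pmf \<mu> (om i)))
   <= (\<Sum>om\<in>tuples Q \<mu>. exp (- (t * eps)) ^ Q * (\<Prod>i<Q. pmf \<mu> (om i) * exp (t * g (om i))))"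
  proof (intro sum_mono)
   fix om
   have "of_bool (real Q * eps < (\<Sum>i<Q. g (om i))) <= exp (t * ((\<Sum>i<Q. g (om i)) - real Q * eps))"
    using t by (cases "real Q * eps < (\<Sum>i<Q. g (om i))") auto
   also have "t * ((\<Sum>i<Q. g (om i)) - real Q * eps) = (\<Sum>i<Q. t * g (om i)) + real Q * (- (t * eps))"
    by (simp add: algebra_simps sum_distrib_left)
   also have "exp ... = (\<Prod>i<Q. exp (t * g (om i))) * exp (- (t * eps)) ^ Q"
    by (simp only: exp_add exp_sum finite_lessThan exp_of_nat_mult)
   finally have "of_bool (real Q * eps < (\<Sum>i<Q. g (om i))) * (\<Prod>i<Q. pmf \<mu> (om i))
    <= ((\<Prod>i<Q. exp (t * g (om i))) * exp (- (t * eps)) ^ Q) * (\<Prod>i<Q. pmf \<mu> (om i))"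
    by (intro mult_right_mono prod_nonneg) auto
   then show "of_bool (real Q * eps < (\<Sum>i<Q. g (om i))) * (\<Prod>i<Q. pmf \<mu> (om i))
    <= exp (- (t * eps)) ^ Q * (\<Prod>i<Q. pmf \<mu> (om i) * exp (t * g (om i)))"
    by (simp add: prod.distrib mult_ac)
  qed
  also have "... = exp (- (t * eps)) ^ Q * (\<Sum>x\<in>set_pmf \<mu>. pmf \<mu> x * exp (t * g x)) ^ Q"
   unfolding sum_distrib_left[symmetric]
   by (subst sum_tuples_prod[OF fin, of "%_ x. pmf \<mu> x * exp (t * g x)"]) simp
  also have "... <= exp (- (t * eps)) ^ Q * exp (t * eps / 2) ^ Q"
   using mgf by (intro mult_left_mono power_mono sum_nonneg) auto
  also have "... = exp (- (t * eps / 2)) ^ Q"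
   unfolding power_mult_distrib[symmetric] exp_add[symmetric] by (simp add: field_simps)
  finally show ?thesis .
 qed
 have "(%Q. exp (- (t * eps / 2)) ^ Q) \<longlonglongrightarrow> 0"
  using t eps by (intro LIMSEQ_realpow_zero) auto
 then have "eventually (%Q. exp (- (t * eps / 2)) ^ Q < \<eta>) sequentially"
  using \<eta> by (rule order_tendstoD)
 then show ?thesis
  by eventually_elim (use bound in \<open>auto intro: order_trans less_imp_le\<close>)
qed

text \<open>A probability vector on tuples such that, around every tuple of its support and for all
  U in \<open>dspans\<close> at once, the class of tuples congruent modulo U is no heavier than the
  entropy predicts, up to eps per entry. A product measure satisfies this only around typical
  tuples; conditioning on them enforces it on the whole support.\<close>

definition typical_weight :: "(rat ^ 'k::finite) pmf => real => nat => ((nat => rat ^ 'k) => real) => bool" where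
 "typical_weight \<mu> eps Q p \<longleftrightarrow> (\<forall>om. 0 <= p om) & (\<Sum>om\<in>tuples Q \<mu>. p om) = 1 &
   (\<forall>om\<in>tuples Q \<mu>. 0 < p om \<longrightarrow> (\<forall>U\<in>dspans.
    (\<Sum>om'\<in>{om'\<in>tuples Q \<mu>. \<forall>i<Q. om' i - om i \<in> U}. p om') <= exp (- (real Q * (coset_entropy \<mu> U - eps)))))"

lemma ex_typical_weight:
 fixes \<mu> :: "(rat ^ 'k::finite) pmf"
 assumes fin: "finite (set_pmf \<mu>)" and eps: "0 < eps"
 shows "eventually (%Q. \<exists>p. typical_weight \<mu> eps Q p) sequentially"
proof -
 define P where "P U x = measure_pmf.prob \<mu> {y. y - x \<in> U}" for U and x :: "rat ^ 'k"
 define m where "m om Q = (\<Prod>i<Q. pmf \<mu> (om i))" for om :: "nat => rat ^ 'k" and Q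
 define g where "g U x = ln (P U x) + coset_entropy \<mu> U" for U x
 let ?N = "real (card (dspans :: (rat ^ 'k) set set)) + 1"
 have m0: "0 <= m om Q" for om Q unfolding m_def by (intro prod_nonneg) auto
 have tail: "eventually (%Q. \<forall>U\<in>dspans. (\<Sum>om\<in>tuples Q \<mu>. of_bool (real Q * (eps / 2) < (\<Sum>i<Q. g U (om i))) * m om Q) <= 1 / (2 * ?N)) sequentially"
  unfolding m_def
 proof (intro eventually_ball_finite[OF finite_dspans] ballI upper_tail_tuples)
  fix U :: "(rat ^ 'k) set" assume "U \<in> dspans"
  have "(\<Sum>x\<in>set_pmf \<mu>. pmf \<mu> x * g U x) = (\<Sum>x\<in>set_pmf \<mu>. pmf \<mu> x * ln (P U x)) + (\<Sum>x\<in>set_pmf \<mu>. pmf \<mu> x) * coset_entropy \<mu> U"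
   by (simp add: g_def algebra_simps sum.distrib sum_distrib_left)
  also have "... = 0" using sum_pmf_eq_1[OF fin order_refl] by (simp add: coset_entropy_alt P_def)
  finally show "(\<Sum>x\<in>set_pmf \<mu>. pmf \<mu> x * g U x) = 0" .
 qed (use fin eps in auto)
 \<comment> \<open>One half of eps defines typicality; the other half pays for the conditioning,
   which loses a factor of at most 2.\<close>
 have large: "eventually (%Q. 2 <= exp (real Q * (eps / 2))) sequentially"
 proof -
  have "filterlim (%Q. exp (real Q * (eps / 2))) at_top sequentially"
   using eps by (intro filterlim_compose[OF exp_at_top]
     filterlim_at_top_mult_tendsto_pos[OF tendsto_const _ filterlim_real_sequentially]) auto
  then show ?thesis by (simp add: filterlim_at_top)
 qed
 show ?thesis
  using tail large
 proof eventually_elim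
  case (elim Q)
  define tyok where "tyok om \<longleftrightarrow> (\<forall>U\<in>dspans. (\<Sum>i<Q. g U (om i)) <= real Q * (eps / 2))" for om
  define Z where "Z = (\<Sum>om\<in>tuples Q \<mu>. of_bool (tyok om) * m om Q)"
  define p where "p om = of_bool (tyok om) * m om Q / Z" for om
  have fT: "finite (tuples Q \<mu>)" by (rule finite_tuples[OF fin])
  have tot: "(\<Sum>om\<in>tuples Q \<mu>. m om Q) = 1"
   unfolding m_def using sum_tuples_prod[OF fin, of "%_. pmf \<mu>" Q] sum_pmf_eq_1[OF fin order_refl] by simp
  have "(\<Sum>om\<in>tuples Q \<mu>. m om Q) <= (\<Sum>om\<in>tuples Q \<mu>. of_bool (tyok om) * m om Q +
    (\<Sum>U\<in>dspans. of_bool (real Q * (eps / 2) < (\<Sum>i<Q. g U (om i))) * m om Q))"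
  proof (intro sum_mono)
   fix om :: "nat => rat ^ 'k"
   let ?s = "\<Sum>U\<in>dspans. of_bool (real Q * (eps / 2) < (\<Sum>i<Q. g U (om i))) * m om Q"
   have s0: "0 <= ?s" using m0 by (intro sum_nonneg) auto
   show "m om Q <= of_bool (tyok om) * m om Q + ?s"
   proof (cases "tyok om")
    case False
    then obtain U where U: "U \<in> dspans" "real Q * (eps / 2) < (\<Sum>i<Q. g U (om i))"
     by (auto simp: tyok_def not_le)
    have "of_bool (real Q * (eps / 2) < (\<Sum>i<Q. g U (om i))) * m om Q <= ?s"
     using U m0 by (intro member_le_sum) auto
    then show ?thesis using U False by simp
   qed (use s0 in auto)
  qed
  also have "... = Z + (\<Sum>U\<in>dspans. \<Sum>om\<in>tuples Q \<mu>. of_bool (real Q * (eps / 2) < (\<Sum>i<Q. g U (om i))) * m om Q)"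
   unfolding sum.distrib Z_def by (subst (2) sum.swap) (rule refl)
  also have "... <= Z + (\<Sum>U\<in>(dspans :: (rat ^ 'k) set set). 1 / (2 * ?N))"
   using elim by (intro add_left_mono sum_mono) auto
  also have "... <= Z + 1 / 2" by (simp add: field_simps)
  finally have Z: "1 / 2 <= Z" using tot by simp
  have "typical_weight \<mu> eps Q p" unfolding typical_weight_def
  proof (intro conjI allI ballI impI)
   show "0 <= p om" for om unfolding p_def using Z m0 by simp
   show "(\<Sum>om\<in>tuples Q \<mu>. p om) = 1"
    unfolding p_def sum_divide_distrib[symmetric] Z_def[symmetric] using Z by simp
   fix om and U :: "(rat ^ 'k) set"
   assume om: "om \<in> tuples Q \<mu>" "0 < p om" and U: "U \<in> dspans"
   have "tyok om" using om(2) unfolding p_def by (cases "tyok om") auto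
   then have tyok: "(\<Sum>i<Q. g U (om i)) <= real Q * (eps / 2)" using U unfolding tyok_def by blast
   have sup: "om i \<in> set_pmf \<mu>" if "i < Q" for i using om that by (auto simp: tuples_def)
   have Ppos: "0 < P U (om i)" if "i < Q" for i
    unfolding P_def using subspace_dspans[OF U] sup[OF that] by (rule coset_prob_pos)
   have "(\<Sum>om'\<in>{om'\<in>tuples Q \<mu>. \<forall>i<Q. om' i - om i \<in> U}. p om')
    = (\<Sum>om'\<in>tuples Q \<mu>. if \<forall>i<Q. om' i - om i \<in> U then p om' else 0)"
    using fT by (simp add: sum.inter_filter)
   also have "... <= (\<Sum>om'\<in>tuples Q \<mu>. 2 * (\<Prod>i<Q. of_bool (om' i - om i \<in> U) * pmf \<mu> (om' i)))"
   proof (intro sum_mono)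
    fix om' :: "nat => rat ^ 'k"
    have nn: "0 <= 2 * (\<Prod>i<Q. of_bool (om' i - om i \<in> U) * pmf \<mu> (om' i))"
     by (intro mult_nonneg_nonneg prod_nonneg) auto
    show "(if \<forall>i<Q. om' i - om i \<in> U then p om' else 0) <= 2 * (\<Prod>i<Q. of_bool (om' i - om i \<in> U) * pmf \<mu> (om' i))"
    proof (cases "\<forall>i<Q. om' i - om i \<in> U")
     case True
     have "p om' <= m om' Q / Z" unfolding p_def using Z m0 by (intro divide_right_mono) auto
     also have "... <= m om' Q / (1 / 2)" using Z m0 by (intro divide_left_mono) auto
     also have "... = 2 * (\<Prod>i<Q. of_bool (om' i - om i \<in> U) * pmf \<mu> (om' i))"
      unfolding m_def using True by simp
     finally show ?thesis using True by simp
    qed (use nn in auto)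
   qed
   also have "... = 2 * (\<Prod>i<Q. \<Sum>x\<in>set_pmf \<mu>. of_bool (x - om i \<in> U) * pmf \<mu> x)"
    unfolding sum_distrib_left[symmetric] using fin
    by (subst sum_tuples_prod[OF fin, of "%i x. of_bool (x - om i \<in> U) * pmf \<mu> x"]) auto
   also have "(\<Prod>i<Q. \<Sum>x\<in>set_pmf \<mu>. of_bool (x - om i \<in> U) * pmf \<mu> x) = (\<Prod>i<Q. P U (om i))"
   proof (intro prod.cong refl)
    fix i
    have "P U (om i) = measure_pmf.prob \<mu> ({y. y - om i \<in> U} \<inter> set_pmf \<mu>)"
     unfolding P_def by (simp add: measure_Int_set_pmf)
    also have "... = (\<Sum>x\<in>{y. y - om i \<in> U} \<inter> set_pmf \<mu>. pmf \<mu> x)"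
     using fin by (intro measure_measure_pmf_finite) auto
    also have "... = (\<Sum>x\<in>set_pmf \<mu>. of_bool (x - om i \<in> U) * pmf \<mu> x)"
     using fin by (intro sum.mono_neutral_cong_left) auto
    finally show "(\<Sum>x\<in>set_pmf \<mu>. of_bool (x - om i \<in> U) * pmf \<mu> x) = P U (om i)" by simp
   qed
   also have "... = exp (\<Sum>i<Q. ln (P U (om i)))"
    using Ppos by (simp add: exp_sum)
   also have "2 * ... <= exp (real Q * (eps / 2)) * exp (- (real Q * (coset_entropy \<mu> U - eps / 2)))"
   proof (intro mult_mono)
    have "(\<Sum>i<Q. g U (om i)) = (\<Sum>i<Q. ln (P U (om i))) + real Q * coset_entropy \<mu> U"
     by (simp add: g_def sum.distrib)
    then show "exp (\<Sum>i<Q. ln (P U (om i))) <= exp (- (real Q * (coset_entropy \<mu> U - eps / 2)))"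
     using tyok by (simp add: algebra_simps)
   qed (use elim in auto)
   also have "... = exp (- (real Q * (coset_entropy \<mu> U - eps)))"
    unfolding exp_add[symmetric] by (simp add: algebra_simps)
   finally show "(\<Sum>om'\<in>{om'\<in>tuples Q \<mu>. \<forall>i<Q. om' i - om i \<in> U}. p om') <= exp (- (real Q * (coset_entropy \<mu> U - eps)))"
    by simp
  qed
  then show ?case by blast
 qed
qed

section \<open>Lower bound: the energy of a pair of assignments against the entropy of the
  flag\<close>

section \<open>Energy of profiles\<close>

lemma flag_entropy_cong:
 assumes "!!j. j <= r ==> V j = V' j"
 shows "flag_entropy r V c \<mu> = flag_entropy r V' c \<mu>"
proof -
 have "(\<Sum>j=1..r. (c j - c (j + 1)) * coset_entropy (\<mu> j) (V j)) =
  (\<Sum>j=1..r. (c j - c (j + 1)) * coset_entropy (\<mu> j) (V' j))"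
  using assms by (intro sum.cong refl) auto
 moreover have "(\<Sum>j=1..r. c j * quotient_dim (V j) (V (j - 1))) =
  (\<Sum>j=1..r. c j * quotient_dim (V' j) (V' (j - 1)))"
  using assms by (intro sum.cong refl) auto
 ultimately show ?thesis unfolding flag_entropy_def by simp
qed

text \<open>Flags with all spaces in \<open>dspans\<close> take only finitely many values of the
  entropy, so strictness improves to a uniform gap.\<close>

lemma strict_gap:
 fixes V :: "nat => (rat ^ 'k::finite) set"
 assumes "strict_entropy_condition r V c \<mu>"
 obtains eps where "0 < eps" "!!V'. proper_subflag r V' V ==> (!!j. j <= r ==> V' j \<in> dspans) ==>
  flag_entropy r V c \<mu> + eps <= flag_entropy r V' c \<mu>"
proof -
 let ?F = "Pi\<^sub>E {0..r} (%_. dspans :: (rat ^ 'k) set set)"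
 define E where "E = {e \<in> (%V'. flag_entropy r V' c \<mu>) ` ?F. flag_entropy r V c \<mu> < e}"
 have "finite ?F" by (intro finite_PiE) auto
 then have finE: "finite E" unfolding E_def by simp
 define eps where "eps = Min (insert (flag_entropy r V c \<mu> + 1) E) - flag_entropy r V c \<mu>"
 show ?thesis
 proof (rule that)
  have "Min (insert (flag_entropy r V c \<mu> + 1) E) \<in> insert (flag_entropy r V c \<mu> + 1) E"
   using finE by (intro Min_in) auto
  then show "0 < eps" by (auto simp: eps_def E_def)
  fix V' assume V': "proper_subflag r V' V" "!!j. j <= r ==> V' j \<in> dspans"
  have eq: "flag_entropy r (restrict V' {0..r}) c \<mu> = flag_entropy r V' c \<mu>"
   by (intro flag_entropy_cong) auto
  have "flag_entropy r V c \<mu> < flag_entropy r V' c \<mu>"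
   using assms V' by (auto simp: strict_entropy_condition_def)
  then have "flag_entropy r V' c \<mu> \<in> E"
   unfolding E_def using V'(2) by (auto intro!: image_eqI[of _ _ "restrict V' {0..r}"] simp: eq)
  then have "Min (insert (flag_entropy r V c \<mu> + 1) E) <= flag_entropy r V' c \<mu>"
   using finE by (intro Min_le) auto
  then show "flag_entropy r V c \<mu> + eps <= flag_entropy r V' c \<mu>" by (simp add: eps_def)
 qed
qed

text \<open>If c (j + 1) = c j, then V j enters the Abel-summed entropy with weight 0 and can be
  collapsed to V (j - 1): a proper subflag of no larger entropy (for j = r the remaining term with c
  (r + 1) can only drop). Hence every scale has positive length.\<close>

lemma strict_decreasing:
 fixes V :: "nat => (rat ^ 'k::finite) set"
 assumes sys: "system r V c \<mu>" and strict: "strict_entropy_condition r V c \<mu>" and j: "j \<in> {1..r}"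
 shows "c (j + 1) < c j"
proof (rule ccontr)
 assume "\<not> c (j + 1) < c j"
 moreover have "c (j + 1) <= c j" using sys j unfolding system_def by blast
 ultimately have ceq: "c (j + 1) = c j" by simp
 have fl: "flag r V" and inj: "inj_on V {0..r}" using sys by (auto simp: system_def)
 define V' where "V' = V(j := V (j - 1))"
 have "flag r V'"
  unfolding flag_def
 proof (intro conjI allI impI)
  show "V' 0 = vec.span {\<chi> i. 1}" using fl j by (auto simp: V'_def flag_def)
  show "vec.subspace (V' i)" if "i <= r" for i using flag_subspace[OF fl] that j by (auto simp: V'_def)
  show "V' i \<subseteq> V' (Suc i)" if "i < r" for i
  proof -
   have "V i \<subseteq> V (Suc i)" using fl that by (auto simp: flag_def)
   moreover have "V (j - 1) \<subseteq> V (Suc j)" if "j < r"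
    using that by (intro flag_mono[OF fl]) auto
   ultimately show ?thesis using that by (auto simp: V'_def)
  qed
 qed
 moreover have "V' i \<subseteq> V i" if "i <= r" for i
  using flag_mono[OF fl, of "j - 1" j] j by (auto simp: V'_def)
 moreover have "V' j ~= V j" 
 proof -
  have "j - 1 \<in> {0..r}" "j \<in> {0..r}" "j - 1 ~= j" using j by auto
  then have "V (j - 1) ~= V j" using inj_on_eq_iff[OF inj] by blast
  then show ?thesis by (simp add: V'_def)
 qed
 ultimately have "proper_subflag r V' V" using j by (auto simp: proper_subflag_def subflag_def)
 then have "flag_entropy r V c \<mu> < flag_entropy r V' c \<mu>" using strict by (auto simp: strict_entropy_condition_def)
 moreover have "(\<Sum>i=1..r. (c i - c (i + 1)) * (coset_entropy (\<mu> i) (V' i) + real (vec.dim (V' i))))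
  = (\<Sum>i=1..r. (c i - c (i + 1)) * (coset_entropy (\<mu> i) (V i) + real (vec.dim (V i))))"
  using ceq by (intro sum.cong refl) (auto simp: V'_def)
 moreover have "c (r + 1) * real (vec.dim (V' r)) <= c (r + 1) * real (vec.dim (V r))"
  using \<open>!!i. i <= r ==> V' i \<subseteq> V i\<close>[of r] sys
  by (intro mult_left_mono) (auto simp: system_def intro!: vec.dim_subset)
 moreover have "V' 0 = V 0" using j by (simp add: V'_def)
 ultimately show False unfolding flag_entropy_alt by simp
qed

text \<open>One index l < r * P runs through all windows, P for each scale; the shift by 1 makes the
  scales start at 1.\<close>

definition scl :: "nat => nat => nat" where "scl P l = l div P + 1"

text \<open>Logarithm of the upper end of window l. Scale j starts at c j * Lam and descends in P
  steps of length T * (c j - c (j + 1)). Since T * P will stay below Lam by a fixed proportion, a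
  gap remains above c (j + 1) * Lam, which receives the fresh elements of the next scale.\<close>

definition wheight :: "(nat => real) => real => real => nat => nat => real" where
 "wheight c Lam T P l = c (scl P l) * Lam - (c (scl P l) - c (scl P l + 1)) * T * real (l mod P)"

text \<open>A profile is a chain of spaces indexed by all windows. Reading it at the n-th window of
  every scale gives an r-step flag, so a profile consists of P interleaved flags, and the entropy
  condition applies to each of them.\<close>

definition profile_flag :: "nat => (nat => (rat ^ 'k::finite) set) => nat => nat => (rat ^ 'k) set" where
 "profile_flag P W n j = (if j = 0 then W 0 else W ((j - 1) * P + n + 1))"

lemma sum_blocks_Suc:
 fixes f :: "nat => real"
 shows "(\<Sum>l<Suc r * P. f l) = (\<Sum>l<r * P. f l) + (\<Sum>n<P. f (r * P + n))"
proof -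
 have "(\<Sum>l<Suc r * P. f l) = (\<Sum>l<r * P. f l) + (\<Sum>l\<in>{r * P..<r * P + P}. f l)"
  using sum.atLeastLessThan_concat[of 0 "r * P" "r * P + P" f]
  by (simp add: atLeast0LessThan add.commute)
 also have "(\<Sum>l\<in>{r * P..<r * P + P}. f l) = (\<Sum>n<P. f (r * P + n))"
  using sum.shift_bounds_nat_ivl[of f 0 "r * P" P] by (simp add: atLeast0LessThan add.commute)
 finally show ?thesis .
qed

lemma sum_blocks:
 fixes f :: "nat => real"
 shows "(\<Sum>l<r * P. f l) = (\<Sum>j=1..r. \<Sum>n<P. f ((j - 1) * P + n))"
proof (induction r)
 case (Suc r)
 then show ?case unfolding sum_blocks_Suc by simp
qed simp

lemma jumps_double_count:
 fixes d c :: "nat => real"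
 assumes n: "n < P"
 defines "D \<equiv> %j. if j = 0 then d 0 else d ((j - 1) * P + n + 1)"
 shows "(\<Sum>l<i * P. (d (l + 1) - d l) * (if l mod P <= n then c (scl P l) else c (scl P l + 1)))
  = (\<Sum>j=1..i. c j * (D j - D (j - 1))) + c (i + 1) * (d (i * P) - D i)"
proof (induction i)
 case 0 show ?case by (simp add: D_def)
next
 case (Suc i)
 let ?f = "%l. (d (l + 1) - d l) * (if l mod P <= n then c (scl P l) else c (scl P l + 1))"
 have block: "(\<Sum>m<P. ?f (i * P + m)) = c (i + 1) * (d (i * P + n + 1) - d (i * P)) + c (i + 2) * (d (i * P + P) - d (i * P + n + 1))"
 proof -
  have *: "?f (i * P + m) = (d (i * P + m + 1) - d (i * P + m)) * (if m <= n then c (i + 1) else c (i + 2))"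
   if "m < P" for m
   using that n by (auto simp: scl_def)
  have tel: "(\<Sum>m\<in>{a..<b}. d (i * P + m + 1) - d (i * P + m)) = d (i * P + b) - d (i * P + a)" if "a <= b" for a b
   using sum_Suc_diff'[of a b "%m. d (i * P + m)"] that by simp
  have "(\<Sum>m<P. ?f (i * P + m)) = (\<Sum>m\<in>{0..<P}. (d (i * P + m + 1) - d (i * P + m)) * (if m <= n then c (i + 1) else c (i + 2)))"
   using * by (intro sum.cong) auto
  also have "... = (\<Sum>m\<in>{0..<n + 1}. (d (i * P + m + 1) - d (i * P + m)) * (if m <= n then c (i + 1) else c (i + 2)))
    + (\<Sum>m\<in>{n + 1..<P}. (d (i * P + m + 1) - d (i * P + m)) * (if m <= n then c (i + 1) else c (i + 2)))"
   using n by (intro sum.atLeastLessThan_concat[symmetric]) auto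
  also have "(\<Sum>m\<in>{0..<n + 1}. (d (i * P + m + 1) - d (i * P + m)) * (if m <= n then c (i + 1) else c (i + 2)))
   = (\<Sum>m\<in>{0..<n + 1}. d (i * P + m + 1) - d (i * P + m)) * c (i + 1)"
   unfolding sum_distrib_right by (intro sum.cong) auto
  also have "(\<Sum>m\<in>{n + 1..<P}. (d (i * P + m + 1) - d (i * P + m)) * (if m <= n then c (i + 1) else c (i + 2)))
   = (\<Sum>m\<in>{n + 1..<P}. d (i * P + m + 1) - d (i * P + m)) * c (i + 2)"
   unfolding sum_distrib_right by (intro sum.cong) auto
  also have "(\<Sum>m\<in>{0..<n + 1}. d (i * P + m + 1) - d (i * P + m)) = d (i * P + (n + 1)) - d (i * P + 0)"
   by (rule tel) simp
  also have "(\<Sum>m\<in>{n + 1..<P}. d (i * P + m + 1) - d (i * P + m)) = d (i * P + P) - d (i * P + (n + 1))"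
   using n by (intro tel) simp
  finally show ?thesis by (simp only: mult.commute add.assoc add_0_right)
 qed
 have "(\<Sum>l<Suc i * P. ?f l) = (\<Sum>l<i * P. ?f l) + (\<Sum>m<P. ?f (i * P + m))"
  by (rule sum_blocks_Suc)
 also have "... = (\<Sum>j=1..Suc i. c j * (D j - D (j - 1))) + c (Suc i + 1) * (d (Suc i * P) - D (Suc i))"
  unfolding block Suc.IH by (simp add: D_def algebra_simps)
 finally show ?case .
qed

text \<open>A jump of the dimension at window m of scale j is seen at level j by the flags with n >=
  m and at level j + 1 by the others. Averaged over n, its charge is c j * Lam - (c j - c (j + 1)) *
  m * Lam / P, which is at most \<open>wheight\<close> because T <= Lam / P. The real cost of the
  jumps thus dominates the average of the dimension terms of the P flags.\<close>

lemma profile_dimension_energy: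
 fixes d c :: "nat => real"
 assumes P: "1 <= P" and T: "0 <= T" "T * real P <= Lam"
  and c: "!!j. j \<in> {1..r} ==> c (j + 1) <= c j" "0 <= c (r + 1)"
  and d: "!!l. l < r * P ==> d l <= d (l + 1)"
 shows "Lam / real P * (\<Sum>n<P. \<Sum>j=1..r. c j * ((if j = 0 then d 0 else d ((j - 1) * P + n + 1))
   - (if j - 1 = 0 then d 0 else d ((j - 1 - 1) * P + n + 1))))
  <= (\<Sum>l<r * P. (d (l + 1) - d l) * wheight c Lam T P l)"
proof (cases "r = 0")
 case False
 let ?D = "%n j. if j = 0 then d 0 else d ((j - 1) * P + n + 1)"
 let ?cc = "%l n. if l mod P <= n then c (scl P l) else c (scl P l + 1)"
 have dm: "d l <= d l'" if "l <= l'" "l' <= r * P" for l l'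
  using that
 proof (induction l' rule: dec_induct)
  case (step m)
  then show ?case using d[of m] by simp
 qed simp
 have Lam: "0 <= Lam" using T by (meson mult_nonneg_nonneg of_nat_0_le_iff order_trans)
 have "(\<Sum>n<P. \<Sum>j=1..r. c j * (?D n j - ?D n (j - 1)))
  <= (\<Sum>n<P. \<Sum>l<r * P. (d (l + 1) - d l) * ?cc l n)"
 proof (intro sum_mono)
  fix n assume "n \<in> {..<P}"
  then have n: "n < P" by simp
  have "(r - 1) * P + n + 1 <= r * P" using n False by (cases r) auto
  then have "?D n r <= d (r * P)" using False by (auto intro!: dm)
  then show "(\<Sum>j=1..r. c j * (?D n j - ?D n (j - 1))) <= (\<Sum>l<r * P. (d (l + 1) - d l) * ?cc l n)"
   unfolding jumps_double_count[OF n] using c(2) by simp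
 qed
 also have "... = (\<Sum>l<r * P. (d (l + 1) - d l) * (\<Sum>n<P. ?cc l n))"
  unfolding sum_distrib_left by (rule sum.swap)
 finally have "Lam / real P * (\<Sum>n<P. \<Sum>j=1..r. c j * (?D n j - ?D n (j - 1)))
  <= Lam / real P * (\<Sum>l<r * P. (d (l + 1) - d l) * (\<Sum>n<P. ?cc l n))"
  using Lam by (intro mult_left_mono) auto
 also have "... = (\<Sum>l<r * P. (d (l + 1) - d l) * (Lam / real P * (\<Sum>n<P. ?cc l n)))"
  by (simp add: sum_distrib_left mult_ac)
 also have "... <= (\<Sum>l<r * P. (d (l + 1) - d l) * wheight c Lam T P l)"
 proof (intro sum_mono mult_left_mono)
  fix l assume "l \<in> {..<r * P}"
  then have l: "l < r * P" by simp
  let ?j = "scl P l" and ?m = "l mod P"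
  have j: "?j \<in> {1..r}" using l by (auto simp: scl_def less_mult_imp_div_less Suc_le_eq)
  have m: "?m < P" using P by simp
  have "(\<Sum>n<P. ?cc l n) = (\<Sum>n\<in>{0..<?m}. ?cc l n) + (\<Sum>n\<in>{?m..<P}. ?cc l n)"
   using m sum.atLeastLessThan_concat[of 0 ?m P "?cc l"] by (simp add: atLeast0LessThan)
  also have "... = real ?m * c (?j + 1) + (real P - real ?m) * c ?j"
   using m by simp
  finally have S: "(\<Sum>n<P. ?cc l n) = real ?m * c (?j + 1) + (real P - real ?m) * c ?j" .
  have "Lam / real P * (\<Sum>n<P. ?cc l n) = c ?j * Lam - (c ?j - c (?j + 1)) * real ?m * (Lam / real P)"
   unfolding S using P by (simp add: field_simps)
  also have "... <= c ?j * Lam - (c ?j - c (?j + 1)) * real ?m * T"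
  proof -
   have "T <= Lam / real P" using T P by (simp add: field_simps)
   then have "(c ?j - c (?j + 1)) * real ?m * T <= (c ?j - c (?j + 1)) * real ?m * (Lam / real P)"
    using c(1)[OF j] by (intro mult_left_mono) auto
   then show ?thesis by simp
  qed
  finally show "Lam / real P * (\<Sum>n<P. ?cc l n) <= wheight c Lam T P l"
   by (simp add: wheight_def mult_ac)
  show "0 <= d (l + 1) - d l" using d[OF l] by simp
 qed
 finally show ?thesis .
qed simp

text \<open>Exponent per entry that is gained when the differences from a fixed typical assignment
  are confined to U. It is 0, and not -eps, once U = V j: the loss eps must not accumulate over the
  windows where the profile agrees with the flag.\<close>

definition saving :: "(nat => (rat ^ 'k::finite) set) => (nat => (rat ^ 'k) pmf) => real => nat => (rat ^ 'k) set => real" where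
 "saving V \<mu> eps j U = (if U = V j then 0 else max 0 (coset_entropy (\<mu> j) U - eps))"

definition is_profile :: "nat => (nat => (rat ^ 'k::finite) set) => nat => (nat => (rat ^ 'k) set) => bool" where
 "is_profile r V P W \<longleftrightarrow> W 0 = vec.span {ones} & (\<forall>l\<le>r * P. W l \<in> dspans) &
  (\<forall>l<r * P. W l \<subseteq> W (l + 1) & W (l + 1) \<subseteq> V (scl P l))"

definition mismatch :: "nat => (nat => (rat ^ 'k::finite) set) => nat => (nat => (rat ^ 'k) set) => nat" where
 "mismatch r V P W = card {n. n < P & (\<exists>j\<in>{1..r}. profile_flag P W n j ~= V j)}"

lemma is_profile_mono:
 assumes "is_profile r V P W" "l <= l'" "l' <= r * P" shows "W l \<subseteq> W l'"
 using assms(2,3)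
proof (induction l' rule: dec_induct)
 case (step n)
 then show ?case using assms(1) unfolding is_profile_def by (metis Suc_eq_plus1 Suc_le_lessD Suc_leD order_trans)
qed auto

lemma block_index_less:
 fixes j n P r :: nat
 shows "j \<in> {1..r} ==> n < P ==> (j - 1) * P + n < r * P"
proof -
 assume j: "j \<in> {1..r}" and n: "n < P"
 have "(j - 1) * P + n < (j - 1) * P + P" using n by (rule add_strict_left_mono)
 also have "... = j * P" using j by (cases j) auto
 also have "... <= r * P" using j by simp
 finally show ?thesis .
qed

lemma scl_block: "j \<in> {1..r} ==> n < P ==> scl P ((j - 1) * P + n) = j"
 by (auto simp: scl_def)

lemma profile_subset_flag:
 assumes "is_profile r V P W" "j \<in> {1..r}" "n < P"
 shows "profile_flag P W n j \<subseteq> V j"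
proof -
 have "W ((j - 1) * P + n + 1) \<subseteq> V (scl P ((j - 1) * P + n))"
  using assms(1) block_index_less[OF assms(2,3)] unfolding is_profile_def by blast
 then show ?thesis using assms(2) unfolding profile_flag_def scl_block[OF assms(2,3)] by auto
qed

lemma profile_flag_position_mono:
 assumes "is_profile r V P W" "j \<in> {1..r}" "n <= n'" "n' < P"
 shows "profile_flag P W n j \<subseteq> profile_flag P W n' j"
proof -
 have "W ((j - 1) * P + n + 1) \<subseteq> W ((j - 1) * P + n' + 1)"
  using block_index_less[OF assms(2,4)] assms(3) by (intro is_profile_mono[OF assms(1)]) linarith+
 then show ?thesis using assms(2) by (simp add: profile_flag_def)
qed

lemma profile_flag_subflag:
 assumes W: "is_profile r V P W" and fl: "flag r V" and n: "n < P"
 shows "subflag r (profile_flag P W n) V"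
 unfolding subflag_def flag_def
proof (intro conjI allI impI)
 show "profile_flag P W n 0 = vec.span {\<chi> i. 1}" using W by (simp add: profile_flag_def is_profile_def)
 fix j assume j: "j <= r"
 have "profile_flag P W n j \<in> dspans"
 proof (cases "j = 0")
  case False
  then have "(j - 1) * P + n < r * P" using block_index_less[of j r n P] j n by auto
  then show ?thesis using W False unfolding profile_flag_def is_profile_def by auto
 qed (use W in \<open>auto simp: profile_flag_def is_profile_def\<close>)
 then show "vec.subspace (profile_flag P W n j)" by (rule subspace_dspans)
 show "profile_flag P W n j \<subseteq> V j"
  using profile_subset_flag[OF W, of j n] j n W fl
  by (cases "j = 0") (auto simp: profile_flag_def is_profile_def flag_def)
next
 fix j assume j: "j < r"
 have "j * P + n < r * P" using block_index_less[of "Suc j" r n P] j n by auto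
 then have le: "j * P + n + 1 <= r * P" by simp
 show "profile_flag P W n j \<subseteq> profile_flag P W n (Suc j)"
 proof (cases "j = 0")
  case True
  have "W 0 \<subseteq> W (j * P + n + 1)" using le by (intro is_profile_mono[OF W]) auto
  then show ?thesis using True by (simp add: profile_flag_def)
 next
  case False
  have "(j - 1) * P + n + 1 <= j * P + n + 1" by simp
  then have "W ((j - 1) * P + n + 1) \<subseteq> W (j * P + n + 1)" using le by (intro is_profile_mono[OF W])
  then show ?thesis using False by (simp add: profile_flag_def)
 qed
qed

text \<open>Within a scale the profile grows with the position and stays below V j, so once it has
  reached V j it remains there. The mismatched positions therefore form an initial segment, of
  length \<open>mismatch\<close>.\<close>

lemma mismatch_iff:
 assumes W: "is_profile r V P W" and n: "n < P"
 shows "n < mismatch r V P W \<longleftrightarrow> (\<exists>j\<in>{1..r}. profile_flag P W n j ~= V j)"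
proof -
 let ?M = "{n. n < P & (\<exists>j\<in>{1..r}. profile_flag P W n j ~= V j)}"
 have down: "m \<in> ?M" if nM: "n \<in> ?M" and mn: "m <= n" for m n
 proof -
  obtain j where j: "j \<in> {1..r}" "profile_flag P W n j ~= V j" "n < P" using nM by blast
  have "profile_flag P W m j \<subseteq> profile_flag P W n j" using mn j by (intro profile_flag_position_mono[OF W]) auto
  moreover have "profile_flag P W n j \<subseteq> V j" using j by (intro profile_subset_flag[OF W]) auto
  ultimately have "profile_flag P W m j ~= V j" using j by auto
  then show ?thesis using j mn by auto
 qed
 have fin: "finite ?M" by auto
 have "?M = {..<card ?M}"
 proof (intro card_subset_eq[symmetric] ballI)
  show "{..<card ?M} \<subseteq> ?M"
  proof (rule ccontr)
   assume "\<not> {..<card ?M} \<subseteq> ?M"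
   then obtain m where "m \<in> {..<card ?M}" and m2: "m \<notin> ?M" by blast
   then have m: "m < card ?M" by simp
   have "?M \<subseteq> {..<m}" using down m2 by (meson lessThan_iff not_le subsetI)
   then have "card ?M <= m" using card_mono[of "{..<m}" ?M] by simp
   then show False using m by simp
  qed
 qed (use fin in auto)
 then have "n \<in> {..<card ?M} \<longleftrightarrow> n \<in> ?M" by (rule arg_cong[of _ _ "%S. n \<in> S", OF sym])
 then show ?thesis using n unfolding mismatch_def lessThan_iff mem_Collect_eq by blast
qed

lemma mismatch_le: "mismatch r V P W <= P"
 unfolding mismatch_def using card_mono[of "{..<P}" "{n. n < P & (\<exists>j\<in>{1..r}. profile_flag P W n j ~= V j)}"]
 by auto

text \<open>The missing windows are counted on every initial segment of a scale because the
  mismatched positions form such a segment: the loss must be proportional to its length and not to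
  P. The constant C takes care of short segments.\<close>

definition good_pattern :: "nat => nat => real => real => nat set => bool" where
 "good_pattern r P eps C g \<longleftrightarrow>
  (\<forall>j\<in>{1..r}. \<forall>t\<le>P. real (card {n. n < t & (j - 1) * P + n \<notin> g}) <= eps * real t + C)"

text \<open>The entropy is averaged over the P flags of the profile, and each proper one gains
  \<open>eps\<^sub>0\<close>. Half of this pays for the errors, which occur only at mismatched
  positions: (4 * H + 1) * eps for a window that is present and 2 * H for a missing one, the latter
  having density at most eps up to C. This is where the coefficient 6 * H + 1 comes from; C itself
  costs only a bounded factor.\<close>

lemma profile_energy:
 fixes V :: "nat => (rat ^ 'k::finite) set"
 assumes sys: "system r V c \<mu>"
  and gap: "!!V'. proper_subflag r V' V ==> (!!j. j <= r ==> V' j \<in> dspans) ==>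
   flag_entropy r V c \<mu> + eps\<^sub>0 <= flag_entropy r V' c \<mu>"
  and W: "is_profile r V P W" and g: "good_pattern r P eps C g" and C: "0 <= C"
  and P: "1 <= P" and T: "0 < T" "T * real P <= Lam" "Lam <= (1 + 2 * eps) * (T * real P)"
  and eps: "0 < eps" "eps <= 1 / 2" "eps * (6 * H + 1) <= eps\<^sub>0 / 2"
  and H: "H = real (card (cube :: (rat ^ 'k) set))"
  and Q: "!!j. j \<in> {1..r} ==> (1 - 2 * eps) * (T * (c j - c (j + 1))) <= real (Q j)"
   "!!j. j \<in> {1..r} ==> real (Q j) <= T * (c j - c (j + 1))"
 shows "Lam * flag_entropy r V c \<mu> + T * eps\<^sub>0 / 2 * real (mismatch r V P W) - 2 * T * H * C
  <= (\<Sum>l<r * P. (real (vec.dim (W (l + 1))) - real (vec.dim (W l))) * wheight c Lam T P l)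
   + (\<Sum>l\<in>g \<inter> {..<r * P}. real (Q (scl P l)) * saving V \<mu> eps (scl P l) (W (l + 1)))"
proof -
 let ?w = "%j. c j - c (j + 1)"
 let ?N = "mismatch r V P W"
 let ?F = "profile_flag P W"
 let ?a = "Lam / real P"
 have fl: "flag r V" using sys by (simp add: system_def)
 have r1: "1 <= r" using sys by (simp add: system_def)
 have w0: "0 <= ?w j" if "j \<in> {1..r}" for j using sys that by (auto simp: system_def)
 have cr: "0 <= c (r + 1)" and c1: "c 1 <= 1" using sys by (auto simp: system_def)
 have sumw: "(\<Sum>j=1..r. ?w j) <= 1"
 proof -
  have "(\<Sum>j=1..r. ?w j) = c 1 - c (r + 1)"
   using sum_Suc_diff[of 1 r "%j. - c j"] r1 by simp
  then show ?thesis using cr c1 by simp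
 qed
 have H0: "0 <= H" using H by simp
 have a: "T <= ?a" "?a <= (1 + 2 * eps) * T" using T P by (auto simp: field_simps)
 have sub: "subflag r (?F n) V" if "n < P" for n using W fl that by (rule profile_flag_subflag)
 have dsp: "?F n j \<in> dspans" if "n < P" "j <= r" for n j
 proof (cases "j = 0")
  case False
  then have "(j - 1) * P + n < r * P" using block_index_less[of j r n P] that by auto
  then show ?thesis using W False unfolding profile_flag_def is_profile_def by auto
 qed (use W in \<open>auto simp: profile_flag_def is_profile_def\<close>)
 have energy_n: "flag_entropy r V c \<mu> + eps\<^sub>0 * of_bool (n < ?N) <= flag_entropy r (?F n) c \<mu>" if n: "n < P" for n
 proof (cases "n < ?N")
  case True
  then have "proper_subflag r (?F n) V"
   using mismatch_iff[OF W n] sub[OF n] by (auto simp: proper_subflag_def)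
  then show ?thesis using True gap[of "?F n"] dsp[OF n] by simp
 next
  case False
  have "?F n j = V j" if "j <= r" for j
   using False mismatch_iff[OF W n] that W fl
   by (cases "j = 0") (auto simp: profile_flag_def is_profile_def flag_def)
  then have "flag_entropy r (?F n) c \<mu> = flag_entropy r V c \<mu>" by (intro flag_entropy_cong) auto
  then show ?thesis using False by simp
 qed
 have cardN: "(\<Sum>n<P. of_bool (n < ?N) :: real) = real ?N"
 proof -
  have "{..<P} \<inter> {n. n < ?N} = {..<?N}" using mismatch_le[of r V P W] by auto
  then show ?thesis by simp
 qed
 have total: "Lam * flag_entropy r V c \<mu> + T * eps\<^sub>0 * real ?N <= ?a * (\<Sum>n<P. flag_entropy r (?F n) c \<mu>)"
 proof -
  have eps0: "0 <= eps\<^sub>0"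
  proof -
   have "0 <= eps * (6 * H + 1)" using eps(1) H0 by (intro mult_nonneg_nonneg) auto
   then show ?thesis using eps(3) by linarith
  qed
  have "(\<Sum>n<P. flag_entropy r V c \<mu> + eps\<^sub>0 * of_bool (n < ?N)) <= (\<Sum>n<P. flag_entropy r (?F n) c \<mu>)"
   using energy_n by (intro sum_mono) auto
  then have "real P * flag_entropy r V c \<mu> + eps\<^sub>0 * real ?N <= (\<Sum>n<P. flag_entropy r (?F n) c \<mu>)"
   by (simp only: sum.distrib sum_constant card_lessThan sum_distrib_left[symmetric] cardN)
  then have "?a * (real P * flag_entropy r V c \<mu> + eps\<^sub>0 * real ?N) <= ?a * (\<Sum>n<P. flag_entropy r (?F n) c \<mu>)"
   using a T by (intro mult_left_mono) auto
  moreover have "?a * (real P * flag_entropy r V c \<mu> + eps\<^sub>0 * real ?N) = Lam * flag_entropy r V c \<mu> + ?a * (eps\<^sub>0 * real ?N)"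
   using P by (simp add: field_simps)
  moreover have "T * (eps\<^sub>0 * real ?N) <= ?a * (eps\<^sub>0 * real ?N)"
   using a eps0 by (intro mult_right_mono) auto
  ultimately show ?thesis by (simp add: mult.assoc)
 qed
 have dims: "?a * (\<Sum>n<P. \<Sum>j=1..r. c j * quotient_dim (?F n j) (?F n (j - 1)))
  <= (\<Sum>l<r * P. (real (vec.dim (W (l + 1))) - real (vec.dim (W l))) * wheight c Lam T P l)"
 proof -
  have dimF: "(real (vec.dim (?F n j))) = (if j = 0 then real (vec.dim (W 0)) else real (vec.dim (W ((j - 1) * P + n + 1))))" for n j
   by (simp add: profile_flag_def)
  have "?a * (\<Sum>n<P. \<Sum>j=1..r. c j * quotient_dim (?F n j) (?F n (j - 1)))
   = ?a * (\<Sum>n<P. \<Sum>j=1..r. c j * ((if j = 0 then real (vec.dim (W 0)) else real (vec.dim (W ((j - 1) * P + n + 1))))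
   - (if j - 1 = 0 then real (vec.dim (W 0)) else real (vec.dim (W ((j - 1 - 1) * P + n + 1))))))"
   unfolding quotient_dim_def by (simp only: dimF)
  also have "... <= (\<Sum>l<r * P. (real (vec.dim (W (l + 1))) - real (vec.dim (W l))) * wheight c Lam T P l)"
  proof (rule profile_dimension_energy[OF P])
   show "real (vec.dim (W l)) <= real (vec.dim (W (l + 1)))" if "l < r * P" for l
    using W that by (auto simp: is_profile_def intro!: vec.dim_subset)
  qed (use T w0 cr in auto)
  finally show ?thesis .
 qed
 have ent_j: "(\<Sum>n<P. ?a * (?w j * coset_entropy (\<mu> j) (?F n j)))
   - T * ?w j * (eps * (4 * H + 1) * real ?N + 2 * H * (eps * real ?N + C))
  <= (\<Sum>n<P. of_bool ((j - 1) * P + n \<in> g) * (real (Q j) * saving V \<mu> eps j (?F n j)))" if j: "j \<in> {1..r}" for j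
 proof -
  let ?A = "eps * T * ?w j * (4 * H + 1)" and ?B = "2 * T * ?w j * H"
  let ?bad = "%n. (j - 1) * P + n \<notin> g"
  \<comment> \<open>If the profile agrees with V j the entropy vanishes and there is no error. A
    missing mismatched window forfeits its saving, at most \<open>?B\<close>. In the remaining case
    replacing Lam / P and Q by T times the scale length costs 4 * eps * H, and typicality costs
    eps.\<close>
  have one_window: "?a * (?w j * coset_entropy (\<mu> j) (?F n j)) - (of_bool (n < ?N) * ?A + of_bool (n < ?N & ?bad n) * ?B)
   <= of_bool ((j - 1) * P + n \<in> g) * (real (Q j) * saving V \<mu> eps j (?F n j))" if n: "n < P" for n
  proof -
   let ?h = "coset_entropy (\<mu> j) (?F n j)"
   have ssub: "vec.subspace (?F n j)" using dsp[OF n, of j] j by (auto intro: subspace_dspans)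
   have h: "0 <= ?h" "?h <= H"
    using coset_entropy_nonneg[OF ssub] coset_entropy_le[OF ssub, of "\<mu> j"] sys j by (auto simp: system_def H)
   have A0: "0 <= ?A" "0 <= ?B" using eps T w0[OF j] H0 by auto
   have s0: "0 <= saving V \<mu> eps j (?F n j)" by (simp add: saving_def)
   have aw: "?a * (?w j * ?h) <= (1 + 2 * eps) * T * (?w j * ?h)"
    using a(2) w0[OF j] h by (intro mult_right_mono) auto
   show ?thesis
   proof (cases "?F n j = V j")
    case True
    have "?h = 0" unfolding True using sys j flag_subspace[OF fl, of j]
     by (intro coset_entropy_zero) (auto simp: system_def)
    moreover have "0 <= of_bool ((j - 1) * P + n \<in> g) * (real (Q j) * saving V \<mu> eps j (?F n j))"
     using s0 by simp
    moreover have "0 <= of_bool (n < ?N) * ?A + of_bool (n < ?N & ?bad n) * ?B"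
     using A0 by simp
    ultimately show ?thesis by simp
   next
    case False
    then have nN: "n < ?N" using mismatch_iff[OF W n] j by auto
    show ?thesis
    proof (cases "?bad n")
     case True
     have "(1 + 2 * eps) * T * (?w j * ?h) <= 2 * T * (?w j * H)"
      using eps T w0[OF j] h by (intro mult_mono mult_nonneg_nonneg) auto
     then show ?thesis using nN True aw A0 by (simp add: mult.assoc)
    next
     case False
     have "real (Q j) * (?h - eps) <= real (Q j) * saving V \<mu> eps j (?F n j)"
      using \<open>?F n j ~= V j\<close> by (intro mult_left_mono) (auto simp: saving_def)
     moreover have "real (Q j) * eps <= T * ?w j * eps" using Q(2)[OF j] eps by (intro mult_right_mono) auto
     moreover have "(1 - 2 * eps) * (T * ?w j) * ?h <= real (Q j) * ?h" using Q(1)[OF j] h by (intro mult_right_mono) auto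
     moreover have "4 * eps * (T * ?w j) * ?h <= 4 * eps * (T * ?w j) * H"
      using h eps T w0[OF j] by (intro mult_left_mono) auto
     ultimately show ?thesis using nN False aw by (simp add: algebra_simps)
    qed
   qed
  qed
  have cb: "(\<Sum>n<P. of_bool (n < ?N & ?bad n) :: real) <= eps * real ?N + C"
  proof -
   have "{..<P} \<inter> {n. n < ?N & ?bad n} = {n. n < ?N & ?bad n}" using mismatch_le[of r V P W] by auto
   then have "(\<Sum>n<P. of_bool (n < ?N & ?bad n) :: real) = real (card {n. n < ?N & ?bad n})" by simp
   also have "... <= eps * real ?N + C" using g j mismatch_le[of r V P W] by (auto simp: good_pattern_def)
   finally show ?thesis .
  qed
  have "(\<Sum>n<P. ?a * (?w j * coset_entropy (\<mu> j) (?F n j)) - (of_bool (n < ?N) * ?A + of_bool (n < ?N & ?bad n) * ?B))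
   <= (\<Sum>n<P. of_bool ((j - 1) * P + n \<in> g) * (real (Q j) * saving V \<mu> eps j (?F n j)))"
   using one_window by (intro sum_mono) auto
  then have "(\<Sum>n<P. ?a * (?w j * coset_entropy (\<mu> j) (?F n j)))
    - ((\<Sum>n<P. of_bool (n < ?N)) * ?A + (\<Sum>n<P. of_bool (n < ?N & ?bad n)) * ?B)
   <= (\<Sum>n<P. of_bool ((j - 1) * P + n \<in> g) * (real (Q j) * saving V \<mu> eps j (?F n j)))"
   by (simp only: sum_subtractf sum.distrib sum_distrib_right)
  moreover have "(\<Sum>n<P. of_bool (n < ?N & ?bad n)) * ?B <= (eps * real ?N + C) * ?B"
   using cb T w0[OF j] H0 by (intro mult_right_mono) auto
  ultimately have "(\<Sum>n<P. ?a * (?w j * coset_entropy (\<mu> j) (?F n j)))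
    - (real ?N * ?A + (eps * real ?N + C) * ?B)
   <= (\<Sum>n<P. of_bool ((j - 1) * P + n \<in> g) * (real (Q j) * saving V \<mu> eps j (?F n j)))"
   unfolding cardN by linarith
  moreover have "real ?N * ?A + (eps * real ?N + C) * ?B
   = T * ?w j * (eps * (4 * H + 1) * real ?N + 2 * H * (eps * real ?N + C))"
   by (simp add: algebra_simps)
  ultimately show ?thesis by simp
 qed
 let ?X = "eps * (4 * H + 1) * real ?N + 2 * H * (eps * real ?N + C)"
 have "(\<Sum>j=1..r. \<Sum>n<P. ?a * (?w j * coset_entropy (\<mu> j) (?F n j))) - T * ?X
  <= (\<Sum>j=1..r. \<Sum>n<P. ?a * (?w j * coset_entropy (\<mu> j) (?F n j))) - (\<Sum>j=1..r. T * ?w j * ?X)"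
 proof -
  have "(\<Sum>j=1..r. T * ?w j * ?X) = T * (\<Sum>j=1..r. ?w j) * ?X"
   by (simp only: sum_distrib_left sum_distrib_right)
  also have "... <= T * 1 * ?X"
   using sumw T eps H0 C by (intro mult_right_mono mult_left_mono) auto
  finally show ?thesis by simp
 qed
 also have "... <= (\<Sum>j=1..r. \<Sum>n<P. of_bool ((j - 1) * P + n \<in> g) * (real (Q j) * saving V \<mu> eps j (?F n j)))"
  unfolding sum_subtractf[symmetric] using ent_j by (intro sum_mono) auto
 also have "... = (\<Sum>j=1..r. \<Sum>n<P. of_bool ((j - 1) * P + n \<in> g) *
   (real (Q (scl P ((j - 1) * P + n))) * saving V \<mu> eps (scl P ((j - 1) * P + n)) (W ((j - 1) * P + n + 1))))"
 proof (intro sum.cong refl)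
  fix j n assume "j \<in> {1..r}" "n \<in> {..<P}"
  then have "scl P ((j - 1) * P + n) = j" and "?F n j = W ((j - 1) * P + n + 1)"
   using scl_block[of j r n P] by (auto simp: profile_flag_def)
  then show "of_bool ((j - 1) * P + n \<in> g) * (real (Q j) * saving V \<mu> eps j (?F n j))
   = of_bool ((j - 1) * P + n \<in> g) *
   (real (Q (scl P ((j - 1) * P + n))) * saving V \<mu> eps (scl P ((j - 1) * P + n)) (W ((j - 1) * P + n + 1)))"
   by (simp only:)
 qed
 also have "... = (\<Sum>l<r * P. of_bool (l \<in> g) * (real (Q (scl P l)) * saving V \<mu> eps (scl P l) (W (l + 1))))"
  by (rule sum_blocks[symmetric])
 also have "... = (\<Sum>l\<in>g \<inter> {..<r * P}. real (Q (scl P l)) * saving V \<mu> eps (scl P l) (W (l + 1)))"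
  by (intro sum.mono_neutral_cong_right) auto
 finally have ents: "(\<Sum>j=1..r. \<Sum>n<P. ?a * (?w j * coset_entropy (\<mu> j) (?F n j))) - T * ?X
  <= (\<Sum>l\<in>g \<inter> {..<r * P}. real (Q (scl P l)) * saving V \<mu> eps (scl P l) (W (l + 1)))" .
 have "?a * (\<Sum>n<P. flag_entropy r (?F n) c \<mu>)
  = (\<Sum>j=1..r. \<Sum>n<P. ?a * (?w j * coset_entropy (\<mu> j) (?F n j)))
   + ?a * (\<Sum>n<P. \<Sum>j=1..r. c j * quotient_dim (?F n j) (?F n (j - 1)))"
  unfolding flag_entropy_def sum.distrib distrib_left
  by (subst (1) sum.swap) (simp add: sum_distrib_left)
 moreover have "T * ?X <= T * eps\<^sub>0 / 2 * real ?N + 2 * T * H * C"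
 proof -
  have "eps * (6 * H + 1) * real ?N <= eps\<^sub>0 / 2 * real ?N" using eps by (intro mult_right_mono) auto
  then have "T * (eps * (6 * H + 1) * real ?N) <= T * (eps\<^sub>0 / 2 * real ?N)" using T by (intro mult_left_mono) auto
  then show ?thesis by (simp add: algebra_simps)
 qed
 moreover have "T * eps\<^sub>0 / 2 * real ?N = (T * eps\<^sub>0 * real ?N) / 2" by simp
 ultimately show ?thesis using total dims ents by linarith
qed

section \<open>Collisions of assignments\<close>

definition profiles :: "nat => (nat => (rat ^ 'k::finite) set) => nat => (nat => (rat ^ 'k) set) set" where
 "profiles r V P = {W \<in> Pi\<^sub>E {0..r * P} (%_. dspans). is_profile r V P W}"

lemma finite_profiles:
 fixes V :: "nat => (rat ^ 'k::finite) set"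
 shows "finite (profiles r V P)"
proof -
 have "finite (Pi\<^sub>E {0..r * P} (%_. dspans :: (rat ^ 'k) set set))" by (intro finite_PiE) auto
 then show ?thesis unfolding profiles_def by simp
qed

lemma block_decompose:
 fixes l r P :: nat
 assumes "l < r * P"
 shows "scl P l \<in> {1..r}" "l mod P < P" "(scl P l - 1) * P + l mod P = l"
proof -
 have "0 < P" using assms by (cases P) auto
 then show "l mod P < P" by simp
 show "scl P l \<in> {1..r}" using assms by (auto simp: scl_def less_mult_imp_div_less Suc_le_eq)
 show "(scl P l - 1) * P + l mod P = l" by (simp add: scl_def)
qed

text \<open>After the mismatched positions the profile coincides with V, so it is determined by its
  spaces at the first m windows of each of the r scales.\<close>

lemma card_profiles_mismatch:
 fixes V :: "nat => (rat ^ 'k::finite) set"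
 shows "card {W \<in> profiles r V P. mismatch r V P W = m} <= card (dspans :: (rat ^ 'k) set set) ^ (r * m)"
proof -
 let ?S = "{W \<in> profiles r V P. mismatch r V P W = m}"
 let ?X = "{1..r} \<times> {..<m}"
 let ?f = "%W. restrict (%(j, n). profile_flag P W n j) (?X :: (nat \<times> nat) set)"
 let ?T = "Pi\<^sub>E ?X (%_. dspans :: (rat ^ 'k) set set)"
 have finT: "finite ?T" by (intro finite_PiE) auto
 have "inj_on ?f ?S"
 proof (rule inj_onI)
  fix W W' assume W: "W \<in> ?S" "W' \<in> ?S" and eq: "?f W = ?f W'"
  have pr: "is_profile r V P W" "is_profile r V P W'" using W by (auto simp: profiles_def)
  have mm: "mismatch r V P W = m" "mismatch r V P W' = m" using W by auto
  show "W = W'"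
  proof (rule PiE_ext[of _ "{0..r * P}"])
   show "W \<in> Pi\<^sub>E {0..r * P} (%_. dspans)" "W' \<in> Pi\<^sub>E {0..r * P} (%_. dspans)"
    using W by (auto simp: profiles_def)
   fix l assume l: "l \<in> {0..r * P}"
   show "W l = W' l"
   proof (cases l)
    case 0 then show ?thesis using pr by (simp add: is_profile_def)
   next
    case (Suc l')
    then have l': "l' < r * P" using l by simp
    let ?j = "scl P l'" and ?n = "l' mod P"
    note b = block_decompose[OF l']
    have Wl: "W l = profile_flag P W ?n ?j" "W' l = profile_flag P W' ?n ?j"
     using b Suc by (auto simp: profile_flag_def)
    show ?thesis
    proof (cases "?n < m")
     case True
     then have "(?j, ?n) \<in> ?X" using b by auto
     then have "?f W (?j, ?n) = profile_flag P W ?n ?j" "?f W' (?j, ?n) = profile_flag P W' ?n ?j"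
      by (simp_all only: restrict_apply' case_prod_conv)
     then show ?thesis using Wl eq by metis
    next
     case False
     then have "\<forall>j\<in>{1..r}. profile_flag P W ?n j = V j" "\<forall>j\<in>{1..r}. profile_flag P W' ?n j = V j"
      using mismatch_iff[OF pr(1) b(2)] mismatch_iff[OF pr(2) b(2)] unfolding mm by blast+
     then have "profile_flag P W ?n ?j = V ?j" "profile_flag P W' ?n ?j = V ?j"
      using b(1) by blast+
     then show ?thesis using Wl by simp
    qed
   qed
  qed
 qed
 moreover have "?f ` ?S \<subseteq> ?T"
 proof (rule image_subsetI)
  fix W assume W: "W \<in> ?S"
  then have pr: "is_profile r V P W" by (simp add: profiles_def)
  have m: "m <= P" using W mismatch_le[of r V P W] by auto
  show "?f W \<in> ?T"
  proof (rule restrict_PiE_iff[THEN iffD2], rule ballI)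
   fix x assume "x \<in> ?X"
   then obtain j n where x: "x = (j, n)" "j \<in> {1..r}" "n < m" by auto
   have "(j - 1) * P + n < r * P" using x m by (intro block_index_less) auto
   then have "W ((j - 1) * P + n + 1) \<in> dspans" using pr unfolding is_profile_def by auto
   then show "(case x of (j, n) => profile_flag P W n j) \<in> dspans"
    using x by (auto simp: profile_flag_def)
  qed
 qed
 ultimately have "card ?S <= card ?T" using finT by (rule card_inj_on_le)
 also have "card ?T = card (dspans :: (rat ^ 'k) set set) ^ (r * m)"
  by (subst card_PiE) (auto simp: card_cartesian_product)
 finally show ?thesis .
qed

text \<open>At most N^(r m) profiles have mismatch m, where N is the number of available subspaces;
  a weight x with N^r x <= 1/2 thus gives a geometric series whose bound does not depend on
  P.\<close>

lemma sum_profiles: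
 fixes V :: "nat => (rat ^ 'k::finite) set"
 assumes x: "0 <= x" "real (card (dspans :: (rat ^ 'k) set set)) ^ r * x <= 1 / 2"
 shows "(\<Sum>W\<in>profiles r V P. x ^ mismatch r V P W) <= 2"
proof -
 let ?N = "real (card (dspans :: (rat ^ 'k) set set))"
 have "(\<Sum>W\<in>profiles r V P. x ^ mismatch r V P W)
  = (\<Sum>m\<in>{..P}. \<Sum>W\<in>{W \<in> profiles r V P. mismatch r V P W = m}. x ^ mismatch r V P W)"
  using finite_profiles mismatch_le by (intro sum.group[symmetric]) auto
 also have "... = (\<Sum>m\<in>{..P}. real (card {W \<in> profiles r V P. mismatch r V P W = m}) * x ^ m)"
  by (intro sum.cong refl) simp
 also have "... <= (\<Sum>m\<in>{..P}. (1 / 2) ^ m)"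
 proof (intro sum_mono)
  fix m
  have "real (card {W \<in> profiles r V P. mismatch r V P W = m}) <= ?N ^ (r * m)"
   unfolding of_nat_power[symmetric] by (rule of_nat_mono[OF card_profiles_mismatch])
  then have "real (card {W \<in> profiles r V P. mismatch r V P W = m}) * x ^ m <= ?N ^ (r * m) * x ^ m"
   using x by (intro mult_right_mono) auto
  also have "... = (?N ^ r * x) ^ m" by (simp add: power_mult power_mult_distrib)
  also have "... <= (1 / 2) ^ m" using x by (intro power_mono) auto
  finally show "real (card {W \<in> profiles r V P. mismatch r V P W = m}) * x ^ m <= (1 / 2) ^ m" .
 qed
 also have "... <= 2"
 proof -
  have "(\<Sum>m\<in>{..P}. (1 / 2 :: real) ^ m) = 2 - (1 / 2) ^ P" by (induction P) simp_all
  then show ?thesis by simp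
 qed
 finally show ?thesis .
qed

definition assigns :: "nat => nat => (nat => nat) => (nat => (rat ^ 'k::finite) pmf) => (nat => nat => rat ^ 'k) set" where
 "assigns r P Q \<mu> = Pi\<^sub>E {..<r * P} (%l. tuples (Q (scl P l)) (\<mu> (scl P l)))"

definition aweight :: "nat => nat => (nat => (nat => rat ^ 'k::finite) => real) => (nat => nat => rat ^ 'k) => real" where
 "aweight r P p om = (\<Prod>l<r * P. p (scl P l) (om l))"

lemma system_finite_support:
 assumes "system r V c \<mu>" "j \<in> {1..r}" shows "finite (set_pmf (\<mu> j :: (rat ^ 'k::finite) pmf))"
proof -
 have "set_pmf (\<mu> j) \<subseteq> cube" using assms by (auto simp: system_def)
 then show ?thesis by (rule finite_subset) simp
qed

lemma finite_assigns:
 assumes "system r V c \<mu>" shows "finite (assigns r P Q \<mu>)"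
 unfolding assigns_def
proof (intro finite_PiE finite_tuples system_finite_support[OF assms])
 fix l assume "l \<in> {..<r * P}"
 then show "scl P l \<in> {1..r}" using block_decompose(1)[of l r P] by simp
qed simp

lemma typical_weight_nonneg: "typical_weight \<mu> eps Q p ==> 0 <= p om"
 unfolding typical_weight_def by blast

lemma typical_weight_sum: "typical_weight \<mu> eps Q p ==> (\<Sum>om\<in>tuples Q \<mu>. p om) = 1"
 unfolding typical_weight_def by blast

lemma aweight_nonneg:
 assumes "!!j. j \<in> {1..r} ==> typical_weight (\<mu> j) eps (Q j) (p j)"
 shows "0 <= aweight r P p om"
 unfolding aweight_def
proof (intro prod_nonneg)
 fix l assume "l \<in> {..<r * P}"
 then have "scl P l \<in> {1..r}" using block_decompose(1)[of l r P] by simp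
 then show "0 <= p (scl P l) (om l)" by (rule typical_weight_nonneg[OF assms])
qed

lemma sum_assigns_prod:
 fixes f :: "nat => (nat => rat ^ 'k::finite) => real"
 assumes "system r V c \<mu>"
 shows "(\<Sum>om\<in>assigns r P Q \<mu>. \<Prod>l<r * P. f l (om l)) = (\<Prod>l<r * P. \<Sum>\<tau>\<in>tuples (Q (scl P l)) (\<mu> (scl P l)). f l \<tau>)"
 unfolding assigns_def
proof (subst prod_sum_PiE)
 fix l assume "l \<in> {..<r * P}"
 then show "finite (tuples (Q (scl P l)) (\<mu> (scl P l)))"
  using block_decompose(1)[of l r P] by (intro finite_tuples system_finite_support[OF assms]) simp
qed auto

lemma sum_aweight:
 assumes "system r V c \<mu>" "!!j. j \<in> {1..r} ==> typical_weight (\<mu> j) eps (Q j) (p j)"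
 shows "(\<Sum>om\<in>assigns r P Q \<mu>. aweight r P p om) = 1"
 unfolding aweight_def sum_assigns_prod[OF assms(1), where f = "%l. p (scl P l)"]
proof (intro prod.neutral ballI)
 fix l assume "l \<in> {..<r * P}"
 then have "scl P l \<in> {1..r}" using block_decompose(1)[of l r P] by simp
 then show "(\<Sum>\<tau>\<in>tuples (Q (scl P l)) (\<mu> (scl P l)). p (scl P l) \<tau>) = 1"
  by (rule typical_weight_sum[OF assms(2)])
qed

lemma assigns_mem:
 assumes sys: "system r V c \<mu>" and om: "om \<in> assigns r P Q \<mu>" and l: "l < r * P" and i: "i < Q (scl P l)"
 shows "om l i \<in> cube" "om l i \<in> V (scl P l)"
proof -
 have "om l \<in> tuples (Q (scl P l)) (\<mu> (scl P l))" using om l by (auto simp: assigns_def)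
 then have "om l i \<in> set_pmf (\<mu> (scl P l))" using i by (auto simp: tuples_def)
 moreover have "set_pmf (\<mu> (scl P l)) \<subseteq> V (scl P l) \<inter> cube"
  using sys block_decompose(1)[OF l] unfolding system_def by blast
 ultimately show "om l i \<in> cube" "om l i \<in> V (scl P l)" by auto
qed

lemma scl_mono: "l <= l' ==> scl P l <= scl P l'"
 by (simp add: scl_def div_le_mono)

lemma dspan_is_profile:
 fixes V :: "nat => (rat ^ 'k::finite) set" and g :: "nat set"
 assumes sys: "system r V c \<mu>" and om: "om \<in> assigns r P Q \<mu>" "om' \<in> assigns r P Q \<mu>"
 defines "W \<equiv> dspan g (%l. Q (scl P l)) (%l i. om' l i - om l i)"
 shows "restrict W {0..r * P} \<in> profiles r V P"
proof -
 let ?gen = "%l. insert ones (\<Union>l'\<in>g \<inter> {..<l}. (%i. om' l' i - om l' i) ` {..<Q (scl P l')})"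
 have fl: "flag r V" using sys by (simp add: system_def)
 have W: "W l = vec.span (?gen l)" for l by (simp add: W_def dspan_def)
 have dsp: "W l \<in> dspans" if "l <= r * P" for l
  unfolding W
 proof (rule span_in_dspans, rule subsetI)
  fix x assume "x \<in> ?gen l"
  then consider "x = ones" | l' i where "l' < l" "i < Q (scl P l')" "x = om' l' i - om l' i" by auto
  then show "x \<in> dcube"
  proof cases
   case 1 then show ?thesis using ones_in_cube cube_subset_dcube by auto
  next
   case 2
   then show ?thesis using that assigns_mem[OF sys] om by (auto intro!: diff_in_dcube)
  qed
 qed
 have sub: "W (l + 1) \<subseteq> V (scl P l)" if l: "l < r * P" for l
  unfolding W
 proof (rule vec.span_minimal)
  have sc: "scl P l <= r" using block_decompose(1)[OF l] by simp
  show ss: "vec.subspace (V (scl P l))" by (rule flag_subspace[OF fl sc])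
  show "?gen (l + 1) \<subseteq> V (scl P l)"
  proof
   fix x assume "x \<in> ?gen (l + 1)"
   then consider "x = ones" | l' i where "l' < l + 1" "i < Q (scl P l')" "x = om' l' i - om l' i" by blast
   then show "x \<in> V (scl P l)"
   proof cases
    case 1 then show ?thesis using flag_ones[OF fl sc] by simp
   next
    case 2
    then have "l' <= l" by simp
    then have "V (scl P l') \<subseteq> V (scl P l)" using sc by (intro flag_mono[OF fl] scl_mono)
    moreover have "om' l' i \<in> V (scl P l')" "om l' i \<in> V (scl P l')"
     using 2 l by (auto intro!: assigns_mem(2)[OF sys] om)
    ultimately show ?thesis using 2 ss by (auto intro!: vec.subspace_diff)
   qed
  qed
 qed
 have "W l \<subseteq> W (l + 1)" for l unfolding W_def by (rule dspan_mono) simp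
 then show ?thesis using dsp sub unfolding profiles_def is_profile_def
  by (auto simp: W_def dspan_0)
qed

text \<open>The assignments om' are grouped by the profile W of their differences from om. The jumps
  of the dimension contribute exp (- \<open>?E W\<close>), typicality around om bounds the mass of
  the group by exp (- \<open>?S W\<close>), and \<open>profile_energy\<close> together with
  \<open>sum_profiles\<close> sums over W. Everything except the main exponential is bounded
  uniformly in P.\<close>

lemma collision_sum:
 fixes V :: "nat => (rat ^ 'k::finite) set"
 assumes sys: "system r V c \<mu>"
  and gap: "!!V'. proper_subflag r V' V ==> (!!j. j <= r ==> V' j \<in> dspans) ==>
   flag_entropy r V c \<mu> + eps\<^sub>0 <= flag_entropy r V' c \<mu>"
  and g: "good_pattern r P eps C g" and C: "0 <= C"
  and P: "1 <= P" and T: "0 < T" "T * real P <= Lam" "Lam <= (1 + 2 * eps) * (T * real P)"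
  and eps: "0 < eps" "eps <= 1 / 2" "eps * (6 * H + 1) <= eps\<^sub>0 / 2"
  and H: "H = real (card (cube :: (rat ^ 'k) set))"
  and Q: "!!j. j \<in> {1..r} ==> (1 - 2 * eps) * (T * (c j - c (j + 1))) <= real (Q j)"
   "!!j. j \<in> {1..r} ==> real (Q j) <= T * (c j - c (j + 1))"
  and p: "!!j. j \<in> {1..r} ==> typical_weight (\<mu> j) eps (Q j) (p j)"
  and large: "real (card (dspans :: (rat ^ 'k) set set)) ^ r * exp (- (T * eps\<^sub>0 / 2)) <= 1 / 2"
  and K: "1 <= K" and om: "om \<in> assigns r P Q \<mu>" "0 < aweight r P p om"
 defines "D \<equiv> %om'. dspan g (%l. Q (scl P l)) (%l i. om' l i - om l i)"
 shows "(\<Sum>om'\<in>assigns r P Q \<mu>. aweight r P p om' *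
   (\<Prod>l<r * P. (K / exp (wheight c Lam T P l)) ^ (vec.dim (D om' (Suc l)) - vec.dim (D om' l))))
  <= 2 * K ^ CARD('k) * exp (2 * T * H * C) * exp (- (Lam * flag_entropy r V c \<mu>))"
proof -
 let ?h = "wheight c Lam T P"
 let ?Om = "assigns r P Q \<mu>" and ?\<P> = "profiles r V P"
 let ?pr = "%om'. restrict (D om') {0..r * P}"
 let ?E = "%W. (\<Sum>l<r * P. (real (vec.dim (W (l + 1))) - real (vec.dim (W l))) * ?h l)"
 let ?S = "%W. \<Sum>l\<in>g \<inter> {..<r * P}. real (Q (scl P l)) * saving V \<mu> eps (scl P l) (W (l + 1))"
 have aw: "0 <= aweight r P p om'" for om' using p by (rule aweight_nonneg)
 have prof: "?pr om' \<in> ?\<P>" if "om' \<in> ?Om" for om'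
  unfolding D_def by (rule dspan_is_profile[OF sys om(1) that])
 have prod: "(\<Prod>l<r * P. (K / exp (?h l)) ^ (vec.dim (D om' (Suc l)) - vec.dim (D om' l)))
  <= K ^ CARD('k) * exp (- ?E (?pr om'))" for om'
 proof -
  let ?d = "%l. vec.dim (D om' l)"
  have mono: "?d l <= ?d (Suc l)" for l
   unfolding D_def by (intro vec.dim_subset dspan_mono) simp
  have "(\<Prod>l<r * P. (K / exp (?h l)) ^ (?d (Suc l) - ?d l))
   = (\<Prod>l<r * P. K ^ (?d (Suc l) - ?d l)) * (\<Prod>l<r * P. exp (- (?h l)) ^ (?d (Suc l) - ?d l))"
   unfolding prod.distrib[symmetric] power_mult_distrib[symmetric] by (simp add: exp_minus divide_inverse)
  also have "(\<Prod>l<r * P. K ^ (?d (Suc l) - ?d l)) = K ^ (\<Sum>l<r * P. ?d (Suc l) - ?d l)"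
   by (simp add: power_sum)
  also have "(\<Sum>l<r * P. ?d (Suc l) - ?d l) = ?d (r * P) - ?d 0"
  proof -
   have "(\<Sum>l<m. ?d (Suc l) - ?d l) = ?d m - ?d 0 & ?d 0 <= ?d m" for m
   proof (induction m)
    case (Suc m)
    then show ?case using mono[of m] by simp
   qed simp
   then show ?thesis by blast
  qed
  also have "(\<Prod>l<r * P. exp (- (?h l)) ^ (?d (Suc l) - ?d l)) = exp (- ?E (?pr om'))"
  proof -
   have "(\<Prod>l<r * P. exp (- (?h l)) ^ (?d (Suc l) - ?d l)) = exp (\<Sum>l<r * P. real (?d (Suc l) - ?d l) * - ?h l)"
    by (simp only: exp_sum finite_lessThan exp_of_nat_mult)
   also have "(\<Sum>l<r * P. real (?d (Suc l) - ?d l) * - ?h l) = - ?E (?pr om')"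
    unfolding sum_negf[symmetric] using mono by (intro sum.cong refl) (auto simp: of_nat_diff algebra_simps)
   finally show ?thesis .
  qed
  also have "K ^ (?d (r * P) - ?d 0) * exp (- ?E (?pr om')) <= K ^ CARD('k) * exp (- ?E (?pr om'))"
  proof (intro mult_right_mono power_increasing K)
   have "?d (r * P) <= CARD('k)"
    using vec.dim_subset_UNIV[of "D om' (r * P)"] by (simp add: vec.dimension_def card_cart_basis)
   then show "?d (r * P) - ?d 0 <= CARD('k)" by simp
  qed simp
  finally show ?thesis .
 qed
 \<comment> \<open>Only the windows of g constrain om': the others contribute no vectors to the
   profile, and summing over them costs at most the full mass 1.\<close>
 have cls: "(\<Sum>om'\<in>{om'\<in>?Om. ?pr om' = W}. aweight r P p om') <= exp (- ?S W)" if W: "W \<in> ?\<P>" for W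
 proof -
  let ?ok = "%l \<tau>. l \<in> g \<longrightarrow> (\<forall>i<Q (scl P l). \<tau> i - om l i \<in> W (l + 1))"
  have "(\<Sum>om'\<in>{om'\<in>?Om. ?pr om' = W}. aweight r P p om')
   = (\<Sum>om'\<in>{om'\<in>?Om. ?pr om' = W}. \<Prod>l<r * P. of_bool (?ok l (om' l)) * p (scl P l) (om' l))"
  proof (intro sum.cong refl)
   fix om' assume om': "om' \<in> {om'\<in>?Om. ?pr om' = W}"
   have "?ok l (om' l)" if l: "l < r * P" for l
   proof (intro impI allI)
    fix i assume i: "l \<in> g" "i < Q (scl P l)"
    have "W (l + 1) = ?pr om' (l + 1)" using om' by simp
    also have "... = D om' (l + 1)" using l by simp
    finally show "om' l i - om l i \<in> W (l + 1)"
     using i unfolding D_def dspan_def by (auto intro!: vec.span_base)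
   qed
   then show "aweight r P p om' = (\<Prod>l<r * P. of_bool (?ok l (om' l)) * p (scl P l) (om' l))"
    unfolding aweight_def by (intro prod.cong) auto
  qed
  also have "... <= (\<Sum>om'\<in>?Om. \<Prod>l<r * P. of_bool (?ok l (om' l)) * p (scl P l) (om' l))"
  proof (rule sum_mono2[OF finite_assigns[OF sys]])
   fix om' assume "om' \<in> ?Om - {om'\<in>?Om. ?pr om' = W}"
   show "0 <= (\<Prod>l<r * P. of_bool (?ok l (om' l)) * p (scl P l) (om' l))"
   proof (intro prod_nonneg)
    fix l assume "l \<in> {..<r * P}"
    then have "scl P l \<in> {1..r}" using block_decompose(1)[of l r P] by simp
    then have "0 <= p (scl P l) (om' l)" by (rule typical_weight_nonneg[OF p])
    then show "0 <= of_bool (?ok l (om' l)) * p (scl P l) (om' l)" by simp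
   qed
  qed auto
  also have "... = (\<Prod>l<r * P. \<Sum>\<tau>\<in>tuples (Q (scl P l)) (\<mu> (scl P l)). of_bool (?ok l \<tau>) * p (scl P l) \<tau>)"
   by (rule sum_assigns_prod[OF sys])
  also have "... <= (\<Prod>l<r * P. exp (- (if l \<in> g then real (Q (scl P l)) * saving V \<mu> eps (scl P l) (W (l + 1)) else 0)))"
  proof (intro prod_mono conjI)
   fix l assume "l \<in> {..<r * P}"
   then have l: "l < r * P" by simp
   let ?j = "scl P l"
   let ?t = "tuples (Q ?j) (\<mu> ?j)"
   have j: "?j \<in> {1..r}" by (rule block_decompose(1)[OF l])
   have tw: "!!\<tau>. 0 <= p ?j \<tau>" "(\<Sum>\<tau>\<in>?t. p ?j \<tau>) = 1"
    using typical_weight_nonneg[OF p[OF j]] typical_weight_sum[OF p[OF j]] by blast+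
   show "0 <= (\<Sum>\<tau>\<in>?t. of_bool (?ok l \<tau>) * p ?j \<tau>)" using tw by (intro sum_nonneg) auto
   have le1: "(\<Sum>\<tau>\<in>?t. of_bool (?ok l \<tau>) * p ?j \<tau>) <= 1"
   proof -
    have "(\<Sum>\<tau>\<in>?t. of_bool (?ok l \<tau>) * p ?j \<tau>) <= (\<Sum>\<tau>\<in>?t. p ?j \<tau>)"
     using tw by (intro sum_mono) auto
    then show ?thesis using tw by simp
   qed
   show "(\<Sum>\<tau>\<in>?t. of_bool (?ok l \<tau>) * p ?j \<tau>)
    <= exp (- (if l \<in> g then real (Q ?j) * saving V \<mu> eps ?j (W (l + 1)) else 0))"
   proof (cases "l \<in> g & 0 < saving V \<mu> eps ?j (W (l + 1))")
    case True
    have wt: "om l \<in> ?t" using om l by (auto simp: assigns_def)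
    have "p ?j (om l) ~= 0"
    proof
     assume "p ?j (om l) = 0"
     then have "aweight r P p om = 0" unfolding aweight_def using l by (intro prod_zero) auto
     then show False using om by simp
    qed
    then have pos: "0 < p ?j (om l)" using tw(1)[of "om l"] by linarith
    have WU: "W (l + 1) \<in> dspans" using W l by (auto simp: profiles_def is_profile_def)
    have "(\<Sum>\<tau>\<in>?t. of_bool (?ok l \<tau>) * p ?j \<tau>) = (\<Sum>\<tau>\<in>?t. of_bool (\<forall>i<Q ?j. \<tau> i - om l i \<in> W (l + 1)) * p ?j \<tau>)"
     using True by simp
    also have "... = (\<Sum>\<tau>\<in>{\<tau>\<in>?t. \<forall>i<Q ?j. \<tau> i - om l i \<in> W (l + 1)}. p ?j \<tau>)"
     using finite_tuples[OF system_finite_support[OF sys j]]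
     by (intro sum.mono_neutral_cong_right) auto
    also have "... <= exp (- (real (Q ?j) * (coset_entropy (\<mu> ?j) (W (l + 1)) - eps)))"
     using p[OF j] wt pos WU unfolding typical_weight_def by blast
    also have "coset_entropy (\<mu> ?j) (W (l + 1)) - eps = saving V \<mu> eps ?j (W (l + 1))"
     using True by (auto simp: saving_def max_def split: if_splits)
    finally show ?thesis using True by simp
   next
    case False
    moreover have "0 <= saving V \<mu> eps ?j (W (l + 1))" by (simp add: saving_def)
    ultimately have "(if l \<in> g then real (Q ?j) * saving V \<mu> eps ?j (W (l + 1)) else 0) = 0" by auto
    then show ?thesis using le1 by (simp only: minus_zero exp_zero)
   qed
  qed
  also have "... = exp (- (\<Sum>l<r * P. if l \<in> g then real (Q (scl P l)) * saving V \<mu> eps (scl P l) (W (l + 1)) else 0))"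
   by (simp only: exp_sum finite_lessThan sum_negf[symmetric])
  also have "(\<Sum>l<r * P. if l \<in> g then real (Q (scl P l)) * saving V \<mu> eps (scl P l) (W (l + 1)) else 0) = ?S W"
   by (simp add: sum.inter_restrict[symmetric] Int_commute)
  finally show ?thesis .
 qed
 have "(\<Sum>om'\<in>?Om. aweight r P p om' *
   (\<Prod>l<r * P. (K / exp (?h l)) ^ (vec.dim (D om' (Suc l)) - vec.dim (D om' l))))
  <= (\<Sum>om'\<in>?Om. aweight r P p om' * (K ^ CARD('k) * exp (- ?E (?pr om'))))"
  using prod aw by (intro sum_mono mult_left_mono) auto
 also have "... = (\<Sum>W\<in>?\<P>. \<Sum>om'\<in>{om'\<in>?Om. ?pr om' = W}. aweight r P p om' * (K ^ CARD('k) * exp (- ?E (?pr om'))))"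
  using finite_assigns[OF sys] finite_profiles prof by (intro sum.group[symmetric]) auto
 also have "... = (\<Sum>W\<in>?\<P>. (\<Sum>om'\<in>{om'\<in>?Om. ?pr om' = W}. aweight r P p om') * (K ^ CARD('k) * exp (- ?E W)))"
  unfolding sum_distrib_right by (intro sum.cong refl) auto
 also have "... <= (\<Sum>W\<in>?\<P>. exp (- ?S W) * (K ^ CARD('k) * exp (- ?E W)))"
  using cls K by (intro sum_mono mult_right_mono) auto
 also have "... <= (\<Sum>W\<in>?\<P>. K ^ CARD('k) * (exp (2 * T * H * C) * exp (- (Lam * flag_entropy r V c \<mu>))) * exp (- (T * eps\<^sub>0 / 2)) ^ mismatch r V P W)"
 proof (intro sum_mono)
  fix W assume W: "W \<in> ?\<P>"
  have "Lam * flag_entropy r V c \<mu> + T * eps\<^sub>0 / 2 * real (mismatch r V P W) - 2 * T * H * C <= ?E W + ?S W"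
   by (rule profile_energy[OF sys gap _ g C P T eps H Q]) (use W in \<open>auto simp: profiles_def\<close>)
  then have "exp (- (?E W + ?S W)) <= exp (- (Lam * flag_entropy r V c \<mu> + T * eps\<^sub>0 / 2 * real (mismatch r V P W) - 2 * T * H * C))"
   by simp
  also have "... = exp (2 * T * H * C) * exp (- (Lam * flag_entropy r V c \<mu>)) * exp (- (T * eps\<^sub>0 / 2)) ^ mismatch r V P W"
   unfolding exp_of_nat_mult[symmetric] exp_add[symmetric] by (simp add: algebra_simps)
  finally have "K ^ CARD('k) * exp (- (?E W + ?S W)) <= K ^ CARD('k) * (exp (2 * T * H * C) * exp (- (Lam * flag_entropy r V c \<mu>)) * exp (- (T * eps\<^sub>0 / 2)) ^ mismatch r V P W)"
   using K by (intro mult_left_mono) auto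
  moreover have "exp (- ?S W) * (K ^ CARD('k) * exp (- ?E W)) = K ^ CARD('k) * exp (- (?E W + ?S W))"
   by (simp add: exp_add exp_minus field_simps exp_diff)
  ultimately show "exp (- ?S W) * (K ^ CARD('k) * exp (- ?E W))
   <= K ^ CARD('k) * (exp (2 * T * H * C) * exp (- (Lam * flag_entropy r V c \<mu>))) * exp (- (T * eps\<^sub>0 / 2)) ^ mismatch r V P W"
   by (simp only: mult.assoc)
 qed
 also have "... = K ^ CARD('k) * (exp (2 * T * H * C) * exp (- (Lam * flag_entropy r V c \<mu>))) * (\<Sum>W\<in>?\<P>. exp (- (T * eps\<^sub>0 / 2)) ^ mismatch r V P W)"
  by (rule sum_distrib_left[symmetric])
 also have "... <= K ^ CARD('k) * (exp (2 * T * H * C) * exp (- (Lam * flag_entropy r V c \<mu>))) * 2"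
  using large K by (intro mult_left_mono sum_profiles) auto
 finally show ?thesis by (simp only: mult_ac)
qed

section \<open>Lower bound: from few collisions to many distinct sums\<close>

section \<open>Windows\<close>

definition win :: "(nat => real) => real => real => nat => nat => nat set" where
 "win c Lam T P l = expint (wheight c Lam T P l - T * (c (scl P l) - c (scl P l + 1))) (wheight c Lam T P l)"

definition wbot :: "(nat => real) => real => real => nat => nat => real" where
 "wbot c Lam T P l = wheight c Lam T P l - T * (c (scl P l) - c (scl P l + 1))"

lemma win_eq: "win c Lam T P l = expint (wbot c Lam T P l) (wheight c Lam T P l)"
 by (simp add: win_def wbot_def)

lemma finite_win [simp]: "finite (win c Lam T P l)" by (simp add: win_def)

lemma wbot_ge:
 assumes "l < r * P" "0 < T" "!!j. j \<in> {1..r} ==> c (j + 1) <= c j"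
 shows "c (scl P l) * Lam - (c (scl P l) - c (scl P l + 1)) * (T * real P) <= wbot c Lam T P l"
proof -
 note b = block_decompose[OF assms(1)]
 let ?w = "c (scl P l) - c (scl P l + 1)"
 have "0 <= ?w" using assms(3)[OF b(1)] by simp
 moreover have "T * real (l mod P + 1) <= T * real P" using b(2) assms(2) by (intro mult_left_mono) auto
 ultimately have "?w * (T * real (l mod P + 1)) <= ?w * (T * real P)" by (rule mult_left_mono[rotated])
 then show ?thesis by (simp add: wbot_def wheight_def algebra_simps)
qed

lemma wheight_le:
 assumes "l < r * P" "0 < T" "!!j. j \<in> {1..r} ==> c (j + 1) <= c j"
 shows "wheight c Lam T P l <= c (scl P l) * Lam"
 using assms(3)[OF block_decompose(1)[OF assms(1)]] assms(2) by (simp add: wheight_def)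

lemma c_antimono:
 fixes c :: "nat => real"
 assumes "!!j. j \<in> {1..r} ==> c (j + 1) <= c j" "1 <= i" "i <= j" "j <= r + 1"
 shows "c j <= c i"
 using assms(3,4)
proof (induction j rule: dec_induct)
 case (step n)
 then have "c (n + 1) <= c n" using assms(1)[of n] assms(2) by auto
 then show ?case using step by simp
qed simp

lemma win_separated:
 assumes l: "l < l'" "l' < r * P" and T: "0 < T" "T * real P <= Lam"
  and c: "!!j. j \<in> {1..r} ==> c (j + 1) <= c j"
 shows "wheight c Lam T P l' <= wbot c Lam T P l"
proof -
 have lr: "l < r * P" using l by simp
 note b = block_decompose[OF lr] and b' = block_decompose[OF l(2)]
 have Lam: "0 <= Lam" using T by (meson mult_nonneg_nonneg of_nat_0_le_iff order_trans less_imp_le)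
 show ?thesis
 proof (cases "scl P l = scl P l'")
  case True
  then have "(scl P l - 1) * P + l mod P < (scl P l - 1) * P + l' mod P" using b(3) b'(3) l(1) by metis
  then have lt: "l mod P + 1 <= l' mod P" by simp
  let ?w = "c (scl P l) - c (scl P l + 1)"
  have "0 <= ?w" using c[OF b(1)] by simp
  moreover have "T * real (l mod P + 1) <= T * real (l' mod P)" using lt T by (intro mult_left_mono) auto
  ultimately have "?w * (T * real (l mod P + 1)) <= ?w * (T * real (l' mod P))" by (rule mult_left_mono[rotated])
  then show ?thesis using True by (simp add: wbot_def wheight_def algebra_simps)
 next
  case False
  then have lt: "scl P l + 1 <= scl P l'" using scl_mono[of l l' P] l by simp
  have "wheight c Lam T P l' <= c (scl P l') * Lam" by (rule wheight_le[OF l(2) T(1)]) (rule c)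
  also have "... <= c (scl P l + 1) * Lam"
  proof (rule mult_right_mono[OF _ Lam], rule c_antimono[of r], rule c, assumption)
   show "scl P l' <= r + 1" using b'(1) by simp
  qed (use lt in simp_all)
  also have "... = c (scl P l) * Lam - (c (scl P l) - c (scl P l + 1)) * Lam" by (simp add: algebra_simps)
  also have "... <= c (scl P l) * Lam - (c (scl P l) - c (scl P l + 1)) * (T * real P)"
   using T c[OF b(1)] by (intro diff_left_mono mult_left_mono) auto
  also have "... <= wbot c Lam T P l" by (rule wbot_ge[OF lr T(1)]) (rule c)
  finally show ?thesis .
 qed
qed

lemma win_disjoint:
 assumes "l < r * P" "l' < r * P" "l ~= l'" "0 < T" "T * real P <= Lam"
  and "!!j. j \<in> {1..r} ==> c (j + 1) <= c j"
 shows "win c Lam T P l \<inter> win c Lam T P l' = {}"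
proof -
 have *: "win c Lam T P m \<inter> win c Lam T P m' = {}" if "m < m'" "m' < r * P" for m m'
 proof -
  have "wheight c Lam T P m' <= wbot c Lam T P m" by (rule win_separated[of m m' r, OF that assms(4,5)]) (rule assms(6))
  then have *: "exp (wheight c Lam T P m') <= exp (wbot c Lam T P m)" by simp
  have False if "x \<in> win c Lam T P m \<inter> win c Lam T P m'" for x
   using that * unfolding win_eq expint_def Int_iff mem_Collect_eq by linarith
  then show ?thesis by blast
 qed
 show ?thesis
 proof (cases "l < l'")
  case True then show ?thesis using * assms by blast
 next
  case False
  then show ?thesis using *[of l' l] assms by (auto simp: Int_commute)
 qed
qed

lemma wbot_nonneg:
 assumes "l < r * P" "0 < T" "T * real P <= Lam" "!!j. j \<in> {1..r} ==> c (j + 1) <= c j" "0 <= c (r + 1)"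
 shows "0 <= wbot c Lam T P l"
proof -
 note b = block_decompose[OF assms(1)]
 have Lam: "0 <= Lam" using assms(2,3) by (meson mult_nonneg_nonneg of_nat_0_le_iff order_trans less_imp_le)
 have "0 <= c (r + 1) * Lam" using assms(5) Lam by simp
 also have "... <= c (scl P l + 1) * Lam"
 proof (rule mult_right_mono[OF _ Lam], rule c_antimono[of r], rule assms(4), assumption)
  show "scl P l + 1 <= r + 1" using b(1) by simp
 qed simp_all
 also have "... = c (scl P l) * Lam - (c (scl P l) - c (scl P l + 1)) * Lam" by (simp add: algebra_simps)
 also have "... <= c (scl P l) * Lam - (c (scl P l) - c (scl P l + 1)) * (T * real P)"
  using assms(3) assms(4)[OF b(1)] by (intro diff_left_mono mult_left_mono) auto
 also have "... <= wbot c Lam T P l" by (rule wbot_ge[OF assms(1,2)]) (rule assms(4))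
 finally show ?thesis .
qed

lemma card_expint_le: "real (card (expint x y)) <= exp y"
proof -
 have "card (expint x y) <= nat \<lfloor>exp y\<rfloor>" unfolding expint_eq by simp
 then show ?thesis by (simp add: le_nat_floor le_nat_iff le_floor_iff)
qed

lemma prb_few_elements:
 assumes "0 <= x" "0 <= d" "1 < eps * d" "real Q <= (1 - eps) * d"
 shows "prb (expint x (x + d)) (%A. \<not> Q <= card A) <= (d + 1) / (eps * d - 1)\<^sup>2"
proof -
 let ?I = "expint x (x + d)" and ?t = "eps * d - 1"
 have m: "d - 1 <= hsum ?I" "hsum ?I <= d + 1"
  using hsum_expint_ge[of x "x + d"] hsum_expint_le[of x "x + d"] assms by auto
 have "prb ?I (%A. \<not> Q <= card A) <= prb ?I (%A. ?t <= \<bar>real (card A) - hsum ?I\<bar>)"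
 proof (rule prb_mono)
  fix A assume "\<not> Q <= card A"
  then have "real (card A) <= (1 - eps) * d" using assms(4) by linarith
  then have "?t <= hsum ?I - real (card A)" using m by (simp add: algebra_simps)
  then show "?t <= \<bar>real (card A) - hsum ?I\<bar>" by linarith
 qed
 also have "... <= hsum ?I / ?t\<^sup>2" using assms by (intro prb_card_deviation) auto
 also have "... <= (d + 1) / ?t\<^sup>2" using m by (intro divide_right_mono) auto
 finally show ?thesis .
qed

definition gset :: "nat => (nat => nat set) => (nat => nat) => nat set => nat set" where
 "gset B I Q A = {l. l < B & Q l <= card (A \<inter> I l)}"

text \<open>Exponential Markov inequality with a factor 2 for every missing window. By independence
  a segment of length t has moment (1 + p)^t <= 2^(eps t / 2), against the threshold 2^(eps t + C).
  The union over t is a geometric series, so C need not grow with P.\<close>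

lemma prb_bad_pattern:
 fixes I :: "nat => nat set"
 assumes I: "!!l. l < r * P ==> finite (I l)"
  "!!l l'. l < r * P ==> l' < r * P ==> l ~= l' ==> I l \<inter> I l' = {}"
  and bad: "!!l. l < r * P ==> prb (I l) (%A. \<not> Q l <= card A) <= p"
  and p: "0 <= p" "1 + p <= 2 powr (eps / 2)" and eps: "0 < eps"
 shows "prb (\<Union>l<r * P. I l) (%A. \<not> good_pattern r P eps C (gset (r * P) I Q A))
  <= real r * 2 powr (- C) / (1 - 2 powr (- eps / 2))"
proof -
 let ?R = "\<Union>l<r * P. I l"
 let ?g = "gset (r * P) I Q"
 let ?N = "%A j t. card {n. n < t & (j - 1) * P + n \<notin> ?g A}"
 define z where "z = 2 powr (- eps / 2)"
 have "2 powr (- eps / 2) < 2 powr (0 :: real)" using eps by (intro powr_less_mono) auto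
 then have z: "0 < z" "z < 1" by (auto simp: z_def)
 have one: "prb ?R (%A. eps * real t + C < real (?N A j t)) <= z ^ t * 2 powr (- C)"
  if j: "j \<in> {1..r}" and t: "t <= P" for j t
 proof -
  define L where "L = (%n. (j - 1) * P + n) ` {..<t}"
  have L: "L \<subseteq> {..<r * P}" using block_index_less[OF j] t by (auto simp: L_def)
  have cardL: "card L = t" unfolding L_def by (subst card_image) (auto intro: inj_onI)
  define f where "f l A = (if l \<in> L & \<not> Q l <= card A then 2 else (1::real))" for l and A :: "nat set"
  have N: "(\<Prod>l<r * P. f l (A \<inter> I l)) = 2 powr real (?N A j t)" for A
  proof -
   let ?b = "{l\<in>L. \<not> Q l <= card (A \<inter> I l)}"
   have "(\<Prod>l<r * P. f l (A \<inter> I l)) = (\<Prod>l\<in>?b. 2)"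
    using L by (intro prod.mono_neutral_cong_right) (auto simp: f_def)
   also have "... = 2 ^ card ?b" by simp
   also have "?b = (%n. (j - 1) * P + n) ` {n. n < t & (j - 1) * P + n \<notin> ?g A}"
    using L by (auto simp: L_def gset_def)
   also have "card ... = ?N A j t" by (subst card_image) (auto intro: inj_onI)
   finally show ?thesis by (simp add: powr_realpow)
  qed
  have Ef: "expect (I l) (f l) <= (if l \<in> L then 1 + p else 1)" if l: "l < r * P" for l
  proof (cases "l \<in> L")
   case True
   have "expect (I l) (f l) = expect (I l) (%A. 1 + of_bool (\<not> Q l <= card A))"
    using True by (intro expect_cong) (auto simp: f_def)
   also have "... = 1 + prb (I l) (%A. \<not> Q l <= card A)"
    using I(1)[OF l] by (simp only: expect_add expect_const)
   finally show ?thesis using True bad[OF l] by simp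
  next
   case False
   have "expect (I l) (f l) = expect (I l) (%A. 1)"
    using False by (intro expect_cong) (auto simp: f_def)
   then show ?thesis using False I(1)[OF l] by simp
  qed
  have "prb ?R (%A. eps * real t + C < real (?N A j t))
   <= prb ?R (%A. 2 powr (eps * real t + C) <= (\<Prod>l<r * P. f l (A \<inter> I l)))"
   unfolding N by (intro prb_mono) simp
  also have "... <= expect ?R (%A. \<Prod>l<r * P. f l (A \<inter> I l)) / 2 powr (eps * real t + C)"
   by (intro prb_markov prod_nonneg) (auto simp: f_def)
  also have "expect ?R (%A. \<Prod>l<r * P. f l (A \<inter> I l)) = (\<Prod>l<r * P. expect (I l) (f l))"
   using I by (intro expect_prod_Int) auto
  also have "... <= (\<Prod>l<r * P. if l \<in> L then 1 + p else 1)"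
   using Ef by (intro prod_mono conjI expect_nonneg) (auto simp: f_def)
  also have "... = (\<Prod>l\<in>L. 1 + p)" using L by (intro prod.mono_neutral_cong_right) auto
  also have "... = (1 + p) ^ t" by (simp add: cardL)
  also have "(1 + p) ^ t / 2 powr (eps * real t + C) <= (2 powr (eps / 2)) ^ t / 2 powr (eps * real t + C)"
   using p by (intro divide_right_mono power_mono) auto
  also have "... = z ^ t * 2 powr (- C)"
  proof -
   have "(2 powr (eps / 2)) ^ t = 2 powr (eps / 2 * real t)" "z ^ t = 2 powr (- eps / 2 * real t)"
    unfolding z_def by (simp_all add: powr_realpow[symmetric] powr_powr)
   then show ?thesis by (simp add: powr_diff[symmetric] powr_add[symmetric])
  qed
  finally show ?thesis by (simp add: divide_right_mono)
 qed
 have "prb ?R (%A. \<not> good_pattern r P eps C (?g A))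
  <= prb ?R (%A. \<exists>x\<in>{1..r} \<times> {..P}. eps * real (snd x) + C < real (?N A (fst x) (snd x)))"
  by (rule prb_mono) (auto simp: good_pattern_def not_le)
 also have "... <= (\<Sum>x\<in>{1..r} \<times> {..P}. prb ?R (%A. eps * real (snd x) + C < real (?N A (fst x) (snd x))))"
  by (intro prb_Bex) auto
 also have "... <= (\<Sum>x\<in>{1..r} \<times> {..P}. z ^ snd x * 2 powr (- C))"
  by (intro sum_mono one) auto
 also have "... = real r * 2 powr (- C) * (\<Sum>t\<le>P. z ^ t)"
  by (simp add: sum.cartesian_product[symmetric, where g = "%x y. z ^ y * 2 powr (- C)", unfolded case_prod_beta] sum_distrib_left sum_distrib_right mult_ac)
 also have "... <= real r * 2 powr (- C) * (1 / (1 - z))"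
 proof (intro mult_left_mono)
  have "(\<Sum>t\<le>P. z ^ t) = (1 - z ^ Suc P) / (1 - z)"
   using z sum_gp_basic[of z P] by (simp add: field_simps)
  also have "... <= 1 / (1 - z)" using z by (intro divide_right_mono) auto
  finally show "(\<Sum>t\<le>P. z ^ t) <= 1 / (1 - z)" .
 qed auto
 finally show ?thesis by (simp add: z_def)
qed

definition csum :: "nat => (nat => nat set) => (nat => nat) => (nat => nat => rat ^ 'k::finite) => nat set => rat ^ 'k" where
 "csum B I Q om A = (\<Sum>l\<in>gset B I Q A. lsum (Q l) (om l) (A \<inter> I l))"

lemma csum_diff:
 "csum B I Q om' A - csum B I Q om A = csum B I Q (%l i. om' l i - om l i) A"
 unfolding csum_def lsum_def sum_subtractf[symmetric] vec.scale_right_diff_distrib[symmetric] by simp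

text \<open>The expectation is split according to the exact set g of windows with enough elements.
  For fixed g the bound of \<open>relation_prob\<close> contains the probability of this pattern as
  a factor, and these probabilities sum to at most 1 over the good patterns.\<close>

lemma expect_collisions:
 fixes V :: "nat => (rat ^ 'k::finite) set"
 assumes sys: "system r V c \<mu>"
  and gap: "!!V'. proper_subflag r V' V ==> (!!j. j <= r ==> V' j \<in> dspans) ==>
   flag_entropy r V c \<mu> + eps\<^sub>0 <= flag_entropy r V' c \<mu>"
  and C: "0 <= C"
  and P: "1 <= P" and T: "0 < T" "T * real P <= Lam" "Lam <= (1 + 2 * eps) * (T * real P)"
  and eps: "0 < eps" "eps <= 1 / 2" "eps * (6 * H + 1) <= eps\<^sub>0 / 2"
  and H: "H = real (card (cube :: (rat ^ 'k) set))"
  and Q: "!!j. j \<in> {1..r} ==> (1 - 2 * eps) * (T * (c j - c (j + 1))) <= real (Q j)"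
   "!!j. j \<in> {1..r} ==> real (Q j) <= T * (c j - c (j + 1))"
  and p: "!!j. j \<in> {1..r} ==> typical_weight (\<mu> j) eps (Q j) (p j)"
  and large: "real (card (dspans :: (rat ^ 'k) set set)) ^ r * exp (- (T * eps\<^sub>0 / 2)) <= 1 / 2"
 defines "I \<equiv> win c Lam T P" and "Q' \<equiv> %l. Q (scl P l)"
 assumes half: "!!l. l < r * P ==> 1 / 2 <= prb (I l) (%A. Q' l <= card A)"
 shows "expect (\<Union>l<r * P. I l) (%A. of_bool (good_pattern r P eps C (gset (r * P) I Q' A)) *
   (\<Sum>om\<in>assigns r P Q \<mu>. \<Sum>om'\<in>assigns r P Q \<mu>. aweight r P p om * aweight r P p om' *
    of_bool (csum (r * P) I Q' om' A - csum (r * P) I Q' om A \<in> vec.span {ones})))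
  <= 2 * (2 * exp (T\<^sup>2)) ^ CARD('k) * exp (2 * T * H * C) * exp (- (Lam * flag_entropy r V c \<mu>))"
proof -
 let ?B = "r * P"
 let ?R = "\<Union>l<?B. I l"
 let ?Om = "assigns r P Q \<mu>"
 let ?aw = "aweight r P p"
 \<comment> \<open>A window has logarithmic length at most T and carries at most T vectors, so exp
   (T^2) bounds the ratio of its ends to the power Q.\<close>
 let ?K = "2 * exp (T\<^sup>2)"
 let ?M = "2 * ?K ^ CARD('k) * exp (2 * T * H * C) * exp (- (Lam * flag_entropy r V c \<mu>))"
 let ?X = "%l. exp (wheight c Lam T P l)"
 let ?st = "%g A. \<forall>l<?B. (Q' l <= card (A \<inter> I l)) = (l \<in> g)"
 let ?gs = "{g \<in> Pow {..<?B}. good_pattern r P eps C g}"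
 let ?v = "%om om' l i. om' l i - om l i"
 let ?rel = "%g om om' A. ?st g A & (\<Sum>l\<in>g \<inter> {..<?B}. lsum (Q' l) (?v om om' l) (A \<inter> I l)) - 0 \<in> vec.span {ones}"
 let ?pg = "%g l. prb (I l) (%A. (Q' l <= card A) = (l \<in> g))"
 let ?D = "%g om om'. dspan g Q' (?v om om')"
 let ?f = "%g om om' l. (?K / ?X l) ^ (vec.dim (?D g om om' (Suc l)) - vec.dim (?D g om om' l))"
 have cdec: "c (j + 1) <= c j" if "j \<in> {1..r}" for j using sys that by (auto simp: system_def)
 have cr: "0 <= c (r + 1)" and c1: "c 1 <= 1" and r1: "1 <= r" using sys by (auto simp: system_def)
 have aw0: "0 <= ?aw om" for om using p by (rule aweight_nonneg)
 have finI: "finite (I l)" for l by (simp add: I_def)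
 have disI: "I l \<inter> I l' = {}" if "l < ?B" "l' < ?B" "l ~= l'" for l l'
  unfolding I_def using that T cdec by (intro win_disjoint[of _ r]) auto
 have gsA: "?st g A \<longleftrightarrow> g = gset ?B I Q' A" if "g \<subseteq> {..<?B}" for g A
  using that unfolding gset_def by auto
 have w1: "c j - c (j + 1) <= 1" if "j \<in> {1..r}" for j
 proof -
  have "c j <= c 1" by (rule c_antimono[of r], rule cdec, assumption) (use that in simp_all)
  moreover have "c (r + 1) <= c (j + 1)" by (rule c_antimono[of r], rule cdec, assumption) (use that in simp_all)
  moreover note c1 cr
  ultimately show ?thesis by linarith
 qed
 have relp: "prb ?R (?rel g om om') <= (\<Prod>l<?B. ?pg g l * ?f g om om' l)" for g om om'
 proof (rule relation_prob[where h = "%l. exp (wbot c Lam T P l)" and K = "%_. ?K"])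
  fix l assume l: "l < ?B"
  note b = block_decompose[OF l]
  show "real (card (I l)) <= ?X l" unfolding I_def win_def by (rule card_expint_le)
  have wb: "0 <= wbot c Lam T P l" by (rule wbot_nonneg[OF l T(1,2)]) (rule cdec cr, assumption?)+
  have w0: "0 <= c (scl P l) - c (scl P l + 1)" using cdec[OF b(1)] by simp
  have wh: "wbot c Lam T P l <= wheight c Lam T P l" using w0 T by (simp add: wbot_def)
  show "1 <= ?X l" using wb wh by simp
  show "exp (wbot c Lam T P l) <= ?X l" using wh by simp
  show "1 / 2 <= prb (I l) (%A. Q' l <= card A)" by (rule half[OF l])
  show "exp (wbot c Lam T P l) <= real a" if "a \<in> I l" for a
   using that by (auto simp: I_def win_eq expint_def)
  have "?X l / exp (wbot c Lam T P l) = exp (T * (c (scl P l) - c (scl P l + 1)))"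
   by (simp add: wbot_def exp_diff[symmetric])
  then have "(?X l / exp (wbot c Lam T P l)) ^ Q' l = exp (real (Q' l) * (T * (c (scl P l) - c (scl P l + 1))))"
   by (simp only: exp_of_nat_mult)
  also have "real (Q' l) * (T * (c (scl P l) - c (scl P l + 1))) <= (T * 1) * (T * 1)"
  proof (intro mult_mono)
   have "real (Q' l) <= T * (c (scl P l) - c (scl P l + 1))" unfolding Q'_def by (rule Q(2)[OF b(1)])
   also have "... <= T * 1" using w1[OF b(1)] T by (intro mult_left_mono) auto
   finally show "real (Q' l) <= T * 1" .
  qed (use w1[OF b(1)] T w0 in auto)
  finally show "2 * (?X l / exp (wbot c Lam T P l)) ^ Q' l <= ?K" by (simp add: power2_eq_square)
 qed (use finI disI in auto)
 have pg0: "0 <= (\<Prod>l<?B. ?pg g l)" for g by (intro prod_nonneg) (auto intro: expect_nonneg)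
 have sumpg: "(\<Sum>g\<in>?gs. \<Prod>l<?B. ?pg g l) <= 1"
 proof -
  have "(\<Prod>l<?B. ?pg g l) = prb ?R (?st g)" for g
  proof -
   have "(\<Prod>l<?B. ?pg g l) = expect ?R (%A. \<Prod>l<?B. of_bool ((Q' l <= card (A \<inter> I l)) = (l \<in> g)))"
    using finI disI by (intro expect_prod_Int[symmetric]) auto
   also have "... = prb ?R (?st g)"
   proof (rule expect_cong)
    fix A
    show "(\<Prod>l<?B. of_bool ((Q' l <= card (A \<inter> I l)) = (l \<in> g))) = (of_bool (?st g A) :: real)"
     by (cases "?st g A") (auto intro!: prod_zero bexI)
   qed
   finally show ?thesis .
  qed
  then have "(\<Sum>g\<in>?gs. \<Prod>l<?B. ?pg g l) = expect ?R (%A. \<Sum>g\<in>?gs. of_bool (?st g A))"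
   by (simp only: expect_sum)
  also have "... <= expect ?R (%A. 1)"
  proof (rule expect_mono)
   fix A
   have "(\<Sum>g\<in>?gs. of_bool (?st g A) :: real) = (\<Sum>g\<in>?gs. of_bool (g = gset ?B I Q' A))"
    using gsA by (intro sum.cong refl) auto
   also have "... <= 1" by (simp add: of_bool_def sum.delta)
   finally show "(\<Sum>g\<in>?gs. of_bool (?st g A) :: real) <= 1" .
  qed
  also have "... = 1" using finI by simp
  finally show ?thesis .
 qed
 have "expect ?R (%A. of_bool (good_pattern r P eps C (gset ?B I Q' A)) *
   (\<Sum>om\<in>?Om. \<Sum>om'\<in>?Om. ?aw om * ?aw om' *
    of_bool (csum ?B I Q' om' A - csum ?B I Q' om A \<in> vec.span {ones})))
  = expect ?R (%A. \<Sum>g\<in>?gs. \<Sum>om\<in>?Om. \<Sum>om'\<in>?Om. ?aw om * ?aw om' * of_bool (?rel g om om' A))"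
 proof (rule expect_cong)
  fix A
  let ?g = "gset ?B I Q' A"
  let ?F = "%g. \<Sum>om\<in>?Om. \<Sum>om'\<in>?Om. ?aw om * ?aw om' * of_bool (?rel g om om' A)"
  have gB: "?g \<subseteq> {..<?B}" by (auto simp: gset_def)
  have "(\<Sum>g\<in>?gs. ?F g) = (\<Sum>g\<in>?gs \<inter> {?g}. ?F g)"
  proof (rule sum.mono_neutral_right)
   show "\<forall>g\<in>?gs - ?gs \<inter> {?g}. ?F g = 0"
   proof
    fix g assume g: "g \<in> ?gs - ?gs \<inter> {?g}"
    then have "\<not> ?st g A" using gsA[of g A] by blast
    then show "?F g = 0" by (simp only: simp_thms of_bool_eq mult_zero_right sum.neutral_const)
   qed
  qed auto
  also have "... = of_bool (good_pattern r P eps C ?g) * ?F ?g"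
   using gB by (cases "good_pattern r P eps C ?g") auto
  also have "?F ?g = (\<Sum>om\<in>?Om. \<Sum>om'\<in>?Om. ?aw om * ?aw om' *
    of_bool (csum ?B I Q' om' A - csum ?B I Q' om A \<in> vec.span {ones}))"
  proof -
   have st: "?st ?g A = True" using gsA[OF gB] by blast
   have "(\<Sum>l\<in>?g \<inter> {..<?B}. lsum (Q' l) (?v om om' l) (A \<inter> I l)) - 0 = csum ?B I Q' om' A - csum ?B I Q' om A" for om om' :: "nat => nat => rat ^ 'k"
    unfolding csum_diff unfolding csum_def using gB by (simp add: Int_absorb2)
   then show ?thesis by (simp only: st simp_thms)
  qed
  finally show "of_bool (good_pattern r P eps C ?g) *
   (\<Sum>om\<in>?Om. \<Sum>om'\<in>?Om. ?aw om * ?aw om' *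
    of_bool (csum ?B I Q' om' A - csum ?B I Q' om A \<in> vec.span {ones})) = (\<Sum>g\<in>?gs. ?F g)" by simp
 qed
 also have "... = (\<Sum>g\<in>?gs. \<Sum>om\<in>?Om. \<Sum>om'\<in>?Om. ?aw om * ?aw om' * prb ?R (?rel g om om'))"
  by (simp only: expect_sum expect_cmult)
 also have "... <= (\<Sum>g\<in>?gs. \<Sum>om\<in>?Om. \<Sum>om'\<in>?Om. ?aw om * ?aw om' * ((\<Prod>l<?B. ?pg g l) * (\<Prod>l<?B. ?f g om om' l)))"
  unfolding prod.distrib[symmetric] using aw0 relp by (intro sum_mono mult_left_mono) auto
 also have "... = (\<Sum>g\<in>?gs. (\<Prod>l<?B. ?pg g l) * (\<Sum>om\<in>?Om. ?aw om * (\<Sum>om'\<in>?Om. ?aw om' * (\<Prod>l<?B. ?f g om om' l))))"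
  by (simp add: sum_distrib_left mult_ac)
 also have "... <= (\<Sum>g\<in>?gs. (\<Prod>l<?B. ?pg g l) * (\<Sum>om\<in>?Om. ?aw om * ?M))"
 proof (intro sum_mono mult_left_mono[OF _ pg0])
  fix g om assume g: "g \<in> ?gs" and om: "om \<in> ?Om"
  show "?aw om * (\<Sum>om'\<in>?Om. ?aw om' * (\<Prod>l<?B. ?f g om om' l)) <= ?aw om * ?M"
  proof (cases "?aw om = 0")
   case False
   then have pos: "0 < ?aw om" using aw0[of om] by linarith
   have gp: "good_pattern r P eps C g" using g by simp
   have K1: "1 <= ?K"
   proof -
    have "1 <= exp (T\<^sup>2)" by simp
    then show ?thesis by linarith
   qed
   show ?thesis unfolding Q'_def
    by (intro mult_left_mono aw0 collision_sum[OF sys gap gp C P T eps H Q p large K1 om pos])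
  qed simp
 qed
 also have "... = (\<Sum>g\<in>?gs. \<Prod>l<?B. ?pg g l) * ?M"
 proof -
  have "sum ?aw ?Om = 1" by (rule sum_aweight[OF sys p])
  then show ?thesis unfolding sum_distrib_right[symmetric] by simp
 qed
 also have "... <= 1 * ?M" using sumpg by (intro mult_right_mono) auto
 finally show ?thesis by simp
qed

text \<open>Cauchy-Schwarz: a unit mass spread over n values has collision probability at least 1 /
  n. One representative is kept for every value modulo the line of \<open>ones\<close>; subtracting
  a fixed coordinate serves as normal form there.\<close>

lemma distinct_sums_from_collisions:
 fixes f :: "'a => rat ^ 'k::finite" and a :: "'a => real"
 assumes fin: "finite Om" and a: "!!om. 0 <= a om" "(\<Sum>om\<in>Om. a om) = 1"
 obtains Om0 where "Om0 \<subseteq> Om"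
  "!!om om'. om \<in> Om0 ==> om' \<in> Om0 ==> f om' - f om \<in> vec.span {ones} ==> om = om'"
  "1 <= real (card Om0) * (\<Sum>om\<in>Om. \<Sum>om'\<in>Om. a om * a om' * of_bool (f om' - f om \<in> vec.span {ones}))"
proof -
 obtain i0 :: 'k where True by simp
 define \<pi> where "\<pi> x = x - (x $ i0) *s ones" for x :: "rat ^ 'k"
 have \<pi>: "\<pi> x = \<pi> y \<longleftrightarrow> y - x \<in> vec.span {ones}" for x y
 proof
  assume h: "\<pi> x = \<pi> y"
  have e: "y - x = (y $ i0 - x $ i0) *s ones + (\<pi> y - \<pi> x)"
   unfolding \<pi>_def by (simp add: vec.scale_left_diff_distrib)
  have "y - x = (y $ i0 - x $ i0) *s ones" using e h by simp
  then show "y - x \<in> vec.span {ones}" by (simp only:) (intro vec.span_scale vec.span_base, simp)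
 next
  assume "y - x \<in> vec.span {ones}"
  then have h: "(y - x) $ i = (y - x) $ i'" for i i' by (simp only: span_ones_iff)
  have "\<pi> x $ i = \<pi> y $ i" for i using h[of i i0] by (simp add: \<pi>_def)
  then show "\<pi> x = \<pi> y" by (simp add: vec_eq_iff)
 qed
 let ?g = "%om. \<pi> (f om)"
 let ?S = "?g ` Om"
 obtain Om0 where Om0: "Om0 \<subseteq> Om" "inj_on ?g Om0" "?S = ?g ` Om0"
  using subset_image_inj[of ?S ?g Om] by auto
 have card: "card Om0 = card ?S" using Om0 by (simp add: card_image)
 define \<rho> where "\<rho> z = (\<Sum>om\<in>{om\<in>Om. ?g om = z}. a om)" for z
 have "1 = (\<Sum>z\<in>?S. \<rho> z)"
  unfolding \<rho>_def using fin a by (subst sum.group) auto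
 then have "1 = (\<Sum>z\<in>?S. \<rho> z)\<^sup>2" by simp
 also have "... <= (\<Sum>z\<in>?S. (\<rho> z)\<^sup>2) * real (card ?S)"
  by (rule sum_squared_le_sum_of_squares)
 also have "(\<Sum>z\<in>?S. (\<rho> z)\<^sup>2) = (\<Sum>z\<in>?S. \<Sum>om\<in>{om\<in>Om. ?g om = z}. a om * \<rho> (?g om))"
 proof (intro sum.cong refl)
  fix z
  have "(\<Sum>om\<in>{om\<in>Om. ?g om = z}. a om * \<rho> (?g om)) = (\<Sum>om\<in>{om\<in>Om. ?g om = z}. a om * \<rho> z)"
   by (intro sum.cong) auto
  then show "(\<rho> z)\<^sup>2 = (\<Sum>om\<in>{om\<in>Om. ?g om = z}. a om * \<rho> (?g om))"
   by (simp add: sum_distrib_right[symmetric] \<rho>_def[of z, symmetric] power2_eq_square)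
 qed
 also have "... = (\<Sum>om\<in>Om. a om * \<rho> (?g om))"
  using fin by (subst sum.group) auto
 also have "... = (\<Sum>om\<in>Om. \<Sum>om'\<in>Om. a om * a om' * of_bool (f om' - f om \<in> vec.span {ones}))"
 proof (intro sum.cong refl)
  fix om
  have "\<rho> (?g om) = (\<Sum>om'\<in>Om. a om' * of_bool (f om' - f om \<in> vec.span {ones}))"
   unfolding \<rho>_def using fin by (intro sum.mono_neutral_cong_left) (auto simp: \<pi>[symmetric])
  then show "a om * \<rho> (?g om) = (\<Sum>om'\<in>Om. a om * a om' * of_bool (f om' - f om \<in> vec.span {ones}))"
   by (simp add: sum_distrib_left mult.assoc)
 qed
 finally have "1 <= real (card Om0) * (\<Sum>om\<in>Om. \<Sum>om'\<in>Om. a om * a om' * of_bool (f om' - f om \<in> vec.span {ones}))"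
  by (simp add: card mult.commute)
 moreover have "om = om'" if "om \<in> Om0" "om' \<in> Om0" "f om' - f om \<in> vec.span {ones}" for om om'
  using that Om0(2) \<pi> by (auto dest: inj_onD)
 ultimately show ?thesis using that Om0(1) by blast
qed

section \<open>Many distinct sums\<close>

definition dense_sums :: "nat => (nat => (rat ^ 'k::finite) set) => (nat => real) => (nat => (rat ^ 'k) pmf) =>
  (nat => nat) => real => real => nat => real => nat set => bool" where
 "dense_sums r V c \<mu> Q Lam T P \<delta> A \<longleftrightarrow> (\<exists>Om0\<subseteq>assigns r P Q \<mu>.
   (\<forall>om\<in>Om0. \<forall>om'\<in>Om0. csum (r * P) (win c Lam T P) (%l. Q (scl P l)) om' A
    - csum (r * P) (win c Lam T P) (%l. Q (scl P l)) om A \<in> vec.span {ones} \<longrightarrow> om = om') &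
   \<delta> * exp (Lam * flag_entropy r V c \<mu>) <= real (card Om0))"

lemma window_error_small:
 fixes d eps p :: real
 assumes "0 < eps" "0 < p" "2 <= eps * d" "1 <= d" "8 / (eps\<^sup>2 * p) <= d"
 shows "(d + 1) / (eps * d - 1)\<^sup>2 <= p"
proof -
 have "(eps * d / 2)\<^sup>2 <= (eps * d - 1)\<^sup>2" by (intro power_mono; use assms(3) in linarith)
 moreover have "0 < (eps * d / 2)\<^sup>2" using assms by simp
 ultimately have "(d + 1) / (eps * d - 1)\<^sup>2 <= (2 * d) / (eps * d / 2)\<^sup>2"
  using assms by (intro frac_le) auto
 also have "... = 8 / (eps\<^sup>2 * d)" using assms by (simp add: power2_eq_square field_simps)
 also have "... <= p" using assms by (simp add: field_simps)
 finally show ?thesis .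
qed

text \<open>The order of the constants matters: eps comes from the gap, \<open>pm\<close> from eps,
  then T is large in terms of these, of the typical weights and of the number of subspaces, and C
  depends on \<eta> and eps. All of them precede Lam, so \<delta> is independent of Lam; only P
  grows, like (1 - eps) * Lam / T. The spare proportion eps of each scale yields the separation
  \<theta>.\<close>

lemma prb_dense_sums:
 fixes V :: "nat => (rat ^ 'k::finite) set"
 assumes sys: "system r V c \<mu>" and strict: "strict_entropy_condition r V c \<mu>" and \<eta>: "0 < \<eta>"
 obtains T Q \<theta> \<delta> Lam\<^sub>0 where "0 < T" "0 < \<theta>" "0 < \<delta>" "!!j. j \<in> {1..r} ==> real (Q j) <= T"
  "!!Lam. Lam\<^sub>0 <= Lam ==> \<exists>P. 1 <= P & T * real P <= Lam &
   (\<forall>j\<in>{1..r}. (c (j + 1) + \<theta>) * Lam <= c j * Lam - (c j - c (j + 1)) * (T * real P)) &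
   prb (\<Union>l<r * P. win c Lam T P l) (%A. \<not> dense_sums r V c \<mu> Q Lam T P \<delta> A) <= \<eta>"
proof -
 obtain eps\<^sub>0 where eps0: "0 < eps\<^sub>0" and gap: "!!V'. proper_subflag r V' V ==> (!!j. j <= r ==> V' j \<in> dspans) ==>
  flag_entropy r V c \<mu> + eps\<^sub>0 <= flag_entropy r V' c \<mu>"
  using strict_gap[OF strict] by blast
 have r1: "1 <= r" and cr: "0 <= c (r + 1)" and c1: "c 1 <= 1" using sys by (auto simp: system_def)
 have cdec: "c (j + 1) <= c j" if "j \<in> {1..r}" for j using sys that by (auto simp: system_def)
 define w where "w j = c j - c (j + 1)" for j
 have w: "0 < w j" if "j \<in> {1..r}" for j using strict_decreasing[OF sys strict that] by (simp add: w_def)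
 have w1: "w j <= 1" if "j \<in> {1..r}" for j
 proof -
  have "c j <= c 1" by (rule c_antimono[of r], rule cdec, assumption) (use that in simp_all)
  moreover have "c (r + 1) <= c (j + 1)" by (rule c_antimono[of r], rule cdec, assumption) (use that in simp_all)
  ultimately show ?thesis unfolding w_def using c1 cr by linarith
 qed
 define wm where "wm = Min (w ` {1..r})"
 have wm: "0 < wm" "!!j. j \<in> {1..r} ==> wm <= w j"
  unfolding wm_def using w r1 by (auto simp: Min_gr_iff)
 define H where "H = real (card (cube :: (rat ^ 'k) set))"
 define eps where "eps = min (1 / 4) (eps\<^sub>0 / (2 * (6 * H + 1)))"
 have H0: "0 <= H" by (simp add: H_def)
 have eps: "0 < eps" "eps <= 1 / 4" "eps * (6 * H + 1) <= eps\<^sub>0 / 2"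
 proof -
  show "eps <= 1 / 4" unfolding eps_def by (rule min.cobounded1)
  show "0 < eps" using eps0 H0 by (auto simp: eps_def)
  have "eps * (6 * H + 1) <= (eps\<^sub>0 / (2 * (6 * H + 1))) * (6 * H + 1)"
   using H0 by (intro mult_right_mono) (auto simp: eps_def)
  also have "... = eps\<^sub>0 / 2" using H0 by (simp add: field_simps)
  finally show "eps * (6 * H + 1) <= eps\<^sub>0 / 2" .
 qed
 \<comment> \<open>The tolerated probability that a window has too few elements: at most 1/2 for
   \<open>window_relation_prob\<close>, and small enough for the moment bound in
   \<open>prb_bad_pattern\<close>.\<close>
 define pm where "pm = min (1 / 2) (2 powr (eps / 2) - 1)"
 have pm: "0 < pm" "pm <= 1 / 2" "1 + pm <= 2 powr (eps / 2)"
 proof -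
  have "2 powr (0 :: real) < 2 powr (eps / 2)" using eps by (intro powr_less_mono) auto
  then show "0 < pm" by (simp add: pm_def)
  show "pm <= 1 / 2" unfolding pm_def by (rule min.cobounded1)
  have "pm <= 2 powr (eps / 2) - 1" unfolding pm_def by (rule min.cobounded2)
  then show "1 + pm <= 2 powr (eps / 2)" by linarith
 qed
 define Qf where "Qf T j = nat \<lfloor>(1 - eps) * (T * w j)\<rfloor>" for T j
 define N where "N = real (card (dspans :: (rat ^ 'k) set set)) ^ r"
 have ev1: "eventually (%T. \<forall>j\<in>{1..r}. 2 / (eps * w j) <= T & 1 / w j <= T & 8 / (eps\<^sup>2 * pm) / w j <= T) at_top"
  by (intro eventually_ball_finite ballI eventually_conj eventually_ge_at_top) auto
 have ev2: "eventually (%T. \<forall>j\<in>{1..r}. \<exists>p. typical_weight (\<mu> j) eps (Qf T j) p) at_top"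
 proof (intro eventually_ball_finite ballI)
  fix j assume j: "j \<in> {1..r}"
  obtain Q0 where Q0: "!!Q. Q0 <= Q ==> \<exists>p. typical_weight (\<mu> j) eps Q p"
   using ex_typical_weight[OF system_finite_support[OF sys j] eps(1)] by (auto simp: eventually_sequentially)
  have "eventually (%T. real Q0 / ((1 - eps) * w j) <= T) at_top" by (rule eventually_ge_at_top)
  then show "eventually (%T. \<exists>p. typical_weight (\<mu> j) eps (Qf T j) p) at_top"
  proof eventually_elim
   case (elim T)
   have "0 < (1 - eps) * w j" using eps w[OF j] by simp
   then have "real Q0 <= (1 - eps) * (T * w j)" using elim by (simp add: field_simps)
   then have "Q0 <= Qf T j" unfolding Qf_def by (simp add: le_nat_floor)
   then show ?case by (rule Q0)
  qed
 qed simp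
 have ev3: "eventually (%T. ln (2 * N + 1) * (2 / eps\<^sub>0) <= T & 1 <= T) at_top"
  by (intro eventually_conj eventually_ge_at_top)
 have "eventually (%T. (\<forall>j\<in>{1..r}. 2 / (eps * w j) <= T & 1 / w j <= T & 8 / (eps\<^sup>2 * pm) / w j <= T) &
   (\<forall>j\<in>{1..r}. \<exists>p. typical_weight (\<mu> j) eps (Qf T j) p) & (ln (2 * N + 1) * (2 / eps\<^sub>0) <= T & 1 <= T)) at_top"
  by (intro eventually_conj ev1 ev2 ev3)
 from eventually_happens'[OF trivial_limit_at_top_linorder this] obtain T where T1: "!!j. j \<in> {1..r} ==> 2 / (eps * w j) <= T & 1 / w j <= T & 8 / (eps\<^sup>2 * pm) / w j <= T"
  and T2: "!!j. j \<in> {1..r} ==> \<exists>p. typical_weight (\<mu> j) eps (Qf T j) p"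
  and T3: "ln (2 * N + 1) * (2 / eps\<^sub>0) <= T" "1 <= T"
  by blast
 define Q where "Q = Qf T"
 obtain p where p: "!!j. j \<in> {1..r} ==> typical_weight (\<mu> j) eps (Q j) (p j)"
  using T2 unfolding Q_def by metis
 have N0: "0 <= N" by (simp add: N_def)
 have large: "N * exp (- (T * eps\<^sub>0 / 2)) <= 1 / 2"
 proof -
  have "ln (2 * N + 1) <= T * eps\<^sub>0 / 2" using T3(1) eps0 by (simp add: field_simps)
  then have "exp (ln (2 * N + 1)) <= exp (T * eps\<^sub>0 / 2)" by (simp only: exp_le_cancel_iff)
  moreover have "exp (ln (2 * N + 1)) = 2 * N + 1" using N0 by (intro exp_ln) simp
  ultimately have "2 * N + 1 <= exp (T * eps\<^sub>0 / 2)" by simp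
  then have "2 * N <= exp (T * eps\<^sub>0 / 2)" by simp
  then show ?thesis by (simp add: exp_minus field_simps)
 qed
 have dj: "2 <= eps * (T * w j)" "1 <= T * w j" "8 / (eps\<^sup>2 * pm) <= T * w j" if j: "j \<in> {1..r}" for j
 proof -
  show "2 <= eps * (T * w j)" "1 <= T * w j" using T1[OF j] w[OF j] eps by (simp_all add: field_simps)
  have "8 / (eps\<^sup>2 * pm) / w j <= T" using T1[OF j] by blast
  then show "8 / (eps\<^sup>2 * pm) <= T * w j" using w[OF j] by (simp only: pos_divide_le_eq)
 qed
 have Qle: "real (Q j) <= (1 - eps) * (T * w j)" if j: "j \<in> {1..r}" for j
  unfolding Q_def Qf_def using dj(2)[OF j] eps by simp
 have Qge: "(1 - 2 * eps) * (T * w j) <= real (Q j)" if j: "j \<in> {1..r}" for j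
 proof -
  have "(1 - eps) * (T * w j) - 1 <= real (Q j)" unfolding Q_def Qf_def by linarith
  moreover have "(1 - 2 * eps) * (T * w j) = (1 - eps) * (T * w j) - eps * (T * w j)" by (simp add: algebra_simps)
  ultimately show ?thesis using dj(1)[OF j] by linarith
 qed
 have Qle': "real (Q j) <= T * w j" if j: "j \<in> {1..r}" for j
 proof -
  have "(1 - eps) * (T * w j) <= 1 * (T * w j)" using dj(2)[OF j] eps by (intro mult_right_mono) auto
  then show ?thesis using Qle[OF j] by simp
 qed
 define z where "z = 2 powr (- eps / 2)"
 have "2 powr (- eps / 2) < 2 powr (0 :: real)" using eps by (intro powr_less_mono) auto
 then have z: "z < 1" by (simp add: z_def)
 define X where "X = 2 * real r / (\<eta> * (1 - z))"
 have X: "0 < X" using r1 \<eta> z by (simp add: X_def)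
 define C where "C = max 0 (log 2 X)"
 have C: "0 <= C" "real r * 2 powr (- C) / (1 - z) <= \<eta> / 2"
 proof -
  show "0 <= C" by (simp add: C_def)
  have "X = 2 powr (log 2 X)" using X by simp
  also have "... <= 2 powr C" by (intro powr_mono) (auto simp: C_def)
  finally have "2 powr (- C) <= 1 / X" using X by (simp add: powr_minus field_simps)
  then have "real r * 2 powr (- C) / (1 - z) <= real r * (1 / X) / (1 - z)"
   using z by (intro divide_right_mono mult_left_mono) auto
  also have "... = \<eta> / 2" using r1 \<eta> z by (simp add: X_def field_simps)
  finally show "real r * 2 powr (- C) / (1 - z) <= \<eta> / 2" .
 qed
 define M where "M = 2 * (2 * exp (T\<^sup>2)) ^ CARD('k) * exp (2 * T * H * C)"
 have M: "0 < M" by (simp add: M_def)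
 define \<delta> where "\<delta> = \<eta> / (2 * M)"
 have T0: "0 < T" using T3 by simp
 show ?thesis
 proof (rule that[of T "eps * wm" \<delta> Q "4 * T / eps"])
  show "0 < T" by (rule T0)
  show "0 < eps * wm" using eps wm by simp
  show "0 < \<delta>" using \<eta> M by (simp add: \<delta>_def)
  show "real (Q j) <= T" if "j \<in> {1..r}" for j
  proof -
   have "T * w j <= T * 1" using T0 w1[OF that] by (intro mult_left_mono) auto
   then show ?thesis using Qle'[OF that] by simp
  qed
  fix Lam assume Lam: "4 * T / eps <= Lam"
  have LamT: "16 * T <= Lam"
  proof -
   have "4 * T <= Lam * eps" using Lam eps by (simp add: field_simps)
   also have "... <= Lam * (1 / 4)"
   proof (rule mult_left_mono[OF eps(2)])
    have "0 < 4 * T / eps" using T0 eps by simp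
    then show "0 <= Lam" using Lam by linarith
   qed
   finally show ?thesis by simp
  qed
  have Lam0: "0 < Lam" using LamT T0 by linarith
  define P where "P = nat \<lfloor>(1 - eps) * Lam / T\<rfloor>"
  have x1: "1 <= (1 - eps) * Lam / T"
  proof -
   have "(3 / 4) * (16 * T) <= (1 - eps) * Lam" using eps LamT T0 by (intro mult_mono) auto
   then show ?thesis using T0 by (simp add: field_simps)
  qed
  have P1: "1 <= P" unfolding P_def using x1 by (simp add: le_nat_floor)
  have Ple: "real P <= (1 - eps) * Lam / T" unfolding P_def using x1 by simp
  have Pge: "(1 - eps) * Lam / T - 1 <= real P" unfolding P_def by linarith
  have TP: "T * real P <= (1 - eps) * Lam" using Ple T0 by (simp add: field_simps)
  have TP': "(1 - eps) * Lam - T <= T * real P" using Pge T0 by (simp add: field_simps)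
  have TPLam: "T * real P <= Lam"
  proof -
   have "(1 - eps) * Lam <= 1 * Lam" using eps Lam0 by (intro mult_right_mono) auto
   then show ?thesis using TP by simp
  qed
  have LamTP: "Lam <= (1 + 2 * eps) * (T * real P)"
  proof -
   have "(1 + 2 * eps) * ((1 - eps) * Lam - T) <= (1 + 2 * eps) * (T * real P)"
    using TP' eps by (intro mult_left_mono) auto
   moreover have "(1 + 2 * eps) * ((1 - eps) * Lam - T) = Lam + (eps - 2 * eps * eps) * Lam - (1 + 2 * eps) * T"
    by (simp add: algebra_simps)
   moreover have "(eps / 2) * Lam <= (eps - 2 * eps * eps) * Lam"
   proof (intro mult_right_mono)
    have "2 * eps * eps <= 2 * eps * (1 / 4)" using eps by (intro mult_left_mono) auto
    then show "eps / 2 <= eps - 2 * eps * eps" by simp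
   qed (use Lam0 in simp)
   moreover have "2 * T <= (eps / 2) * Lam" using Lam eps by (simp add: field_simps)
   moreover have "(1 + 2 * eps) * T <= 2 * T" using eps T0 by (intro mult_right_mono) auto
   ultimately show ?thesis by linarith
  qed
  have sep: "(c (j + 1) + eps * wm) * Lam <= c j * Lam - (c j - c (j + 1)) * (T * real P)" if j: "j \<in> {1..r}" for j
  proof -
   have "w j * (T * real P) <= w j * ((1 - eps) * Lam)" using TP w[OF j] by (intro mult_left_mono) auto
   moreover have "eps * wm * Lam <= eps * w j * Lam" using wm(2)[OF j] eps Lam0 by (intro mult_right_mono mult_left_mono) auto
   ultimately show ?thesis by (simp add: w_def algebra_simps)
  qed
  let ?I = "win c Lam T P" and ?Q' = "%l. Q (scl P l)" and ?B = "r * P"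
  let ?R = "\<Union>l<?B. ?I l"
  have bad: "prb (?I l) (%A. \<not> ?Q' l <= card A) <= pm" if l: "l < ?B" for l
  proof -
   note j = block_decompose(1)[OF l]
   have wb: "0 <= wbot c Lam T P l"
    by (rule wbot_nonneg[OF l T0 TPLam], rule cdec, assumption) (rule cr)
   have "?I l = expint (wbot c Lam T P l) (wbot c Lam T P l + T * w (scl P l))"
    unfolding win_eq by (simp add: wbot_def w_def)
   then have "prb (?I l) (%A. \<not> ?Q' l <= card A) <= (T * w (scl P l) + 1) / (eps * (T * w (scl P l)) - 1)\<^sup>2"
    using prb_few_elements[OF wb, of "T * w (scl P l)" eps "?Q' l"] dj(1,2)[OF j] Qle[OF j] by simp
   also have "... <= pm" using dj[OF j] eps pm by (intro window_error_small) auto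
   finally show ?thesis .
  qed
  have half: "1 / 2 <= prb (?I l) (%A. ?Q' l <= card A)" if l: "l < ?B" for l
   using bad[OF l] pm prb_compl[of "?I l" "%A. ?Q' l <= card A"] by simp
  have patt: "prb ?R (%A. \<not> good_pattern r P eps C (gset ?B ?I ?Q' A)) <= \<eta> / 2"
  proof -
   have "prb ?R (%A. \<not> good_pattern r P eps C (gset ?B ?I ?Q' A)) <= real r * 2 powr (- C) / (1 - 2 powr (- eps / 2))"
   proof (rule prb_bad_pattern)
    fix l l' assume ll: "l < ?B" "l' < ?B" "l ~= l'"
    show "?I l \<inter> ?I l' = {}" by (rule win_disjoint[OF ll T0 TPLam], rule cdec, assumption)
   qed (use bad pm eps in auto)
   then show ?thesis using C unfolding z_def by linarith
  qed
  let ?Om = "assigns r P Q \<mu>" and ?aw = "aweight r P p"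
  let ?coll = "%A. \<Sum>om\<in>?Om. \<Sum>om'\<in>?Om. ?aw om * ?aw om' *
    of_bool (csum ?B ?I ?Q' om' A - csum ?B ?I ?Q' om A \<in> vec.span {ones})"
  let ?f = "%A. of_bool (good_pattern r P eps C (gset ?B ?I ?Q' A)) * ?coll A"
  let ?e = "flag_entropy r V c \<mu>"
  have aw0: "0 <= ?aw om" for om using p by (rule aweight_nonneg)
  have Ef: "expect ?R ?f <= M * exp (- (Lam * ?e))"
   unfolding M_def
   by (rule expect_collisions[OF sys gap C(1) P1 T0 TPLam LamTP eps(1) _ eps(3) H_def _ _ p _ half])
    (use eps Qge Qle' large in \<open>auto simp: w_def N_def\<close>)
  let ?t = "2 * M * exp (- (Lam * ?e)) / \<eta>"
  have t0: "0 < ?t" using M \<eta> by simp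
  have "prb ?R (%A. ?t <= ?f A) <= expect ?R ?f / ?t"
   using aw0 by (intro prb_markov t0) (auto intro!: mult_nonneg_nonneg sum_nonneg)
  also have "... <= M * exp (- (Lam * ?e)) / ?t" using Ef t0 by (intro divide_right_mono) auto
  also have "... = \<eta> / 2" using M \<eta> by (simp add: field_simps)
  finally have coll: "prb ?R (%A. ?t <= ?f A) <= \<eta> / 2" .
  have "prb ?R (%A. \<not> dense_sums r V c \<mu> Q Lam T P \<delta> A)
   <= prb ?R (%A. \<not> good_pattern r P eps C (gset ?B ?I ?Q' A) \<or> ?t <= ?f A)"
  proof (rule prb_mono, rule ccontr)
   fix A assume nd: "\<not> dense_sums r V c \<mu> Q Lam T P \<delta> A"
    and h: "\<not> (\<not> good_pattern r P eps C (gset ?B ?I ?Q' A) \<or> ?t <= ?f A)"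
   then have ct: "?coll A < ?t" by simp
   obtain Om0 where Om0: "Om0 \<subseteq> ?Om"
    "!!om om'. om \<in> Om0 ==> om' \<in> Om0 ==> csum ?B ?I ?Q' om' A - csum ?B ?I ?Q' om A \<in> vec.span {ones} ==> om = om'"
    "1 <= real (card Om0) * ?coll A"
    by (rule distinct_sums_from_collisions[where f = "%om. csum ?B ?I ?Q' om A",
       OF finite_assigns[OF sys, of P Q] aw0 sum_aweight[OF sys p]]) blast+
   have "1 <= real (card Om0) * ?t"
    using Om0(3) ct by (meson less_imp_le mult_left_mono of_nat_0_le_iff order_trans)
   then have "\<eta> / (2 * M * exp (- (Lam * ?e))) <= real (card Om0)"
    using M \<eta> by (simp add: field_simps)
   moreover have "\<eta> / (2 * M * exp (- (Lam * ?e))) = \<delta> * exp (Lam * ?e)"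
    using M by (simp add: \<delta>_def exp_minus field_simps)
   ultimately have "dense_sums r V c \<mu> Q Lam T P \<delta> A"
    unfolding dense_sums_def using Om0(1,2) by (intro exI[of _ Om0]) auto
   then show False using nd by simp
  qed
  also have "... <= \<eta> / 2 + \<eta> / 2"
   by (rule order_trans[OF prb_disj add_mono[OF patt coll]])
  finally have "prb ?R (%A. \<not> dense_sums r V c \<mu> Q Lam T P \<delta> A) <= \<eta>" by simp
  then show "\<exists>P. 1 <= P & T * real P <= Lam &
   (\<forall>j\<in>{1..r}. (c (j + 1) + eps * wm) * Lam <= c j * Lam - (c j - c (j + 1)) * (T * real P)) &
   prb (\<Union>l<r * P. win c Lam T P l) (%A. \<not> dense_sums r V c \<mu> Q Lam T P \<delta> A) <= \<eta>"
   using P1 TPLam sep by blast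
 qed
qed

section \<open>Lower bound: completion of one of the sums by fresh elements\<close>

section \<open>A basis adapted to the flag\<close>

lemma has_equal_sums_indexedI:
 fixes om :: "'j => rat ^ 'k::finite" and el :: "'j => nat"
 assumes J: "finite J" "inj_on el J" "el ` J \<subseteq> S" and cube: "!!j. j \<in> J ==> om j \<in> cube"
  and bal: "(\<Sum>j\<in>J. of_nat (el j) *s om j) \<in> vec.span {ones}"
  and sep: "!!i i'. i ~= i' ==> \<exists>j\<in>J. om j $ i ~= om j $ i'"
 shows "has_equal_sums CARD('k) S"
proof (rule has_equal_sumsI[where E = "el ` J" and om = "%a. om (the_inv_into J el a)"])
 have inv: "the_inv_into J el (el j) = j" if "j \<in> J" for j
  using J(2) that by (rule the_inv_into_f_f)
 show "finite (el ` J)" "el ` J \<subseteq> S" using J by auto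
 show "om (the_inv_into J el a) \<in> cube" if "a \<in> el ` J" for a using that inv cube by auto
 have "(\<Sum>a\<in>el ` J. of_nat a *s om (the_inv_into J el a)) = (\<Sum>j\<in>J. of_nat (el j) *s om j)"
  using J(2) inv by (subst sum.reindex) auto
 then show "(\<Sum>a\<in>el ` J. of_nat a *s om (the_inv_into J el a)) \<in> vec.span {ones}" using bal by simp
 show "\<exists>a\<in>el ` J. om (the_inv_into J el a) $ i ~= om (the_inv_into J el a) $ i'" if "i ~= i'" for i i'
  using sep[OF that] inv by auto
qed

lemma adapted_chain:
 fixes V :: "nat => (rat ^ 'k::finite) set"
 assumes fl: "flag r V" and sp: "!!j. j <= r ==> \<exists>S\<subseteq>cube. V j = vec.span S"
 shows "\<exists>B. B 0 = {ones} & (\<forall>j\<le>r. vec.independent (B j) & vec.span (B j) = V j & B j \<subseteq> cube) &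
   (\<forall>j<r. B j \<subseteq> B (Suc j))"
proof -
 define good where "good j S \<longleftrightarrow> (if j <= r then vec.independent S & vec.span S = V j & S \<subseteq> cube else True)" for j S
 have V0: "V 0 = vec.span {ones}" using fl by (simp add: flag_def)
 have g0: "good 0 {ones}"
  unfolding good_def using V0 ones_in_cube ones_neq_0
  by (auto simp: vec.independent_insert)
 have step: "\<exists>S'. good (Suc j) S' & (j < r \<longrightarrow> S \<subseteq> S')" if S: "good j S" for j S
 proof (cases "j < r")
  case True
  then have ind: "vec.independent S" and sps: "vec.span S = V j" and Sc: "S \<subseteq> cube" using S by (auto simp: good_def)
  obtain S0 where S0: "S0 \<subseteq> cube" "V (Suc j) = vec.span S0" using sp[of "Suc j"] True by auto
  have VV: "V j \<subseteq> V (Suc j)" using fl True by (simp add: flag_def)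
  obtain S' where S': "S \<subseteq> S'" "S' \<subseteq> S \<union> S0" "vec.independent S'" "S \<union> S0 \<subseteq> vec.span S'"
   using vec.maximal_independent_subset_extend[of S "S \<union> S0"] ind by auto
  have "vec.span S' = V (Suc j)"
  proof
   have "S \<union> S0 \<subseteq> V (Suc j)" using S0 sps VV vec.span_superset[of S] vec.span_superset[of S0] by auto
   then have "S' \<subseteq> V (Suc j)" using S' by blast
   moreover have "vec.subspace (V (Suc j))" using S0 by simp
   ultimately show "vec.span S' \<subseteq> V (Suc j)" by (intro vec.span_minimal)
   show "V (Suc j) \<subseteq> vec.span S'" unfolding S0(2) using S' by (intro vec.span_minimal) auto
  qed
  then have "good (Suc j) S'" using S' Sc S0 by (auto simp: good_def)
  then show ?thesis using S' by blast
 next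
  case False
  then show ?thesis by (auto simp: good_def)
 qed
 have "\<exists>B. \<forall>j. (good j (B j) & (j = 0 \<longrightarrow> B j = {ones})) & (j < r \<longrightarrow> B j \<subseteq> B (Suc j))"
 proof (rule dependent_nat_choice)
  show "\<exists>S. good 0 S & (0 = (0::nat) \<longrightarrow> S = {ones})" using g0 by auto
  show "\<exists>S'. (good (Suc j) S' & (Suc j = 0 \<longrightarrow> S' = {ones})) & (j < r \<longrightarrow> S \<subseteq> S')"
   if "good j S & (j = 0 \<longrightarrow> S = {ones})" for S j
   using step[of j S] that by auto
 qed
 then obtain B where BB: "\<forall>j. (good j (B j) & (j = 0 \<longrightarrow> B j = {ones})) & (j < r \<longrightarrow> B j \<subseteq> B (Suc j))"
  by (rule exE)
 have B: "good j (B j)" "j = 0 ==> B j = {ones}" "j < r ==> B j \<subseteq> B (Suc j)" for j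
  using spec[OF BB, of j] by simp_all
 show ?thesis
  using B unfolding good_def by (intro exI[of _ B]) auto
qed

lemma flag_entropy_full:
 fixes V :: "nat => (rat ^ 'k::finite) set"
 assumes sys: "system r V c \<mu>"
 shows "flag_entropy r V c \<mu> = (\<Sum>j=1..r. c j * quotient_dim (V j) (V (j - 1)))"
proof -
 have "coset_entropy (\<mu> j) (V j) = 0" if "j \<in> {1..r}" for j
  using sys that by (intro coset_entropy_zero) (auto simp: system_def flag_def)
 then show ?thesis by (simp add: flag_entropy_def)
qed

text \<open>Cube bases of the spaces V j are nested, and the last one is extended to a basis of the
  whole space so that the coordinates \<open>co f\<close> are total functionals. The vector
  \<open>ones\<close> is left out of F. Exactly dim (V j / V (j - 1)) elements of F have level j,
  and all entropies of the full flag vanish, whence the formula for its value.\<close>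

lemma adapted_basis:
 fixes V :: "nat => (rat ^ 'k::finite) set"
 assumes sys: "system r V c \<mu>"
 obtains F :: "(rat ^ 'k) set" and lev :: "rat ^ 'k => nat" and co :: "rat ^ 'k => rat ^ 'k => rat"
 where "finite F" "F \<subseteq> cube \<inter> V r" "!!f. f \<in> F ==> lev f \<in> {1..r}"
  "!!f x y. co f (x + y) = co f x + co f y" "!!f t x. co f (t *s x) = t * co f x"
  "!!f. f \<in> F ==> co f ones = 0" "!!f f'. f \<in> F ==> f' \<in> F ==> co f f' = (if f = f' then 1 else 0)"
  "!!f x j. f \<in> F ==> j < lev f ==> x \<in> V j ==> co f x = 0"
  "!!x. x \<in> V r ==> (!!f. f \<in> F ==> co f x = 0) ==> x \<in> vec.span {ones}"
  "(\<Sum>f\<in>F. c (lev f)) = flag_entropy r V c \<mu>"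
  "!!i i'. i ~= i' ==> \<exists>f\<in>F. f $ i ~= f $ i'"
proof -
 have fl: "flag r V" using sys by (simp add: system_def)
 have sp: "\<exists>S\<subseteq>cube. V j = vec.span S" if "j <= r" for j using sys that by (auto simp: system_def)
 obtain B where B0: "B 0 = {ones}"
  and B: "!!j. j <= r ==> vec.independent (B j)" "!!j. j <= r ==> vec.span (B j) = V j" "!!j. j <= r ==> B j \<subseteq> cube"
  and Bm: "!!j. j < r ==> B j \<subseteq> B (Suc j)"
  using adapted_chain[OF fl sp] by metis
 have mono: "B i \<subseteq> B j" if "i <= j" "j <= r" for i j
  using that
 proof (induction j rule: dec_induct)
  case (step n)
  then show ?case using Bm[of n] by auto
 qed simp
 have finB: "finite (B j)" if "j <= r" for j using B(3)[OF that] finite_cube finite_subset by blast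
 define E where "E = vec.extend_basis (B r)"
 have E: "vec.independent E" "B r \<subseteq> E" "vec.span E = UNIV"
  unfolding E_def using B(1)[of r] vec.independent_extend_basis vec.extend_basis_superset vec.span_extend_basis by auto
 define F where "F = B r - {ones}"
 define lev where "lev f = (LEAST j. f \<in> B j)" for f
 define co where "co f x = vec.representation E x f" for f x
 have onesB: "ones \<in> B j" if "j <= r" for j using mono[of 0 j] that B0 by auto
 have levB: "f \<in> B (lev f)" "lev f \<in> {1..r}" if "f \<in> F" for f
 proof -
  have f: "f \<in> B r" "f ~= ones" using that by (auto simp: F_def)
  show fl: "f \<in> B (lev f)" unfolding lev_def using f by (rule_tac LeastI)
  have "lev f <= r" unfolding lev_def using f by (rule_tac Least_le)
  moreover have "lev f ~= 0"
  proof
   assume "lev f = 0"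
   then show False using fl f B0 by auto
  qed
  ultimately show "lev f \<in> {1..r}" by auto
 qed
 have low: "f \<notin> B j" if "j < lev f" for f j using that unfolding lev_def by (rule not_less_Least)
 have rep: "co f x = vec.representation (B j) x f" if "x \<in> V j" "j <= r" for f x j
 proof -
  have "vec.representation E x = vec.representation (B j) x"
   using that B[OF that(2)] E mono[of j r] by (intro vec.representation_extend) auto
  then show ?thesis by (simp add: co_def)
 qed
 have co3: "co f x = 0" if "f \<in> F" "j < lev f" "x \<in> V j" for f x j
 proof -
  have j: "j <= r" using levB(2)[OF that(1)] that(2) by auto
  show ?thesis unfolding rep[OF that(3) j]
   using low[OF that(2)] vec.representation_ne_zero[of "B j" x f] by blast
 qed
 have ones0: "ones \<in> V 0" using fl by (auto simp: flag_def intro: vec.span_base)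
 have co4: "x \<in> vec.span {ones}" if x: "x \<in> V r" and z: "!!f. f \<in> F ==> co f x = 0" for x
 proof -
  have "x = (\<Sum>b\<in>B r. vec.representation (B r) x b *s b)"
   using B[of r] x finB[of r] by (subst vec.sum_representation_eq[of "B r" x "B r"]) auto
  also have "... = (\<Sum>b\<in>{ones}. vec.representation (B r) x b *s b)"
  proof (rule sum.mono_neutral_right)
   show "\<forall>b\<in>B r - {ones}. vec.representation (B r) x b *s b = 0"
    using z rep[OF x order_refl] by (auto simp: F_def)
  qed (use finB onesB in auto)
  also have "... \<in> vec.span {ones}" by (intro vec.span_sum vec.span_scale vec.span_base) auto
  finally show ?thesis .
 qed
 have dimB: "vec.dim (V j) = card (B j)" if "j <= r" for j
  using vec.dim_span_eq_card_independent[OF B(1)[OF that]] B(2)[OF that] by simp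
 have sumc: "(\<Sum>f\<in>B i - {ones}. c (lev f)) = (\<Sum>j=1..i. c j * quotient_dim (V j) (V (j - 1)))" if "i <= r" for i
  using that
 proof (induction i)
  case 0 then show ?case using B0 by simp
 next
  case (Suc i)
  have BB: "B i \<subseteq> B (Suc i)" using Suc.prems by (intro Bm) auto
  have "B (Suc i) - {ones} = (B i - {ones}) \<union> (B (Suc i) - B i)" using BB onesB[of i] Suc.prems by auto
  then have "(\<Sum>f\<in>B (Suc i) - {ones}. c (lev f)) = (\<Sum>f\<in>B i - {ones}. c (lev f)) + (\<Sum>f\<in>B (Suc i) - B i. c (lev f))"
   using finB[of i] finB[of "Suc i"] Suc.prems by (simp only:) (intro sum.union_disjoint, auto)
  also have "(\<Sum>f\<in>B (Suc i) - B i. c (lev f)) = (\<Sum>f\<in>B (Suc i) - B i. c (Suc i))"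
  proof (intro sum.cong refl)
   fix f assume f: "f \<in> B (Suc i) - B i"
   have "lev f = Suc i" unfolding lev_def
   proof (rule Least_equality)
    show "f \<in> B (Suc i)" using f by simp
    fix j assume "f \<in> B j"
    show "Suc i <= j"
    proof (rule ccontr)
     assume "\<not> Suc i <= j"
     then have "B j \<subseteq> B i" using Suc.prems by (intro mono) auto
     then show False using f \<open>f \<in> B j\<close> by auto
    qed
   qed
   then show "c (lev f) = c (Suc i)" by simp
  qed
  also have "... = c (Suc i) * quotient_dim (V (Suc i)) (V (Suc i - 1))"
   using BB finB[of i] finB[of "Suc i"] Suc.prems dimB[of i] dimB[of "Suc i"] card_mono[of "B (Suc i)" "B i"]
   by (simp add: quotient_dim_def card_Diff_subset of_nat_diff mult.commute)
  finally show ?case using Suc by simp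
 qed
 have sep: "\<exists>f\<in>F. f $ i ~= f $ i'" if "i ~= i'" for i i'
 proof (rule ccontr)
  assume "\<not> (\<exists>f\<in>F. f $ i ~= f $ i')"
  then have "B r \<subseteq> {x. x $ i = x $ i'}" by (auto simp: F_def)
  moreover have "vec.subspace {x :: rat ^ 'k. x $ i = x $ i'}" by (auto simp: vec.subspace_def)
  ultimately have "V r \<subseteq> {x. x $ i = x $ i'}" unfolding B(2)[OF order_refl, symmetric] by (rule vec.span_minimal)
  then show False using sys that unfolding system_def nondegenerate_def by blast
 qed
 show ?thesis
 proof (rule that[of F lev co])
  show "finite F" using finB by (simp add: F_def)
  show "F \<subseteq> cube \<inter> V r" using B[of r] vec.span_superset[of "B r"] by (auto simp: F_def)
  show "co f (x + y) = co f x + co f y" for f x y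
   unfolding co_def using E by (simp add: vec.representation_add)
  show "co f (t *s x) = t * co f x" for f t x
   unfolding co_def using E by (simp add: vec.representation_scale)
  show "co f ones = 0" if "f \<in> F" for f using levB(2)[OF that] ones0 by (intro co3[OF that, of 0]) auto
  show "co f f' = (if f = f' then 1 else 0)" if "f \<in> F" "f' \<in> F" for f f'
  proof -
   have "f' \<in> E" using that E by (auto simp: F_def)
   then show ?thesis unfolding co_def using vec.representation_basis[OF E(1)] by simp
  qed
  show "(\<Sum>f\<in>F. c (lev f)) = flag_entropy r V c \<mu>"
   unfolding flag_entropy_full[OF sys] F_def by (rule sumc) simp
 qed (fact levB co3 co4 sep)+
qed

lemma common_denominator:
 fixes g :: "'a => rat"
 assumes "finite S" shows "\<exists>q::nat. 0 < q & (\<forall>x\<in>S. of_nat q * g x \<in> \<int>)"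
 using assms
proof (induction S rule: finite_induct)
 case (insert x S)
 then obtain q where q: "0 < q" "!!y. y \<in> S ==> of_nat q * g y \<in> \<int>" by auto
 obtain a b where ab: "quotient_of (g x) = (a, b)" by (cases "quotient_of (g x)")
 then have b: "0 < b" "g x = of_int a / of_int b" by (auto dest: quotient_of_denom_pos quotient_of_div)
 show ?case
 proof (intro exI[of _ "q * nat b"] conjI ballI)
  show "0 < q * nat b" using q b by simp
  fix y assume "y \<in> insert x S"
  then consider "y = x" | "y \<in> S" by auto
  then show "of_nat (q * nat b) * g y \<in> \<int>"
  proof cases
   case 1
   have "of_nat (q * nat b) * g x = of_int (int q * a)" using b by simp
   then show ?thesis unfolding 1 by (simp only: Ints_of_int)
  next
   case 2
   have "of_nat (q * nat b) * g y = of_int b * (of_nat q * g y)" using b by simp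
   then show ?thesis using q(2)[OF 2] by (simp only: Ints_mult Ints_of_int)
  qed
 qed
qed (auto intro: exI[of _ 1])

section \<open>Hitting a prescribed family and independent trials\<close>

lemma prb_hit:
 fixes Wd :: "'i => nat set" and u :: "'i => real"
 assumes X: "finite X" and G: "finite G" "!!a. a \<in> G ==> 2 <= a"
  and Wd: "!!x. x \<in> X ==> Wd x \<subseteq> G"
  and dis: "!!x x'. x \<in> X ==> x' \<in> X ==> x ~= x' ==> Wd x \<inter> Wd x' = {}"
  and u: "!!x a. x \<in> X ==> a \<in> Wd x ==> real a <= u x"
  and T: "T \<subseteq> Pi\<^sub>E X Wd" "!!t. t \<in> T ==> Pr (t ` X)"
 shows "real (card T) * (\<Prod>x\<in>X. 1 / u x) * exp (- 2 * hsum G) <= prb G Pr"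
proof -
 let ?im = "%t. t ` X"
 have finT: "finite T"
  by (intro finite_subset[OF T(1) finite_PiE[OF X]] finite_subset[OF Wd G(1)])
 have mem: "t x \<in> Wd x" if "t \<in> T" "x \<in> X" for t x using T(1) that by (auto simp: PiE_def)
 have injt: "inj_on t X" if "t \<in> T" for t
  using dis mem[OF that] by (intro inj_onI) (metis disjoint_iff)
 have inj: "inj_on ?im T"
 proof (rule inj_onI)
  fix t t' assume t: "t \<in> T" "t' \<in> T" "t ` X = t' ` X"
  show "t = t'"
  proof (rule PiE_ext[of _ X Wd])
   fix x assume x: "x \<in> X"
   obtain x' where x': "x' \<in> X" "t x = t' x'" using t(3) x by (metis imageE imageI)
   have "x = x'"
   proof (rule ccontr)
    assume "x ~= x'"
    then have "Wd x \<inter> Wd x' = {}" using x x' by (intro dis)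
    then show False using mem[OF t(1) x] mem[OF t(2) x'(1)] x'(2) by auto
   qed
   then show "t x = t' x" using x' by simp
  qed (use t T in auto)
 qed
 have low: "(\<Prod>x\<in>X. 1 / u x) * exp (- 2 * hsum G) <= wt G (t ` X)" if t: "t \<in> T" for t
 proof -
  have tG: "t ` X \<subseteq> G" using mem[OF t] Wd by blast
  have "(\<Prod>x\<in>X. 1 / u x) <= (\<Prod>x\<in>X. 1 / real (t x))"
  proof (intro prod_mono conjI)
   fix x assume x: "x \<in> X"
   have "2 <= t x" using tG x G by blast
   then have "0 < real (t x)" by simp
   moreover have "real (t x) <= u x" using u[OF x mem[OF t x]] .
   ultimately show "1 / u x <= 1 / real (t x)" "0 <= 1 / u x" by (auto simp: frac_le)
  qed
  also have "... = (\<Prod>a\<in>t ` X. 1 / real a)" using injt[OF t] by (simp add: prod.reindex)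
  finally have 1: "(\<Prod>x\<in>X. 1 / u x) <= (\<Prod>a\<in>t ` X. 1 / real a)" .
  have "exp (- 2 * hsum G) = (\<Prod>a\<in>G. exp (- 2 / real a))"
   unfolding hsum_def using G by (simp add: exp_sum[symmetric] sum_distrib_left)
  also have "... <= (\<Prod>a\<in>G. 1 - 1 / real a)"
  proof (intro prod_mono conjI)
   fix a assume "a \<in> G"
   then have a: "2 <= real a" using G(2) by fastforce
   have "1 / (1 - 1 / real a) <= 1 + 2 / real a"
    using a by (simp add: field_simps)
   also have "... <= exp (2 / real a)" by (rule exp_ge_add_one_self)
   finally have "1 <= exp (2 / real a) * (1 - 1 / real a)" using a by (simp add: field_simps)
   then show "exp (- 2 / real a) <= 1 - 1 / real a" by (simp add: exp_minus field_simps)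
  qed auto
  also have "... <= (\<Prod>a\<in>G - t ` X. 1 - 1 / real a)"
  proof -
   have "(\<Prod>a\<in>G. 1 - 1 / real a) = (\<Prod>a\<in>G - t ` X. 1 - 1 / real a) * (\<Prod>a\<in>t ` X. 1 - 1 / real a)"
    using tG G by (simp add: prod.subset_diff)
   also have "... <= (\<Prod>a\<in>G - t ` X. 1 - 1 / real a) * 1"
    using G tG by (intro mult_left_mono prod_le_1 prod_nonneg) (fastforce simp: field_simps)+
   finally show ?thesis by simp
  qed
  finally have 2: "exp (- 2 * hsum G) <= (\<Prod>a\<in>G - t ` X. 1 - 1 / real a)" .
  have "wt G (t ` X) = (\<Prod>a\<in>G - t ` X. 1 - 1 / real a) * (\<Prod>a\<in>t ` X. 1 / real a)"
   unfolding wt_def using tG G by (subst prod.subset_diff[of "t ` X" G]) auto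
  moreover have "(\<Prod>x\<in>X. 1 / u x) * exp (- 2 * hsum G)
   <= (\<Prod>a\<in>t ` X. 1 / real a) * (\<Prod>a\<in>G - t ` X. 1 - 1 / real a)"
   using 1 2 by (intro mult_mono prod_nonneg) auto
  ultimately show ?thesis by (simp add: mult.commute)
 qed
 have "real (card T) * (\<Prod>x\<in>X. 1 / u x) * exp (- 2 * hsum G) <= (\<Sum>t\<in>T. wt G (t ` X))"
  using low sum_mono[of T "%_. (\<Prod>x\<in>X. 1 / u x) * exp (- 2 * hsum G)" "%t. wt G (t ` X)"] by (simp add: mult.assoc)
 also have "... = (\<Sum>B\<in>?im ` T. wt G B)" using inj by (simp add: sum.reindex)
 also have "... = (\<Sum>B\<in>?im ` T. wt G B * of_bool (Pr B))" using T(2) by (intro sum.cong) auto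
 also have "... <= (\<Sum>B\<in>Pow G. wt G B * of_bool (Pr B))"
 proof (rule sum_mono2)
  show "?im ` T \<subseteq> Pow G" using mem Wd by blast
 qed (use G in \<open>auto intro!: mult_nonneg_nonneg wt_nonneg\<close>)
 finally show ?thesis by (simp add: expect_def)
qed

text \<open>The weights \<open>(1 - \<delta>) ^ (number of good trials)\<close> turn the failure indicators
 into a supermartingale as the regions are revealed from the innermost one outwards.\<close>

lemma prb_all_trials_fail:
 fixes R :: "nat => nat set"
 assumes R: "!!m. finite (R m)" "!!m. R (Suc m) \<subseteq> R m"
  and \<delta>: "0 < \<delta>" "\<delta> < 1" and M: "0 < M"
  and good: "!!m. m < M ==> prb (R (Suc m)) (%A. \<not> good m A) <= \<eta>"
  and hit: "!!m A. m < M ==> A \<subseteq> R (Suc m) ==> good m A ==> \<delta> <= prb (R m - R (Suc m)) (%B. S (A \<union> B))"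
 shows "prb (R 0) (%A. \<forall>m<M. \<not> S (A \<inter> R m)) <= 2 * \<eta> + (1 - \<delta>) powr (real M / 2)"
proof -
 let ?w = "%m A. if good m (A \<inter> R (Suc m)) then 1 / (1 - \<delta>) else 1"
 let ?F = "%A. \<forall>m<M. \<not> S (A \<inter> R m)"
 define Z where "Z m A = (\<Prod>i\<in>{m..<M}. of_bool (\<not> S (A \<inter> R i)) * ?w i A)" for m A
 have anti: "R j \<subseteq> R i" if "i <= j" for i j
  using that R(2) by (induction j rule: dec_induct) blast+
 have Z0: "0 <= Z m A" for m A unfolding Z_def using \<delta> by (intro prod_nonneg) auto
 have EZ: "expect (R m) (Z m) <= 1" if "m <= M" for m
  using that
 proof (induction m rule: inc_induct)
  case base
  then show ?case using R(1) by (simp add: Z_def)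
 next
  case (step m)
  let ?D = "R m - R (Suc m)"
  have fin: "finite (R (Suc m))" "finite ?D" using R(1) by auto
  have "expect (R m) (Z m) = expect (R (Suc m) \<union> ?D) (Z m)"
   using R(2)[of m] by (simp add: Un_absorb1)
  also have "... = expect (R (Suc m)) (%A. expect ?D (%B. Z m (A \<union> B)))"
   using fin by (intro expect_Un) auto
  also have "... <= expect (R (Suc m)) (Z (Suc m))"
  proof (rule expect_mono)
   fix A assume A: "A \<subseteq> R (Suc m)"
   have eq: "Z m (A \<union> B) = Z (Suc m) A * ?w m A * of_bool (\<not> S (A \<union> B))" if B: "B \<subseteq> ?D" for B
   proof -
    have Ri: "(A \<union> B) \<inter> R i = A \<inter> R i" if "Suc m <= i" for i
     using anti[OF that] B by blast
    have Rm: "(A \<union> B) \<inter> R m = A \<union> B" using A B R(2)[of m] by blast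
    have "{m..<M} = insert m {Suc m..<M}" using step by auto
    then have "Z m (A \<union> B) = (of_bool (\<not> S ((A \<union> B) \<inter> R m)) * ?w m (A \<union> B)) *
      (\<Prod>i\<in>{Suc m..<M}. of_bool (\<not> S ((A \<union> B) \<inter> R i)) * ?w i (A \<union> B))"
     by (simp add: Z_def)
    also have "(\<Prod>i\<in>{Suc m..<M}. of_bool (\<not> S ((A \<union> B) \<inter> R i)) * ?w i (A \<union> B)) = Z (Suc m) A"
     unfolding Z_def by (intro prod.cong refl) (simp add: Ri)
    finally show ?thesis by (simp add: Rm Ri mult_ac)
   qed
   have AR: "A \<inter> R (Suc m) = A" using A by blast
   have "expect ?D (%B. Z m (A \<union> B)) = Z (Suc m) A * ?w m A * prb ?D (%B. \<not> S (A \<union> B))"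
    unfolding expect_cmult[symmetric] by (intro expect_cong eq)
   also have "... = Z (Suc m) A * (?w m A * (1 - prb ?D (%B. S (A \<union> B))))"
    using fin by (simp add: prb_compl)
   also have "... <= Z (Suc m) A * 1"
   proof (intro mult_left_mono Z0)
    have p0: "0 <= prb ?D (%B. S (A \<union> B))" by (intro expect_nonneg) auto
    show "?w m A * (1 - prb ?D (%B. S (A \<union> B))) <= 1"
    proof (cases "good m A")
     case True
     then show ?thesis using hit[OF step(2) A True] \<delta> by (simp add: AR field_simps)
    next
     case False
     then show ?thesis using p0 by (simp add: AR)
    qed
   qed
   finally show "expect ?D (%B. Z m (A \<union> B)) <= Z (Suc m) A" by simp
  qed
  also have "... <= 1" by (rule step.IH)
  finally show ?case .
 qed
 let ?bad = "%A. \<Sum>m<M. of_bool (\<not> good m (A \<inter> R (Suc m))) :: real"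
 let ?K = "(1 / (1 - \<delta>)) powr (real M / 2)"
 have K: "0 < ?K" using \<delta> by simp
 show ?thesis
 proof -
  \<comment> \<open>If all trials fail, either at least half of them were not good, which Markov's
    inequality controls, or at least half were good and the supermartingale has reached
    \<open>?K\<close>.\<close>
  have "prb (R 0) ?F <= prb (R 0) (%A. real M / 2 <= ?bad A \<or> ?K <= Z 0 A)"
  proof (rule prb_mono, rule ccontr)
   fix A assume F: "?F A" and n: "\<not> (real M / 2 <= ?bad A \<or> ?K <= Z 0 A)"
   let ?g = "{m. m < M & good m (A \<inter> R (Suc m))}"
   have "Z 0 A = (\<Prod>m<M. ?w m A)" unfolding Z_def using F by (intro prod.cong) auto
   also have "... = (\<Prod>m\<in>?g. 1 / (1 - \<delta>))" by (intro prod.mono_neutral_cong_right) auto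
   also have "... = (1 / (1 - \<delta>)) powr real (card ?g)" using \<delta> by (simp add: powr_realpow)
   finally have Zg: "Z 0 A = (1 / (1 - \<delta>)) powr real (card ?g)" .
   have "?bad A + real (card ?g) = real M"
   proof -
    have "real (card ?g) = (\<Sum>m<M. of_bool (good m (A \<inter> R (Suc m))))"
     by (simp add: Int_def)
    then have "?bad A + real (card ?g) = (\<Sum>m<M. of_bool (\<not> good m (A \<inter> R (Suc m))) + of_bool (good m (A \<inter> R (Suc m))))"
     by (simp only: sum.distrib)
    also have "... = (\<Sum>m<M. 1)" by (intro sum.cong) auto
    finally show ?thesis by simp
   qed
   then have "real M / 2 <= real (card ?g)" using n by linarith
   then have "?K <= Z 0 A" unfolding Zg using \<delta> by (intro powr_mono) (auto simp: field_simps)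
   then show False using n by simp
  qed
  also have "... <= prb (R 0) (%A. real M / 2 <= ?bad A) + prb (R 0) (%A. ?K <= Z 0 A)"
   by (rule prb_disj)
  also have "prb (R 0) (%A. ?K <= Z 0 A) <= (1 - \<delta>) powr (real M / 2)"
  proof -
   have "prb (R 0) (%A. ?K <= Z 0 A) <= expect (R 0) (Z 0) / ?K" using Z0 K by (intro prb_markov)
   also have "... <= 1 / ?K" using EZ[of 0] K by (intro divide_right_mono) auto
   also have "... = (1 - \<delta>) powr (real M / 2)" using \<delta> by (simp add: powr_divide)
   finally show ?thesis .
  qed
  also have "prb (R 0) (%A. real M / 2 <= ?bad A) <= 2 * \<eta>"
  proof -
   have "prb (R 0) (%A. real M / 2 <= ?bad A) <= expect (R 0) ?bad / (real M / 2)"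
    using M by (intro prb_markov sum_nonneg) auto
   also have "expect (R 0) ?bad = (\<Sum>m<M. prb (R (Suc m)) (%A. \<not> good m A))"
    unfolding expect_sum using R(1) anti[of 0] by (intro sum.cong refl expect_Int) auto
   also have "... <= (\<Sum>m<M. \<eta>)" using good by (intro sum_mono) auto
   also have "... / (real M / 2) = 2 * \<eta>" using M by simp
   finally show ?thesis using M by (simp add: divide_right_mono)
  qed
  finally show ?thesis by simp
 qed
qed

section \<open>A single trial\<close>

text \<open>Residue 1 is used because adding n such numbers changes a residue by exactly n. It is
  written \<open>1 mod q\<close> since q = 1 is possible.\<close>

lemma card_residue_interval:
 fixes \<alpha> \<beta> :: real
 assumes q: "0 < q" and \<alpha>: "0 <= \<alpha>"
 shows "(\<beta> - \<alpha>) / real q - 1 <= real (card {a::nat. \<alpha> < real a & real a <= \<beta> & a mod q = 1 mod q})"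
proof -
 let ?S = "{a::nat. \<alpha> < real a & real a <= \<beta> & a mod q = 1 mod q}"
 define m where "m = nat \<lfloor>\<alpha> / real q\<rfloor>"
 define K where "K = nat \<lfloor>(\<beta> - \<alpha>) / real q\<rfloor>"
 define r0 where "r0 = (if real (m * q + 1 mod q) > \<alpha> then m else m + 1)"
 have fin: "finite ?S" by (rule finite_subset[of _ "{..nat \<lfloor>\<beta>\<rfloor>}"]) (auto simp: le_nat_floor)
 have m1: "real m * real q <= \<alpha>" "\<alpha> < (real m + 1) * real q"
 proof -
  have "real m <= \<alpha> / real q" using \<alpha> q by (simp add: m_def)
  then show "real m * real q <= \<alpha>" using q by (simp add: field_simps)
  have "\<alpha> / real q < real m + 1" unfolding m_def by linarith
  then show "\<alpha> < (real m + 1) * real q" using q by (simp add: field_simps)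
 qed
 have modle: "1 mod q < q" using q by simp
 have r0: "\<alpha> < real (r0 * q + 1 mod q)" "real (r0 * q + 1 mod q) <= \<alpha> + real q"
 proof -
  have "real (1 mod q) <= real q - 1" using modle by linarith
  then show "\<alpha> < real (r0 * q + 1 mod q)" "real (r0 * q + 1 mod q) <= \<alpha> + real q"
   using m1 by (auto simp: r0_def algebra_simps not_less)
 qed
 have "(%i. (r0 + i) * q + 1 mod q) ` {..<K} \<subseteq> ?S"
 proof (rule image_subsetI)
  fix i assume "i \<in> {..<K}"
  then have "real i + 1 <= real K" by simp
  also have "real K <= (\<beta> - \<alpha>) / real q" if "0 < K"
   unfolding K_def using that by (simp add: K_def)
  finally have "(real i + 1) * real q <= \<beta> - \<alpha>"
   using \<open>i \<in> {..<K}\<close> q by (simp add: field_simps)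
  then have "real ((r0 + i) * q + 1 mod q) <= \<beta>" using r0(2) by (simp add: algebra_simps)
  moreover have "\<alpha> < real ((r0 + i) * q + 1 mod q)"
  proof -
   have "r0 * q + 1 mod q <= (r0 + i) * q + 1 mod q" by (simp add: algebra_simps)
   then show ?thesis using r0(1) by linarith
  qed
  moreover have "((r0 + i) * q + 1 mod q) mod q = 1 mod q" by simp
  ultimately show "(r0 + i) * q + 1 mod q \<in> ?S" by blast
 qed
 moreover have "inj_on (%i. (r0 + i) * q + 1 mod q) {..<K}" using q by (intro inj_onI) simp
 ultimately have "K <= card ?S" using card_inj_on_le[of "%i. (r0 + i) * q + 1 mod q" "{..<K}" ?S] fin by simp
 moreover have "(\<beta> - \<alpha>) / real q - 1 <= real K" unfolding K_def by linarith
 ultimately show ?thesis by linarith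
qed

lemma sum_UN_le:
 fixes f :: "'a => real"
 assumes "finite J" "!!j. j \<in> J ==> finite (B j)" "!!x. 0 <= f x"
 shows "(\<Sum>x\<in>(\<Union>j\<in>J. B j). f x) <= (\<Sum>j\<in>J. \<Sum>x\<in>B j. f x)"
 using assms(1,2)
proof (induction J rule: finite_induct)
 case (insert j J)
 have "(\<Sum>x\<in>(\<Union>j\<in>insert j J. B j). f x) <= (\<Sum>x\<in>B j. f x) + (\<Sum>x\<in>(\<Union>j\<in>J. B j). f x)"
  using insert.prems insert.hyps sum.union_inter[of "B j" "\<Union>j\<in>J. B j" f] assms(3)
  by (simp add: sum_nonneg) (smt (verit) sum_nonneg)
 then show ?case using insert by simp
qed simp

text \<open>The random set A on the main windows is fixed. Fresh elements, indexed by X, complete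
  the sum of an assignment to a solution: for every cube vector v of V r there are q elements of
  residue 1 at the lowest scale, which make the total multiplicity of v divisible by q, and for
  every basis vector f there are three elements at scale lev f, which cancel the coordinate
  \<open>co f\<close>. The integer q clears the denominators of these coordinates.\<close>

locale trial =
 fixes r :: nat and V :: "nat => (rat ^ 'k::finite) set" and c :: "nat => real" and \<mu> :: "nat => (rat ^ 'k) pmf"
  and F :: "(rat ^ 'k) set" and lev :: "rat ^ 'k => nat" and co :: "rat ^ 'k => rat ^ 'k => rat"
  and q :: nat and Rm :: real and E1 :: nat and en :: "(rat ^ 'k) \<times> nat => nat" and nf :: "rat ^ 'k => nat"
  and T :: real and Q :: "nat => nat" and Lam :: real and P :: nat and A :: "nat set" and C1 Kc :: real
 assumes sys: "system r V c \<mu>" and cs: "!!j. j \<in> {1..r} ==> c (j + 1) < c j"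
  and F: "finite F" "F \<subseteq> cube \<inter> V r" and lev: "!!f. f \<in> F ==> lev f \<in> {1..r}"
  and co_add: "!!f x y. co f (x + y) = co f x + co f y" and co_scale: "!!f t x. co f (t *s x) = t * co f x"
  and co_ones: "!!f. f \<in> F ==> co f ones = 0"
  and co_basis: "!!f f'. f \<in> F ==> f' \<in> F ==> co f f' = (if f = f' then 1 else 0)"
  and co_low: "!!f x j. f \<in> F ==> j < lev f ==> x \<in> V j ==> co f x = 0"
  and co_zero: "!!x. x \<in> V r ==> (!!f. f \<in> F ==> co f x = 0) ==> x \<in> vec.span {ones}"
  and lev_sum: "(\<Sum>f\<in>F. c (lev f)) = flag_entropy r V c \<mu>"
  and F_sep: "!!i i'. i ~= i' ==> \<exists>f\<in>F. f $ i ~= f $ i'"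
  and q: "0 < q" "!!f v. f \<in> F ==> v \<in> cube \<inter> V r ==> of_nat q * co f v \<in> \<int>"
  and Rm: "0 <= Rm" "!!f v. f \<in> F ==> v \<in> cube \<inter> V r ==> \<bar>real_of_rat (co f v)\<bar> <= Rm"
  and en: "inj_on en ((cube \<inter> V r) \<times> {..<q})" "!!x. x \<in> (cube \<inter> V r) \<times> {..<q} ==> en x < card (cube \<inter> V r) * q"
  and nf: "inj_on nf F" "!!f. f \<in> F ==> nf f < card F"
  and E1: "card (cube \<inter> V r) * q <= E1"
   "2 * (C1 + Rm * real (card (cube \<inter> V r) * q) * (3 * 10 ^ (card (cube \<inter> V r) * q))) <= 10 ^ E1"
  and C1: "C1 = Rm * T * (\<Sum>j=1..r. 1 / (1 - exp (- (T * (c j - c (j + 1))))))"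
  and Kc: "Kc = 9 * 10 ^ (E1 + card F)"
  and T: "0 < T" "T * real P <= Lam" and Q: "!!j. j \<in> {1..r} ==> real (Q j) <= T"
  and A: "A \<subseteq> (\<Union>l<r * P. win c Lam T P l)"
  and levels: "!!j j'. j \<in> {1..r} ==> j' \<in> {1..r} ==> j < j' ==> Kc * exp (c j' * Lam) <= exp (c j * Lam)"
  and big: "!!j. j \<in> {1..r} ==> 4 * real q <= exp (c j * Lam)"
  and main_sep: "!!j. A \<inter> expint (c j * Lam) (c j * Lam + ln Kc) = {} \<or> j \<notin> {1..r}"
begin

definition "I = win c Lam T P"
definition "Q' l = Q (scl P l)"
definition "gs = gset (r * P) I Q' A"
definition "el x = sorted_list_of_set (A \<inter> I (fst x)) ! snd x" for x :: "nat \<times> nat"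
definition "Mn = (SIGMA l:gs. {..<Q' l})"
definition "xs om = csum (r * P) I Q' om A" for om :: "nat => nat => rat ^ 'k"
definition "Cb = cube \<inter> V r"
definition "nn om v = (\<Sum>x\<in>{x\<in>Mn. om (fst x) (snd x) = v}. el x)" for om :: "nat => nat => rat ^ 'k" and v
definition "nu om v = (q - nn om v mod q) mod q" for om :: "nat => nat => rat ^ 'k" and v
text \<open>The second component is a label: below q it numbers the correcting elements of a cube
  vector; q and q + 1 mark the two elements that receive \<open>ones - f\<close>; q + 2 marks the
  element that receives f and is determined by all the others. Y omits the determined
  elements.\<close>

definition "X = Cb \<times> {..<q} \<union> F \<times> {q, q + 1, q + 2}"
definition "Y = Cb \<times> {..<q} \<union> F \<times> {q, q + 1}"
definition "slot x = (if snd x < q then en x else E1 + nf (fst x))"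
definition "lv x = (if snd x < q then r else lev (fst x))"
text \<open>Slots are separated by powers of 10. In the slot of f, the elements q and q + 1 lie
  between 2 and 3 and between 4 and 5 units, so the determined element, their sum up to half a unit,
  falls between 5 and 9 units and differs from both. With one element instead of two, the determined
  one would fall near it, and they could coincide.\<close>

definition "lo x = (if snd x = q + 1 then 4 else if snd x = q + 2 then 5 else 2 :: real)" for x :: "(rat ^ 'k) \<times> nat"
definition "hi x = (if snd x = q + 1 then 5 else if snd x = q + 2 then 9 else 3 :: real)" for x :: "(rat ^ 'k) \<times> nat"
definition "H j = exp (c j * Lam)"
definition "Wd x = {a::nat. lo x * 10 ^ slot x * H (lv x) < real a & real a <= hi x * 10 ^ slot x * H (lv x) &
 (snd x < q \<longrightarrow> a mod q = 1 mod q)}"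
definition "G = (\<Union>j\<in>{1..r}. expint (c j * Lam) (c j * Lam + ln Kc))"

lemma H_pos: "0 < H j" by (simp add: H_def)

lemma fl: "flag r V" using sys by (simp add: system_def)
lemma r1: "1 <= r" using sys by (simp add: system_def)
lemma sub_Vr: "vec.subspace (V r)" by (rule flag_subspace[OF fl order_refl])

lemma finite_Cb: "finite Cb" by (simp add: Cb_def)
lemma finite_X: "finite X" using finite_Cb F by (simp add: X_def)
lemma lv_range: "x \<in> X ==> lv x \<in> {1..r}"
 using r1 lev by (auto simp: X_def lv_def)

lemma slot_le: "x \<in> X ==> slot x < E1 + card F \<or> (slot x < E1)"
 using en(2) nf(2) E1(1) by (fastforce simp: X_def slot_def Cb_def)

lemma slot_less: "x \<in> X ==> slot x <= E1 + card F"
 using slot_le[of x] by auto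

lemma lo_hi: "2 <= lo x" "hi x <= 9" "lo x + 1 <= hi x" by (auto simp: lo_def hi_def)

lemma Kc_pos: "1 <= Kc"
proof -
 have "1 <= (10::real) ^ (E1 + card F)" by (rule one_le_power) simp
 then show ?thesis unfolding Kc by linarith
qed

lemma Wd_bounds:
 assumes x: "x \<in> X" and a: "a \<in> Wd x"
 shows "H (lv x) < real a" "real a <= Kc * H (lv x)"
proof -
 have "1 * H (lv x) <= lo x * 10 ^ slot x * H (lv x)"
 proof (intro mult_right_mono)
  have "1 * 1 <= lo x * 10 ^ slot x" using lo_hi(1)[of x] by (intro mult_mono one_le_power) auto
  then show "1 <= lo x * 10 ^ slot x" by simp
 qed (use H_pos in \<open>simp add: less_imp_le\<close>)
 then show "H (lv x) < real a" using a by (simp add: Wd_def)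
 have "hi x * 10 ^ slot x * H (lv x) <= Kc * H (lv x)"
  unfolding Kc using lo_hi[of x] slot_less[OF x] H_pos[of "lv x"]
  by (intro mult_right_mono mult_mono power_increasing) auto
 then show "real a <= Kc * H (lv x)" using a by (simp add: Wd_def)
qed

lemma finite_Wd: "finite (Wd x)"
 by (rule finite_subset[of _ "{..nat \<lfloor>hi x * 10 ^ slot x * H (lv x)\<rfloor>}"]) (auto simp: Wd_def le_nat_floor)

lemma Wd_sub_G: assumes x: "x \<in> X" shows "Wd x \<subseteq> G"
proof
 fix a assume a: "a \<in> Wd x"
 have "exp (c (lv x) * Lam + ln Kc) = Kc * H (lv x)" using Kc_pos by (simp add: H_def exp_add)
 then have "a \<in> expint (c (lv x) * Lam) (c (lv x) * Lam + ln Kc)"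
  using Wd_bounds[OF x a] by (simp add: expint_def H_def)
 then show "a \<in> G" using lv_range[OF x] by (auto simp: G_def)
qed

lemma Wd_disjoint:
 assumes x: "x \<in> X" "x' \<in> X" "x ~= x'" shows "Wd x \<inter> Wd x' = {}"
proof -
 have lvl: False if "y \<in> X" "y' \<in> X" "lv y < lv y'" "a \<in> Wd y" "a \<in> Wd y'" for y y' a
 proof -
  have "Kc * H (lv y') <= H (lv y)" unfolding H_def using that lv_range by (intro levels) auto
  then show False using Wd_bounds(1)[OF that(1,4)] Wd_bounds(2)[OF that(2,5)] by linarith
 qed
 have slt: False if "y \<in> X" "y' \<in> X" "lv y = lv y'" "slot y < slot y'" "a \<in> Wd y" "a \<in> Wd y'" for y y' a
 proof -
  have "hi y * 10 ^ slot y <= 10 * 10 ^ slot y" using lo_hi(2)[of y] by (intro mult_right_mono) auto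
  also have "... = 10 ^ Suc (slot y)" by simp
  also have "... <= 10 ^ slot y'" using that by (intro power_increasing) auto
  also have "... <= lo y' * 10 ^ slot y'" using lo_hi(1)[of y'] by simp
  finally have "hi y * 10 ^ slot y * H (lv y) <= lo y' * 10 ^ slot y' * H (lv y)"
   using H_pos[of "lv y"] by (intro mult_right_mono) auto
  then show False using that by (simp add: Wd_def)
 qed
 show ?thesis
 proof (rule ccontr)
  assume "Wd x \<inter> Wd x' ~= {}"
  then obtain a where a: "a \<in> Wd x" "a \<in> Wd x'" by auto
  have leq: "lv x = lv x'" using lvl[of x x' a] lvl[of x' x a] x a by (meson linorder_neqE_nat)
  have seq: "slot x = slot x'" using slt[of x x' a] slt[of x' x a] x a leq by (metis linorder_neqE_nat)
  obtain v t v' t' where xx: "x = (v, t)" "x' = (v', t')" by (cases x, cases x')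
  have cases: "(t < q & v \<in> Cb) \<or> (v \<in> F & t \<in> {q, q + 1, q + 2})" "(t' < q & v' \<in> Cb) \<or> (v' \<in> F & t' \<in> {q, q + 1, q + 2})"
   using x xx by (auto simp: X_def)
  show False
  proof (cases "t < q")
   case True
   show False
   proof (cases "t' < q")
    case t': True
    have "en x = en x'" using seq True t' xx by (simp add: slot_def)
    then have "x = x'" using en(1) True t' cases xx by (auto simp: Cb_def dest: inj_onD)
    then show False using x by simp
   next
    case False
    have "en x < E1" using en(2)[of x] E1(1) True cases xx by (auto simp: Cb_def)
    then show False using seq True False xx by (simp add: slot_def)
   qed
  next
   case False
   show False
   proof (cases "t' < q")
    case t': True
    have "en x' < E1" using en(2)[of x'] E1(1) t' cases xx by (auto simp: Cb_def)
    then show False using seq t' False xx by (simp add: slot_def)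
   next
    case t': False
    have "nf v = nf v'" using seq t' False xx by (simp add: slot_def)
    then have vv: "v = v'" using nf(1) cases False t' by (auto dest: inj_onD)
    then have tt: "t ~= t'" using x xx by auto
    let ?u = "10 ^ slot x * H (lv x)"
    have u: "0 < ?u" using H_pos by simp
    have "lo x * ?u < real a" "real a <= hi x * ?u" "lo x' * ?u < real a" "real a <= hi x' * ?u"
     using a leq seq by (auto simp: Wd_def mult.assoc)
    then have "lo x * ?u < hi x' * ?u" "lo x' * ?u < hi x * ?u" by linarith+
    then have "lo x < hi x'" "lo x' < hi x" using u by (simp_all add: mult_less_cancel_right)
    then show False using tt cases False t' xx by (auto simp: lo_def hi_def split: if_splits)
   qed
  qed
 qed
qed

lemma card_Wd: assumes x: "x \<in> X" shows "H (lv x) / (2 * real q) <= real (card (Wd x))"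
proof -
 let ?\<alpha> = "lo x * 10 ^ slot x * H (lv x)" and ?\<beta> = "hi x * 10 ^ slot x * H (lv x)"
 let ?S = "{a::nat. ?\<alpha> < real a & real a <= ?\<beta> & a mod q = 1 mod q}"
 have "?S \<subseteq> Wd x" by (auto simp: Wd_def)
 then have "real (card ?S) <= real (card (Wd x))" using finite_Wd by (intro of_nat_mono card_mono)
 moreover have "(?\<beta> - ?\<alpha>) / real q - 1 <= real (card ?S)"
  using lo_hi(1)[of x] H_pos[of "lv x"] by (intro card_residue_interval q(1)) auto
 moreover have "H (lv x) <= ?\<beta> - ?\<alpha>"
 proof -
  have "1 * 1 * H (lv x) <= (hi x - lo x) * 10 ^ slot x * H (lv x)"
   using lo_hi(3)[of x] H_pos[of "lv x"] by (intro mult_right_mono mult_mono one_le_power) auto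
  then show ?thesis by (simp add: algebra_simps)
 qed
 then have "H (lv x) / real q <= (?\<beta> - ?\<alpha>) / real q" by (rule divide_right_mono) simp
 moreover have "1 <= H (lv x) / (2 * real q)"
  using big[OF lv_range[OF x]] q(1) by (simp add: H_def field_simps)
 moreover have "H (lv x) / real q = H (lv x) / (2 * real q) + H (lv x) / (2 * real q)" by simp
 ultimately show ?thesis by linarith
qed

lemma cdec: "j \<in> {1..r} ==> c (j + 1) <= c j" using cs by (simp add: less_imp_le)

lemma I_disjoint: "l < r * P ==> l' < r * P ==> l ~= l' ==> I l \<inter> I l' = {}"
 unfolding I_def by (rule win_disjoint[of l r P l', OF _ _ _ T]) (assumption | erule cdec)+

lemma gs_less: "l \<in> gs ==> l < r * P" by (simp add: gs_def gset_def)

lemma finite_Mn: "finite Mn"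
 unfolding Mn_def gs_def gset_def by auto

lemma el_mem: assumes "x \<in> Mn" shows "el x \<in> A \<inter> I (fst x)" "fst x < r * P"
proof -
 obtain l i where x: "x = (l, i)" "l \<in> gs" "i < Q' l" using assms by (auto simp: Mn_def)
 have fin: "finite (A \<inter> I l)" by (simp add: I_def)
 have "i < length (sorted_list_of_set (A \<inter> I l))" using x by (simp add: gs_def gset_def)
 then have "sorted_list_of_set (A \<inter> I l) ! i \<in> set (sorted_list_of_set (A \<inter> I l))" by (rule nth_mem)
 then show "el x \<in> A \<inter> I (fst x)" using x fin by (simp add: el_def)
 show "fst x < r * P" using x gs_less by simp
qed

lemma inj_el: "inj_on el Mn"
proof (rule inj_onI)
 fix x y assume xy: "x \<in> Mn" "y \<in> Mn" "el x = el y"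
 have "fst x = fst y"
 proof (rule ccontr)
  assume "fst x ~= fst y"
  then have "I (fst x) \<inter> I (fst y) = {}" using el_mem(2) xy by (intro I_disjoint)
  then show False using el_mem(1)[OF xy(1)] el_mem(1)[OF xy(2)] xy(3) by auto
 qed
 moreover have "snd x = snd y"
 proof -
  let ?L = "sorted_list_of_set (A \<inter> I (fst x))"
  have "snd x < length ?L" "snd y < length ?L"
   using xy \<open>fst x = fst y\<close> by (auto simp: Mn_def gs_def gset_def)
  moreover have "?L ! snd x = ?L ! snd y" using xy(3) \<open>fst x = fst y\<close> by (simp add: el_def)
  moreover have "distinct ?L" by simp
  ultimately show ?thesis using nth_eq_iff_index_eq by blast
 qed
 ultimately show "x = y" by (simp add: prod_eq_iff)
qed

lemma xs_eq: "xs om = (\<Sum>x\<in>Mn. of_nat (el x) *s om (fst x) (snd x))"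
proof -
 have "xs om = (\<Sum>l\<in>gs. \<Sum>i<Q' l. of_nat (el (l, i)) *s om l i)"
  unfolding xs_def csum_def lsum_def gs_def el_def by simp
 also have "... = (\<Sum>x\<in>Mn. of_nat (el x) *s om (fst x) (snd x))"
  unfolding Mn_def by (subst sum.Sigma) (auto simp: gs_def gset_def case_prod_beta)
 finally show ?thesis .
qed

lemma assign_mem:
 assumes om: "om \<in> assigns r P Q \<mu>" and x: "x \<in> Mn"
 shows "om (fst x) (snd x) \<in> Cb" "om (fst x) (snd x) \<in> V (scl P (fst x))"
proof -
 have l: "fst x < r * P" "snd x < Q (scl P (fst x))" using x gs_less by (auto simp: Mn_def Q'_def)
 note m = assigns_mem[OF sys om l]
 have "V (scl P (fst x)) \<subseteq> V r" using block_decompose(1)[OF l(1)] by (intro flag_mono[OF fl]) auto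
 then show "om (fst x) (snd x) \<in> Cb" "om (fst x) (snd x) \<in> V (scl P (fst x))" using m by (auto simp: Cb_def)
qed

lemma co_sum: "co f (\<Sum>x\<in>S. t x *s v x) = (\<Sum>x\<in>S. t x * co f (v x))"
proof (induction S rule: infinite_finite_induct)
 have z: "co f 0 = 0" using co_scale[of f 0 0] by simp
 case (infinite S) then show ?case using z by simp
next
 have z: "co f 0 = 0" using co_scale[of f 0 0] by simp
 case empty then show ?case using z by simp
qed (simp add: co_add co_scale)

lemma co_diff: "co f (x - y) = co f x - co f y"
 using co_add[of f "x - y" y] by simp

text \<open>On the scales before lev f, which hold the larger elements, the vectors lie in spaces
  where \<open>co f\<close> vanishes. What remains is at most H (lev f) in size, with at most T
  vectors per window, and the upper ends of the windows decay geometrically within each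
  scale.\<close>

lemma xs_bound:
 assumes om: "om \<in> assigns r P Q \<mu>" and f: "f \<in> F"
 shows "\<bar>real_of_rat (co f (xs om))\<bar> <= C1 * H (lev f)"
proof -
 let ?h = "%l. of_bool (lev f <= scl P l) * exp (wheight c Lam T P l)"
 have Lam0: "0 <= Lam" using T by (meson mult_nonneg_nonneg of_nat_0_le_iff order_trans less_imp_le)
 have "real_of_rat (co f (xs om)) = (\<Sum>x\<in>Mn. real (el x) * real_of_rat (co f (om (fst x) (snd x))))"
  unfolding xs_eq co_sum by (simp add: of_rat_sum of_rat_mult)
 also have "\<bar>...\<bar> <= (\<Sum>x\<in>Mn. \<bar>real (el x) * real_of_rat (co f (om (fst x) (snd x)))\<bar>)" by (rule sum_abs)
 also have "... <= (\<Sum>x\<in>Mn. ?h (fst x) * Rm)"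
 proof (intro sum_mono)
  fix x assume x: "x \<in> Mn"
  note m = assign_mem[OF om x]
  show "\<bar>real (el x) * real_of_rat (co f (om (fst x) (snd x)))\<bar> <= ?h (fst x) * Rm"
  proof (cases "lev f <= scl P (fst x)")
   case True
   have "real (el x) <= exp (wheight c Lam T P (fst x))"
    using el_mem(1)[OF x] by (auto simp: I_def win_eq expint_def)
   then have "real (el x) * \<bar>real_of_rat (co f (om (fst x) (snd x)))\<bar> <= exp (wheight c Lam T P (fst x)) * Rm"
    using Rm(2)[OF f] m by (intro mult_mono) (auto simp: Cb_def)
   then show ?thesis using True by (simp add: abs_mult)
  next
   case False
   then have "co f (om (fst x) (snd x)) = 0" using m by (intro co_low[OF f, of "scl P (fst x)"]) auto
   then show ?thesis using Rm(1) by simp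
  qed
 qed
 also have "... = (\<Sum>l\<in>gs. real (Q' l) * (?h l * Rm))"
  unfolding Mn_def by (subst sum.Sigma[symmetric, where g = "%l i. ?h l * Rm", unfolded case_prod_beta]) (auto simp: gs_def gset_def)
 also have "... <= (\<Sum>l\<in>gs. T * (?h l * Rm))"
 proof (intro sum_mono mult_right_mono)
  fix l assume "l \<in> gs"
  then show "real (Q' l) <= T" unfolding Q'_def using block_decompose(1)[of l r P] gs_less by (intro Q) auto
 qed (use Rm in auto)
 also have "... <= (\<Sum>l<r * P. T * (?h l * Rm))"
  using T Rm gs_less by (intro sum_mono2) auto
 also have "... = Rm * T * (\<Sum>l<r * P. ?h l)" by (simp only: sum_distrib_left mult_ac)
 also have "... <= Rm * T * (\<Sum>j=1..r. H (lev f) * (1 / (1 - exp (- (T * (c j - c (j + 1)))))))"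
 proof (intro mult_left_mono)
  have "(\<Sum>l<r * P. ?h l) = (\<Sum>j=1..r. \<Sum>n<P. ?h ((j - 1) * P + n))" by (rule sum_blocks)
  also have "... <= (\<Sum>j=1..r. H (lev f) * (1 / (1 - exp (- (T * (c j - c (j + 1)))))))"
  proof (intro sum_mono)
   fix j assume j: "j \<in> {1..r}"
   let ?z = "exp (- (T * (c j - c (j + 1))))"
   have z: "0 < ?z" "?z < 1" using T cs[OF j] by auto
   have "(\<Sum>n<P. ?h ((j - 1) * P + n)) <= (\<Sum>n<P. H (lev f) * ?z ^ n)"
   proof (intro sum_mono)
    fix n assume "n \<in> {..<P}"
    then have n: "n < P" by simp
    have s: "scl P ((j - 1) * P + n) = j" by (rule scl_block[OF j n])
    have md: "((j - 1) * P + n) mod P = n" using n by simp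
    have ex: "exp (wheight c Lam T P ((j - 1) * P + n)) = H j * ?z ^ n"
     unfolding wheight_def s md H_def exp_of_nat_mult[symmetric] exp_add[symmetric] by (simp add: algebra_simps)
    show "?h ((j - 1) * P + n) <= H (lev f) * ?z ^ n"
    proof (cases "lev f <= j")
     case True
     have "c j <= c (lev f)"
      by (rule c_antimono[of r], rule cdec, assumption) (use lev[OF f] True j in auto)
     then have "H j <= H (lev f)" unfolding H_def using Lam0 by (simp add: mult_right_mono)
     then have "H j * ?z ^ n <= H (lev f) * ?z ^ n" by (intro mult_right_mono) auto
     then show ?thesis using ex s True by simp
    next
     case False
     have "0 <= H (lev f) * ?z ^ n" using H_pos[of "lev f"] by (intro mult_nonneg_nonneg) auto
     then show ?thesis using False s by simp
    qed
   qed
   also have "... = H (lev f) * (\<Sum>n<P. ?z ^ n)" by (rule sum_distrib_left[symmetric])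
   also have "... <= H (lev f) * (1 / (1 - ?z))"
   proof (intro mult_left_mono)
    have "(\<Sum>n<P. ?z ^ n) = (1 - ?z ^ P) / (1 - ?z)" using z by (subst sum_gp_strict) auto
    also have "... <= 1 / (1 - ?z)" using z by (intro divide_right_mono) auto
    finally show "(\<Sum>n<P. ?z ^ n) <= 1 / (1 - ?z)" .
   qed (use H_pos[of "lev f"] in simp)
   finally show "(\<Sum>n<P. ?h ((j - 1) * P + n)) <= H (lev f) * (1 / (1 - ?z))" .
  qed
  finally show "(\<Sum>l<r * P. ?h l) <= (\<Sum>j=1..r. H (lev f) * (1 / (1 - exp (- (T * (c j - c (j + 1)))))))" .
 qed (use Rm T in auto)
 also have "... = C1 * H (lev f)" unfolding C1 by (simp only: sum_distrib_left mult_ac)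
 finally show ?thesis .
qed

definition "S = Pi\<^sub>E Y Wd"
definition "adj s om = (\<Sum>v\<in>Cb. (\<Sum>t<nu om v. of_nat (s (v, t))) *s v)" for s :: "(rat ^ 'k) \<times> nat => nat" and om :: "nat => nat => rat ^ 'k"
text \<open>The value that the element labelled q + 2 must have for the coordinate
  \<open>co f\<close> of the total to vanish: \<open>ones - f\<close> has coordinate -1 and f has
  coordinate 1.\<close>

definition "bv s om f = of_nat (s (f, q) + s (f, q + 1)) - co f (xs om) - co f (adj s om)" for s :: "(rat ^ 'k) \<times> nat => nat" and om :: "nat => nat => rat ^ 'k"

lemma Y_sub: "Y \<subseteq> X" by (auto simp: X_def Y_def)

lemma nu_less: "nu om v < q" using q by (simp add: nu_def)

lemma S_mem: "s \<in> S ==> y \<in> Y ==> s y \<in> Wd y" by (auto simp: S_def)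

lemma adj_bound:
 assumes s: "s \<in> S" and f: "f \<in> F"
 shows "\<bar>real_of_rat (co f (adj s om))\<bar> <= Rm * real (card Cb * q) * (3 * 10 ^ (card Cb * q)) * H (lev f)"
proof -
 let ?W = "3 * 10 ^ (card Cb * q) * H (lev f)"
 have Lam0: "0 <= Lam" using T by (meson mult_nonneg_nonneg of_nat_0_le_iff order_trans less_imp_le)
 have "real_of_rat (co f (adj s om)) = (\<Sum>v\<in>Cb. (\<Sum>t<nu om v. real (s (v, t))) * real_of_rat (co f v))"
  unfolding adj_def co_sum by (simp add: of_rat_sum of_rat_mult)
 also have "\<bar>...\<bar> <= (\<Sum>v\<in>Cb. \<bar>(\<Sum>t<nu om v. real (s (v, t))) * real_of_rat (co f v)\<bar>)" by (rule sum_abs)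
 also have "... <= (\<Sum>v\<in>Cb. (real q * ?W) * Rm)"
 proof (intro sum_mono)
  fix v assume v: "v \<in> Cb"
  have "real (s (v, t)) <= ?W" if t: "t < q" for t
  proof -
   have y: "(v, t) \<in> Y" using v t by (simp add: Y_def)
   have "slot (v, t) <= card Cb * q" using en(2)[of "(v, t)"] v t by (auto simp: slot_def Cb_def)
   then have p: "(10::real) ^ slot (v, t) <= 10 ^ (card Cb * q)" by (intro power_increasing) auto
   have "c r <= c (lev f)" by (rule c_antimono[of r], rule cdec, assumption) (use lev[OF f] in auto)
   then have h: "H r <= H (lev f)" unfolding H_def using Lam0 by (simp add: mult_right_mono)
   have "real (s (v, t)) <= 3 * 10 ^ slot (v, t) * H r"
    using S_mem[OF s y] t by (auto simp: Wd_def lv_def hi_def)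
   also have "... <= ?W" using p h H_pos[of r] by (intro mult_mono) auto
   finally show ?thesis .
  qed
  then have "(\<Sum>t<nu om v. real (s (v, t))) <= (\<Sum>t<nu om v. ?W)"
   using nu_less[of om v] by (intro sum_mono) auto
  also have "... <= real q * ?W" using nu_less[of om v] H_pos[of "lev f"] by (simp add: mult_right_mono)
  finally have "(\<Sum>t<nu om v. real (s (v, t))) <= real q * ?W" .
  moreover have "\<bar>real_of_rat (co f v)\<bar> <= Rm" using Rm(2)[OF f] v by (simp add: Cb_def)
  ultimately have "(\<Sum>t<nu om v. real (s (v, t))) * \<bar>real_of_rat (co f v)\<bar> <= (real q * ?W) * Rm"
   using Rm H_pos[of "lev f"] by (intro mult_mono sum_nonneg) auto
  moreover have "\<bar>\<Sum>t<nu om v. real (s (v, t))\<bar> = (\<Sum>t<nu om v. real (s (v, t)))"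
   by (intro abs_of_nonneg sum_nonneg) simp
  ultimately show "\<bar>(\<Sum>t<nu om v. real (s (v, t))) * real_of_rat (co f v)\<bar> <= (real q * ?W) * Rm"
   by (simp only: abs_mult)
 qed
 also have "... = Rm * real (card Cb * q) * (3 * 10 ^ (card Cb * q)) * H (lev f)" by (simp add: mult_ac)
 finally show ?thesis .
qed

lemma xs_group:
 assumes om: "om \<in> assigns r P Q \<mu>"
 shows "xs om = (\<Sum>v\<in>Cb. of_nat (nn om v) *s v)"
proof -
 have "xs om = (\<Sum>v\<in>Cb. \<Sum>x\<in>{x\<in>Mn. om (fst x) (snd x) = v}. of_nat (el x) *s om (fst x) (snd x))"
  unfolding xs_eq using assign_mem[OF om] finite_Mn finite_Cb by (intro sum.group[symmetric]) auto
 also have "... = (\<Sum>v\<in>Cb. of_nat (nn om v) *s v)"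
  unfolding nn_def of_nat_sum vec.scale_sum_left by (intro sum.cong refl) auto
 finally show ?thesis .
qed

text \<open>The multiplicity \<open>nn om v\<close> is completed by \<open>nu om v\<close> elements
  of residue 1 to a multiple of q, and q times \<open>co f v\<close> is an integer.\<close>

lemma bv_int:
 assumes om: "om \<in> assigns r P Q \<mu>" and s: "s \<in> S" and f: "f \<in> F"
 shows "bv s om f \<in> \<int>"
proof -
 let ?m = "%v. nn om v + (\<Sum>t<nu om v. s (v, t))"
 have "q dvd ?m v" if v: "v \<in> Cb" for v
 proof -
  have res: "s (v, t) mod q = 1 mod q" if "t < nu om v" for t
  proof -
   have t: "t < q" using that nu_less[of om v] by simp
   then have "s (v, t) \<in> Wd (v, t)" using v by (intro S_mem[OF s]) (simp add: Y_def)
   then show ?thesis using t by (simp add: Wd_def)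
  qed
  have "(\<Sum>t<nu om v. s (v, t) mod q) = (\<Sum>t<nu om v. 1 mod q)"
   by (rule sum.cong[OF refl], rule res) (simp only: lessThan_iff)
  then have "(\<Sum>t<nu om v. s (v, t) mod q) mod q = (\<Sum>t<nu om v. 1 mod q) mod q"
   by (rule arg_cong)
  then have "(\<Sum>t<nu om v. s (v, t)) mod q = (\<Sum>t<nu om v. 1) mod q"
   unfolding mod_sum_eq .
  then have *: "(\<Sum>t<nu om v. s (v, t)) mod q = nu om v mod q" by (simp only: sum_constant card_lessThan mult_1_right of_nat_id)
  have "?m v mod q = (nn om v + nu om v) mod q"
   using mod_add_cong[OF refl *] .
  also have "... = (nn om v mod q + (q - nn om v mod q)) mod q"
   unfolding nu_def by (simp add: mod_simps)
  also have "... = 0" using q(1) by (simp add: less_imp_le)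
  finally show ?thesis by (simp add: dvd_eq_mod_eq_0)
 qed
 then have int: "of_nat (?m v) * co f v \<in> \<int>" if v: "v \<in> Cb" for v
 proof -
  obtain k where k: "?m v = q * k" using \<open>!!v. v \<in> Cb ==> q dvd ?m v\<close>[OF v] by (auto elim: dvdE)
  have "of_nat (?m v) * co f v = of_nat k * (of_nat q * co f v)" unfolding k by simp
  moreover have "of_nat q * co f v \<in> \<int>" using q(2)[OF f] v by (simp add: Cb_def)
  ultimately show ?thesis by (simp only: Ints_mult Ints_of_nat)
 qed
 have "co f (xs om) + co f (adj s om) = (\<Sum>v\<in>Cb. of_nat (?m v) * co f v)"
  unfolding xs_group[OF om] adj_def co_sum by (simp add: algebra_simps sum.distrib)
 also have "... \<in> \<int>" using int by (intro Ints_sum)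
 finally have "co f (xs om) + co f (adj s om) \<in> \<int>" .
 moreover have "bv s om f = of_nat (s (f, q) + s (f, q + 1)) - (co f (xs om) + co f (adj s om))"
  by (simp add: bv_def)
 ultimately show ?thesis by (simp only: Ints_diff Ints_of_nat)
qed

definition "bn s om f = nat \<lfloor>bv s om f\<rfloor>" for s :: "(rat ^ 'k) \<times> nat => nat" and om :: "nat => nat => rat ^ 'k"

lemma bn:
 assumes om: "om \<in> assigns r P Q \<mu>" and s: "s \<in> S" and f: "f \<in> F"
 shows "of_nat (bn s om f) = bv s om f" "bn s om f \<in> Wd (f, q + 2)"
proof -
 let ?u = "10 ^ (E1 + nf f) * H (lev f)"
 have sl: "slot (f, q) = E1 + nf f" "slot (f, q + 1) = E1 + nf f" "slot (f, q + 2) = E1 + nf f"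
  "lv (f, q) = lev f" "lv (f, q + 1) = lev f" "lv (f, q + 2) = lev f" by (auto simp: slot_def lv_def)
 have y: "2 * ?u < real (s (f, q))" "real (s (f, q)) <= 3 * ?u"
  "4 * ?u < real (s (f, q + 1))" "real (s (f, q + 1)) <= 5 * ?u"
 proof -
  have "s (f, q) \<in> Wd (f, q)" "s (f, q + 1) \<in> Wd (f, q + 1)"
   using f by (auto intro!: S_mem[OF s] simp: Y_def)
  then show "2 * ?u < real (s (f, q))" "real (s (f, q)) <= 3 * ?u"
   "4 * ?u < real (s (f, q + 1))" "real (s (f, q + 1)) <= 5 * ?u"
   unfolding Wd_def sl by (auto simp: lo_def hi_def mult.assoc)
 qed
 \<comment> \<open>E1 was chosen so that one unit of the slot is at least twice the bound for the
   main part and the residue corrections together.\<close>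
 have small: "\<bar>real_of_rat (co f (xs om))\<bar> + \<bar>real_of_rat (co f (adj s om))\<bar> <= ?u / 2"
 proof -
  let ?C2 = "Rm * real (card Cb * q) * (3 * 10 ^ (card Cb * q))"
  have "\<bar>real_of_rat (co f (xs om))\<bar> + \<bar>real_of_rat (co f (adj s om))\<bar> <= (C1 + ?C2) * H (lev f)"
   using xs_bound[OF om f] adj_bound[OF s f, of om] by (simp add: algebra_simps)
  also have "... <= (10 ^ (E1 + nf f) / 2) * H (lev f)"
  proof (intro mult_right_mono)
   have "2 * (C1 + ?C2) <= 10 ^ E1" using E1(2) by (simp add: Cb_def)
   also have "... <= 10 ^ (E1 + nf f)" by (intro power_increasing) auto
   finally show "C1 + ?C2 <= 10 ^ (E1 + nf f) / 2" by simp
  qed (use H_pos[of "lev f"] in simp)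
  finally show ?thesis by simp
 qed
 have eq: "real_of_rat (bv s om f) = real (s (f, q)) + real (s (f, q + 1)) - real_of_rat (co f (xs om)) - real_of_rat (co f (adj s om))"
  by (simp add: bv_def of_rat_diff of_rat_add)
 have rng: "5 * ?u < real_of_rat (bv s om f)" "real_of_rat (bv s om f) <= 9 * ?u"
  unfolding eq using y small by linarith+
 have u0: "0 < ?u" using H_pos[of "lev f"] by simp
 have pos: "0 < bv s om f" using rng(1) u0 by (metis (no_types, opaque_lifting) less_trans mult_pos_pos zero_less_numeral zero_less_of_rat_iff)
 obtain k where k: "bv s om f = of_int k" using bv_int[OF om s f] by (auto elim: Ints_cases)
 then have "0 < k" using pos by simp
 then show e: "of_nat (bn s om f) = bv s om f" unfolding bn_def k by simp
 have "real (bn s om f) = real_of_rat (bv s om f)" unfolding e[symmetric] by simp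
 then show "bn s om f \<in> Wd (f, q + 2)"
  using rng unfolding Wd_def sl by (simp add: lo_def hi_def mult.assoc)
qed

definition "tt s om = restrict (%x. if snd x = q + 2 then bn s om (fst x) else s x) X" for s :: "(rat ^ 'k) \<times> nat => nat" and om :: "nat => nat => rat ^ 'k"

lemma X_Y: "x \<in> X ==> snd x ~= q + 2 ==> x \<in> Y" "f \<in> F ==> (f, q + 2) \<in> X" "x \<in> Y ==> snd x ~= q + 2"
 "x \<in> X ==> snd x = q + 2 ==> fst x \<in> F"
 by (auto simp: X_def Y_def)

lemma tt_mem:
 assumes om: "om \<in> assigns r P Q \<mu>" and s: "s \<in> S"
 shows "tt s om \<in> Pi\<^sub>E X Wd"
 unfolding tt_def
proof (rule restrict_PiE_iff[THEN iffD2], rule ballI)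
 fix x assume x: "x \<in> X"
 show "(if snd x = q + 2 then bn s om (fst x) else s x) \<in> Wd x"
 proof (cases "snd x = q + 2")
  case True
  then have "bn s om (fst x) \<in> Wd (fst x, q + 2)" using x X_Y(4) by (intro bn[OF om s]) auto
  then show ?thesis using True by (metis prod.collapse)
 next
  case False
  then show ?thesis using S_mem[OF s] X_Y(1)[OF x] by auto
 qed
qed

text \<open>Surplus correcting elements receive the zero vector: they belong to none of the k
  sets.\<close>

definition "vecs om y = (if snd y < q then (if snd y < nu om (fst y) then fst y else 0) else if snd y = q + 2 then fst y else ones - fst y)"
 for om :: "nat => nat => rat ^ 'k" and y :: "(rat ^ 'k) \<times> nat"

lemma vecs_cube: "y \<in> X ==> vecs om y \<in> cube"
proof -
 assume y: "y \<in> X"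
 have "fst y \<in> cube" using y F by (auto simp: X_def Cb_def)
 moreover have "(0 :: rat ^ 'k) \<in> cube" by (simp add: cube_def)
 ultimately show ?thesis by (simp add: vecs_def ones_minus_in_cube)
qed

lemma extra_sum:
 "(\<Sum>y\<in>X. of_nat (tt s om y) *s vecs om y)
  = adj s om + (\<Sum>f\<in>F. of_nat (s (f, q) + s (f, q + 1)) *s (ones - f)) + (\<Sum>f\<in>F. of_nat (bn s om f) *s f)"
proof -
 let ?g = "%y. of_nat (tt s om y) *s vecs om y"
 have "(\<Sum>y\<in>X. ?g y) = (\<Sum>y\<in>Cb \<times> {..<q}. ?g y) + (\<Sum>y\<in>F \<times> {q, q + 1, q + 2}. ?g y)"
  unfolding X_def using finite_Cb F by (intro sum.union_disjoint) auto
 also have "(\<Sum>y\<in>Cb \<times> {..<q}. ?g y) = (\<Sum>v\<in>Cb. \<Sum>t<q. ?g (v, t))"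
  by (simp add: sum.cartesian_product case_prod_beta)
 also have "... = adj s om"
  unfolding adj_def
 proof (intro sum.cong refl)
  fix v assume v: "v \<in> Cb"
  have "(\<Sum>t<q. ?g (v, t)) = (\<Sum>t<nu om v. of_nat (s (v, t)) *s v)"
  proof (rule sum.mono_neutral_cong_right)
   show "{..<nu om v} \<subseteq> {..<q}" using nu_less[of om v] by auto
   show "\<forall>t\<in>{..<q} - {..<nu om v}. ?g (v, t) = 0" by (auto simp: vecs_def)
   show "?g (v, t) = of_nat (s (v, t)) *s v" if "t \<in> {..<nu om v}" for t
    using that v nu_less[of om v] by (auto simp: vecs_def tt_def X_def)
  qed simp
  then show "(\<Sum>t<q. ?g (v, t)) = (\<Sum>t<nu om v. of_nat (s (v, t))) *s v" by (simp add: vec.scale_sum_left)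
 qed
 also have "(\<Sum>y\<in>F \<times> {q, q + 1, q + 2}. ?g y) = (\<Sum>f\<in>F. \<Sum>t\<in>{q, q + 1, q + 2}. ?g (f, t))"
  by (subst sum.cartesian_product, rule sum.cong[OF refl]) (simp only: case_prod_beta prod.collapse)
 also have "... = (\<Sum>f\<in>F. of_nat (s (f, q) + s (f, q + 1)) *s (ones - f) + of_nat (bn s om f) *s f)"
 proof (intro sum.cong refl)
  fix f assume f: "f \<in> F"
  have m: "(f, q) \<in> X" "(f, q + 1) \<in> X" "(f, q + 2) \<in> X" using f by (auto simp: X_def)
  have g: "?g (f, q) = of_nat (s (f, q)) *s (ones - f)" "?g (f, q + 1) = of_nat (s (f, q + 1)) *s (ones - f)"
   "?g (f, q + 2) = of_nat (bn s om f) *s f"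
   using m by (simp_all add: tt_def vecs_def)
  have "(\<Sum>t\<in>{q, q + 1, q + 2}. ?g (f, t)) = ?g (f, q) + (?g (f, q + 1) + ?g (f, q + 2))" by simp
  then show "(\<Sum>t\<in>{q, q + 1, q + 2}. ?g (f, t)) = of_nat (s (f, q) + s (f, q + 1)) *s (ones - f) + of_nat (bn s om f) *s f"
   unfolding g by (simp add: vec.scale_left_distrib)
 qed
 finally show ?thesis by (simp add: sum.distrib add.assoc)
qed

text \<open>The total lies in V r and all its coordinates \<open>co f\<close> vanish, so it is on
  the line of \<open>ones\<close>. Separation of coordinates does not depend on om: every basis
  vector f is itself used, by the element labelled q + 2.\<close>

lemma trial_success:
 assumes om: "om \<in> assigns r P Q \<mu>" and s: "s \<in> S"
 shows "has_equal_sums CARD('k) (A \<union> tt s om ` X)"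
proof -
 let ?t = "tt s om"
 let ?J = "Mn <+> X"
 let ?el = "case_sum el ?t" and ?w = "case_sum (%x. om (fst x) (snd x)) (vecs om)"
 have tW: "?t y \<in> Wd y" if "y \<in> X" for y using tt_mem[OF om s] that by (auto simp: PiE_def)
 let ?tot = "\<Sum>j\<in>?J. of_nat (?el j) *s ?w j"
 have tot: "?tot = xs om + (adj s om + (\<Sum>f\<in>F. of_nat (s (f, q) + s (f, q + 1)) *s (ones - f)) + (\<Sum>f\<in>F. of_nat (bn s om f) *s f))"
  unfolding extra_sum[symmetric] xs_eq using finite_Mn finite_X by (simp add: sum.Plus)
 have onesV: "ones \<in> V r" by (rule flag_ones[OF fl order_refl])
 have "?tot \<in> V r"
  unfolding tot xs_group[OF om] adj_def
  by (intro vec.subspace_add[OF sub_Vr] vec.subspace_sum[OF sub_Vr] vec.subspace_scale[OF sub_Vr] vec.subspace_diff[OF sub_Vr])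
    (use F onesV in \<open>auto simp: Cb_def\<close>)
 moreover have "co f ?tot = 0" if f: "f \<in> F" for f
 proof -
  have 1: "co f (\<Sum>f'\<in>F. of_nat (s (f', q) + s (f', q + 1)) *s (ones - f')) = - of_nat (s (f, q) + s (f, q + 1))"
  proof -
   have "co f (\<Sum>f'\<in>F. of_nat (s (f', q) + s (f', q + 1)) *s (ones - f'))
    = (\<Sum>f'\<in>F. of_nat (s (f', q) + s (f', q + 1)) * (if f = f' then - 1 else 0))"
    unfolding co_sum using co_ones[OF f] co_basis[OF f] by (intro sum.cong refl) (simp add: co_diff)
   also have "... = (\<Sum>f'\<in>F. if f = f' then - of_nat (s (f', q) + s (f', q + 1)) else 0)"
    by (intro sum.cong refl) simp
   also have "... = - of_nat (s (f, q) + s (f, q + 1))" using f F(1) by simp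
   finally show ?thesis .
  qed
  have 2: "co f (\<Sum>f'\<in>F. of_nat (bn s om f') *s f') = of_nat (bn s om f)"
  proof -
   have "co f (\<Sum>f'\<in>F. of_nat (bn s om f') *s f') = (\<Sum>f'\<in>F. if f = f' then of_nat (bn s om f') else 0)"
    unfolding co_sum using co_basis[OF f] by (intro sum.cong refl) simp
   also have "... = of_nat (bn s om f)" using f F(1) by simp
   finally show ?thesis .
  qed
  show ?thesis unfolding tot co_add 1 2 bn(1)[OF om s f] by (simp add: bv_def)
 qed
 ultimately have bal: "?tot \<in> vec.span {ones}" by (rule co_zero)
 show ?thesis
 proof (rule has_equal_sums_indexedI[OF _ _ _ _ bal])
  show "finite ?J" using finite_Mn finite_X by simp
  have notG: "el x \<notin> Wd y" if "x \<in> Mn" "y \<in> X" for x y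
  proof
   assume h: "el x \<in> Wd y"
   then have "el x \<in> G" using Wd_sub_G[OF that(2)] by auto
   then obtain j where "j \<in> {1..r}" "el x \<in> expint (c j * Lam) (c j * Lam + ln Kc)" by (auto simp: G_def)
   then show False using main_sep[of j] el_mem(1)[OF that(1)] by auto
  qed
  show "inj_on ?el ?J"
  proof (rule inj_onI)
   fix i j assume ij: "i \<in> ?J" "j \<in> ?J" "?el i = ?el j"
   show "i = j"
   proof (cases i)
    case (Inl x)
    show ?thesis
    proof (cases j)
     case (Inl y)
     then show ?thesis using \<open>i = Inl x\<close> ij inj_el by (auto dest: inj_onD)
    next
     case (Inr y)
     then show ?thesis using \<open>i = Inl x\<close> ij notG[of x y] tW[of y] by auto
    qed
   next
    case (Inr x)
    show ?thesis
    proof (cases j)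
     case (Inl y)
     then show ?thesis using \<open>i = Inr x\<close> ij notG[of y x] tW[of x] by auto
    next
     case j: (Inr y)
     have xy: "x \<in> X" "y \<in> X" "?t x = ?t y" using \<open>i = Inr x\<close> j ij by auto
     have "x = y"
     proof (rule ccontr)
      assume "x ~= y"
      then have "Wd x \<inter> Wd y = {}" using xy by (intro Wd_disjoint)
      then show False using tW[OF xy(1)] tW[OF xy(2)] xy(3) by auto
     qed
     then show ?thesis using \<open>i = Inr x\<close> j by simp
    qed
   qed
  qed
  show "?el ` ?J \<subseteq> A \<union> ?t ` X" using el_mem(1) by auto
  show "?w j \<in> cube" if "j \<in> ?J" for j
   using that assign_mem(1)[OF om] vecs_cube by (auto simp: Cb_def)
  show "\<exists>j\<in>?J. ?w j $ i ~= ?w j $ i'" if ne: "i ~= i'" for i i'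
  proof -
   obtain f where f: "f \<in> F" "f $ i ~= f $ i'" using F_sep[OF ne] by auto
   have mem: "Inr (f, q + 2) \<in> ?J" using X_Y(2)[OF f(1)] by auto
   have e: "?w (Inr (f, q + 2)) = f" by (simp add: vecs_def)
   show ?thesis
    by (rule bexI[OF _ mem]) (unfold e, rule f(2))
  qed
 qed
qed

lemma finite_S: "finite S"
 unfolding S_def using finite_subset[OF Y_sub finite_X] finite_Wd by (intro finite_PiE)

text \<open>The tuple tt shows s directly. Together with the residues nu it also determines the
  coordinates of xs om, and hence om, because the chosen sums are distinct modulo
  \<open>ones\<close>. Forgetting the residues costs the factor q ^ card Cb.\<close>

lemma count_configurations:
 assumes Om0: "Om0 \<subseteq> assigns r P Q \<mu>"
  and dist: "!!om om'. om \<in> Om0 ==> om' \<in> Om0 ==> xs om' - xs om \<in> vec.span {ones} ==> om = om'"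
 shows "card S * card Om0 <= card ((%(s, om). tt s om) ` (S \<times> Om0)) * q ^ card Cb"
proof -
 let ?T = "(%(s, om). tt s om) ` (S \<times> Om0)"
 let ?N = "Pi\<^sub>E Cb (%_. {..<q})"
 let ?\<phi> = "%(s, om). (tt s om, restrict (nu om) Cb)"
 have finOm: "finite Om0" using Om0 finite_assigns[OF sys] by (rule finite_subset)
 have xsV: "xs om \<in> V r" if "om \<in> Om0" for om
 proof -
  have "om \<in> assigns r P Q \<mu>" using that Om0 by blast
  then show ?thesis unfolding xs_group[OF \<open>om \<in> assigns r P Q \<mu>\<close>]
   by (intro vec.subspace_sum[OF sub_Vr] vec.subspace_scale[OF sub_Vr]) (auto simp: Cb_def)
 qed
 have "inj_on ?\<phi> (S \<times> Om0)"
 proof (rule inj_onI)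
  fix a b assume ab: "a \<in> S \<times> Om0" "b \<in> S \<times> Om0" "?\<phi> a = ?\<phi> b"
  obtain s om s' om' where a: "a = (s, om)" "b = (s', om')" by (cases a, cases b)
  have m: "s \<in> S" "s' \<in> S" "om \<in> Om0" "om' \<in> Om0" using ab a by auto
  have ma: "om \<in> assigns r P Q \<mu>" "om' \<in> assigns r P Q \<mu>" using m Om0 by auto
  have tt: "tt s om = tt s' om'" and nueq: "restrict (nu om) Cb = restrict (nu om') Cb" using ab a by auto
  have ss: "s = s'"
  proof (rule PiE_ext[of _ Y Wd])
   show "s \<in> Pi\<^sub>E Y Wd" "s' \<in> Pi\<^sub>E Y Wd" using m by (auto simp: S_def)
   fix y assume y: "y \<in> Y"
   have "tt s om y = s y" "tt s' om' y = s' y" using y Y_sub X_Y(3)[OF y] by (auto simp: tt_def)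
   then show "s y = s' y" using tt by metis
  qed
  have nu: "nu om v = nu om' v" if "v \<in> Cb" for v using fun_cong[OF nueq, of v] that by simp
  have adj: "adj s om = adj s om'" unfolding adj_def using nu by (intro sum.cong refl) auto
  have co0: "co f (xs om' - xs om) = 0" if f: "f \<in> F" for f
  proof -
   have "tt s om (f, q + 2) = bn s om f" "tt s' om' (f, q + 2) = bn s' om' f"
    using X_Y(2)[OF f] by (auto simp: tt_def)
   then have "bn s om f = bn s om' f" using tt ss by metis
   then have "bv s om f = bv s om' f" using bn(1)[OF ma(1) m(1) f] bn(1)[OF ma(2) m(1) f] by metis
   then show ?thesis by (simp add: bv_def adj co_diff)
  qed
  have "xs om' - xs om \<in> V r" using xsV m by (intro vec.subspace_diff[OF sub_Vr])
  then have "xs om' - xs om \<in> vec.span {ones}" using co0 by (rule co_zero)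
  then have "om = om'" using dist m by blast
  then show "a = b" using a ss by simp
 qed
 moreover have "?\<phi> ` (S \<times> Om0) \<subseteq> ?T \<times> ?N" using nu_less by auto
 moreover have "finite (?T \<times> ?N)" using finite_S finOm finite_Cb by (auto intro!: finite_PiE)
 ultimately have "card (S \<times> Om0) <= card (?T \<times> ?N)" by (rule card_inj_on_le)
 then show ?thesis using finite_Cb by (simp add: card_cartesian_product card_PiE)
qed

text \<open>The degrees of freedom balance. Every determined element would cost a factor of order H
  (lev f), and the product of these is exp (Lam * e), e being the entropy of the full flag; the set
  Om0 supplies that many assignments up to \<delta>. Only constants remain.\<close>

lemma prb_trial:
 assumes dense: "dense_sums r V c \<mu> Q Lam T P \<delta> A"
 shows "\<delta> * (1 / (2 * real q)) ^ card Y / real q ^ card Cb * (1 / Kc) ^ card X * exp (- 2 * (real r * (ln Kc + 1)))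
  <= prb G (%B. has_equal_sums CARD('k) (A \<union> B))"
proof -
 obtain Om0 where Om0: "Om0 \<subseteq> assigns r P Q \<mu>"
  and dist: "!!om om'. om \<in> Om0 ==> om' \<in> Om0 ==> xs om' - xs om \<in> vec.span {ones} ==> om = om'"
  and cardOm: "\<delta> * exp (Lam * flag_entropy r V c \<mu>) <= real (card Om0)"
  using dense unfolding dense_sums_def xs_def I_def Q'_def[abs_def] by blast
 let ?T = "(%(s, om). tt s om) ` (S \<times> Om0)"
 let ?HY = "\<Prod>y\<in>Y. H (lv y)" and ?HF = "\<Prod>f\<in>F. H (lev f)"
 have finY: "finite Y" by (rule finite_subset[OF Y_sub finite_X])
 have HF: "?HF = exp (Lam * flag_entropy r V c \<mu>)"
  unfolding lev_sum[symmetric] H_def using F by (simp add: exp_sum[symmetric] sum_distrib_left mult.commute)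
 have HX: "(\<Prod>x\<in>X. H (lv x)) = ?HY * ?HF"
 proof -
  have "X = Y \<union> (%f. (f, q + 2)) ` F" "Y \<inter> (%f. (f, q + 2)) ` F = {}" by (auto simp: X_def Y_def)
  then have "(\<Prod>x\<in>X. H (lv x)) = ?HY * (\<Prod>x\<in>(%f. (f, q + 2)) ` F. H (lv x))"
   using finY F by (simp add: prod.union_disjoint)
  also have "(\<Prod>x\<in>(%f. (f, q + 2)) ` F. H (lv x)) = ?HF"
   by (subst prod.reindex) (auto intro!: inj_onI prod.cong simp: lv_def)
  finally show ?thesis .
 qed
 have pos: "0 < ?HY" "0 < ?HF" using H_pos by (auto intro: prod_pos)
 have cardS: "(1 / (2 * real q)) ^ card Y * ?HY <= real (card S)"
 proof -
  have "(1 / (2 * real q)) ^ card Y * ?HY = (\<Prod>y\<in>Y. H (lv y) / (2 * real q))"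
   by (simp add: prod_dividef power_one_over field_simps)
  also have "... <= (\<Prod>y\<in>Y. real (card (Wd y)))"
  proof (intro prod_mono conjI)
   fix y assume y: "y \<in> Y"
   show "0 <= H (lv y) / (2 * real q)" using less_imp_le[OF H_pos[of "lv y"]] by simp
   show "H (lv y) / (2 * real q) <= real (card (Wd y))" using y Y_sub by (intro card_Wd) auto
  qed
  also have "... = real (card S)" unfolding S_def using finY by (simp add: card_PiE)
  finally show ?thesis .
 qed
 have q0: "0 < real q ^ card Cb" using q(1) by simp
 have low: "\<delta> * (1 / (2 * real q)) ^ card Y / real q ^ card Cb * (?HY * ?HF) <= real (card ?T)"
 proof -
  have "real (card S * card Om0) <= real (card ?T * q ^ card Cb)"
   by (intro of_nat_mono count_configurations[OF Om0 dist])
  then have "real (card S) * real (card Om0) <= real (card ?T) * real q ^ card Cb" by simp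
  moreover have "((1 / (2 * real q)) ^ card Y * ?HY) * (\<delta> * ?HF) <= real (card S) * real (card Om0)"
  proof (cases "0 <= \<delta>")
   case True
   then show ?thesis using cardS cardOm pos HF by (intro mult_mono) auto
  next
   case False
   then have "((1 / (2 * real q)) ^ card Y * ?HY) * (\<delta> * ?HF) <= 0"
    using pos by (intro mult_nonneg_nonpos mult_nonpos_nonneg) (auto intro!: mult_nonneg_nonneg)
   also have "0 <= real (card S) * real (card Om0)" by simp
   finally show ?thesis .
  qed
  ultimately have "((1 / (2 * real q)) ^ card Y * ?HY) * (\<delta> * ?HF) <= real (card ?T) * real q ^ card Cb" by linarith
  moreover have "\<delta> * (1 / (2 * real q)) ^ card Y / real q ^ card Cb * (?HY * ?HF)
    = ((1 / (2 * real q)) ^ card Y * ?HY) * (\<delta> * ?HF) / real q ^ card Cb"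
   by (simp only: times_divide_eq_left times_divide_eq_right mult_ac)
  ultimately show ?thesis by (simp only: pos_divide_le_eq[OF q0])
 qed
 have "real (card ?T) * (\<Prod>x\<in>X. 1 / (Kc * H (lv x))) * exp (- 2 * hsum G) <= prb G (%B. has_equal_sums CARD('k) (A \<union> B))"
 proof (rule prb_hit[OF finite_X _ _ Wd_sub_G Wd_disjoint])
  show "finite G" by (simp add: G_def)
  show "2 <= a" if a: "a \<in> G" for a
  proof -
   obtain j where j: "j \<in> {1..r}" "a \<in> expint (c j * Lam) (c j * Lam + ln Kc)" using a by (auto simp: G_def)
   have "4 * real q <= exp (c j * Lam)" by (rule big[OF j(1)])
   moreover have "1 <= real q" using q(1) by simp
   moreover have "exp (c j * Lam) < real a" using j by (simp add: expint_def)
   ultimately have "2 < real a" by linarith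
   then show ?thesis by simp
  qed
  show "real a <= Kc * H (lv x)" if "x \<in> X" "a \<in> Wd x" for x a by (rule Wd_bounds(2)[OF that])
  show "?T \<subseteq> Pi\<^sub>E X Wd" using tt_mem Om0 by auto
  show "has_equal_sums CARD('k) (A \<union> t ` X)" if "t \<in> ?T" for t using that trial_success Om0 by auto
 qed
 moreover have "\<delta> * (1 / (2 * real q)) ^ card Y / real q ^ card Cb * (1 / Kc) ^ card X * exp (- 2 * (real r * (ln Kc + 1)))
  <= real (card ?T) * (\<Prod>x\<in>X. 1 / (Kc * H (lv x))) * exp (- 2 * hsum G)"
 proof -
  have "(\<Prod>x\<in>X. 1 / (Kc * H (lv x))) = (1 / Kc) ^ card X / (?HY * ?HF)"
   unfolding HX[symmetric] by (simp add: prod_dividef prod.distrib power_one_over field_simps)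
  then have e: "real (card ?T) * (\<Prod>x\<in>X. 1 / (Kc * H (lv x))) = real (card ?T) / (?HY * ?HF) * (1 / Kc) ^ card X" by simp
  have "\<delta> * (1 / (2 * real q)) ^ card Y / real q ^ card Cb <= real (card ?T) / (?HY * ?HF)"
   using low pos by (simp only: pos_le_divide_eq mult_pos_pos)
  moreover have "hsum G <= real r * (ln Kc + 1)"
  proof -
   have "hsum G <= (\<Sum>j=1..r. hsum (expint (c j * Lam) (c j * Lam + ln Kc)))"
    unfolding G_def hsum_def by (intro sum_UN_le) auto
   also have "... <= (\<Sum>j=1..r. ln Kc + 1)"
   proof (intro sum_mono)
    fix j assume j: "j \<in> {1..r}"
    have "1 <= real q" using q(1) by simp
    then have "1 <= exp (c j * Lam)" using big[OF j] by linarith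
    then have "0 <= c j * Lam" by simp
    moreover have "0 <= ln Kc" using Kc_pos by simp
    ultimately show "hsum (expint (c j * Lam) (c j * Lam + ln Kc)) <= ln Kc + 1"
     using hsum_expint_le[of "c j * Lam" "c j * Lam + ln Kc"] by simp
   qed
   finally show ?thesis by simp
  qed
  moreover have "0 <= real (card ?T) / (?HY * ?HF)" using pos by simp
  ultimately show ?thesis unfolding e using Kc_pos
   by (intro mult_mono mult_right_mono mult_nonneg_nonneg) auto
 qed
 ultimately show ?thesis by linarith
qed

end

section \<open>Lower bound: independent trials on nested regions\<close>

section \<open>The lower bound\<close>

lemma system_c_antimono:
 assumes "system r V c \<mu>" "1 <= i" "i <= j" "j <= r + 1" shows "c j <= c i"
proof (rule c_antimono[of r])
 show "c (j + 1) <= c j" if "j \<in> {1..r}" for j using assms(1) that by (auto simp: system_def)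
qed (use assms in auto)

lemma single_trial:
 fixes V :: "nat => (rat ^ 'k::finite) set"
 assumes sys: "system r V c \<mu>" and strict: "strict_entropy_condition r V c \<mu>" and \<eta>: "0 < \<eta>"
 obtains \<delta> \<theta> \<kappa> Lam\<^sub>0 where "0 < \<delta>" "\<delta> < 1" "0 < \<theta>" "0 <= \<kappa>"
  "!!Lam. Lam\<^sub>0 <= Lam ==> \<exists>R good. finite R &
    R \<subseteq> {a. \<exists>j\<in>{1..r}. exp ((c (j + 1) + \<theta>) * Lam) < real a & real a <= exp (c j * Lam)} &
    prb R (%A. \<not> good A) <= \<eta> &
    (\<forall>A\<subseteq>R. good A \<longrightarrow> \<delta> <= prb (\<Union>j\<in>{1..r}. expint (c j * Lam) (c j * Lam + \<kappa>)) (%B. has_equal_sums CARD('k) (A \<union> B)))"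
proof -
 obtain T Q \<theta> \<delta>0 Lam1 where T: "0 < T" and \<theta>: "0 < \<theta>" and \<delta>0: "0 < \<delta>0" and Q: "!!j. j \<in> {1..r} ==> real (Q j) <= T"
  and main: "!!Lam. Lam1 <= Lam ==> \<exists>P. 1 <= P & T * real P <= Lam &
   (\<forall>j\<in>{1..r}. (c (j + 1) + \<theta>) * Lam <= c j * Lam - (c j - c (j + 1)) * (T * real P)) &
   prb (\<Union>l<r * P. win c Lam T P l) (%A. \<not> dense_sums r V c \<mu> Q Lam T P \<delta>0 A) <= \<eta>"
  by (rule prb_dense_sums[OF sys strict \<eta>]) (rule that)
 obtain F lev co where F: "finite F" "F \<subseteq> cube \<inter> V r" and lev: "!!f. f \<in> F ==> lev f \<in> {1..r}"
  and co_add: "!!f x y. co f (x + y) = co f x + co f y" and co_scale: "!!f t x. co f (t *s x) = t * co f x"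
  and co_ones: "!!f. f \<in> F ==> co f ones = 0"
  and co_basis: "!!f f'. f \<in> F ==> f' \<in> F ==> co f f' = (if f = f' then 1 else 0)"
  and co_low: "!!f x j. f \<in> F ==> j < lev f ==> x \<in> V j ==> co f x = 0"
  and co_zero: "!!x. x \<in> V r ==> (!!f. f \<in> F ==> co f x = 0) ==> x \<in> vec.span {ones}"
  and lev_sum: "(\<Sum>f\<in>F. c (lev f)) = flag_entropy r V c \<mu>"
  and F_sep: "!!i i'. i ~= i' ==> \<exists>f\<in>F. f $ i ~= f $ i'"
 proof (rule adapted_basis[OF sys], goal_cases)
  case (1 F lev co)
  show ?case by (rule that[of F lev co]; fact 1)
 qed
 let ?Cb = "cube \<inter> V r"
 have finCb: "finite ?Cb" by simp
 have cs: "c (j + 1) < c j" if "j \<in> {1..r}" for j by (rule strict_decreasing[OF sys strict that])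
 have cr: "0 <= c (r + 1)" using sys by (simp add: system_def)
 have cpos: "0 < c j" if "j \<in> {1..r}" for j
  using cs[OF that] system_c_antimono[OF sys, of "j + 1" "r + 1"] that cr by auto
 have clt: "c j' < c j" if "j \<in> {1..r}" "j' \<in> {1..r}" "j < j'" for j j'
  using cs[OF that(1)] system_c_antimono[OF sys, of "j + 1" j'] that by auto
 obtain q where q: "0 < q" "!!x. x \<in> F \<times> ?Cb ==> of_nat q * co (fst x) (snd x) \<in> \<int>"
  using common_denominator[of "F \<times> ?Cb" "%x. co (fst x) (snd x)"] F finCb by blast
 define Rm where "Rm = Max (insert 0 ((%x. \<bar>real_of_rat (co (fst x) (snd x))\<bar>) ` (F \<times> ?Cb)))"
 have Rm: "0 <= Rm" "!!x. x \<in> F \<times> ?Cb ==> \<bar>real_of_rat (co (fst x) (snd x))\<bar> <= Rm"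
  unfolding Rm_def using F finCb by (auto intro!: Max_ge)
 obtain en where en: "bij_betw en (?Cb \<times> {..<q}) {0..<card (?Cb \<times> {..<q})}"
  using ex_bij_betw_finite_nat[of "?Cb \<times> {..<q}"] by auto
 obtain nf where nf: "bij_betw nf F {0..<card F}" using ex_bij_betw_finite_nat[OF F(1)] by auto
 define C1 where "C1 = Rm * T * (\<Sum>j=1..r. 1 / (1 - exp (- (T * (c j - c (j + 1))))))"
 let ?x = "2 * (C1 + Rm * real (card ?Cb * q) * (3 * 10 ^ (card ?Cb * q)))"
 obtain n0 where n0: "?x < 10 ^ n0" using real_arch_pow[of 10 ?x] by auto
 define E1 where "E1 = max (card ?Cb * q) n0"
 have E1: "card ?Cb * q <= E1" "?x <= 10 ^ E1"
 proof -
  have "(10::real) ^ n0 <= 10 ^ E1" by (intro power_increasing) (auto simp: E1_def)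
  then show "?x <= 10 ^ E1" using n0 by linarith
 qed (simp add: E1_def)
 define Kc :: real where "Kc = 9 * 10 ^ (E1 + card F)"
 have Kc1: "1 <= Kc"
 proof -
  have "1 <= (10::real) ^ (E1 + card F)" by (rule one_le_power) simp
  then show ?thesis unfolding Kc_def by linarith
 qed
 let ?Y = "?Cb \<times> {..<q} \<union> F \<times> {q, q + 1}" and ?X = "?Cb \<times> {..<q} \<union> F \<times> {q, q + 1, q + 2}"
 define \<delta>1 where "\<delta>1 = \<delta>0 * (1 / (2 * real q)) ^ card ?Y / real q ^ card ?Cb * (1 / Kc) ^ card ?X * exp (- 2 * (real r * (ln Kc + 1)))"
 have \<delta>1: "0 < \<delta>1" unfolding \<delta>1_def using \<delta>0 q Kc1 by simp
 \<comment> \<open>Lam must be so large that the fresh intervals above different points c j * Lam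
   are disjoint, fit into the gaps of length \<theta> * Lam left by the main windows, and start
   beyond 4 * q.\<close>
 have ev: "eventually (%Lam. Lam1 <= Lam & ln Kc / \<theta> <= Lam & 0 <= Lam &
   (\<forall>j\<in>{1..r}. ln (4 * real q) / c j <= Lam) &
   (\<forall>j\<in>{1..r}. \<forall>j'\<in>{1..r}. j < j' \<longrightarrow> ln Kc / (c j - c j') <= Lam)) at_top"
  by (intro eventually_conj eventually_ge_at_top eventually_ball_finite ballI) auto
 then obtain Lam2 where Lam2: "!!Lam. Lam2 <= Lam ==> Lam1 <= Lam & ln Kc / \<theta> <= Lam & 0 <= Lam &
   (\<forall>j\<in>{1..r}. ln (4 * real q) / c j <= Lam) &
   (\<forall>j\<in>{1..r}. \<forall>j'\<in>{1..r}. j < j' \<longrightarrow> ln Kc / (c j - c j') <= Lam)"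
  unfolding eventually_at_top_linorder by blast
 show ?thesis
 proof (rule that[of "min (1 / 2) \<delta>1" \<theta> "ln Kc" Lam2])
  show "0 < min (1 / 2) \<delta>1" using \<delta>1 by simp
  show "min (1 / 2) \<delta>1 < 1" by (rule le_less_trans[OF min.cobounded1]) simp
  show "0 < \<theta>" by (rule \<theta>)
  show "0 <= ln Kc" using Kc1 by simp
  fix Lam assume "Lam2 <= Lam"
  note L = Lam2[OF this]
  obtain P where P: "1 <= P" "T * real P <= Lam"
   "!!j. j \<in> {1..r} ==> (c (j + 1) + \<theta>) * Lam <= c j * Lam - (c j - c (j + 1)) * (T * real P)"
   "prb (\<Union>l<r * P. win c Lam T P l) (%A. \<not> dense_sums r V c \<mu> Q Lam T P \<delta>0 A) <= \<eta>"
   using main[of Lam] L by blast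
  let ?R = "\<Union>l<r * P. win c Lam T P l"
  have Lam0: "0 <= Lam" using L by blast
  have region: "exp ((c (scl P l + 1) + \<theta>) * Lam) < real a & real a <= exp (c (scl P l) * Lam) & scl P l \<in> {1..r}"
   if a: "a \<in> win c Lam T P l" and l: "l < r * P" for a l
  proof -
   have j: "scl P l \<in> {1..r}" by (rule block_decompose(1)[OF l])
   have "(c (scl P l + 1) + \<theta>) * Lam <= wbot c Lam T P l"
    using P(3)[OF j] wbot_ge[OF l T, of c Lam] cs by (force intro: less_imp_le order_trans)
   then have "exp ((c (scl P l + 1) + \<theta>) * Lam) <= exp (wbot c Lam T P l)" by simp
   moreover have "wheight c Lam T P l <= c (scl P l) * Lam"
    using wheight_le[OF l T, of c Lam] cs by (force intro: less_imp_le)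
   then have "exp (wheight c Lam T P l) <= exp (c (scl P l) * Lam)" by simp
   moreover have "exp (wbot c Lam T P l) < real a" "real a <= exp (wheight c Lam T P l)"
    using a by (auto simp: win_eq expint_def)
   ultimately show ?thesis using j by linarith
  qed
  have Kexp: "Kc <= exp (\<theta> * Lam)"
  proof -
   have "ln Kc <= \<theta> * Lam" using L \<theta> by (simp add: field_simps)
   then have "exp (ln Kc) <= exp (\<theta> * Lam)" by (simp only: exp_le_cancel_iff)
   then show ?thesis using Kc1 by simp
  qed
  have tr: "trial r V c \<mu> F lev co q Rm E1 en nf T Q Lam P A C1 Kc" if A: "A \<subseteq> ?R" for A
  proof (unfold_locales, goal_cases)
   case 1 then show ?case by (rule sys)
  next case (2 j) then show ?case by (rule cs)
  next case 3 then show ?case by (rule F)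
  next case 4 then show ?case by (rule F)
  next case (5 f) then show ?case by (rule lev)
  next case (6 f x y) then show ?case by (rule co_add)
  next case (7 f t x) then show ?case by (rule co_scale)
  next case (8 f) then show ?case by (rule co_ones)
  next case (9 f f') then show ?case by (rule co_basis)
  next case (10 f x j) then show ?case by (rule_tac co_low)
  next case (11 x) then show ?case by (rule_tac co_zero) auto
  next case 12 then show ?case by (rule lev_sum)
  next case (13 i i') then show ?case by (rule F_sep)
  next case 14 then show ?case by (rule q)
  next case (15 f v) then show ?case using q(2)[of "(f, v)"] by auto
  next case 16 then show ?case by (rule Rm)
  next case (17 f v) then show ?case using Rm(2)[of "(f, v)"] by auto
  next case 18 then show ?case using en by (simp add: bij_betw_def)
  next case (19 x) 
   have "en x \<in> {0..<card (?Cb \<times> {..<q})}" by (rule bij_betwE[OF en, rule_format, OF 19])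
   then show ?case by (simp add: card_cartesian_product)
  next case 20 then show ?case using nf by (simp add: bij_betw_def)
  next case (21 f) then show ?case using bij_betwE[OF nf] by auto
  next case 22 then show ?case by (rule E1)
  next case 23 then show ?case by (rule E1)
  next case 24 then show ?case by (rule C1_def)
  next case 25 then show ?case by (rule Kc_def)
  next case 26 then show ?case by (rule T)
  next case 27 then show ?case by (rule P)
  next case (28 j) then show ?case by (rule Q)
  next case 29 then show ?case by (rule A)
  next case (30 j j')
   have "ln Kc / (c j - c j') <= Lam" using L 30 by blast
   then have "ln Kc <= (c j - c j') * Lam" using clt[OF 30] by (simp add: field_simps)
   then have "exp (ln Kc) * exp (c j' * Lam) <= exp ((c j - c j') * Lam) * exp (c j' * Lam)"
    by (intro mult_right_mono) auto
   then show ?case using Kc1 by (simp add: exp_add[symmetric] algebra_simps)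
  next case (31 j)
   have "ln (4 * real q) / c j <= Lam" using L 31 by blast
   then have "ln (4 * real q) <= c j * Lam" using cpos[OF 31] by (simp add: field_simps)
   then have "exp (ln (4 * real q)) <= exp (c j * Lam)" by (simp only: exp_le_cancel_iff)
   then show ?case using q(1) by simp
  next case (32 j)
   show ?case
   proof (rule ccontr)
    assume "\<not> (A \<inter> expint (c j * Lam) (c j * Lam + ln Kc) = {} \<or> j \<notin> {1..r})"
    then obtain a where j: "j \<in> {1..r}" and a: "a \<in> A" "a \<in> expint (c j * Lam) (c j * Lam + ln Kc)" by auto
    obtain l where l: "l < r * P" "a \<in> win c Lam T P l" using a A by auto
    note rg = region[OF l(2,1)]
    have aj: "exp (c j * Lam) < real a" "real a <= Kc * exp (c j * Lam)"
     using a(2) Kc1 by (auto simp: expint_def exp_add mult.commute)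
    show False
    proof (cases "j <= scl P l")
     case True
     have "c (scl P l) <= c j" using True j rg by (intro system_c_antimono[OF sys]) auto
     then have "exp (c (scl P l) * Lam) <= exp (c j * Lam)" using Lam0 by (simp add: mult_right_mono)
     then show False using rg aj by linarith
    next
     case False
     have "c j <= c (scl P l + 1)" using False j by (intro system_c_antimono[OF sys]) auto
     then have "exp (c j * Lam) <= exp (c (scl P l + 1) * Lam)" using Lam0 by (simp add: mult_right_mono)
     then have "Kc * exp (c j * Lam) <= exp (\<theta> * Lam) * exp (c (scl P l + 1) * Lam)"
      using Kexp Kc1 by (intro mult_mono) auto
     also have "... = exp ((c (scl P l + 1) + \<theta>) * Lam)" by (simp add: exp_add[symmetric] algebra_simps)
     finally show False using rg aj by linarith
    qed
   qed
  qed
  show "\<exists>R good. finite R &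
    R \<subseteq> {a. \<exists>j\<in>{1..r}. exp ((c (j + 1) + \<theta>) * Lam) < real a & real a <= exp (c j * Lam)} &
    prb R (%A. \<not> good A) <= \<eta> &
    (\<forall>A\<subseteq>R. good A \<longrightarrow> min (1 / 2) \<delta>1 <= prb (\<Union>j\<in>{1..r}. expint (c j * Lam) (c j * Lam + ln Kc)) (%B. has_equal_sums CARD('k) (A \<union> B)))"
  proof (intro exI[of _ ?R] exI[of _ "dense_sums r V c \<mu> Q Lam T P \<delta>0"] conjI allI impI)
   show "finite ?R" by simp
   show "?R \<subseteq> {a. \<exists>j\<in>{1..r}. exp ((c (j + 1) + \<theta>) * Lam) < real a & real a <= exp (c j * Lam)}"
    using region by blast
   show "prb ?R (%A. \<not> dense_sums r V c \<mu> Q Lam T P \<delta>0 A) <= \<eta>" by (rule P(4))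
   fix A assume A: "A \<subseteq> ?R" and dense: "dense_sums r V c \<mu> Q Lam T P \<delta>0 A"
   interpret t: trial r V c \<mu> F lev co q Rm E1 en nf T Q Lam P A C1 Kc by (rule tr[OF A])
   have "\<delta>1 <= prb t.G (%B. has_equal_sums CARD('k) (A \<union> B))"
    using t.prb_trial[OF dense] unfolding \<delta>1_def t.X_def t.Y_def t.Cb_def .
   then show "min (1 / 2) \<delta>1 <= prb (\<Union>j\<in>{1..r}. expint (c j * Lam) (c j * Lam + ln Kc)) (%B. has_equal_sums CARD('k) (A \<union> B))"
    unfolding t.G_def by (rule order_trans[OF min.cobounded2])
  qed
 qed
qed

lemma prb_subset_mono:
 assumes "finite D" "G \<subseteq> D" "!!B. B \<subseteq> D ==> Pr (B \<inter> G) ==> Pr' B"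
 shows "prb G Pr <= prb D Pr'"
proof -
 have "prb G Pr = prb D (%B. Pr (B \<inter> G))" by (rule expect_Int[symmetric, OF assms(1,2)])
 also have "... <= prb D Pr'" using assms(3) by (intro prb_mono)
 finally show ?thesis .
qed

text \<open>Trial m uses the parameter L - h * (m + 1). With h = \<kappa> / c r, one step moves
  every upper end c j * Lam by at least \<kappa>, so the fresh intervals of trial m fit into Rg m -
  Rg (Suc m), whereas its main part lies in Rg (Suc m). The number M of trials depends only on
  \<delta> and \<eta>, so the regions shrink by a bounded factor altogether.\<close>

lemma prb_equal_sums_large:
 fixes V :: "nat => (rat ^ 'k::finite) set"
 assumes sys: "system r V c \<mu>" and strict: "strict_entropy_condition r V c \<mu>" and c0: "c0 < c (r + 1)" and \<eta>: "0 < \<eta>"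
 shows "eventually (%D. 1 - 3 * \<eta> <= measure log_random_measure (equal_sums_event CARD('k) c0 D)) at_top"
proof -
 obtain \<delta> \<theta> \<kappa> Lam\<^sub>0 where \<delta>: "0 < \<delta>" "\<delta> < 1" and \<theta>: "0 < \<theta>" and \<kappa>: "0 <= \<kappa>"
  and tr: "!!Lam. Lam\<^sub>0 <= Lam ==> \<exists>R good. finite R &
    R \<subseteq> {a. \<exists>j\<in>{1..r}. exp ((c (j + 1) + \<theta>) * Lam) < real a & real a <= exp (c j * Lam)} &
    prb R (%A. \<not> good A) <= \<eta> &
    (\<forall>A\<subseteq>R. good A \<longrightarrow> \<delta> <= prb (\<Union>j\<in>{1..r}. expint (c j * Lam) (c j * Lam + \<kappa>)) (%B. has_equal_sums CARD('k) (A \<union> B)))"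
  by (rule single_trial[OF sys strict \<eta>]) (rule that)
 have r1: "1 <= r" and cr: "0 <= c (r + 1)" and c1: "c 1 <= 1" using sys by (auto simp: system_def)
 have cs: "c (j + 1) < c j" if "j \<in> {1..r}" for j by (rule strict_decreasing[OF sys strict that])
 have crr: "0 < c r" using cs[of r] r1 cr by auto
 have cge: "c r <= c j" "c j <= 1" "0 <= c j" "c (r + 1) <= c (j + 1)" "0 <= c (j + 1)" "c (j + 1) <= 1" if "j \<in> {1..r}" for j
 proof -
  show "c r <= c j" using that by (intro system_c_antimono[OF sys]) auto
  then show "0 <= c j" using crr by simp
  have "c j <= c 1" using that by (intro system_c_antimono[OF sys]) auto
  then show "c j <= 1" using c1 by simp
  then show "c (j + 1) <= 1" using cs[OF that] by simp
  show "c (r + 1) <= c (j + 1)" using that by (intro system_c_antimono[OF sys]) auto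
  then show "0 <= c (j + 1)" using cr by simp
 qed
 obtain M :: nat where M: "0 < M" "(1 - \<delta>) powr (real M / 2) <= \<eta>"
 proof -
  have "(%n. (1 - \<delta>) ^ n) \<longlonglongrightarrow> 0" using \<delta> by (intro LIMSEQ_realpow_zero) auto
  then have "eventually (%n. (1 - \<delta>) ^ n < \<eta>) sequentially" using \<eta> by (rule order_tendstoD)
  then obtain n where n: "!!m. n <= m ==> (1 - \<delta>) ^ m < \<eta>" by (auto simp: eventually_sequentially)
  have "real (2 * Suc n) / 2 = real (Suc n)" by (simp only: of_nat_mult) simp
  then have "(1 - \<delta>) powr (real (2 * Suc n) / 2) = (1 - \<delta>) ^ Suc n" using \<delta> by (simp only: powr_realpow diff_gt_0_iff_gt)
  then show ?thesis using n[of "Suc n"] by (intro that[of "2 * Suc n"]) auto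
 qed
 define h where "h = \<kappa> / c r"
 have h: "0 <= h" "!!j. j \<in> {1..r} ==> \<kappa> <= c j * h"
 proof -
  show h0: "0 <= h" using \<kappa> crr by (simp add: h_def)
  fix j assume "j \<in> {1..r}"
  then have "c r * h <= c j * h" using cge h0 by (intro mult_right_mono) auto
  then show "\<kappa> <= c j * h" using crr by (simp add: h_def)
 qed
 define B where "B = h * real (M + 1)"
 have B0: "0 <= B" using h by (simp add: B_def)
 have "eventually (%L. B + max 0 Lam\<^sub>0 <= L & (\<kappa> + (1 + \<theta>) * B) / \<theta> <= L & (\<forall>j\<in>{1..r}. (\<kappa> + B) / (c j - c (j + 1)) <= L)) at_top"
  by (intro eventually_conj eventually_ge_at_top eventually_ball_finite ballI) auto
 then have evD: "eventually (%D. 1 < D & (B + max 0 Lam\<^sub>0 <= ln D & (\<kappa> + (1 + \<theta>) * B) / \<theta> <= ln D &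
   (\<forall>j\<in>{1..r}. (\<kappa> + B) / (c j - c (j + 1)) <= ln D))) at_top"
  using eventually_compose_filterlim[OF _ ln_at_top] by (intro eventually_conj[OF eventually_gt_at_top]) blast
 then show ?thesis
 proof eventually_elim
  case (elim D)
  define L where "L = ln D"
  have D: "D = exp L" using elim by (simp add: L_def)
  have L1: "B + max 0 Lam\<^sub>0 <= L" and L2: "\<kappa> + (1 + \<theta>) * B <= \<theta> * L"
   using elim \<theta> by (auto simp: L_def field_simps)
  have L3: "\<kappa> + B <= (c j - c (j + 1)) * L" if "j \<in> {1..r}" for j
  proof -
   have "(\<kappa> + B) / (c j - c (j + 1)) <= L" using elim that by (auto simp: L_def)
   then show ?thesis using cs[OF that] by (simp add: field_simps)
  qed
  have L0: "0 <= L" using L1 B0 by linarith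
  let ?Lam = "%m. L - h * real m"
  \<comment> \<open>The regions shrink only at their upper ends. The common lower end of scale j
    lies above the fresh intervals of scale j + 1 in every trial.\<close>
  define Rg where "Rg m = {a::nat. \<exists>j\<in>{1..r}. exp (c (j + 1) * L + \<kappa>) < real a & real a <= exp (c j * ?Lam m)}" for m
  have Lamm: "max 0 Lam\<^sub>0 <= ?Lam (Suc m)" "L - ?Lam (Suc m) <= B" "0 <= L - ?Lam (Suc m)" if "m < M" for m
  proof -
   have "h * real (Suc m) <= B" unfolding B_def using that h by (intro mult_left_mono) auto
   then show "max 0 Lam\<^sub>0 <= ?Lam (Suc m)" "L - ?Lam (Suc m) <= B" using L1 by linarith+
   show "0 <= L - ?Lam (Suc m)" using h by simp
  qed
  have finR: "finite (Rg m)" for m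
  proof (rule finite_subset[of _ "\<Union>j\<in>{1..r}. {..nat \<lfloor>exp (c j * ?Lam m)\<rfloor>}"])
   show "Rg m \<subseteq> (\<Union>j\<in>{1..r}. {..nat \<lfloor>exp (c j * ?Lam m)\<rfloor>})"
    unfolding Rg_def by (auto simp: le_nat_floor)
  qed simp
  have subR: "Rg (Suc m) \<subseteq> Rg m" for m
  proof
   fix a assume "a \<in> Rg (Suc m)"
   then obtain j where j: "j \<in> {1..r}" "exp (c (j + 1) * L + \<kappa>) < real a" "real a <= exp (c j * ?Lam (Suc m))"
    by (auto simp: Rg_def)
   have "c j * ?Lam (Suc m) <= c j * ?Lam m" using cge(3)[OF j(1)] h by (intro mult_left_mono) (auto simp: algebra_simps)
   then have "exp (c j * ?Lam (Suc m)) <= exp (c j * ?Lam m)" by simp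
   then have "real a <= exp (c j * ?Lam m)" using j(3) by linarith
   then show "a \<in> Rg m" using j(1,2) by (auto simp: Rg_def)
  qed
  define ok where "ok m R good \<longleftrightarrow> finite R &
    R \<subseteq> {a. \<exists>j\<in>{1..r}. exp ((c (j + 1) + \<theta>) * ?Lam (Suc m)) < real a & real a <= exp (c j * ?Lam (Suc m))} &
    prb R (%A. \<not> good A) <= \<eta> &
    (\<forall>A\<subseteq>R. good A \<longrightarrow> \<delta> <= prb (\<Union>j\<in>{1..r}. expint (c j * ?Lam (Suc m)) (c j * ?Lam (Suc m) + \<kappa>)) (%B. has_equal_sums CARD('k) (A \<union> B)))"
   for m and R :: "nat set" and good
  have "\<forall>m. \<exists>x. m < M \<longrightarrow> ok m (fst x) (snd x)"
  proof
   fix m show "\<exists>x. m < M \<longrightarrow> ok m (fst x) (snd x)"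
   proof (cases "m < M")
    case True
    have "Lam\<^sub>0 <= ?Lam (Suc m)" using Lamm(1)[OF True] by linarith
    from tr[OF this] obtain R good where "ok m R good" unfolding ok_def by blast
    then show ?thesis by (intro exI[of _ "(R, good)"]) simp
   qed simp
  qed
  from choice[OF this] obtain x where x: "!!m. m < M ==> ok m (fst (x m)) (snd (x m))" by blast
  define R where "R m = fst (x m)" for m
  define good where "good m = snd (x m)" for m
  note Rgood = x[folded R_def good_def, unfolded ok_def]
  let ?G = "%m. \<Union>j\<in>{1..r}. expint (c j * ?Lam (Suc m)) (c j * ?Lam (Suc m) + \<kappa>)"
  have RRg: "R m \<subseteq> Rg (Suc m)" if m: "m < M" for m
  proof
   fix a assume "a \<in> R m"
   then obtain j where j: "j \<in> {1..r}" "exp ((c (j + 1) + \<theta>) * ?Lam (Suc m)) < real a" "real a <= exp (c j * ?Lam (Suc m))"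
    using Rgood[OF m] by blast
   have "c (j + 1) * L + \<kappa> <= (c (j + 1) + \<theta>) * ?Lam (Suc m)"
   proof -
    have "(c (j + 1) + \<theta>) * (L - ?Lam (Suc m)) <= (1 + \<theta>) * B"
     using Lamm[OF m] cge[OF j(1)] \<theta> B0 by (intro mult_mono) auto
    then show ?thesis using L2 by (simp add: algebra_simps)
   qed
   then have "exp (c (j + 1) * L + \<kappa>) <= exp ((c (j + 1) + \<theta>) * ?Lam (Suc m))" by simp
   then have "exp (c (j + 1) * L + \<kappa>) < real a" using j(2) by linarith
   then show "a \<in> Rg (Suc m)" using j(1,3) unfolding Rg_def by blast
  qed
  have GRg: "?G m \<subseteq> Rg m - Rg (Suc m)" if m: "m < M" for m
  proof
   fix a assume "a \<in> ?G m"
   then obtain j where j: "j \<in> {1..r}" "exp (c j * ?Lam (Suc m)) < real a" "real a <= exp (c j * ?Lam (Suc m) + \<kappa>)"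
    by (auto simp: expint_def)
   note lm = Lamm[OF m]
   have "c (j + 1) * L + \<kappa> <= c j * ?Lam (Suc m)"
   proof -
    have "c j * (L - ?Lam (Suc m)) <= 1 * B" using lm cge[OF j(1)] B0 by (intro mult_mono) auto
    then show ?thesis using L3[OF j(1)] by (simp add: algebra_simps)
   qed
   then have "exp (c (j + 1) * L + \<kappa>) <= exp (c j * ?Lam (Suc m))" by simp
   then have 1: "exp (c (j + 1) * L + \<kappa>) < real a" using j(2) by linarith
   have "c j * ?Lam (Suc m) + \<kappa> <= c j * ?Lam m" using h(2)[OF j(1)] by (simp add: algebra_simps)
   then have "exp (c j * ?Lam (Suc m) + \<kappa>) <= exp (c j * ?Lam m)" by simp
   then have 2: "real a <= exp (c j * ?Lam m)" using j(3) by linarith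
   have "a \<notin> Rg (Suc m)"
   proof
    assume "a \<in> Rg (Suc m)"
    then obtain i where i: "i \<in> {1..r}" "exp (c (i + 1) * L + \<kappa>) < real a" "real a <= exp (c i * ?Lam (Suc m))"
     by (auto simp: Rg_def)
    show False
    proof (cases "j <= i")
     case True
     have "c i <= c j" using True i j by (intro system_c_antimono[OF sys]) auto
     then have "c i * ?Lam (Suc m) <= c j * ?Lam (Suc m)" using lm(1) by (intro mult_right_mono) auto
     then have "exp (c i * ?Lam (Suc m)) <= exp (c j * ?Lam (Suc m))" by simp
     then show False using i j by linarith
    next
     case False
     have "c j <= c (i + 1)" using False i j by (intro system_c_antimono[OF sys]) auto
     then have "c j * ?Lam (Suc m) <= c (i + 1) * L"
      using lm cge[OF i(1)] by (intro mult_mono) auto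
     then have "exp (c j * ?Lam (Suc m) + \<kappa>) <= exp (c (i + 1) * L + \<kappa>)" by simp
     then show False using i j by linarith
    qed
   qed
   then show "a \<in> Rg m - Rg (Suc m)" using 1 2 j(1) unfolding Rg_def by blast
  qed
  have fail: "prb (Rg 0) (%A. \<forall>m<M. \<not> has_equal_sums CARD('k) (A \<inter> Rg m)) <= 2 * \<eta> + (1 - \<delta>) powr (real M / 2)"
  proof (rule prb_all_trials_fail[where good = "%m A. good m (A \<inter> R m)" and R = Rg and \<delta> = \<delta> and \<eta> = \<eta>])
   show "finite (Rg m)" "Rg (Suc m) \<subseteq> Rg m" for m by (rule finR subR)+
   show "0 < \<delta>" "\<delta> < 1" "0 < M" by (rule \<delta> M)+
   fix m assume m: "m < M"
   have "prb (Rg (Suc m)) (%A. \<not> good m (A \<inter> R m)) = prb (R m) (%A. \<not> good m A)"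
    by (rule expect_Int[OF finR RRg[OF m]])
   then show "prb (Rg (Suc m)) (%A. \<not> good m (A \<inter> R m)) <= \<eta>" using Rgood[OF m] by simp
   fix A assume A: "A \<subseteq> Rg (Suc m)" and g: "good m (A \<inter> R m)"
   have "\<delta> <= prb (?G m) (%B. has_equal_sums CARD('k) ((A \<inter> R m) \<union> B))" using Rgood[OF m] g by blast
   also have "... <= prb (Rg m - Rg (Suc m)) (%B. has_equal_sums CARD('k) (A \<union> B))"
    using finR GRg[OF m] by (intro prb_subset_mono) (auto elim!: has_equal_sums_mono)
   finally show "\<delta> <= prb (Rg m - Rg (Suc m)) (%B. has_equal_sums CARD('k) (A \<union> B))" .
  qed
  let ?N = "{a::nat. 1 <= a & D powr c0 <= real a & real a <= D}"
  have finN: "finite ?N" by (rule finite_subset[of _ "{..nat \<lfloor>D\<rfloor>}"]) (auto simp: le_nat_floor)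
  have RN: "Rg 0 \<subseteq> ?N"
  proof
   fix a assume "a \<in> Rg 0"
   then obtain j where j: "j \<in> {1..r}" "exp (c (j + 1) * L + \<kappa>) < real a" "real a <= exp (c j * L)" by (auto simp: Rg_def)
   have "c j * L <= 1 * L" using cge[OF j(1)] L0 by (intro mult_right_mono) auto
   then have "exp (c j * L) <= D" by (simp add: D)
   moreover have "D powr c0 <= exp (c (j + 1) * L + \<kappa>)"
   proof -
    have "c0 <= c (j + 1)" using c0 cge[OF j(1)] by linarith
    then have "c0 * L <= c (j + 1) * L" using L0 by (intro mult_right_mono)
    then show ?thesis using \<kappa> by (simp add: D powr_def)
   qed
   moreover have "0 < real a" using j(2) by (rule less_trans[OF exp_gt_zero])
   then have "1 <= a" by simp
   ultimately show "a \<in> ?N" using j by auto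
  qed
  have "prb ?N (%A. \<not> has_equal_sums CARD('k) A) <= prb ?N (%A. \<forall>m<M. \<not> has_equal_sums CARD('k) ((A \<inter> Rg 0) \<inter> Rg m))"
   by (intro prb_mono) (meson has_equal_sums_mono inf_le1 order_trans)
  also have "... = prb (Rg 0) (%A. \<forall>m<M. \<not> has_equal_sums CARD('k) (A \<inter> Rg m))"
   by (rule expect_Int[OF finN RN])
  also have "... <= 3 * \<eta>" using fail M by linarith
  finally show ?case unfolding measure_equal_sums_event using prb_compl[OF finN, of "has_equal_sums CARD('k)"] by linarith
 qed
qed

theorem gamma_tilde_le_beta: "gamma_tilde TYPE('k::finite) <= beta CARD('k)"
 unfolding gamma_tilde_def
proof (rule Sup_least)
 fix x assume "x \<in> ereal ` {c (r + 1) | r (V :: nat => (rat ^ 'k) set) c \<mu>. system r V c \<mu> & strict_entropy_condition r V c \<mu>}"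
 then obtain r and V :: "nat => (rat ^ 'k) set" and c \<mu> where x: "x = ereal (c (r + 1))"
  and sys: "system r V c \<mu>" and strict: "strict_entropy_condition r V c \<mu>" by auto
 have mem: "ereal c0 <= beta CARD('k)" if c0: "c0 < c (r + 1)" for c0
  unfolding beta_def
 proof (rule Sup_upper, rule imageI, rule CollectI, rule conjI)
  have "c (r + 1) <= c 1" by (rule system_c_antimono[OF sys]) auto
  then show "c0 < 1" using c0 sys by (auto simp: system_def)
  interpret lp: prob_space log_random_measure unfolding log_random_measure_def by (rule lrm.prob_space_axioms)
  show "((%D. measure log_random_measure (equal_sums_event CARD('k) c0 D)) \<longlongrightarrow> 1) at_top"
  proof (rule order_tendstoI)
   fix a :: real assume a: "a < 1"
   have "eventually (%D. 1 - 3 * ((1 - a) / 6) <= measure log_random_measure (equal_sums_event CARD('k) c0 D)) at_top"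
    using a by (intro prb_equal_sums_large[OF sys strict c0]) auto
   then show "eventually (%D. a < measure log_random_measure (equal_sums_event CARD('k) c0 D)) at_top"
    by eventually_elim (use a in \<open>auto simp: field_simps\<close>)
  next
   fix a :: real assume "1 < a"
   then show "eventually (%D. measure log_random_measure (equal_sums_event CARD('k) c0 D) < a) at_top"
    using lp.prob_le_1 by (intro always_eventually allI) (meson le_less_trans)
  qed
 qed
 show "x <= beta CARD('k)" unfolding x
 proof (rule dense_le)
  fix y assume y: "y < ereal (c (r + 1))"
  show "y <= beta CARD('k)"
  proof (cases y)
   case (real c0) then show ?thesis using mem y by simp
  next
   case MInf then show ?thesis by simp
  qed (use y in simp)
 qed
qed

section \<open>Upper bound: a uniform entropy gap by compactness\<close>

section \<open>Compactness of the space of systems\<close>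

lemma common_subsequence:
 fixes f :: "nat => 'i => real"
 assumes "finite I" "!!n i. i \<in> I ==> f n i \<in> {a..b}"
 shows "\<exists>s l. strict_mono s & (\<forall>i\<in>I. (%n. f (s n) i) \<longlonglongrightarrow> l i)"
 using assms
proof (induction I rule: finite_induct)
 case empty
 show ?case by (intro exI[of _ id]) (simp add: strict_mono_id)
next
 case (insert i I)
 then obtain s l where s: "strict_mono s" "!!i. i \<in> I ==> (%n. f (s n) i) \<longlonglongrightarrow> l i" by (metis insertI2)
 have "seq_compact {a..b}" by (simp add: compact_imp_seq_compact)
 moreover have "\<forall>n. f (s n) i \<in> {a..b}" using insert by auto
 ultimately obtain l' t where t: "strict_mono t" "((%n. f (s n) i) \<circ> t) \<longlonglongrightarrow> l'"
  unfolding seq_compact_def by metis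
 have "(%n. f ((s \<circ> t) n) i') \<longlonglongrightarrow> (l(i := l')) i'" if "i' \<in> insert i I" for i'
 proof (cases "i' = i")
  case True then show ?thesis using t(2) by (simp add: o_def)
 next
  case False
  then have "(%n. f (s n) i') \<longlonglongrightarrow> l i'" using s(2) that by auto
  then show ?thesis using False LIMSEQ_subseq_LIMSEQ[OF _ t(1)] by (force simp: o_def)
 qed
 then show ?case using strict_mono_o[OF s(1) t(1)] by blast
qed

text \<open>Only u' = 0 needs an argument, since v may then tend to 0 as well: u |ln v| <= u |ln u|
  <= 2 sqrt u.\<close>

lemma tendsto_mult_ln_dominated:
 fixes u v :: "nat => real"
 assumes u: "u \<longlonglongrightarrow> u'" and v: "v \<longlonglongrightarrow> v'" and uv: "!!n. 0 <= u n" "!!n. u n <= v n" "!!n. v n <= 1"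
 shows "(%n. u n * ln (v n)) \<longlonglongrightarrow> u' * ln v'"
proof (cases "u' = 0")
 case False
 have "0 <= u'" using u uv(1) by (intro LIMSEQ_le_const) auto
 moreover have "u' <= v'" using uv(2) by (intro LIMSEQ_le[OF u v]) auto
 ultimately have "0 < v'" using False by linarith
 then show ?thesis using u v by (intro tendsto_mult tendsto_ln) auto
next
 case True
 have "norm (u n * ln (v n)) <= 2 * sqrt (u n)" for n
 proof (cases "u n = 0")
  case False
  then have un: "0 < u n" "u n <= 1" using uv[of n] by auto
  have "ln (v n) <= 0" "ln (u n) <= ln (v n)" using un uv[of n] by (auto simp: ln_le_zero_iff)
  then have "norm (u n * ln (v n)) = u n * (- ln (v n))" using un by (simp add: abs_mult)
  also have "... <= u n * (- ln (u n))" using un \<open>ln (u n) <= ln (v n)\<close> by (intro mult_left_mono) auto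
  also have "... = 2 * sqrt (u n) * (sqrt (u n) * (- ln (sqrt (u n))))"
   using un by (simp add: ln_sqrt)
  also have "... <= 2 * sqrt (u n) * 1"
   using un by (intro mult_left_mono minus_x_ln_x_le_1) auto
  finally show ?thesis by simp
 qed simp
 moreover have "(%n. 2 * sqrt (u n)) \<longlonglongrightarrow> 2 * sqrt 0"
  using u True by (intro tendsto_intros) auto
 ultimately have "(%n. u n * ln (v n)) \<longlonglongrightarrow> 0"
  by (intro Lim_null_comparison[of "%n. u n * ln (v n)" "%n. 2 * sqrt (u n)"]) auto
 then show ?thesis using True by simp
qed

lemma coset_entropy_cube:
 assumes "set_pmf \<nu> \<subseteq> cube"
 shows "coset_entropy \<nu> (W :: (rat ^ 'k::finite) set) =
  - (\<Sum>x\<in>cube. pmf \<nu> x * ln (\<Sum>y\<in>{y \<in> cube. y - x \<in> W}. pmf \<nu> y))"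
proof -
 have "measure_pmf.prob \<nu> {y. y - x \<in> W} = (\<Sum>y\<in>{y \<in> cube. y - x \<in> W}. pmf \<nu> y)" for x
 proof -
  have "measure_pmf.prob \<nu> {y. y - x \<in> W} = measure_pmf.prob \<nu> {y \<in> cube. y - x \<in> W}"
   using assms by (intro measure_pmf.finite_measure_eq_AE) (auto simp: AE_measure_pmf_iff)
  then show ?thesis by (simp add: measure_measure_pmf_finite)
 qed
 moreover have "(\<Sum>x\<in>set_pmf \<nu>. pmf \<nu> x * f x) = (\<Sum>x\<in>cube. pmf \<nu> x * f x)" for f :: "_ => real"
  using assms by (intro sum.mono_neutral_left) (auto simp: set_pmf_iff)
 ultimately show ?thesis by (simp add: coset_entropy_alt)
qed

lemma coset_entropy_tendsto:
 assumes \<mu>: "!!n. set_pmf (\<mu> n) \<subseteq> cube" and \<nu>: "set_pmf \<nu> \<subseteq> cube"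
  and lim: "!!x. x \<in> cube ==> (%n. pmf (\<mu> n) x) \<longlonglongrightarrow> pmf \<nu> x" and W: "vec.subspace W"
 shows "(%n. coset_entropy (\<mu> n) (W :: (rat ^ 'k::finite) set)) \<longlonglongrightarrow> coset_entropy \<nu> W"
 unfolding coset_entropy_cube[OF \<mu>] coset_entropy_cube[OF \<nu>]
proof (rule tendsto_minus, rule tendsto_sum, rule tendsto_mult_ln_dominated)
 fix x assume x: "x \<in> (cube :: (rat ^ 'k) set)"
 fix n
 show "(%n. pmf (\<mu> n) x) \<longlonglongrightarrow> pmf \<nu> x" by (rule lim[OF x])
 show "(%n. \<Sum>y\<in>{y \<in> cube. y - x \<in> W}. pmf (\<mu> n) y) \<longlonglongrightarrow> (\<Sum>y\<in>{y \<in> cube. y - x \<in> W}. pmf \<nu> y)"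
  using lim by (intro tendsto_sum) auto
 have "x \<in> {y \<in> cube. y - x \<in> W}" using x W by (simp add: vec.subspace_0)
 then show "pmf (\<mu> n) x <= (\<Sum>y\<in>{y \<in> cube. y - x \<in> W}. pmf (\<mu> n) y)"
  by (intro member_le_sum) auto
 have "(\<Sum>y\<in>{y \<in> cube. y - x \<in> W}. pmf (\<mu> n) y) = measure_pmf.prob (\<mu> n) {y \<in> cube. y - x \<in> W}"
  by (simp add: measure_measure_pmf_finite)
 then show "(\<Sum>y\<in>{y \<in> cube. y - x \<in> W}. pmf (\<mu> n) y) <= 1" by simp
 show "0 <= pmf (\<mu> n) x" by simp
qed

lemma pmf_with_weights:
 fixes w :: "'a => real"
 assumes "finite X" "!!x. x \<in> X ==> 0 <= w x" "sum w X = 1"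
 obtains \<nu> where "!!x. pmf \<nu> x = (if x \<in> X then w x else 0)" "set_pmf \<nu> \<subseteq> X"
proof -
 let ?w = "%x. if x \<in> X then w x else 0"
 have "(\<integral>\<^sup>+ x. ennreal (?w x) \<partial>count_space UNIV) = (\<Sum>x\<in>X. ennreal (w x))"
  using assms(1) by (subst nn_integral_count_space'[of X]) auto
 also have "... = 1" using assms by (subst sum_ennreal) auto
 finally have "pmf (embed_pmf ?w) x = ?w x" for x
  using assms by (intro pmf_embed_pmf) auto
 then show ?thesis by (intro that[of "embed_pmf ?w"]) (auto simp: set_pmf_iff split: if_splits)
qed

lemma system_dim_ge:
 fixes V :: "nat => (rat ^ 'k::finite) set"
 assumes sys: "system r V c \<mu>" shows "j <= r ==> j + 1 <= vec.dim (V j)"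
proof (induction j)
 case 0
 then show ?case using sys by (simp add: system_def flag_def dim_span_ones del: vec.dim_span)
next
 case (Suc j)
 have fl: "flag r V" and inj: "inj_on V {0..r}" using sys by (auto simp: system_def)
 have sub: "V j \<subseteq> V (Suc j)" using fl Suc by (auto simp: flag_def)
 have "V j ~= V (Suc j)" using inj_onD[OF inj, of j "Suc j"] Suc by auto
 then have "vec.dim (V j) ~= vec.dim (V (Suc j))"
  using sub vec.subspace_dim_equal[of "V j" "V (Suc j)"] flag_subspace[OF fl] Suc by auto
 moreover have "vec.dim (V j) <= vec.dim (V (Suc j))" by (rule vec.dim_subset[OF sub])
 ultimately show ?case using Suc by simp
qed

lemma system_length_le:
 fixes V :: "nat => (rat ^ 'k::finite) set"
 assumes sys: "system r V c \<mu>" shows "r + 1 <= CARD('k)"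
proof -
 have "vec.dim (V r) <= CARD('k)" using vec.dim_subset_UNIV[of "V r"] by (simp add: vec.dimension_def card_cart_basis)
 then show ?thesis using system_dim_ge[OF sys, of r] by simp
qed

text \<open>Otherwise for every n there is a system without gap 1 / (n + 1). As r < k and the spaces
  lie in \<open>dspans\<close>, one flag occurs infinitely often; the exponents and probabilities
  range over a compact cube, and a limit system satisfies the entropy condition by continuity. The
  support conditions and the last exponent pass to the limit, which contradicts the assumption for
  c0.\<close>

lemma entropy_gap:
 assumes none: "!!r (V :: nat => (rat ^ 'k::finite) set) c \<mu>. system r V c \<mu> ==> c (r + 1) = c0 ==> \<not> entropy_condition r V c \<mu>"
 obtains eps where "0 < eps" "!!r (V :: nat => (rat ^ 'k) set) c \<mu>. system r V c \<mu> ==> c (r + 1) = c0 ==>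
  \<exists>V'. subflag r V' V & (\<forall>j. V' j \<in> dspans) & flag_entropy r V' c \<mu> <= flag_entropy r V c \<mu> - eps"
proof (rule ccontr)
 assume not_thesis: "\<not> thesis"
 define bad where "bad n r V c \<mu> \<longleftrightarrow> system r V c \<mu> & c (r + 1) = c0 &
  (\<forall>V'. subflag r V' V & (\<forall>j. V' j \<in> dspans) \<longrightarrow> flag_entropy r V c \<mu> - 1 / real (Suc n) < flag_entropy r V' c \<mu>)"
  for n r and V :: "nat => (rat ^ 'k) set" and c \<mu>
 have "\<exists>r V c \<mu>. bad n r V c \<mu>" for n
 proof (rule ccontr)
  assume no: "\<nexists>r V c \<mu>. bad n r V c \<mu>"
  have "\<exists>V'. subflag r V' V & (\<forall>j. V' j \<in> dspans) & flag_entropy r V' c \<mu> <= flag_entropy r V c \<mu> - 1 / real (Suc n)"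
   if "system r V c \<mu>" "c (r + 1) = c0" for r and V :: "nat => (rat ^ 'k) set" and c \<mu>
  proof -
   have "\<not> bad n r V c \<mu>" using no by blast
   then show ?thesis using that unfolding bad_def by (meson not_less)
  qed
  then show False using not_thesis that[of "1 / real (Suc n)"] by simp
 qed
 then obtain R W C M where X: "!!n. bad n (R n) (W n) (C n) (M n)" by metis
 note X = X[unfolded bad_def]
 have sys: "system (R n) (W n) (C n) (M n)" and Cc: "C n (R n + 1) = c0" for n using X by auto
 have gap: "flag_entropy (R n) (W n) (C n) (M n) - 1 / real (Suc n) < flag_entropy (R n) V' (C n) (M n)"
  if "subflag (R n) V' (W n)" "!!j. V' j \<in> dspans" for n V' using X that by blast
 have "infinite (UNIV :: nat set)" by simp
 moreover have "finite ((%n. (R n, restrict (W n) {0..R n})) ` UNIV)"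
 proof (rule finite_subset)
  have "restrict (W n) {0..R n} \<in> Pi\<^sub>E {0..R n} (%_. dspans)" for n
  proof (intro restrict_PiE_iff[THEN iffD2] ballI)
   fix j assume "j \<in> {0..R n}"
   then obtain S where "S \<subseteq> cube" "W n j = vec.span S" using sys[of n] by (auto simp: system_def)
   then show "W n j \<in> dspans" using cube_subset_dcube by (auto intro!: span_in_dspans)
  qed
  moreover have "R n <= CARD('k)" for n using system_length_le[OF sys[of n]] by simp
  ultimately show "(%n. (R n, restrict (W n) {0..R n})) ` UNIV \<subseteq> Sigma {..CARD('k)} (%r. Pi\<^sub>E {0..r} (%_. dspans))"
   by (intro image_subsetI SigmaI) simp_all
 qed (auto intro!: finite_SigmaI finite_PiE)
 ultimately obtain n0 where inf: "infinite {n \<in> UNIV. (R n, restrict (W n) {0..R n}) = (R n0, restrict (W n0) {0..R n0})}"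
  using pigeonhole_infinite[of UNIV "%n. (R n, restrict (W n) {0..R n})"] by blast
 define r where "r = R n0"
 define V where "V = W n0"
 let ?N = "{n. (R n, restrict (W n) {0..R n}) = (r, restrict V {0..r})}"
 have infN: "infinite ?N" using inf by (simp add: r_def V_def)
 define e where "e = enumerate ?N"
 have e: "strict_mono e" "!!n. e n \<in> ?N"
  using infN strict_mono_enumerate enumerate_in_set unfolding e_def by blast+
 have Re: "R (e n) = r" for n using e(2)[of n] by simp
 have We: "W (e n) j = V j" if "j <= r" for n j
 proof -
  have "restrict (W (e n)) {0..r} = restrict V {0..r}" using e(2)[of n] Re[of n] by simp
  from fun_cong[OF this, of j] show ?thesis using that by simp
 qed
 have syse: "system r V (C (e n)) (M (e n))" for n
  using sys[of "e n"] We[of _ n] unfolding Re system_def flag_def nondegenerate_def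
  by (auto simp: inj_on_def)
 define I where "I = {1..r} \<times> (insert None (Some ` (cube :: (rat ^ 'k) set)))"
 define F where "F n i = (case snd i of None => C n (fst i) | Some x => pmf (M n (fst i)) x)" for n i
 have C01: "0 <= C (e n) j" "C (e n) j <= 1" if "j \<in> {1..r}" for n j
 proof -
  have "C (e n) (r + 1) <= C (e n) j" "C (e n) j <= C (e n) 1"
   using that by (intro system_c_antimono[OF syse]; simp)+
  then show "0 <= C (e n) j" "C (e n) j <= 1" using syse[of n] by (auto simp: system_def)
 qed
 have "\<exists>s l. strict_mono s & (\<forall>i\<in>I. (%n. F (e (s n)) i) \<longlonglongrightarrow> l i)"
  using C01 by (intro common_subsequence[where a = 0 and b = 1]) (auto simp: I_def F_def pmf_le_1)
 then obtain s l where s: "strict_mono s" and l: "!!i. i \<in> I ==> (%n. F (e (s n)) i) \<longlonglongrightarrow> l i" by auto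
 define t where "t n = e (s n)" for n
 have syst: "system r V (C (t n)) (M (t n))" for n unfolding t_def by (rule syse)
 define c where "c j = (if j \<in> {1..r} then l (j, None) else c0)" for j
 have limc: "(%n. C (t n) j) \<longlonglongrightarrow> c j" if "j \<in> {1..r + 1}" for j
 proof (cases "j = r + 1")
  case True then show ?thesis using Cc[of "t _"] Re[of "s _"] by (simp add: c_def t_def)
 next
  case False
  then have j: "j \<in> {1..r}" using that by auto
  then show ?thesis using l[of "(j, None)"] by (simp add: I_def F_def c_def t_def)
 qed
 have suppM: "set_pmf (M (t n) j) \<subseteq> V j \<inter> cube" if "j \<in> {1..r}" for n j
  using syst[of n] that by (auto simp: system_def)
 have limp: "(%n. pmf (M (t n) j) x) \<longlonglongrightarrow> l (j, Some x)" if "j \<in> {1..r}" "x \<in> cube" for j x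
  using l[of "(j, Some x)"] that by (simp add: I_def F_def t_def)
 have "\<exists>\<nu>. (\<forall>x\<in>cube. pmf \<nu> x = l (j, Some x)) & set_pmf \<nu> \<subseteq> cube" if j: "j \<in> {1..r}" for j
 proof -
  have "(%n. \<Sum>x\<in>cube. pmf (M (t n) j) x) \<longlonglongrightarrow> (\<Sum>x\<in>cube. l (j, Some x))"
   using limp[OF j] by (intro tendsto_sum)
  moreover have "(\<Sum>x\<in>cube. pmf (M (t n) j) x) = 1" for n
   using suppM[OF j, of n] by (intro sum_pmf_eq_1) auto
  ultimately have "(\<Sum>x\<in>cube. l (j, Some x)) = 1" by (simp add: LIMSEQ_const_iff)
  moreover have "0 <= l (j, Some x)" if "x \<in> cube" for x
   using limp[OF j that] by (intro LIMSEQ_le_const) auto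
  ultimately obtain \<nu> where "!!x. pmf \<nu> x = (if x \<in> cube then l (j, Some x) else 0)" "set_pmf \<nu> \<subseteq> cube"
   using pmf_with_weights[of "cube :: (rat ^ 'k) set" "%x. l (j, Some x)"] by auto
  then show ?thesis by (intro exI[of _ \<nu>]) simp
 qed
 then obtain \<nu> where \<nu>: "!!j x. j \<in> {1..r} ==> x \<in> cube ==> pmf (\<nu> j) x = l (j, Some x)"
  "!!j. j \<in> {1..r} ==> set_pmf (\<nu> j) \<subseteq> cube" by metis
 have supp: "set_pmf (\<nu> j) \<subseteq> V j \<inter> cube" if j: "j \<in> {1..r}" for j
 proof
  fix x assume x: "x \<in> set_pmf (\<nu> j)"
  then have xc: "x \<in> cube" using \<nu>(2)[OF j] by auto
  have "x \<in> V j"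
  proof (rule ccontr)
   assume "x \<notin> V j"
   then have "pmf (M (t n) j) x = 0" for n using suppM[OF j, of n] by (auto simp: set_pmf_iff)
   then have "l (j, Some x) = 0" using limp[OF j xc] by (simp add: LIMSEQ_const_iff)
   then show False using x \<nu>(1)[OF j xc] by (simp add: set_pmf_iff)
  qed
  then show "x \<in> V j \<inter> cube" using xc by simp
 qed
 have sysl: "system r V c \<nu>"
  unfolding system_def
 proof (intro conjI ballI)
  have r1: "1 <= r" using syst[of 0] by (simp add: system_def)
  then show "c 1 <= 1" using syst by (intro LIMSEQ_le_const2[OF limc]) (auto simp: system_def)
  show "c (j + 1) <= c j" if "j \<in> {1..r}" for j
   using syst that by (intro LIMSEQ_le[OF limc limc]) (auto simp: system_def)
  show "0 <= c (r + 1)" using syst by (intro LIMSEQ_le_const[OF limc]) (auto simp: system_def)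
 qed (use syst[of 0] supp in \<open>simp_all add: system_def\<close>)
 have lime: "(%n. flag_entropy r V' (C (t n)) (M (t n))) \<longlonglongrightarrow> flag_entropy r V' c \<nu>" if "flag r V'" for V'
  unfolding flag_entropy_def
 proof (intro tendsto_add tendsto_sum tendsto_mult tendsto_diff tendsto_const limc)
  fix j assume j: "j \<in> {1..r}"
  show "(%n. coset_entropy (M (t n) j) (V' j)) \<longlonglongrightarrow> coset_entropy (\<nu> j) (V' j)"
   using suppM[OF j] \<nu>(2)[OF j] limp[OF j] \<nu>(1)[OF j] flag_subspace[OF that, of j] j
   by (intro coset_entropy_tendsto) auto
 qed auto
 have "entropy_condition r V c \<nu>"
  unfolding entropy_condition_def
 proof (intro allI impI)
  fix V' assume sub: "subflag r V' V"
  define V'' where "V'' j = vec.span (V' j \<inter> dcube)" for j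
  note d = subflag_dspans[OF sysl sub, folded V''_def]
  have sub'': "subflag (R (t n)) V'' (W (t n))" for n
   using d(1) We by (auto simp: subflag_def t_def Re)
  have eqW: "flag_entropy r (W (t n)) (C (t n)) (M (t n)) = flag_entropy r V (C (t n)) (M (t n))" for n
   unfolding t_def by (rule flag_entropy_cong) (rule We)
  have Rt: "R (t n) = r" for n by (simp add: t_def Re)
  have "flag_entropy r V (C (t n)) (M (t n)) - 1 / real (Suc n) <= flag_entropy r V'' (C (t n)) (M (t n))" for n
  proof -
   have "n <= t n" unfolding t_def using seq_suble[OF s, of n] seq_suble[OF e(1), of "s n"] by linarith
   then have "1 / real (Suc (t n)) <= 1 / real (Suc n)" by (simp add: frac_le)
   then show ?thesis using gap[OF sub'' d(3), of n] unfolding Rt eqW by linarith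
  qed
  moreover have "(%n. flag_entropy r V (C (t n)) (M (t n)) - 1 / real (Suc n)) \<longlonglongrightarrow> flag_entropy r V c \<nu> - 0"
   using sysl by (intro tendsto_diff lime LIMSEQ_Suc[OF lim_1_over_n]) (simp add: system_def)
  moreover have "(%n. flag_entropy r V'' (C (t n)) (M (t n))) \<longlonglongrightarrow> flag_entropy r V'' c \<nu>"
   using d(1) by (intro lime) (simp add: subflag_def)
  ultimately have "flag_entropy r V c \<nu> - 0 <= flag_entropy r V'' c \<nu>" by (intro LIMSEQ_le) auto
  then show "flag_entropy r V c \<nu> <= flag_entropy r V' c \<nu>" using d(2) by linarith
 qed
 moreover have "c (r + 1) = c0" by (simp add: c_def)
 ultimately show False using none[OF sysl] by blast
qed

section \<open>Upper bound: tools for counting solutions\<close>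

section \<open>Counting lemmas\<close>

text \<open>Coordinates are revealed in the order of t. Once those of strictly smaller rank are
  known, any two possible values of coordinate s differ by at most B s, which leaves B s + 1 values.
  Ties in t do no harm.\<close>

lemma card_successively_determined:
 fixes t :: "'i => nat" and B :: "'i => nat" and Om :: "('i => nat) set"
 assumes "finite S" "finite Om"
  and "!!p p' s. p \<in> Om ==> p' \<in> Om ==> s \<in> S ==> (!!s'. s' \<in> S ==> t s' < t s ==> p s' = p' s') ==> p s <= p' s + B s"
 shows "card ((%p. restrict p S) ` Om) <= (\<Prod>s\<in>S. B s + 1)"
 using assms(1,3)
proof (induction S rule: finite_ranking_induct[where f = t])
 case empty
 have "(%p. restrict p {}) ` Om \<subseteq> {%_. undefined}" by auto
 from card_mono[OF _ this] have "card ((%p. restrict p {}) ` Om) <= 1" by simp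
 then show ?case unfolding prod.empty .
next
 case (insert x S)
 show ?case
 proof (cases "x \<in> S")
  case True
  then show ?thesis using insert by (simp add: insert_absorb)
 next
  case False
  let ?R = "%p. restrict p S" and ?F = "%q. (%p. p x) ` {p \<in> Om. restrict p S = q}"
  have IH: "card (?R ` Om) <= (\<Prod>s\<in>S. B s + 1)"
  proof (rule insert.IH)
   fix p p' s assume p: "p \<in> Om" "p' \<in> Om" "s \<in> S" and eq: "!!s'. s' \<in> S ==> t s' < t s ==> p s' = p' s'"
   show "p s <= p' s + B s"
    using insert.hyps(2)[OF p(3)] eq p by (intro insert.prems) auto
  qed
  have fib: "card (?F q) <= B x + 1" for q
  proof (cases "?F q = {}")
   case False
   have fin: "finite (?F q)" using assms(2) by simp
   have "?F q \<subseteq> {Min (?F q)..Min (?F q) + B x}"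
   proof
    fix y assume y: "y \<in> ?F q"
    obtain p' where p': "p' \<in> Om" "restrict p' S = q" "Min (?F q) = p' x" using Min_in[OF fin False] by auto
    obtain p where p: "p \<in> Om" "restrict p S = q" "y = p x" using y by auto
    have "p s = p' s" if "s \<in> S" for s using p(2) p'(2) that by (metis restrict_apply')
    then have "p x <= p' x + B x" using p(1) p'(1) by (intro insert.prems) auto
    then show "y \<in> {Min (?F q)..Min (?F q) + B x}" using p(3) p'(3) Min_le[OF fin y] by simp
   qed
   from card_mono[OF _ this] show ?thesis by simp
  next
   case True
   then show ?thesis by (simp only: card.empty)
  qed
  have fin: "finite (SIGMA q:?R ` Om. ?F q)" using assms(2) by auto
  have "card ((%p. restrict p (insert x S)) ` Om) <= card (SIGMA q:?R ` Om. ?F q)"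
  proof (rule card_inj_on_le[where f = "%q. (restrict q S, q x)"])
   show "inj_on (%q. (restrict q S, q x)) ((%p. restrict p (insert x S)) ` Om)"
   proof (rule inj_onI)
    fix u v assume uv: "u \<in> (%p. restrict p (insert x S)) ` Om" "v \<in> (%p. restrict p (insert x S)) ` Om"
     and eq: "(restrict u S, u x) = (restrict v S, v x)"
    show "u = v"
    proof (rule extensionalityI[of _ "insert x S"])
     fix s assume "s \<in> insert x S"
     then show "u s = v s" using eq by (auto dest: fun_cong[of _ _ s])
    qed (use uv in auto)
   qed
   show "(%q. (restrict q S, q x)) ` (%p. restrict p (insert x S)) ` Om \<subseteq> (SIGMA q:?R ` Om. ?F q)"
   proof (intro image_subsetI SigmaI)
    fix u assume "u \<in> (%p. restrict p (insert x S)) ` Om"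
    then obtain p where p: "p \<in> Om" "u = restrict p (insert x S)" by auto
    have "restrict u S = restrict p S" using p by (auto simp: restrict_def fun_eq_iff)
    then show "restrict u S \<in> ?R ` Om" "u x \<in> ?F (restrict u S)" using p by auto
   qed
  qed (rule fin)
  also have "... = (\<Sum>q\<in>?R ` Om. card (?F q))" using assms(2) by (intro card_SigmaI) auto
  also have "... <= (\<Sum>q\<in>?R ` Om. B x + 1)" using fib by (intro sum_mono) blast
  also have "... = card (?R ` Om) * (B x + 1)" by simp
  also have "... <= (\<Prod>s\<in>S. B s + 1) * (B x + 1)" using IH by (rule mult_right_mono) simp
  also have "... = (\<Prod>s\<in>insert x S. B s + 1)" using False insert.hyps(1) by simp
  finally show ?thesis .
 qed
qed

text \<open>A type-class bound: under independent labels distributed with the frequencies prescribed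
  by N, every labelling that occurs has at least the probability exp (- E), E being the exponent in
  the claim, and probabilities sum to at most 1. N bounds the counts only from above because in the
  application it also counts the pivots.\<close>

lemma card_labellings_le:
 fixes N :: "'j => 'x => nat" and g :: "'j => 'x => 'x"
 assumes fin: "finite A" "finite X" "finite Lev" and J: "!!a. a \<in> A ==> J a \<in> Lev"
  and S: "!!om a. om \<in> S ==> a \<in> A ==> om a \<in> X"
  and N: "!!om j x. om \<in> S ==> j \<in> Lev ==> x \<in> X ==> card {a \<in> A. J a = j & om a = x} <= N j x"
 defines "q \<equiv> %j x. real (\<Sum>y\<in>{y \<in> X. g j y = g j x}. N j y) / real (\<Sum>y\<in>X. N j y)"
 shows "finite ((%om. \<lambda>a\<in>A. g (J a) (om a)) ` S)"
  and "real (card ((%om. \<lambda>a\<in>A. g (J a) (om a)) ` S)) <= exp (\<Sum>j\<in>Lev. \<Sum>x\<in>X. real (N j x) * (- ln (q j x)))"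
proof -
 let ?lab = "%om. \<lambda>a\<in>A. g (J a) (om a)"
 define Q where "Q j z = real (\<Sum>y\<in>{y \<in> X. g j y = z}. N j y) / real (\<Sum>y\<in>X. N j y)" for j z
 have qQ: "q j x = Q j (g j x)" for j x by (simp add: q_def Q_def)
 have Q0: "0 <= Q j z" for j z by (simp only: Q_def) (intro divide_nonneg_nonneg of_nat_0_le_iff)
 have Qsum: "(\<Sum>z\<in>g j ` X. Q j z) <= 1" for j
 proof -
  have "(\<Sum>z\<in>g j ` X. \<Sum>y\<in>{y \<in> X. g j y = z}. N j y) = (\<Sum>y\<in>X. N j y)"
   using fin by (intro sum.group) auto
  then have "(\<Sum>z\<in>g j ` X. Q j z) = real (\<Sum>y\<in>X. N j y) / real (\<Sum>y\<in>X. N j y)"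
   unfolding Q_def sum_divide_distrib[symmetric] of_nat_sum[symmetric] by simp
  then show ?thesis by simp
 qed
 let ?P = "Pi\<^sub>E A (%a. g (J a) ` X)"
 have finP: "finite ?P" using fin by (intro finite_PiE) auto
 have sub: "?lab ` S \<subseteq> ?P" using S by auto
 then show fin': "finite (?lab ` S)" using finP finite_subset by blast
 let ?E = "\<Sum>j\<in>Lev. \<Sum>x\<in>X. real (N j x) * (- ln (q j x))"
 have low: "exp (- ?E) <= (\<Prod>a\<in>A. Q (J a) (l a))" if l: "l \<in> ?lab ` S" for l
 proof -
  obtain om where om: "om \<in> S" "l = ?lab om" using l by auto
  let ?n = "%j x. card {a \<in> A. J a = j & om a = x}"
  have "exp (real (N j x) * ln (q j x)) <= (q j x) ^ ?n j x" if jx: "j \<in> Lev" "x \<in> X" for j x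
  proof (cases "N j x = 0")
   case True
   then show ?thesis using N[OF om(1) jx] by simp
  next
   case False
   have le: "N j x <= (\<Sum>y\<in>{y \<in> X. g j y = g j x}. N j y)" using jx fin by (intro member_le_sum) auto
   have "(\<Sum>y\<in>{y \<in> X. g j y = g j x}. N j y) <= (\<Sum>y\<in>X. N j y)" using fin by (intro sum_mono2) auto
   then have "q j x <= 1" unfolding q_def using False le by (subst divide_le_eq_1) (auto simp del: of_nat_sum)
   moreover have pos: "0 < q j x" unfolding q_def
    using False le \<open>(\<Sum>y\<in>{y \<in> X. g j y = g j x}. N j y) <= (\<Sum>y\<in>X. N j y)\<close>
    by (intro divide_pos_pos) (auto simp del: of_nat_sum)
   ultimately have "q j x ^ N j x <= q j x ^ ?n j x" using N[OF om(1) jx] by (intro power_decreasing) auto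
   then show ?thesis using pos by (simp add: exp_of_nat_mult)
  qed
  then have "(\<Prod>j\<in>Lev. \<Prod>x\<in>X. exp (real (N j x) * ln (q j x))) <= (\<Prod>j\<in>Lev. \<Prod>x\<in>X. (q j x) ^ ?n j x)"
   by (intro prod_mono conjI prod_nonneg) auto
  also have "(\<Prod>j\<in>Lev. \<Prod>x\<in>X. (q j x) ^ ?n j x) = (\<Prod>z\<in>Lev \<times> X. \<Prod>a\<in>{a \<in> A. (J a, om a) = z}. q (J a) (om a))"
   unfolding prod.cartesian_product by (intro prod.cong refl) (auto intro!: prod.cong)
  also have "... = (\<Prod>a\<in>A. q (J a) (om a))"
   using fin J S[OF om(1)] by (intro prod.group) auto
  also have "... = (\<Prod>a\<in>A. Q (J a) (l a))" unfolding om(2) qQ by (intro prod.cong) auto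
  finally show ?thesis using fin by (simp add: exp_sum sum_negf[symmetric])
 qed
 have "real (card (?lab ` S)) * exp (- ?E) = (\<Sum>l\<in>?lab ` S. exp (- ?E))" by simp
 also have "... <= (\<Sum>l\<in>?lab ` S. \<Prod>a\<in>A. Q (J a) (l a))" by (intro sum_mono low)
 also have "... <= (\<Sum>l\<in>?P. \<Prod>a\<in>A. Q (J a) (l a))" using sub finP Q0 by (intro sum_mono2) (auto intro: prod_nonneg)
 also have "... = (\<Prod>a\<in>A. \<Sum>z\<in>g (J a) ` X. Q (J a) z)"
  using fin by (subst prod_sum_PiE) auto
 also have "... <= 1" using Qsum Q0 by (intro prod_le_1) (auto intro: sum_nonneg)
 finally show "real (card (?lab ` S)) <= exp ?E" by (simp add: exp_minus field_simps)
qed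

section \<open>Linear functionals and greedy bases\<close>

lemma separating_functional:
 fixes U :: "(rat ^ 'k::finite) set"
 assumes U: "vec.subspace U" and f: "f \<notin> U"
 obtains \<phi> :: "rat ^ 'k => rat" where "!!x y. \<phi> (x + y) = \<phi> x + \<phi> y" "!!t x. \<phi> (t *s x) = t * \<phi> x"
  "!!x. x \<in> U ==> \<phi> x = 0" "\<phi> f = 1"
proof -
 obtain B where B: "B \<subseteq> U" "vec.independent B" "U \<subseteq> vec.span B" by (rule vec.basis_exists)
 have spB: "vec.span B = U" using B U vec.span_minimal by blast
 have indep: "vec.independent (insert f B)" using B f by (auto simp: vec.independent_insert spB)
 define E where "E = vec.extend_basis (insert f B)"
 have E: "vec.independent E" "insert f B \<subseteq> E" "vec.span E = UNIV"
  unfolding E_def using indep vec.independent_extend_basis vec.extend_basis_superset vec.span_extend_basis by auto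
 show ?thesis
 proof (rule that[of "%x. vec.representation E x f"])
  fix x assume "x \<in> U"
  then have "vec.representation E x = vec.representation B x"
   using E spB by (intro vec.representation_extend) auto
  then show "vec.representation E x f = 0" using vec.representation_ne_zero[of B x f] f B by auto
 qed (use E vec.representation_basis[OF E(1), of f] in \<open>auto simp: vec.representation_add vec.representation_scale\<close>)
qed

text \<open>There are finitely many pairs of a space U in \<open>dspans\<close> and a cube vector
  outside it, so one bound serves for functionals chosen for all of them.\<close>

lemma bounded_functionals:
 obtains \<Phi> :: real where "1 <= \<Phi>" "!!U f. U \<in> dspans ==> f \<in> cube ==> f \<notin> (U :: (rat ^ 'k::finite) set) ==>
  \<exists>\<phi>. (\<forall>x y. \<phi> (x + y) = \<phi> x + \<phi> y) & (\<forall>t x. \<phi> (t *s x) = t * \<phi> x) & (\<forall>x\<in>U. \<phi> x = 0) & \<phi> f = (1 :: rat) &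
   (\<forall>x\<in>dcube. \<bar>real_of_rat (\<phi> x)\<bar> <= \<Phi>)"
proof -
 let ?I = "{z \<in> dspans \<times> cube. snd z \<notin> fst z} :: ((rat ^ 'k) set \<times> (rat ^ 'k)) set"
 define lin where "lin z \<phi> \<longleftrightarrow> (\<forall>x y. \<phi> (x + y) = \<phi> x + \<phi> y) & (\<forall>t x. \<phi> (t *s x) = t * \<phi> x) & (\<forall>x\<in>fst z. \<phi> x = 0) & \<phi> (snd z) = (1 :: rat)"
  for z :: "(rat ^ 'k) set \<times> (rat ^ 'k)" and \<phi>
 have "\<forall>z\<in>?I. \<exists>\<phi>. lin z \<phi>"
 proof
  fix z assume z: "z \<in> ?I"
  then have "vec.subspace (fst z)" "snd z \<notin> fst z" by (auto intro: subspace_dspans)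
  from separating_functional[OF this] show "\<exists>\<phi>. lin z \<phi>" unfolding lin_def by metis
 qed
 from bchoice[OF this] obtain \<phi> where \<phi>: "!!z. z \<in> ?I ==> lin z (\<phi> z)" by blast
 define \<Phi> where "\<Phi> = Max (insert 1 ((%(z, x). \<bar>real_of_rat (\<phi> z x)\<bar>) ` (?I \<times> dcube)))"
 have finI: "finite (?I \<times> dcube)" by (intro finite_cartesian_product finite_subset[of ?I "dspans \<times> cube"]) auto
 show ?thesis
 proof (rule that[of \<Phi>])
  show "1 <= \<Phi>" unfolding \<Phi>_def using finI by (intro Max_ge) auto
  fix U and f :: "rat ^ 'k" assume U: "U \<in> dspans" "f \<in> cube" "f \<notin> U"
  then have I: "(U, f) \<in> ?I" by simp
  have "\<bar>real_of_rat (\<phi> (U, f) x)\<bar> <= \<Phi>" if "x \<in> dcube" for x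
   unfolding \<Phi>_def using finI I that by (intro Max_ge) (auto intro!: image_eqI[of _ _ "((U, f), x)"])
  then show "\<exists>\<phi>. (\<forall>x y. \<phi> (x + y) = \<phi> x + \<phi> y) & (\<forall>t x. \<phi> (t *s x) = t * \<phi> x) & (\<forall>x\<in>U. \<phi> x = 0) & \<phi> f = (1 :: rat) &
   (\<forall>x\<in>dcube. \<bar>real_of_rat (\<phi> x)\<bar> <= \<Phi>)"
   using \<phi>[OF I] unfolding lin_def by (intro exI[of _ "\<phi> (U, f)"]) simp
 qed
qed

lemma dim_Un_image_le:
 fixes U :: "(rat ^ 'k::finite) set"
 assumes "finite X" shows "vec.dim (U \<union> f ` X) <= vec.dim U + card X"
 using assms
proof (induction X rule: finite_induct)
 case (insert x X)
 then show ?case by (simp add: vec.dim_insert)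
qed simp

text \<open>The vectors are read from f j down to f 1, keeping those that are new modulo U and the
  ones already read. The direction matters: later pivots are smaller, and as j and U grow an index
  can leave this set but never return (\<open>greedy_antimono\<close>), so that each index has a
  threshold.\<close>

definition greedy :: "(rat ^ 'k::finite) set => (nat => rat ^ 'k) => nat => nat set" where
 "greedy U f j = {s \<in> {1..j}. f s \<notin> vec.span (U \<union> f ` {s<..j})}"

lemma greedy_antimono:
 assumes "U \<subseteq> U'" "j <= j'" "s \<in> greedy U' f j'" "s <= j" shows "s \<in> greedy U f j"
proof -
 have "vec.span (U \<union> f ` {s<..j}) \<subseteq> vec.span (U' \<union> f ` {s<..j'})"
  using assms by (intro vec.span_mono Un_mono image_mono) auto
 then show ?thesis using assms by (auto simp: greedy_def)
qed

lemma greedy_dim: "vec.dim (U \<union> f ` {1..j}) = vec.dim (U :: (rat ^ 'k::finite) set) + card (greedy U f j)"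
 and greedy_independent: "s \<in> greedy U f j ==> f s \<notin> vec.span (U \<union> f ` (greedy U f j - {s}))"
proof -
 let ?P = "greedy U f j"
 have fin: "finite {s \<in> ?P. i < s}" for i by (rule finite_subset[of _ "{1..j}"]) (auto simp: greedy_def)
 have main: "vec.span (U \<union> f ` {i<..j}) = vec.span (U \<union> f ` {s \<in> ?P. i < s}) &
   vec.dim (U \<union> f ` {i<..j}) = vec.dim U + card {s \<in> ?P. i < s}" if "i <= j" for i
  using that
 proof (induction i rule: inc_induct)
  case base
  have e: "{s \<in> ?P. j < s} = {}" by (auto simp: greedy_def)
  show ?case unfolding e by simp
 next
  case (step n)
  have set: "{n<..j} = insert (Suc n) {Suc n<..j}" using step by auto
  have U1: "U \<union> f ` {n<..j} = insert (f (Suc n)) (U \<union> f ` {Suc n<..j})" unfolding set by simp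
  show ?case
  proof (cases "Suc n \<in> ?P")
   case True
   then have nin: "f (Suc n) \<notin> vec.span (U \<union> f ` {Suc n<..j})" by (simp add: greedy_def)
   have P: "{s \<in> ?P. n < s} = insert (Suc n) {s \<in> ?P. Suc n < s}" using True by (auto simp: Suc_lessI)
   have U2: "U \<union> f ` {s \<in> ?P. n < s} = insert (f (Suc n)) (U \<union> f ` {s \<in> ?P. Suc n < s})" unfolding P by simp
   have "card {s \<in> ?P. n < s} = Suc (card {s \<in> ?P. Suc n < s})" unfolding P using fin by (subst card_insert_disjoint) auto
   moreover have "vec.span (U \<union> f ` {n<..j}) = vec.span (U \<union> f ` {s \<in> ?P. n < s})"
    unfolding U1 U2 using step.IH by (simp only: vec.span_insert)
   ultimately show ?thesis using step.IH nin unfolding U1 by (simp add: vec.dim_insert)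
  next
   case False
   then have inn: "f (Suc n) \<in> vec.span (U \<union> f ` {Suc n<..j})" using step by (auto simp: greedy_def)
   have P: "{s \<in> ?P. n < s} = {s \<in> ?P. Suc n < s}" using False by (metis Suc_lessI Suc_lessD)
   show ?thesis using step.IH inn unfolding U1 P by (simp add: vec.dim_insert vec.span_redundant)
  qed
 qed
 have P0: "{s \<in> ?P. 0 < s} = ?P" by (auto simp: greedy_def)
 have I0: "{0<..j} = {1..j}" by auto
 show dim: "vec.dim (U \<union> f ` {1..j}) = vec.dim U + card ?P" using main[of 0] unfolding P0 I0 by simp
 have sp: "vec.span (U \<union> f ` {1..j}) = vec.span (U \<union> f ` ?P)" using main[of 0] unfolding P0 I0 by simp
 show "f s \<notin> vec.span (U \<union> f ` (?P - {s}))" if s: "s \<in> ?P"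
 proof
  assume "f s \<in> vec.span (U \<union> f ` (?P - {s}))"
  then have "vec.span (insert (f s) (U \<union> f ` (?P - {s}))) = vec.span (U \<union> f ` (?P - {s}))" by (rule vec.span_redundant)
  moreover have "insert (f s) (U \<union> f ` (?P - {s})) = U \<union> f ` ?P" using s by auto
  ultimately have "vec.dim (U \<union> f ` ?P) = vec.dim (U \<union> f ` (?P - {s}))" by (metis vec.dim_span)
  also have "... <= vec.dim U + card (?P - {s})" using fin[of 0] unfolding P0 by (intro dim_Un_image_le) auto
  also have "... < vec.dim U + card ?P" using s fin[of 0] unfolding P0 by (simp only: nat_add_left_cancel_less card_Diff1_less)
  also have "... = vec.dim (U \<union> f ` ?P)" using dim sp by (metis vec.dim_span)
  finally show False by simp
 qed
qed

section \<open>Typical random sets\<close>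

text \<open>Only upper bounds are required: an excess of elements would inflate the number of
  labellings, whereas a deficit is harmless.\<close>

definition typical :: "real => real => nat set => bool" where
 "typical eps L A \<longleftrightarrow> (\<forall>x y. 0 <= x & x <= y & y <= L \<longrightarrow> real (card (A \<inter> expint x y)) <= y - x + eps * L)"

text \<open>Intervals are rounded outwards to a grid of mesh L / M with M fixed, so Chebyshev's
  inequality is used for boundedly many intervals. Uniformity in G holds because the harmonic sum of
  a subset of an interval is at most that of the interval.\<close>

lemma prb_not_typical:
 assumes eps: "0 < eps" and \<eta>: "0 < \<eta>"
 shows "eventually (%L. \<forall>G. finite G \<longrightarrow> prb G (%A. \<not> typical eps L A) <= \<eta>) at_top"
proof -
 obtain M :: nat where M: "4 / eps < real M" using reals_Archimedean2 by blast
 have M0: "0 < real M" using M eps by (meson divide_pos_pos less_trans zero_less_numeral)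
 have M4: "4 <= eps * real M" using M eps by (simp add: field_simps)
 let ?L0 = "max (max 1 (4 / eps)) (32 * (real M + 1)\<^sup>2 / (eps\<^sup>2 * \<eta>))"
 have "\<forall>G. finite G \<longrightarrow> prb G (%A. \<not> typical eps L A) <= \<eta>" if L: "?L0 <= L" for L
 proof (intro allI impI)
  fix G :: "nat set" assume G: "finite G"
  have L1: "1 <= L" "4 / eps <= L" "32 * (real M + 1)\<^sup>2 / (eps\<^sup>2 * \<eta>) <= L" using L by auto
  then have L4: "4 <= eps * L" using eps by (simp add: field_simps)
  define h where "h = L / real M"
  have h: "0 < h" "real M * h = L" using L1 M0 by (auto simp: h_def)
  have h4: "4 * h <= eps * L" using M4 h mult_right_mono[OF M4, of h] by (simp add: mult.assoc)
  define H where "H z = G \<inter> expint (real (fst z) * h) (real (snd z) * h)" for z :: "nat \<times> nat"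
  define t where "t = eps * L / 4"
  have t: "0 < t" using eps L1 by (simp add: t_def)
  let ?Z = "{z \<in> {0..M} \<times> {0..M}. fst z <= snd z}"
  have finZ: "finite ?Z" by simp
  have hs: "hsum (H z) <= real (snd z) * h - real (fst z) * h + 1" if "z \<in> ?Z" for z
  proof -
   have "hsum (H z) <= hsum (expint (real (fst z) * h) (real (snd z) * h))"
    unfolding hsum_def H_def by (intro sum_mono2) auto
   also have "... <= real (snd z) * h - real (fst z) * h + 1"
    using that h by (intro hsum_expint_le mult_right_mono) auto
   finally show ?thesis .
  qed
  have finH: "finite (H z)" for z by (simp add: H_def)
  have "prb G (%A. \<not> typical eps L A) <= prb G (%A. \<exists>z\<in>?Z. t <= \<bar>real (card (A \<inter> H z)) - hsum (H z)\<bar>)"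
  proof (rule prb_mono)
   fix A assume A: "A \<subseteq> G" and nt: "\<not> typical eps L A"
   obtain x y where xy: "0 <= x" "x <= y" "y <= L" "y - x + eps * L < real (card (A \<inter> expint x y))"
    using nt by (auto simp: typical_def not_le)
   define i where "i = nat \<lfloor>x / h\<rfloor>"
   define j where "j = nat \<lceil>y / h\<rceil>"
   have x0: "0 <= x / h" and y0: "0 <= y / h" using xy h by auto
   have ri: "real i <= x / h" "x / h < real i + 1" unfolding i_def using x0 by (simp_all add: of_nat_nat)
   have rj: "y / h <= real j" "real j < y / h + 1" unfolding j_def using y0 by (simp_all add: of_nat_nat; linarith)+
   have ih: "real i * h <= x" "x < real i * h + h" using ri h by (auto simp: field_simps)
   have jh: "y <= real j * h" "real j * h < y + h" using rj h by (auto simp: field_simps)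
   have "real i * h <= real j * h" using ih jh xy by linarith
   then have ij: "i <= j" using h by simp
   have "y / h <= real M" using xy h by (simp add: field_simps)
   then have jM: "j <= M" unfolding j_def by (simp add: ceiling_le_iff nat_le_iff)
   have "A \<inter> expint x y \<subseteq> A \<inter> H (i, j)"
   proof -
    have "exp (real i * h) <= exp x" "exp y <= exp (real j * h)" using ih jh by auto
    then show ?thesis using A unfolding H_def expint_def by (auto intro: le_less_trans order_trans)
   qed
   then have "card (A \<inter> expint x y) <= card (A \<inter> H (i, j))" using finH by (intro card_mono) auto
   then have c: "y - x + eps * L < real (card (A \<inter> H (i, j)))" using xy(4) by linarith
   have z: "(i, j) \<in> ?Z" using ij jM by auto
   have "hsum (H (i, j)) <= y - x + 2 * h + 1" using hs[OF z] ih jh by simp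
   then have "t <= \<bar>real (card (A \<inter> H (i, j))) - hsum (H (i, j))\<bar>" using c h4 L4 unfolding t_def by linarith
   then show "\<exists>z\<in>?Z. t <= \<bar>real (card (A \<inter> H z)) - hsum (H z)\<bar>" using z by blast
  qed
  also have "... <= (\<Sum>z\<in>?Z. prb G (%A. t <= \<bar>real (card (A \<inter> H z)) - hsum (H z)\<bar>))" by (rule prb_Bex[OF finZ])
  also have "... <= (\<Sum>z\<in>?Z. (L + 1) / t\<^sup>2)"
  proof (rule sum_mono)
   fix z assume z: "z \<in> ?Z"
   have "prb G (%A. t <= \<bar>real (card (A \<inter> H z)) - hsum (H z)\<bar>) = prb (H z) (%A. t <= \<bar>real (card A) - hsum (H z)\<bar>)"
    by (rule expect_Int[OF G]) (simp add: H_def)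
   also have "... <= hsum (H z) / t\<^sup>2" by (rule prb_card_deviation[OF finH t])
   also have "... <= (L + 1) / t\<^sup>2"
   proof (rule divide_right_mono)
    have "real (snd z) * h <= real M * h" "0 <= real (fst z) * h" using z h by auto
    then show "hsum (H z) <= L + 1" using hs[OF z] h by linarith
   qed simp
   finally show "prb G (%A. t <= \<bar>real (card (A \<inter> H z)) - hsum (H z)\<bar>) <= (L + 1) / t\<^sup>2" .
  qed
  also have "... <= (real M + 1)\<^sup>2 * ((L + 1) / t\<^sup>2)"
  proof -
   have "card ?Z <= card ({0..M} \<times> {0..M})" by (intro card_mono) auto
   then have "real (card ?Z) <= real ((M + 1) * (M + 1))" by (simp only: of_nat_le_iff) (simp add: card_cartesian_product)
   then have "real (card ?Z) <= (real M + 1)\<^sup>2" by (simp add: power2_eq_square algebra_simps)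
   then show ?thesis using L1 by (simp only: sum_constant) (intro mult_right_mono, auto)
  qed
  also have "... <= (real M + 1)\<^sup>2 * (2 * L / t\<^sup>2)" using L1 by (intro mult_left_mono divide_right_mono) auto
  also have "... = 32 * (real M + 1)\<^sup>2 / (eps\<^sup>2 * L)" using L1 eps by (simp add: t_def field_simps power2_eq_square)
  also have "... <= \<eta>" using L1(1,3) eps \<eta> by (simp add: field_simps)
  finally show "prb G (%A. \<not> typical eps L A) <= \<eta>" .
 qed
 then show ?thesis unfolding eventually_at_top_linorder by blast
qed

section \<open>Upper bound: pivots and the system attached to a solution\<close>

section \<open>Pivots\<close>

text \<open>For decreasing pivots, level j means that a is at most the j-th pivot but larger than
  the next one.\<close>

definition level :: "nat => (nat => nat) => nat => nat" where
 "level r p a = card {s \<in> {1..r}. a <= p s}"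

definition pflag :: "nat => (nat => rat ^ 'k::finite) => nat => (rat ^ 'k) set" where
 "pflag r f j = vec.span (insert ones (f ` {1..min j r}))"

definition pivots :: "nat set => (nat => rat ^ 'k::finite) => nat => (nat => nat) => bool" where
 "pivots A om r p \<longleftrightarrow> (\<forall>s\<in>{1..r}. p s \<in> A) & (\<forall>s s'. 1 <= s & s < s' & s' <= r \<longrightarrow> p s' < p s) &
  (\<forall>j\<in>{1..r}. om (p j) \<notin> pflag r (om \<circ> p) (j - 1)) &
  (\<forall>a\<in>A. om a \<in> pflag r (om \<circ> p) (level r p a))"

lemma level_le: "level r p a <= r"
proof -
 have "level r p a <= card {1..r}" unfolding level_def by (intro card_mono) auto
 then show ?thesis by simp
qed

lemma le_level_iff:
 assumes "!!s s'. 1 <= s ==> s < s' ==> s' <= r ==> p s' < (p s :: nat)" "s \<in> {1..r}"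
 shows "s <= level r p a \<longleftrightarrow> a <= p s"
proof
 assume a: "a <= p s"
 have "{1..s} \<subseteq> {s \<in> {1..r}. a <= p s}"
 proof
  fix i assume i: "i \<in> {1..s}"
  then have "i = s \<or> p s < p i" using assms(1)[of i s] assms(2) by (cases "i = s") auto
  then show "i \<in> {s \<in> {1..r}. a <= p s}" using a i assms(2) by auto
 qed
 from card_mono[OF _ this] show "s <= level r p a" by (simp add: level_def)
next
 assume s: "s <= level r p a"
 show "a <= p s"
 proof (rule ccontr)
  assume "\<not> a <= p s"
  then have less: "p s < a" by simp
  have "{s \<in> {1..r}. a <= p s} \<subseteq> {1..<s}"
  proof
   fix i assume i: "i \<in> {s \<in> {1..r}. a <= p s}"
   then have "\<not> s < i" using assms(1)[of s i] assms(2) less by auto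
   moreover have "i ~= s" using i less by auto
   ultimately show "i \<in> {1..<s}" using i by simp
  qed
  from card_mono[OF _ this] have "level r p a < s" using assms(2) by (auto simp: level_def)
  then show False using s by simp
 qed
qed

lemma pflag_mono: "i <= j ==> pflag r f i \<subseteq> pflag r f j"
 unfolding pflag_def by (intro vec.span_mono insert_mono image_mono) auto

text \<open>Elements are added in decreasing order. The new minimum either has its vector in the
  space reached so far or becomes the last pivot, and in neither case do the levels of the larger
  elements change.\<close>

lemma pivots_exist:
 assumes "finite A" shows "\<exists>r p. pivots A (om :: nat => rat ^ 'k::finite) r p"
 using assms
proof (induction A rule: finite_linorder_min_induct)
 case empty
 show ?case by (intro exI[of _ 0]) (simp add: pivots_def)
next
 case (insert b A)
 then obtain r p where p: "pivots A om r p" by blast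
 have bp: "b < p s" if "s \<in> {1..r}" for s using insert.hyps(2) p that by (auto simp: pivots_def)
 show ?case
 proof (cases "om b \<in> pflag r (om \<circ> p) r")
  case True
  have "{s \<in> {1..r}. b <= p s} = {1..r}" using bp by (auto intro: less_imp_le)
  then have "level r p b = r" by (simp add: level_def)
  then have "pivots (insert b A) om r p" using p True by (simp add: pivots_def)
  then show ?thesis by blast
 next
  case False
  define p' where "p' = p(Suc r := b)"
  have pf: "pflag (Suc r) (om \<circ> p') j = pflag r (om \<circ> p) j" if "j <= r" for j
  proof -
   have "(om \<circ> p') ` {1..j} = (om \<circ> p) ` {1..j}" using that by (intro image_cong) (auto simp: p'_def)
   then show ?thesis using that by (simp add: pflag_def min_absorb1)
  qed
  have lev: "level (Suc r) p' a = level r p a" if "b < a" for a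
  proof -
   have "{s \<in> {1..Suc r}. a <= p' s} = {s \<in> {1..r}. a <= p s}" using that by (auto simp: p'_def le_Suc_eq)
   then show ?thesis by (simp add: level_def)
  qed
  have "{s \<in> {1..Suc r}. b <= p' s} = {1..Suc r}" using bp by (auto simp: p'_def le_Suc_eq intro: less_imp_le)
  then have levb: "level (Suc r) p' b = Suc r" by (simp add: level_def)
  have "pivots (insert b A) om (Suc r) p'"
   unfolding pivots_def
  proof (intro conjI ballI allI impI)
   fix s assume "s \<in> {1..Suc r}" then show "p' s \<in> insert b A" using p by (auto simp: p'_def pivots_def)
  next
   fix s s' assume "1 <= s & s < s' & s' <= Suc r"
   then show "p' s' < p' s" using p bp[of s] by (auto simp: p'_def pivots_def)
  next
   fix j assume j: "j \<in> {1..Suc r}"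
   then have "pflag (Suc r) (om \<circ> p') (j - 1) = pflag r (om \<circ> p) (j - 1)" by (intro pf) auto
   then show "om (p' j) \<notin> pflag (Suc r) (om \<circ> p') (j - 1)" using p False j by (auto simp: p'_def pivots_def)
  next
   fix a assume a: "a \<in> insert b A"
   show "om a \<in> pflag (Suc r) (om \<circ> p') (level (Suc r) p' a)"
   proof (cases "a = b")
    case True
    have "om b = (om \<circ> p') (Suc r)" by (simp add: p'_def)
    then show ?thesis unfolding True levb pflag_def by (intro vec.span_base) force
   next
    case False
    then have "a \<in> A" "b < a" using a insert.hyps by auto
    then show ?thesis using p pf[OF level_le] by (simp add: lev pivots_def)
   qed
  qed
  then show ?thesis by blast
 qed
qed

text \<open>Here \<kappa> j will be the integer part of the logarithm of the j-th pivot, so that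
  only O(L) values are possible. The maximum with c0 repairs what rounding down may violate, and the
  default c0 makes the last exponent exact.\<close>

definition pexp :: "real => real => nat => (nat => nat) => nat => real" where
 "pexp L c0 r \<kappa> j = (if j \<in> {1..r} then max (real (\<kappa> j) / L) c0 else c0)"

text \<open>Empirical distribution of the vectors at level j. For 1 <= j <= r this level is
  nonempty, since it contains the j-th pivot.\<close>

definition pmeasure :: "nat set => (nat => rat ^ 'k::finite) => nat => (nat => nat) => nat => (rat ^ 'k) pmf" where
 "pmeasure A om r p j = map_pmf om (pmf_of_set {a \<in> A. level r p a = j})"

lemma pivots_system:
 fixes om :: "nat => rat ^ 'k::finite"
 assumes k: "2 <= CARD('k)" and A: "finite A" and piv: "pivots A om r p" and L: "0 < L" and c0: "0 <= c0" "c0 <= 1"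
  and range: "!!a. a \<in> A ==> 1 <= a & ln (real a) <= L" and cube: "!!a. om a \<in> cube"
  and sep: "!!i i'. i ~= i' ==> \<exists>a\<in>A. om a $ i ~= om a $ i'"
 shows "system r (pflag r (om \<circ> p)) (pexp L c0 r (%s. nat \<lfloor>ln (real (p s))\<rfloor>)) (pmeasure A om r p)"
proof -
 let ?V = "pflag r (om \<circ> p)" and ?c = "pexp L c0 r (%s. nat \<lfloor>ln (real (p s))\<rfloor>)"
 have pA: "p s \<in> A" if "s \<in> {1..r}" for s using piv that by (auto simp: pivots_def)
 have dec: "p s' < p s" if "1 <= s" "s < s'" "s' <= r" for s s' using piv that by (auto simp: pivots_def)
 have new: "om (p j) \<notin> ?V (j - 1)" if "j \<in> {1..r}" for j using piv that by (auto simp: pivots_def)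
 have V0: "?V 0 = vec.span {ones}" by (simp add: pflag_def)
 have inVr: "om a \<in> ?V r" if "a \<in> A" for a
  using piv that pflag_mono[OF level_le[of r p a], of r "om \<circ> p"] by (auto simp: pivots_def)
 have nd: "nondegenerate r ?V"
  unfolding nondegenerate_def
 proof (intro allI impI notI)
  fix i i' :: 'k assume "i ~= i'" and sub: "?V r \<subseteq> {x. x $ i = x $ i'}"
  then show False using sep[of i i'] inVr by blast
 qed
 \<comment> \<open>With r = 0 the flag would be the line of \<open>ones\<close>, which is degenerate
   as soon as there are two coordinates.\<close>
 have r1: "1 <= r"
 proof (rule ccontr)
  assume "\<not> 1 <= r"
  then have r0: "r = 0" by simp
  obtain i i' :: 'k where "i ~= i'"
  proof -
   have "\<not> is_singleton (UNIV :: 'k set)" using k by (auto simp: is_singleton_altdef)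
   then show ?thesis using that by (metis UNIV_I is_singletonI' empty_not_UNIV)
  qed
  moreover have "?V r \<subseteq> {x. x $ i = x $ i'}" using V0 r0 by (auto simp: span_ones_iff)
  ultimately show False using nd unfolding nondegenerate_def by blast
 qed
 have kap: "nat \<lfloor>ln (real (p s'))\<rfloor> <= nat \<lfloor>ln (real (p s))\<rfloor>" if "1 <= s" "s < s'" "s' <= r" for s s'
 proof -
  have "1 <= p s'" using range[OF pA, of s'] that by simp
  then have "ln (real (p s')) <= ln (real (p s))" using dec[OF that] by simp
  then show ?thesis by (intro nat_mono floor_mono)
 qed
 show ?thesis
  unfolding system_def flag_def
 proof (intro conjI allI impI ballI)
  show "inj_on ?V {0..r}"
  proof (rule linorder_inj_onI)
   fix i j assume ij: "i < j" "i \<in> {0..r}" "j \<in> {0..r}"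
   have "(om \<circ> p) j \<in> ?V j" unfolding pflag_def using ij by (intro vec.span_base) auto
   moreover have "?V i \<subseteq> ?V (j - 1)" using ij by (intro pflag_mono) auto
   then have "(om \<circ> p) j \<notin> ?V i" using new[of j] ij by auto
   ultimately show "?V i ~= ?V j" by blast
  qed auto
  fix j
  show "vec.subspace (?V j)" by (simp add: pflag_def)
  show "?V j \<subseteq> ?V (Suc j)" by (rule pflag_mono) simp
  show "\<exists>S\<subseteq>cube. ?V j = vec.span S" unfolding pflag_def
   using cube ones_in_cube by (intro exI[of _ "insert ones ((om \<circ> p) ` {1..min j r})"]) auto
 next
  have "1 <= p 1" "ln (real (p 1)) <= L" using range[OF pA, of 1] r1 by auto
  then have "real (nat \<lfloor>ln (real (p 1))\<rfloor>) <= L" by (simp add: of_nat_floor order_trans[OF of_int_floor_le])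
  then show "?c 1 <= 1" using c0 L r1 by (simp add: pexp_def field_simps)
  show "0 <= ?c (r + 1)" using c0 by (simp add: pexp_def)
  fix j assume j: "j \<in> {1..r}"
  show "?c (j + 1) <= ?c j"
  proof (cases "j + 1 <= r")
   case True
   have "real (nat \<lfloor>ln (real (p (j + 1)))\<rfloor>) / L <= real (nat \<lfloor>ln (real (p j))\<rfloor>) / L"
    using kap[of j "j + 1"] True j L by (intro divide_right_mono) (simp_all only: of_nat_le_iff, auto)
   then show ?thesis using True j by (auto simp: pexp_def)
  qed (use j in \<open>simp add: pexp_def\<close>)
  have "p j \<in> {a \<in> A. level r p a = j}"
  proof -
   have "j <= level r p (p j)" by (subst le_level_iff) (use dec j in auto)
   moreover have "\<not> j + 1 <= level r p (p j)"
   proof (cases "j + 1 <= r")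
    case True
    then show ?thesis by (subst le_level_iff) (use dec j in \<open>auto simp: not_le\<close>)
   qed (use level_le[of r p "p j"] in linarith)
   ultimately show ?thesis using pA[OF j] by auto
  qed
  then have "set_pmf (pmf_of_set {a \<in> A. level r p a = j}) = {a \<in> A. level r p a = j}"
   using A by (intro set_pmf_of_set) auto
  then show "set_pmf (pmeasure A om r p j) \<subseteq> ?V j \<inter> cube"
   using piv cube by (auto simp: pmeasure_def pivots_def)
 qed (use r1 V0 nd in auto)
qed

text \<open>The functional \<phi> is applied to both relations and the results are subtracted.
  Elements whose labels agree disappear because \<phi> vanishes on W, and a pivot up to j other than
  s has \<phi> = 0 or the same value in both solutions. All that is left besides pivot s has size at
  most E, so the two values of that pivot differ by at most E up to a factor linear in the number of
  elements.\<close>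

lemma pivot_difference:
 fixes om om' :: "nat => rat ^ 'k::finite" and f :: "nat => rat ^ 'k"
 assumes A: "finite A" and p: "inj_on p {1..r}" "p ` {1..r} \<inter> A = {}" "!!s. s \<in> {1..r} ==> om (p s) = f s"
  and p': "inj_on p' {1..r}" "p' ` {1..r} \<inter> A = {}" "!!s. s \<in> {1..r} ==> om' (p' s) = f s"
  and rel: "(\<Sum>a\<in>A \<union> p ` {1..r}. of_nat a *s om a) \<in> vec.span {ones}"
  and rel': "(\<Sum>a\<in>A \<union> p' ` {1..r}. of_nat a *s om' a) \<in> vec.span {ones}"
  and cube: "!!a. om a \<in> cube" "!!a. om' a \<in> cube" and j: "j <= r" and s: "s \<in> {1..j}" and E: "0 <= E"
  and W: "vec.subspace W" "ones \<in> W" and lab: "!!a. a \<in> A ==> om a - om' a \<in> W \<or> real a <= E"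
  and big: "!!i. i \<in> {j<..r} ==> real (p i) <= E" "!!i. i \<in> {j<..r} ==> real (p' i) <= E"
  and add: "!!x y. \<phi> (x + y) = \<phi> x + \<phi> y" and scale: "!!t x. \<phi> (t *s x) = t * (\<phi> x :: rat)"
  and \<phi>W: "!!x. x \<in> W ==> \<phi> x = 0" and \<phi>s: "\<phi> (f s) = 1"
  and \<phi>0: "!!i. i \<in> {1..j} - {s} ==> \<phi> (f i) = 0 \<or> p i = p' i"
  and \<phi>b: "!!x. x \<in> dcube ==> \<bar>real_of_rat (\<phi> x)\<bar> <= \<Phi>" and \<Phi>: "0 <= \<Phi>"
 shows "real (p s) <= real (p' s) + \<Phi> * E * (real (card A) + real r)"
proof -
 have \<phi>z: "\<phi> 0 = 0" using \<phi>W[of 0] W by (simp add: vec.subspace_0)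
 have \<phi>sum: "\<phi> (sum g X) = (\<Sum>x\<in>X. \<phi> (g x))" if "finite X" for g :: "nat => rat ^ 'k" and X
  using that by (induction X rule: finite_induct) (auto simp: \<phi>z add)
 have spW: "vec.span {ones} \<subseteq> W" using W by (intro vec.span_minimal) auto
 have key: "(\<Sum>a\<in>A. of_nat a * \<phi> (w a)) + (\<Sum>i\<in>{1..r}. of_nat (q i) * \<phi> (f i)) = 0"
  if q: "inj_on q {1..r}" "q ` {1..r} \<inter> A = {}" "!!s. s \<in> {1..r} ==> w (q s) = f s"
   "(\<Sum>a\<in>A \<union> q ` {1..r}. of_nat a *s w a) \<in> vec.span {ones}" for q w
 proof -
  have "0 = \<phi> (\<Sum>a\<in>A \<union> q ` {1..r}. of_nat a *s w a)" using \<phi>W q(4) spW by (metis subsetD)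
  also have "... = (\<Sum>a\<in>A \<union> q ` {1..r}. of_nat a * \<phi> (w a))" using A by (subst \<phi>sum) (auto simp: scale)
  also have "... = (\<Sum>a\<in>A. of_nat a * \<phi> (w a)) + (\<Sum>a\<in>q ` {1..r}. of_nat a * \<phi> (w a))"
   using A q(2) by (intro sum.union_disjoint) auto
  also have "(\<Sum>a\<in>q ` {1..r}. of_nat a * \<phi> (w a)) = (\<Sum>i\<in>{1..r}. of_nat (q i) * \<phi> (f i))"
   using q(1,3) by (subst sum.reindex) (auto intro!: sum.cong)
  finally show ?thesis by simp
 qed
 define x where "x i = real_of_rat ((of_nat (p i) - of_nat (p' i)) * \<phi> (f i))" for i
 define y where "y a = real_of_rat (of_nat a * \<phi> (om a - om' a))" for a
 have \<phi>diff: "\<phi> (u - v) = \<phi> u - \<phi> v" for u v using add[of "u - v" v] by simp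
 have "(\<Sum>a\<in>A. of_nat a * \<phi> (om a - om' a)) + (\<Sum>i\<in>{1..r}. (of_nat (p i) - of_nat (p' i)) * \<phi> (f i)) = 0"
  using key[OF p rel] key[OF p' rel'] by (simp add: \<phi>diff algebra_simps sum_subtractf)
 then have "real_of_rat ((\<Sum>a\<in>A. of_nat a * \<phi> (om a - om' a)) + (\<Sum>i\<in>{1..r}. (of_nat (p i) - of_nat (p' i)) * \<phi> (f i))) = 0"
  by simp
 then have "sum y A + sum x {1..r} = 0" unfolding x_def y_def by (simp only: of_rat_add of_rat_sum)
 moreover have "sum x {1..r} = x s + sum x {j<..r}"
 proof -
  have "sum x {1..r} = sum x ({1..j} \<union> {j<..r})" using j by (intro sum.cong) auto
  also have "... = sum x {1..j} + sum x {j<..r}" by (intro sum.union_disjoint) auto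
  also have "sum x {1..j} = x s + sum x ({1..j} - {s})" using s by (intro sum.remove) auto
  also have "sum x ({1..j} - {s}) = 0" using \<phi>0 by (intro sum.neutral ballI) (force simp: x_def)
  finally show ?thesis by simp
 qed
 moreover have "x s = real (p s) - real (p' s)" by (simp add: x_def \<phi>s of_rat_diff)
 moreover have "\<bar>sum y A\<bar> <= real (card A) * (\<Phi> * E)"
 proof -
  have "\<bar>y a\<bar> <= \<Phi> * E" if a: "a \<in> A" for a
  proof (cases "om a - om' a \<in> W")
   case True
   then show ?thesis using E \<Phi> by (simp add: y_def \<phi>W)
  next
   case False
   have "\<bar>real_of_rat (\<phi> (om a - om' a))\<bar> * real a <= \<Phi> * E"
    using lab[OF a] False \<Phi> by (intro mult_mono \<phi>b diff_in_dcube cube) auto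
   then show ?thesis by (simp add: y_def of_rat_mult abs_mult mult.commute)
  qed
  then have "(\<Sum>a\<in>A. \<bar>y a\<bar>) <= real (card A) * (\<Phi> * E)" by (intro sum_bounded_above)
  then show ?thesis using sum_abs[of y A] by linarith
 qed
 moreover have "\<bar>sum x {j<..r}\<bar> <= real r * (\<Phi> * E)"
 proof -
  have "\<bar>x i\<bar> <= \<Phi> * E" if i: "i \<in> {j<..r}" for i
  proof -
   have "i \<in> {1..r}" using i by auto
   from p(3)[OF this] have "f i \<in> dcube" using cube(1)[of "p i"] cube_subset_dcube by auto
   moreover have "\<bar>real (p i) - real (p' i)\<bar> <= E" using big[OF i] E by linarith
   ultimately have "\<bar>real_of_rat (\<phi> (f i))\<bar> * \<bar>real (p i) - real (p' i)\<bar> <= \<Phi> * E"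
    using \<Phi> by (intro mult_mono \<phi>b) auto
   then show ?thesis by (simp add: x_def of_rat_mult of_rat_diff abs_mult mult.commute)
  qed
  then have "(\<Sum>i\<in>{j<..r}. \<bar>x i\<bar>) <= real (card {j<..r}) * (\<Phi> * E)" by (intro sum_bounded_above)
  then have "\<bar>sum x {j<..r}\<bar> <= real (card {j<..r}) * (\<Phi> * E)" using sum_abs[of x "{j<..r}"] by linarith
  also have "... <= real r * (\<Phi> * E)" using E \<Phi> by (intro mult_right_mono) auto
  finally show ?thesis .
 qed
 ultimately have "real (p s) - real (p' s) <= real (card A) * (\<Phi> * E) + real r * (\<Phi> * E)" by linarith
 then show ?thesis by (simp add: algebra_simps)
qed

section \<open>Upper bound: total weight of the pivot sets with the same data\<close>

section \<open>Pivot sets with prescribed data\<close>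

text \<open>A canonical cube vector of the coset x + W; it serves as label of x.\<close>

definition rep :: "(rat ^ 'k::finite) set => rat ^ 'k => rat ^ 'k" where
 "rep W x = (SOME y. y \<in> cube & y - x \<in> W)"

lemma rep_eq_iff:
 assumes W: "vec.subspace W" and x: "x \<in> cube" "x' \<in> cube"
 shows "rep W x = rep W x' \<longleftrightarrow> x - x' \<in> (W :: (rat ^ 'k::finite) set)"
proof
 have r: "rep W z - z \<in> W" if "z \<in> cube" for z
 proof -
  have "z \<in> cube & z - z \<in> W" using that W by (simp add: vec.subspace_0)
  from someI[of "%y. y \<in> cube & y - z \<in> W", OF this] show ?thesis by (simp add: rep_def)
 qed
 assume "rep W x = rep W x'"
 then have "x - x' = (rep W x' - x') - (rep W x - x)" by simp
 then show "x - x' \<in> W" using vec.subspace_diff[OF W r[OF x(2)] r[OF x(1)]] by simp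
next
 assume d: "x - x' \<in> W"
 have "y - x \<in> W \<longleftrightarrow> y - x' \<in> W" for y
  using vec.subspace_add[OF W _ d, of "y - x"] vec.subspace_diff[OF W _ d, of "y - x'"] by auto
 then show "rep W x = rep W x'" by (simp add: rep_def)
qed

text \<open>The non-pivot part A is fixed, and \<K> collects pivot sets with identical discrete
  data: rounded logarithms \<kappa>, vectors f, ranks m among the elements of A, and numbers N of
  elements with given level and vector. Equal ranks give each element of A the same level for all of
  \<K>. The attached system depends only on these data, so one subflag V' serves for the whole
  class.\<close>

locale pivot_class =
 fixes A :: "nat set" and r :: nat and \<kappa> :: "nat => nat" and f :: "nat => rat ^ 'k::finite" and V' :: "nat => (rat ^ 'k) set"
  and m :: "nat => nat" and N :: "nat => rat ^ 'k => nat" and \<Phi> :: real and \<K> :: "nat set set"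
  and P :: "nat set => nat => nat" and w :: "nat set => nat => rat ^ 'k"
 assumes finA: "finite A" and fin\<K>: "finite \<K>" and \<Phi>: "1 <= \<Phi>"
  and functional: "!!U g. U \<in> dspans ==> g \<in> cube ==> g \<notin> (U :: (rat ^ 'k) set) ==>
   \<exists>\<phi>. (\<forall>x y. \<phi> (x + y) = \<phi> x + \<phi> y) & (\<forall>t x. \<phi> (t *s x) = t * \<phi> x) & (\<forall>x\<in>U. \<phi> x = 0) & \<phi> g = (1 :: rat) &
    (\<forall>x\<in>dcube. \<bar>real_of_rat (\<phi> x)\<bar> <= \<Phi>)"
  and sub: "subflag r V' (pflag r f)" and V'd: "!!j. V' j \<in> dspans"
  and K_eq: "!!K. K \<in> \<K> ==> K = P K ` {1..r}" and K_disj: "!!K. K \<in> \<K> ==> K \<inter> A = {}"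
  and K_piv: "!!K. K \<in> \<K> ==> pivots (A \<union> K) (w K) r (P K)"
  and w_cube: "!!K a. K \<in> \<K> ==> w K a \<in> cube" and w_f: "!!K s. K \<in> \<K> ==> s \<in> {1..r} ==> w K (P K s) = f s"
  and K_rel: "!!K. K \<in> \<K> ==> (\<Sum>a\<in>A \<union> K. of_nat a *s w K a) \<in> vec.span {ones}"
  and P_pos: "!!K s. K \<in> \<K> ==> s \<in> {1..r} ==> 1 <= P K s"
  and P_\<kappa>: "!!K s. K \<in> \<K> ==> s \<in> {1..r} ==> nat \<lfloor>ln (real (P K s))\<rfloor> = \<kappa> s"
  and P_m: "!!K s. K \<in> \<K> ==> s \<in> {1..r} ==> card {a \<in> A. a < P K s} = m s"
  and K_N: "!!K j x. K \<in> \<K> ==> j \<in> {0..r} ==> x \<in> cube ==> card {a \<in> A \<union> K. level r (P K) a = j & w K a = x} = N j x"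
begin

lemma dec: "K \<in> \<K> ==> 1 <= s ==> s < s' ==> s' <= r ==> P K s' < P K s"
 using K_piv by (auto simp: pivots_def)

lemma inj: assumes "K \<in> \<K>" shows "inj_on (P K) {1..r}"
proof (rule linorder_inj_onI)
 fix i j assume "i < j" "i \<in> {1..r}" "j \<in> {1..r}"
 then have "P K j < P K i" using dec[OF assms] by auto
 then show "P K i ~= P K j" by simp
qed auto

lemma level_same:
 assumes K: "K \<in> \<K>" "K' \<in> \<K>" and a: "a \<in> A" shows "level r (P K) a = level r (P K') a"
proof -
 have "a <= P K s \<longleftrightarrow> a <= P K' s" if s: "s \<in> {1..r}" for s
 proof -
  have eq: "{a \<in> A. a < P K s} = {a \<in> A. a < P K' s}"
  proof (cases "P K s <= P K' s")
   case True
   then show ?thesis using finA P_m[OF K(1) s] P_m[OF K(2) s] by (intro card_subset_eq) auto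
  next
   case False
   then show ?thesis using finA P_m[OF K(1) s] P_m[OF K(2) s] by (intro card_subset_eq[symmetric]) auto
  qed
  have "P K s \<notin> A" "P K' s \<notin> A" using s K_eq[OF K(1)] K_eq[OF K(2)] K_disj[OF K(1)] K_disj[OF K(2)] by blast+
  then have "a ~= P K s" "a ~= P K' s" using a by auto
  moreover have "a < P K s \<longleftrightarrow> a < P K' s" using arg_cong[OF eq, of "%S. a \<in> S"] a by simp
  ultimately show ?thesis by linarith
 qed
 then show ?thesis by (simp add: level_def cong: conj_cong)
qed

lemma P_ge: assumes "K \<in> \<K>" "s \<in> {1..r}" shows "exp (real (\<kappa> s)) <= real (P K s)"
proof -
 have p: "1 <= P K s" by (rule P_pos[OF assms])
 have "real (nat \<lfloor>ln (real (P K s))\<rfloor>) <= ln (real (P K s))" using p by (intro of_nat_floor) simp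
 then have "real (\<kappa> s) <= ln (real (P K s))" by (simp only: P_\<kappa>[OF assms])
 then show ?thesis using p by (subst ln_ge_iff[symmetric]) auto
qed

lemma P_le: assumes "K \<in> \<K>" "s \<in> {1..r}" shows "real (P K s) <= exp (real (\<kappa> s) + 1)"
proof -
 have p: "1 <= P K s" by (rule P_pos[OF assms])
 have "ln (real (P K s)) <= real (\<kappa> s) + 1" using P_\<kappa>[OF assms] by linarith
 then have "exp (ln (real (P K s))) <= exp (real (\<kappa> s) + 1)" by (simp only: exp_le_cancel_iff)
 then show ?thesis using p by simp
qed

lemma V'_mono: "i <= j ==> j <= r ==> V' i \<subseteq> V' j"
 using sub by (auto simp: subflag_def dest: flag_mono)

lemma V'_subspace: "vec.subspace (V' j)" by (rule subspace_dspans[OF V'd])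

text \<open>The first j >= s for which f s lies in the span of V' j and f (s + 1), ..., f j, or r +
  1 if there is none. Before this threshold a functional can isolate pivot s, which is therefore
  determined up to roughly the size of pivot T s.\<close>

definition T :: "nat => nat" where
 "T s = (LEAST j. s <= j & (j <= r \<longrightarrow> s \<notin> greedy (V' j) f j))"

lemma T_bounds: assumes "s \<in> {1..r}" shows "s <= T s" "T s <= r + 1" "T s <= r ==> s \<notin> greedy (V' (T s)) f (T s)"
proof -
 have ex: "s <= r + 1 & (r + 1 <= r \<longrightarrow> s \<notin> greedy (V' (r + 1)) f (r + 1))" using assms by auto
 from LeastI[of "%j. s <= j & (j <= r \<longrightarrow> s \<notin> greedy (V' j) f j)", OF ex]
 show "s <= T s" "T s <= r ==> s \<notin> greedy (V' (T s)) f (T s)" by (auto simp: T_def)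
 show "T s <= r + 1" unfolding T_def by (rule Least_le) (use assms in auto)
qed

lemma greedy_iff:
 assumes s: "s \<in> {1..r}" and j: "s <= j" "j <= r" shows "s \<in> greedy (V' j) f j \<longleftrightarrow> j < T s"
proof
 assume "j < T s"
 from not_less_Least[OF this[unfolded T_def]] show "s \<in> greedy (V' j) f j" using j by auto
next
 assume g: "s \<in> greedy (V' j) f j"
 show "j < T s"
 proof (rule ccontr)
  assume "\<not> j < T s"
  then have le: "T s <= j" by simp
  then have "s \<in> greedy (V' (T s)) f (T s)" using V'_mono[OF le] j T_bounds[OF s] by (intro greedy_antimono[OF _ le g]) auto
  then show False using T_bounds(3)[OF s] le j by auto
 qed
qed

definition B :: "nat => nat" where
 "B s = (if T s <= r then nat \<lceil>\<Phi> * exp (real (\<kappa> (T s)) + 1) * (real (card A) + real r)\<rceil> else 0)"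

text \<open>The comparison is made at j = T s - 1, with a functional that is 1 on f s and 0 on V' j
  and on the other greedy vectors. An index i <= j outside the greedy set has T i <= j, so its pivot
  already agrees. If T s = s nothing can be isolated, and B s simply exceeds the pivot
  itself.\<close>

lemma agree:
 assumes K: "K \<in> \<K>" "K' \<in> \<K>" and s: "s \<in> {1..r}"
  and lab: "!!a. a \<in> A ==> w K a - w K' a \<in> V' (level r (P K) a)"
  and eq: "!!s'. s' \<in> {1..r} ==> T s' < T s ==> P K s' = P K' s'"
 shows "P K s <= P K' s + B s"
proof (cases "T s = s")
 case True
 have "1 <= \<Phi> * (real (card A) + real r)" using \<Phi> s by (intro order_trans[OF _ mult_mono[of 1 \<Phi> 1]]) auto
 then have "exp (real (\<kappa> s) + 1) * 1 <= exp (real (\<kappa> s) + 1) * (\<Phi> * (real (card A) + real r))"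
  by (rule mult_left_mono) simp
 also have "... = \<Phi> * exp (real (\<kappa> s) + 1) * (real (card A) + real r)" by (simp only: mult_ac)
 finally have "real (P K s) <= \<Phi> * exp (real (\<kappa> s) + 1) * (real (card A) + real r)"
  using P_le[OF K(1) s] by linarith
 also have "... <= real (B s)" using True s by (simp add: B_def real_nat_ceiling_ge)
 finally show ?thesis by simp
next
 case False
 define j where "j = T s - 1"
 have j: "s <= j" "j <= r" "j < T s" "T s = j + 1" using False T_bounds[OF s] s by (auto simp: j_def)
 let ?G = "greedy (V' j) f j"
 have sG: "s \<in> ?G" using greedy_iff[OF s j(1,2)] j by simp
 let ?U = "vec.span (V' j \<union> f ` (?G - {s}))"
 have Gr: "?G \<subseteq> {1..r}" using j by (auto simp: greedy_def)
 have fc: "f i \<in> cube" if "i \<in> {1..r}" for i using w_f[OF K(1) that] w_cube[OF K(1), of "P K i"] by simp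
 obtain S where S: "S \<subseteq> dcube" "V' j = vec.span S" using V'd[of j] by (auto simp: dspans_def)
 have "?U = vec.span (S \<union> f ` (?G - {s}))" unfolding S vec.span_Un by (simp only: vec.span_span)
 moreover have "S \<union> f ` (?G - {s}) \<subseteq> dcube" using S fc Gr cube_subset_dcube by blast
 ultimately have U: "?U \<in> dspans" by (simp only: span_in_dspans)
 obtain \<phi> where \<phi>: "!!x y. \<phi> (x + y) = \<phi> x + \<phi> y" "!!t x. \<phi> (t *s x) = t * \<phi> x" "!!x. x \<in> ?U ==> \<phi> x = 0" "\<phi> (f s) = (1 :: rat)"
  "!!x. x \<in> dcube ==> \<bar>real_of_rat (\<phi> x)\<bar> <= \<Phi>"
  using functional[OF U fc[OF s] greedy_independent[OF sG]] by blast
 define E where "E = (if T s <= r then exp (real (\<kappa> (T s)) + 1) else 0)"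
 have E0: "0 <= E" by (simp add: E_def)
 have PE: "real (P K'' i) <= E" if "i \<in> {j<..r}" "K'' \<in> \<K>" for i K''
 proof -
  have i: "T s <= i" "i <= r" "1 <= T s" using that j s by auto
  then have "P K'' i <= P K'' (T s)" using dec[OF that(2), of "T s" i] by (cases "T s = i") auto
  moreover have "real (P K'' (T s)) <= exp (real (\<kappa> (T s)) + 1)" using i by (intro P_le that) auto
  ultimately show ?thesis using i by (simp add: E_def)
 qed
 have "real (P K s) <= real (P K' s) + \<Phi> * E * (real (card A) + real r)"
 proof (rule pivot_difference[where \<phi> = \<phi> and j = j and W = "V' j" and p = "P K" and p' = "P K'" and A = A and r = r and s = s and E = E and \<Phi> = \<Phi> and om = "w K" and om' = "w K'" and f = f])
  show "inj_on (P K) {1..r}" "inj_on (P K') {1..r}" using inj K by auto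
  show "P K ` {1..r} \<inter> A = {}" "P K' ` {1..r} \<inter> A = {}" using K_eq K_disj K by metis+
  show "(\<Sum>a\<in>A \<union> P K ` {1..r}. of_nat a *s w K a) \<in> vec.span {ones}"
   using K_rel[OF K(1)] by (simp only: K_eq[OF K(1), symmetric])
  show "(\<Sum>a\<in>A \<union> P K' ` {1..r}. of_nat a *s w K' a) \<in> vec.span {ones}"
   using K_rel[OF K(2)] by (simp only: K_eq[OF K(2), symmetric])
  show "ones \<in> V' j" using sub j by (auto simp: subflag_def intro: flag_ones)
  show "w K a - w K' a \<in> V' j \<or> real a <= E" if a: "a \<in> A" for a
  proof (cases "level r (P K) a <= j")
   case True
   then show ?thesis using lab[OF a] V'_mono[OF True j(2)] by auto
  next
   case False
   then have lt: "j + 1 <= level r (P K) a" by simp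
   then have jr: "j + 1 \<in> {1..r}" using level_le[of r "P K" a] by simp
   then have "a <= P K (j + 1)" using le_level_iff[of r "P K" "j + 1" a] dec[OF K(1)] lt by auto
   then have "real a <= real (P K (j + 1))" by simp
   also have "... <= E" using jr by (intro PE K) auto
   finally show ?thesis by simp
  qed
  show "\<phi> (f i) = 0 \<or> P K i = P K' i" if i: "i \<in> {1..j} - {s}" for i
  proof (cases "i \<in> ?G")
   case True
   then have "f i \<in> ?U" using i by (intro vec.span_base) auto
   then show ?thesis using \<phi>(3) by simp
  next
   case False
   then have "T i < T s" using greedy_iff[of i j] i j by auto
   then show ?thesis using eq[of i] i j by auto
  qed
  show "\<phi> x = 0" if "x \<in> V' j" for x using that by (intro \<phi>(3) vec.span_base) simp
 qed (use K w_f w_cube finA j s E0 V'_subspace PE \<phi> \<Phi> in auto)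
 also have "\<Phi> * E * (real (card A) + real r) <= real (B s)" by (simp add: E_def B_def real_nat_ceiling_ge)
 finally show ?thesis by (simp only: of_nat_add[symmetric] of_nat_le_iff)
qed

definition \<kappa>' :: "nat => real" where "\<kappa>' j = (if j <= r then real (\<kappa> j) else 0)"

definition C :: real where "C = \<Phi> * exp 1 * (real (card A) + real r) + 2"

lemma B_le: "real (B s + 1) <= C * exp (\<kappa>' (T s))"
proof (cases "T s <= r")
 case True
 have n: "0 <= \<Phi> * exp (real (\<kappa> (T s)) + 1) * (real (card A) + real r)" using \<Phi> by simp
 have "real (B s) <= \<Phi> * exp (real (\<kappa> (T s)) + 1) * (real (card A) + real r) + 1"
  unfolding B_def using True n by (simp add: of_nat_ceiling)
 then have "real (B s + 1) <= \<Phi> * exp 1 * (real (card A) + real r) * exp (\<kappa>' (T s)) + 2 * 1"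
  using True by (simp add: \<kappa>'_def exp_add mult_ac)
 also have "... <= \<Phi> * exp 1 * (real (card A) + real r) * exp (\<kappa>' (T s)) + 2 * exp (\<kappa>' (T s))"
  by (intro add_left_mono mult_left_mono) (auto simp: \<kappa>'_def)
 finally show ?thesis by (simp add: C_def algebra_simps)
next
 case False
 have "0 <= \<Phi> * exp 1 * (real (card A) + real r)" using \<Phi> by simp
 then show ?thesis using False by (simp add: B_def C_def \<kappa>'_def)
qed

definition q :: "nat => rat ^ 'k => real" where
 "q j x = real (\<Sum>y\<in>{y \<in> cube. y - x \<in> V' j}. N j y) / real (\<Sum>y\<in>cube. N j y)"

text \<open>The labels of the vectors modulo V' at their levels are counted by the type-class bound;
  for given labels the pivots are determined successively in the order of T, by
  \<open>agree\<close>.\<close>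

lemma card_class:
 "real (card \<K>) <= exp (\<Sum>j\<in>{0..r}. \<Sum>x\<in>cube. real (N j x) * (- ln (q j x))) * (\<Prod>s\<in>{1..r}. real (B s + 1))"
proof (cases "\<K> = {}")
 case True then show ?thesis by (auto intro!: mult_nonneg_nonneg prod_nonneg)
next
 case False
 then obtain K0 where K0: "K0 \<in> \<K>" by blast
 let ?J = "level r (P K0)"
 let ?lab = "%om. \<lambda>a\<in>A. rep (V' (?J a)) (om a)"
 have J: "level r (P K) a = ?J a" if "K \<in> \<K>" "a \<in> A" for K a using level_same that K0 by blast
 have N: "card {a \<in> A. ?J a = j & om a = x} <= N j x" if w: "om \<in> w ` \<K>" and j: "j \<in> {0..r}" and x: "x \<in> cube" for om j x
 proof -
  obtain K where K: "K \<in> \<K>" "om = w K" using w by auto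
  have "finite K" by (subst K_eq[OF K(1)]) simp
  then have "card {a \<in> A. ?J a = j & om a = x} <= card {a \<in> A \<union> K. level r (P K) a = j & w K a = x}"
   using finA J[OF K(1)] K by (intro card_mono) auto
  then show ?thesis using K_N[OF K(1) j x] by simp
 qed
 have labs: "finite (?lab ` w ` \<K>)" "real (card (?lab ` w ` \<K>)) <= exp (\<Sum>j\<in>{0..r}. \<Sum>x\<in>cube. real (N j x) * (- ln (q j x)))"
 proof -
  have qq: "real (\<Sum>y\<in>{y \<in> cube. rep (V' j) y = rep (V' j) x}. N j y) / real (\<Sum>y\<in>cube. N j y) = q j x"
   if "x \<in> cube" for j x
   using that rep_eq_iff[OF V'_subspace] by (simp add: q_def cong: conj_cong)
  have "finite (?lab ` w ` \<K>)" by (simp add: fin\<K>)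
  then show "finite (?lab ` w ` \<K>)" .
  have "real (card (?lab ` w ` \<K>)) <= exp (\<Sum>j\<in>{0..r}. \<Sum>x\<in>cube. real (N j x) * (- ln (real (\<Sum>y\<in>{y \<in> cube. rep (V' j) y = rep (V' j) x}. N j y) / real (\<Sum>y\<in>cube. N j y))))"
   by (rule card_labellings_le(2)[where g = "%j. rep (V' j)" and J = ?J]) (use finA level_le w_cube N in auto)
  also have "... = exp (\<Sum>j\<in>{0..r}. \<Sum>x\<in>cube. real (N j x) * (- ln (q j x)))"
   by (intro arg_cong[where f = exp] sum.cong refl) (simp only: qq)
  finally show "real (card (?lab ` w ` \<K>)) <= exp (\<Sum>j\<in>{0..r}. \<Sum>x\<in>cube. real (N j x) * (- ln (q j x)))" .
 qed
 have fibre: "card {K \<in> \<K>. ?lab (w K) = l} <= (\<Prod>s\<in>{1..r}. B s + 1)" for l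
 proof -
  let ?F = "{K \<in> \<K>. ?lab (w K) = l}"
  have "inj_on (%K. restrict (P K) {1..r}) ?F"
  proof (rule inj_onI)
   fix K K' assume K: "K \<in> ?F" "K' \<in> ?F" and eq: "restrict (P K) {1..r} = restrict (P K') {1..r}"
   have "P K ` {1..r} = P K' ` {1..r}"
   proof (rule image_cong)
    fix s assume "s \<in> {1..r}" then show "P K s = P K' s" using fun_cong[OF eq, of s] by simp
   qed simp
   moreover have "K = P K ` {1..r}" "K' = P K' ` {1..r}" using K K_eq by blast+
   ultimately show "K = K'" by argo
  qed
  then have "card ?F = card ((%K. restrict (P K) {1..r}) ` ?F)" by (rule card_image[symmetric])
  also have "(%K. restrict (P K) {1..r}) ` ?F = (%p. restrict p {1..r}) ` (P ` ?F)" by (simp add: image_image)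
  also have "card ... <= (\<Prod>s\<in>{1..r}. B s + 1)"
  proof (rule card_successively_determined[where t = T])
   fix p p' s assume p: "p \<in> P ` ?F" "p' \<in> P ` ?F" and s: "s \<in> {1..r}"
    and eq: "!!s'. s' \<in> {1..r} ==> T s' < T s ==> p s' = p' s'"
   obtain K K' where K: "K \<in> ?F" "K' \<in> ?F" "p = P K" "p' = P K'" using p by blast
   have "w K a - w K' a \<in> V' (level r (P K) a)" if a: "a \<in> A" for a
   proof -
    have "?lab (w K) = ?lab (w K')" using K by simp
    from fun_cong[OF this, of a] have "rep (V' (?J a)) (w K a) = rep (V' (?J a)) (w K' a)" using a by simp
    then show ?thesis using rep_eq_iff[OF V'_subspace] w_cube K J a by simp
   qed
   then show "p s <= p' s + B s" unfolding K(3,4) using K eq by (intro agree s) auto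
  qed (use fin\<K> in auto)
  finally show ?thesis .
 qed
 have "card \<K> = (\<Sum>l\<in>?lab ` w ` \<K>. card {K \<in> \<K>. ?lab (w K) = l})"
  using sum.group[of \<K> "?lab ` w ` \<K>" "%K. ?lab (w K)" "%_. 1 :: nat"] fin\<K> by (simp add: image_image)
 also have "... <= (\<Sum>l\<in>?lab ` w ` \<K>. \<Prod>s\<in>{1..r}. B s + 1)" by (intro sum_mono fibre)
 also have "... = card (?lab ` w ` \<K>) * (\<Prod>s\<in>{1..r}. B s + 1)" by (simp only: sum_constant of_nat_id)
 finally have "real (card \<K>) <= real (card (?lab ` w ` \<K>)) * (\<Prod>s\<in>{1..r}. real (B s + 1))"
  unfolding of_nat_prod[symmetric] of_nat_mult[symmetric] by (simp only: of_nat_le_iff)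
 also have "... <= exp (\<Sum>j\<in>{0..r}. \<Sum>x\<in>cube. real (N j x) * (- ln (q j x))) * (\<Prod>s\<in>{1..r}. real (B s + 1))"
  by (intro mult_right_mono labs prod_nonneg) auto
 finally show ?thesis .
qed

lemma dim_greedy:
 assumes "j <= r" shows "vec.dim (pflag r f j) = vec.dim (V' j) + card (greedy (V' j) f j)"
proof -
 have "ones \<in> V' j" using sub assms by (auto simp: subflag_def intro: flag_ones)
 moreover have "V' j \<subseteq> pflag r f j" using sub assms by (auto simp: subflag_def)
 ultimately have "vec.span (V' j \<union> f ` {1..j}) = pflag r f j"
 proof (intro antisym)
  assume V: "V' j \<subseteq> pflag r f j" "ones \<in> V' j"
  have "f ` {1..j} \<subseteq> pflag r f j" unfolding pflag_def using assms by (auto intro!: vec.span_base simp: min_absorb1)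
  then show "vec.span (V' j \<union> f ` {1..j}) \<subseteq> pflag r f j"
   using V by (intro vec.span_minimal) (auto simp: pflag_def)
  show "pflag r f j \<subseteq> vec.span (V' j \<union> f ` {1..j})"
   unfolding pflag_def using V assms by (intro vec.span_mono) (auto simp: min_absorb1)
 qed
 then show ?thesis using greedy_dim[of "V' j" f j] by (metis vec.dim_span)
qed

text \<open>The difference of \<kappa>' at s and T s telescopes over s <= j < T s. For fixed j the
  indices s with this property form the greedy set, whose size is the codimension of V' j in the
  j-th space.\<close>

lemma sum_T:
 "(\<Sum>s\<in>{1..r}. \<kappa>' s - \<kappa>' (T s)) =
  (\<Sum>j\<in>{1..r}. (real (vec.dim (pflag r f j)) - real (vec.dim (V' j))) * (\<kappa>' j - \<kappa>' (j + 1)))"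
proof -
 have "\<kappa>' s - \<kappa>' (T s) = (\<Sum>j\<in>{1..r}. of_bool (s \<in> greedy (V' j) f j) * (\<kappa>' j - \<kappa>' (j + 1)))" if s: "s \<in> {1..r}" for s
 proof -
  have "(\<Sum>j\<in>{1..r}. of_bool (s \<in> greedy (V' j) f j) * (\<kappa>' j - \<kappa>' (j + 1))) = (\<Sum>j\<in>{s..<T s}. \<kappa>' j - \<kappa>' (j + 1))"
  proof (rule sum.mono_neutral_cong_right)
   show "{s..<T s} \<subseteq> {1..r}" using s T_bounds[OF s] by auto
   show "\<forall>j\<in>{1..r} - {s..<T s}. of_bool (s \<in> greedy (V' j) f j) * (\<kappa>' j - \<kappa>' (j + 1)) = 0"
   proof
    fix j assume j: "j \<in> {1..r} - {s..<T s}"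
    have "s \<notin> greedy (V' j) f j"
    proof (cases "s <= j")
     case True then show ?thesis using greedy_iff[OF s True] j by auto
    qed (auto simp: greedy_def)
    then show "of_bool (s \<in> greedy (V' j) f j) * (\<kappa>' j - \<kappa>' (j + 1)) = 0" by simp
   qed
   fix j assume j: "j \<in> {s..<T s}"
   then have "s \<in> greedy (V' j) f j" using T_bounds[OF s] by (subst greedy_iff[OF s]) auto
   then show "of_bool (s \<in> greedy (V' j) f j) * (\<kappa>' j - \<kappa>' (j + 1)) = \<kappa>' j - \<kappa>' (j + 1)" by simp
  qed simp
  also have "... = - (\<Sum>j\<in>{s..<T s}. \<kappa>' (Suc j) - \<kappa>' j)" by (simp add: sum_negf[symmetric])
  also have "... = \<kappa>' s - \<kappa>' (T s)" using sum_Suc_diff'[OF T_bounds(1)[OF s], of \<kappa>'] by simp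
  finally show ?thesis by simp
 qed
 then have "(\<Sum>s\<in>{1..r}. \<kappa>' s - \<kappa>' (T s)) = (\<Sum>s\<in>{1..r}. \<Sum>j\<in>{1..r}. of_bool (s \<in> greedy (V' j) f j) * (\<kappa>' j - \<kappa>' (j + 1)))"
  by (intro sum.cong) auto
 also have "... = (\<Sum>j\<in>{1..r}. (\<Sum>s\<in>{1..r}. of_bool (s \<in> greedy (V' j) f j)) * (\<kappa>' j - \<kappa>' (j + 1)))"
  by (subst sum.swap) (simp only: sum_distrib_right)
 also have "... = (\<Sum>j\<in>{1..r}. (real (vec.dim (pflag r f j)) - real (vec.dim (V' j))) * (\<kappa>' j - \<kappa>' (j + 1)))"
 proof (intro sum.cong refl arg_cong2[where f = times])
  fix j assume j: "j \<in> {1..r}"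
  have "{1..r} \<inter> {s. s \<in> greedy (V' j) f j} = greedy (V' j) f j" using j by (auto simp: greedy_def)
  then show "(\<Sum>s\<in>{1..r}. of_bool (s \<in> greedy (V' j) f j)) = real (vec.dim (pflag r f j)) - real (vec.dim (V' j))"
   using dim_greedy[of j] j by (simp add: sum_of_bool_eq)
 qed
 finally show ?thesis .
qed

text \<open>A pivot set has weight at most exp of minus the sum of the \<kappa>' s, while the choice
  of the pivots contributes exp of the sum of the \<kappa>' (T s). By \<open>sum_T\<close> the
  balance is the dimension part of the entropy difference between V' and the flag.\<close>

lemma class_weight:
 "(\<Sum>K\<in>\<K>. \<Prod>a\<in>K. 1 / real a) <= C ^ r * exp ((\<Sum>j\<in>{0..r}. \<Sum>x\<in>cube. real (N j x) * (- ln (q j x))) -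
   (\<Sum>j\<in>{1..r}. (real (vec.dim (pflag r f j)) - real (vec.dim (V' j))) * (\<kappa>' j - \<kappa>' (j + 1))))"
proof -
 let ?S = "\<Sum>j\<in>{0..r}. \<Sum>x\<in>cube. real (N j x) * (- ln (q j x))"
 have "(\<Prod>a\<in>K. 1 / real a) <= exp (- (\<Sum>s\<in>{1..r}. \<kappa>' s))" if K: "K \<in> \<K>" for K
 proof -
  have "(\<Prod>a\<in>K. 1 / real a) = (\<Prod>s\<in>{1..r}. 1 / real (P K s))"
   using prod.reindex[OF inj[OF K], of "%a. 1 / real a"] K_eq[OF K] by (simp add: o_def)
  also have "... <= (\<Prod>s\<in>{1..r}. exp (- \<kappa>' s))"
  proof (intro prod_mono conjI)
   fix s assume s: "s \<in> {1..r}"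
   have "1 / real (P K s) <= 1 / exp (\<kappa>' s)"
    using P_ge[OF K s] P_pos[OF K s] s by (intro divide_left_mono) (auto simp: \<kappa>'_def)
   then show "1 / real (P K s) <= exp (- \<kappa>' s)" by (simp add: exp_minus inverse_eq_divide)
  qed auto
  finally show ?thesis by (simp add: exp_sum sum_negf[symmetric])
 qed
 then have "(\<Sum>K\<in>\<K>. \<Prod>a\<in>K. 1 / real a) <= (\<Sum>K\<in>\<K>. exp (- (\<Sum>s\<in>{1..r}. \<kappa>' s)))" by (rule sum_mono)
 also have "... = real (card \<K>) * exp (- (\<Sum>s\<in>{1..r}. \<kappa>' s))" by simp
 also have "... <= (exp ?S * (\<Prod>s\<in>{1..r}. real (B s + 1))) * exp (- (\<Sum>s\<in>{1..r}. \<kappa>' s))"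
  by (intro mult_right_mono card_class) auto
 also have "... <= (exp ?S * (\<Prod>s\<in>{1..r}. C * exp (\<kappa>' (T s)))) * exp (- (\<Sum>s\<in>{1..r}. \<kappa>' s))"
  using B_le by (intro mult_right_mono mult_left_mono prod_mono) auto
 also have "... = C ^ r * exp (?S - (\<Sum>s\<in>{1..r}. \<kappa>' s - \<kappa>' (T s)))"
  by (simp add: prod.distrib exp_sum[symmetric] exp_add[symmetric] sum_subtractf algebra_simps mult_exp_exp)
 finally show ?thesis unfolding sum_T .
qed

end

section \<open>Weight of a class of pivot sets\<close>

context pivot_class begin

lemma level_sums:
 assumes K: "K \<in> \<K>" and j: "j \<in> {0..r}"
 shows "card {a \<in> A \<union> K. level r (P K) a = j} = (\<Sum>x\<in>cube. N j x)"
proof -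
 let ?S = "{a \<in> A \<union> K. level r (P K) a = j}"
 have "finite K" by (subst K_eq[OF K]) simp
 then have fin: "finite ?S" using finA by simp
 have "(\<Sum>x\<in>cube. card {a \<in> ?S. w K a = x}) = card ?S"
  using sum.group[of ?S cube "w K" "%_. 1 :: nat"] fin w_cube[OF K] by auto
 moreover have "card {a \<in> ?S. w K a = x} = N j x" if "x \<in> cube" for x
 proof -
  have "{a \<in> ?S. w K a = x} = {a \<in> A \<union> K. level r (P K) a = j & w K a = x}" by auto
  then show ?thesis using K_N[OF K j that] by simp
 qed
 ultimately show ?thesis by simp
qed

lemma level_entropy:
 assumes K: "K \<in> \<K>" and j: "j \<in> {1..r}"
 shows "(\<Sum>x\<in>cube. real (N j x) * (- ln (q j x))) =
  real (card {a \<in> A \<union> K. level r (P K) a = j}) * coset_entropy (pmeasure (A \<union> K) (w K) r (P K) j) (V' j)"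
proof (cases "{a \<in> A \<union> K. level r (P K) a = j} = {}")
 case True
 have "j \<in> {0..r}" using j by simp
 from level_sums[OF K this] have "(\<Sum>x\<in>cube. N j x) = 0" unfolding True by simp
 then have "N j x = 0" if "x \<in> cube" for x using that by simp
 then show ?thesis unfolding True by simp
next
 case False
 let ?S = "{a \<in> A \<union> K. level r (P K) a = j}" and ?\<mu> = "pmeasure (A \<union> K) (w K) r (P K) j"
 have "finite K" by (subst K_eq[OF K]) simp
 then have fin: "finite ?S" using finA by simp
 have pm: "pmf ?\<mu> x = real (N j x) / real (card ?S)" if x: "x \<in> cube" for x
 proof -
  have "pmf ?\<mu> x = measure (measure_pmf (pmf_of_set ?S)) (w K -` {x})" by (simp add: pmeasure_def pmf_map)
  also have "... = real (card (?S \<inter> w K -` {x})) / real (card ?S)" by (rule measure_pmf_of_set[OF False fin])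
  also have "?S \<inter> w K -` {x} = {a \<in> A \<union> K. level r (P K) a = j & w K a = x}" by auto
  finally show ?thesis using K_N[OF K _ x, of j] j by simp
 qed
 have n: "0 < card ?S" using False fin by (simp add: card_gt_0_iff)
 have qs: "(\<Sum>y\<in>{y \<in> cube. y - x \<in> V' j}. pmf ?\<mu> y) = q j x" for x
  using level_sums[OF K, of j] j pm by (simp add: q_def sum_divide_distrib)
 have "set_pmf ?\<mu> \<subseteq> cube" using w_cube[OF K] by (auto simp: pmeasure_def)
 then have "coset_entropy ?\<mu> (V' j) = - (\<Sum>x\<in>cube. pmf ?\<mu> x * ln (q j x))"
  by (subst coset_entropy_cube) (simp_all only: qs)
 also have "... = (\<Sum>x\<in>cube. real (N j x) / real (card ?S) * (- ln (q j x)))"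
  unfolding sum_negf[symmetric] by (intro sum.cong refl) (simp add: pm)
 finally have ce: "coset_entropy ?\<mu> (V' j) = (\<Sum>x\<in>cube. real (N j x) / real (card ?S) * (- ln (q j x)))" .
 show ?thesis unfolding ce sum_distrib_left using n by (intro sum.cong refl) simp
qed

text \<open>Elements above all pivots have vectors on the line of \<open>ones\<close>, a single
  coset of V' 0, so they contribute nothing; accordingly the system starts at the first
  pivot.\<close>

lemma level_zero: assumes K: "K \<in> \<K>" shows "(\<Sum>x\<in>cube. real (N 0 x) * (- ln (q 0 x))) = 0"
proof (rule sum.neutral, rule ballI)
 have V0: "V' 0 = vec.span {ones}" using sub by (simp add: subflag_def flag_def)
 have N0: "y \<in> V' 0" if y: "y \<in> cube" "N 0 y ~= 0" for y
 proof -
  have "card {a \<in> A \<union> K. level r (P K) a = 0 & w K a = y} ~= 0" using K_N[OF K _ y(1), of 0] y by simp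
  then obtain a where a: "a \<in> A \<union> K" "level r (P K) a = 0" "w K a = y" by (metis (mono_tags, lifting) card.empty empty_Collect_eq)
  have "w K a \<in> pflag r (w K \<circ> P K) (level r (P K) a)" using K_piv[OF K] a(1) unfolding pivots_def by blast
  then have "y \<in> pflag r (w K \<circ> P K) 0" unfolding a(2,3) .
  then show ?thesis by (simp add: V0 pflag_def)
 qed
 fix x assume x: "x \<in> (cube :: (rat ^ 'k) set)"
 show "real (N 0 x) * (- ln (q 0 x)) = 0"
 proof (cases "N 0 x = 0")
  case False
  have "(\<Sum>y\<in>{y \<in> cube. y - x \<in> V' 0}. N 0 y) = (\<Sum>y\<in>cube. N 0 y)"
   using N0 False x vec.subspace_diff[OF V'_subspace] by (intro sum.mono_neutral_left) auto
  moreover have "N 0 x <= (\<Sum>y\<in>cube. N 0 y)" using x by (intro member_le_sum) auto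
  ultimately have "q 0 x = 1" unfolding q_def using False by (simp del: of_nat_sum sum_eq_0_iff)
  then show ?thesis by simp
 qed simp
qed

text \<open>Typicality is applied between consecutive pivots, and for the last level down to c0 * L.
  There \<open>expint\<close> omits an element equal to exp (c0 * L), which is counted separately.
  The 2 covers the rounding of two logarithms, or of one logarithm and this element.\<close>

lemma card_level:
 assumes K: "K \<in> \<K>" and tpl: "typical eps1 L (A \<union> K)" and L: "0 < L" and c0: "0 <= c0"
  and range: "!!a. a \<in> A \<union> K ==> 1 <= a & c0 * L <= ln (real a) & ln (real a) <= L" and j: "j \<in> {1..r}"
 shows "real (card {a \<in> A \<union> K. level r (P K) a = j}) <=
  (pexp L c0 r \<kappa> j - pexp L c0 r \<kappa> (j + 1)) * L + 2 + eps1 * L"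
proof -
 let ?S = "{a \<in> A \<union> K. level r (P K) a = j}" and ?c = "pexp L c0 r \<kappa>"
 have finK: "finite K" by (subst K_eq[OF K]) simp
 have inK: "P K s \<in> A \<union> K" if "s \<in> {1..r}" for s using K_eq[OF K] that by blast
 have lnP: "real (\<kappa> s) <= ln (real (P K s))" "ln (real (P K s)) <= real (\<kappa> s) + 1" "0 <= ln (real (P K s))"
   "c0 * L <= ln (real (P K s))" "ln (real (P K s)) <= L" if "s \<in> {1..r}" for s
 proof -
  have p: "1 <= P K s" by (rule P_pos[OF K that])
  then have "ln (exp (real (\<kappa> s))) <= ln (real (P K s))" using P_ge[OF K that] by (subst ln_le_cancel_iff) auto
  then show "real (\<kappa> s) <= ln (real (P K s))" by simp
  have "ln (real (P K s)) <= ln (exp (real (\<kappa> s) + 1))" using P_le[OF K that] p by (subst ln_le_cancel_iff) auto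
  then show "ln (real (P K s)) <= real (\<kappa> s) + 1" by simp
  show "0 <= ln (real (P K s))" using p by simp
  show "c0 * L <= ln (real (P K s))" "ln (real (P K s)) <= L" using range[OF inK[OF that]] by auto
 qed
 have cL: "real (\<kappa> s) <= ?c s * L" "?c s * L <= real (\<kappa> s) + 1" if "s \<in> {1..r}" for s
 proof -
  have "?c s * L = max (real (\<kappa> s)) (c0 * L)" using that L by (simp add: pexp_def max_mult_distrib_right)
  then show "real (\<kappa> s) <= ?c s * L" "?c s * L <= real (\<kappa> s) + 1" using lnP[OF that] by auto
 qed
 have le: "a <= P K s \<longleftrightarrow> s <= level r (P K) a" if "s \<in> {1..r}" for a s
  using le_level_iff[of r "P K" s a] dec[OF K] that by auto
 have tD: "real (card ((A \<union> K) \<inter> expint x y)) <= y - x + eps1 * L" if "0 <= x" "x <= y" "y <= L" for x y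
  using tpl that by (simp add: typical_def)
 have expP: "exp (ln (real (P K s))) = real (P K s)" if "s \<in> {1..r}" for s using P_pos[OF K that] by simp
 show ?thesis
 proof (cases "j = r")
  case False
  then have j': "j + 1 \<in> {1..r}" using j by auto
  have "?S \<subseteq> (A \<union> K) \<inter> expint (ln (real (P K (j + 1)))) (ln (real (P K j)))"
  proof
   fix a assume a: "a \<in> ?S"
   have "a <= P K j" using le[OF j, of a] a by simp
   moreover have "\<not> a <= P K (j + 1)" using le[OF j', of a] a by simp
   ultimately show "a \<in> (A \<union> K) \<inter> expint (ln (real (P K (j + 1)))) (ln (real (P K j)))"
    using a unfolding expint_def expP[OF j] expP[OF j'] by simp
  qed
  then have "card ?S <= card ((A \<union> K) \<inter> expint (ln (real (P K (j + 1)))) (ln (real (P K j))))"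
   by (intro card_mono) auto
  also have "real ... <= ln (real (P K j)) - ln (real (P K (j + 1))) + eps1 * L"
  proof (rule tD)
   have "P K (j + 1) < P K j" using dec[OF K, of j "j + 1"] j j' by simp
   then show "ln (real (P K (j + 1))) <= ln (real (P K j))" using P_pos[OF K j'] by simp
  qed (use lnP[OF j] lnP[OF j'] in auto)
  finally show ?thesis using lnP[OF j] lnP[OF j'] cL[OF j] cL[OF j'] by (simp add: algebra_simps)
 next
  case True
  let ?e = "{a \<in> A \<union> K. real a = exp (c0 * L)}"
  have "?S \<subseteq> ((A \<union> K) \<inter> expint (c0 * L) (ln (real (P K r)))) \<union> ?e"
  proof
   fix a assume a: "a \<in> ?S"
   have rr: "r \<in> {1..r}" using j True by simp
   have ar: "1 <= a" "c0 * L <= ln (real a)" using range a by auto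
   then have "exp (c0 * L) <= exp (ln (real a))" by (simp only: exp_le_cancel_iff)
   then have "exp (c0 * L) <= real a" using ar by simp
   moreover have "a <= P K r" using le[OF rr, of a] a True by simp
   ultimately show "a \<in> ((A \<union> K) \<inter> expint (c0 * L) (ln (real (P K r)))) \<union> ?e"
    using a by (cases "real a = exp (c0 * L)") (simp_all add: expint_def expP[OF rr])
  qed
  then have "card ?S <= card (((A \<union> K) \<inter> expint (c0 * L) (ln (real (P K r)))) \<union> ?e)"
   using finA finK by (intro card_mono) auto
  also have "... <= card ((A \<union> K) \<inter> expint (c0 * L) (ln (real (P K r)))) + card ?e" by (rule card_Un_le)
  finally have "real (card ?S) <= real (card ((A \<union> K) \<inter> expint (c0 * L) (ln (real (P K r))))) + real (card ?e)" by linarith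
  moreover have "card ?e <= Suc 0"
   using finA finK by (subst card_le_Suc0_iff_eq) (auto simp flip: of_nat_eq_iff[where 'a = real])
  moreover have "real (card ((A \<union> K) \<inter> expint (c0 * L) (ln (real (P K r))))) <= ln (real (P K r)) - c0 * L + eps1 * L"
   using lnP[OF j] c0 L True by (intro tD) auto
  moreover have "?c (j + 1) = c0" using True by (simp add: pexp_def)
  ultimately show ?thesis using lnP[OF j] cL[OF j] True by (simp add: algebra_simps)
 qed
qed

text \<open>In the Abel-summed form, L times the entropy difference between V' and the flag is the
  exponent of \<open>class_weight\<close> up to bounded errors per level and the term with eps1, so
  the gap eps becomes the factor exp (- eps * L).\<close>

lemma class_small:
 assumes K: "K \<in> \<K>" and tpl: "typical eps1 L (A \<union> K)" and L: "0 < L" and c0: "0 <= c0" and eps1: "0 <= eps1"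
  and range: "!!a. a \<in> A \<union> K ==> 1 <= a & c0 * L <= ln (real a) & ln (real a) <= L"
  and sys: "system r (pflag r f) (pexp L c0 r \<kappa>) (pmeasure (A \<union> K) (w K) r (P K))"
  and ent: "flag_entropy r V' (pexp L c0 r \<kappa>) (pmeasure (A \<union> K) (w K) r (P K)) <=
   flag_entropy r (pflag r f) (pexp L c0 r \<kappa>) (pmeasure (A \<union> K) (w K) r (P K)) - eps"
 shows "(\<Sum>K\<in>\<K>. \<Prod>a\<in>K. 1 / real a) <= C ^ r * exp (- eps * L +
  real r * (real (card (cube :: (rat ^ 'k) set)) * (2 + eps1 * L) + real CARD('k)))"
proof -
 let ?c = "pexp L c0 r \<kappa>" and ?\<mu> = "pmeasure (A \<union> K) (w K) r (P K)" and ?V = "pflag r f"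
 let ?h = "real (card (cube :: (rat ^ 'k) set))"
 define H where "H j = coset_entropy (?\<mu> j) (V' j)" for j
 define d where "d j = real (vec.dim (?V j)) - real (vec.dim (V' j))" for j
 have supp: "set_pmf (?\<mu> j) \<subseteq> ?V j \<inter> cube" if "j \<in> {1..r}" for j using sys that by (auto simp: system_def)
 have H: "0 <= H j" "H j <= ?h" if "j \<in> {1..r}" for j
  unfolding H_def using supp[OF that] by (auto intro: coset_entropy_nonneg coset_entropy_le V'_subspace)
 have d: "0 <= d j" "d j <= real CARD('k)" if "j \<in> {1..r}" for j
 proof -
  show "0 <= d j" using dim_greedy[of j] that by (simp add: d_def)
  have "vec.dim (?V j) <= CARD('k)" using vec.dim_subset_UNIV[of "?V j"] by (simp add: vec.dimension_def card_cart_basis)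
  then show "d j <= real CARD('k)" by (simp add: d_def)
 qed
 have r1: "1 <= r" using sys by (simp add: system_def)
 have "(\<Sum>j\<in>{0..r}. \<Sum>x\<in>cube. real (N j x) * (- ln (q j x))) = (\<Sum>j\<in>{1..r}. \<Sum>x\<in>cube. real (N j x) * (- ln (q j x)))"
  using level_zero[OF K] by (simp add: sum.atLeast_Suc_atMost[of 0 r])
 also have "... <= (\<Sum>j\<in>{1..r}. (?c j - ?c (j + 1)) * L * H j + ?h * (2 + eps1 * L))"
 proof (rule sum_mono)
  fix j assume j: "j \<in> {1..r}"
  have "(\<Sum>x\<in>cube. real (N j x) * (- ln (q j x))) = real (card {a \<in> A \<union> K. level r (P K) a = j}) * H j"
   unfolding H_def by (rule level_entropy[OF K j])
  also have "... <= ((?c j - ?c (j + 1)) * L + 2 + eps1 * L) * H j"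
   by (intro mult_right_mono card_level[OF K tpl L c0 range j] H[OF j])
  also have "... = (?c j - ?c (j + 1)) * L * H j + H j * (2 + eps1 * L)" by (simp add: algebra_simps)
  also have "... <= (?c j - ?c (j + 1)) * L * H j + ?h * (2 + eps1 * L)"
   using H[OF j] eps1 L by (intro add_left_mono mult_right_mono) auto
  finally show "(\<Sum>x\<in>cube. real (N j x) * (- ln (q j x))) <= (?c j - ?c (j + 1)) * L * H j + ?h * (2 + eps1 * L)" .
 qed
 also have "... = L * (\<Sum>j\<in>{1..r}. (?c j - ?c (j + 1)) * H j) + real r * (?h * (2 + eps1 * L))"
  by (simp add: sum.distrib sum_distrib_left mult_ac)
 finally have S: "(\<Sum>j\<in>{0..r}. \<Sum>x\<in>cube. real (N j x) * (- ln (q j x))) <=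
  L * (\<Sum>j\<in>{1..r}. (?c j - ?c (j + 1)) * H j) + real r * (?h * (2 + eps1 * L))" .
 have "(\<Sum>j\<in>{1..r}. (?c j - ?c (j + 1)) * H j) <= (\<Sum>j\<in>{1..r}. (?c j - ?c (j + 1)) * d j) + c0 * d r - eps"
 proof -
  have V0: "V' 0 = vec.span {ones}" "?V 0 = vec.span {ones}" using sub by (simp_all add: subflag_def flag_def pflag_def)
  have Hz: "coset_entropy (?\<mu> j) (?V j) = 0" if "j \<in> {1..r}" for j
   using supp[OF that] by (intro coset_entropy_zero) (auto simp: pflag_def)
  have cr: "?c (r + 1) = c0" by (simp add: pexp_def)
  have "flag_entropy r ?V ?c ?\<mu> = (\<Sum>j=1..r. (?c j - ?c (j + 1)) * real (vec.dim (?V j))) + c0 * real (vec.dim (?V r)) - ?c 1 * real (vec.dim (vec.span {ones :: rat ^ 'k}))"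
   unfolding flag_entropy_alt cr V0
   by (intro arg_cong2[where f = "(-)"] arg_cong2[where f = "(+)"] sum.cong refl) (simp only: Hz add_0)
  moreover have "flag_entropy r V' ?c ?\<mu> = (\<Sum>j=1..r. (?c j - ?c (j + 1)) * H j) + (\<Sum>j=1..r. (?c j - ?c (j + 1)) * real (vec.dim (V' j))) + c0 * real (vec.dim (V' r)) - ?c 1 * real (vec.dim (vec.span {ones :: rat ^ 'k}))"
   unfolding flag_entropy_alt cr V0 H_def by (simp add: distrib_left sum.distrib)
  moreover have "(\<Sum>j\<in>{1..r}. (?c j - ?c (j + 1)) * d j) = (\<Sum>j=1..r. (?c j - ?c (j + 1)) * real (vec.dim (?V j))) - (\<Sum>j=1..r. (?c j - ?c (j + 1)) * real (vec.dim (V' j)))"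
   by (simp add: d_def right_diff_distrib sum_subtractf)
  moreover have "c0 * d r = c0 * real (vec.dim (?V r)) - c0 * real (vec.dim (V' r))" by (simp add: d_def right_diff_distrib)
  ultimately show ?thesis using ent by linarith
 qed
 then have "L * (\<Sum>j\<in>{1..r}. (?c j - ?c (j + 1)) * H j) <= L * ((\<Sum>j\<in>{1..r}. (?c j - ?c (j + 1)) * d j) + c0 * d r - eps)"
  using L by (intro mult_left_mono) auto
 moreover have "L * ((\<Sum>j\<in>{1..r}. (?c j - ?c (j + 1)) * d j) + c0 * d r) <= (\<Sum>j\<in>{1..r}. d j * (\<kappa>' j - \<kappa>' (j + 1))) + real r * real CARD('k)"
 proof -
  have "L * ((\<Sum>j\<in>{1..r}. (?c j - ?c (j + 1)) * d j) + c0 * d r) = (\<Sum>j\<in>{1..r}. d j * (L * (?c j - ?c (j + 1) + (if j = r then c0 else 0))))"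
  proof -
   have "c0 * d r = (\<Sum>j\<in>{1..r}. (if j = r then c0 else 0) * d j)"
    using r1 by (subst sum.remove[of _ r]) (auto intro!: sum.neutral)
   then show ?thesis by (simp add: sum.distrib[symmetric] sum_distrib_left algebra_simps)
  qed
  also have "... <= (\<Sum>j\<in>{1..r}. d j * (\<kappa>' j - \<kappa>' (j + 1)) + real CARD('k))"
  proof (rule sum_mono)
   fix j assume j: "j \<in> {1..r}"
   have cL: "?c s * L = max (real (\<kappa> s)) (c0 * L)" if "s \<in> {1..r}" for s
    using that L by (simp add: pexp_def max_mult_distrib_right)
   have up: "?c j * L <= real (\<kappa> j) + 1"
   proof -
    have "P K j \<in> A \<union> K" using K_eq[OF K] j by blast
    then have "c0 * L <= ln (real (P K j))" using range by blast
    also have "... <= ln (exp (real (\<kappa> j) + 1))" using P_le[OF K j] P_pos[OF K j] by (subst ln_le_cancel_iff) auto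
    finally show ?thesis unfolding cL[OF j] by simp
   qed
   have "L * (?c j - ?c (j + 1) + (if j = r then c0 else 0)) <= \<kappa>' j - \<kappa>' (j + 1) + 1"
   proof (cases "j = r")
    case True
    then show ?thesis using up by (simp add: \<kappa>'_def pexp_def algebra_simps)
   next
    case False
    then have "j + 1 \<in> {1..r}" using j by auto
    then have "real (\<kappa> (j + 1)) <= ?c (j + 1) * L" by (simp add: cL)
    then show ?thesis using up j False by (simp add: \<kappa>'_def algebra_simps)
   qed
   then have "d j * (L * (?c j - ?c (j + 1) + (if j = r then c0 else 0))) <= d j * (\<kappa>' j - \<kappa>' (j + 1) + 1)"
    using d[OF j] by (intro mult_left_mono) auto
   also have "... <= d j * (\<kappa>' j - \<kappa>' (j + 1)) + real CARD('k)" using d[OF j] by (simp add: algebra_simps)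
   finally show "d j * (L * (?c j - ?c (j + 1) + (if j = r then c0 else 0))) <= d j * (\<kappa>' j - \<kappa>' (j + 1)) + real CARD('k)" .
  qed
  also have "... = (\<Sum>j\<in>{1..r}. d j * (\<kappa>' j - \<kappa>' (j + 1))) + real r * real CARD('k)" by (simp add: sum.distrib)
  finally show ?thesis .
 qed
 ultimately have "(\<Sum>j\<in>{0..r}. \<Sum>x\<in>cube. real (N j x) * (- ln (q j x))) - (\<Sum>j\<in>{1..r}. d j * (\<kappa>' j - \<kappa>' (j + 1)))
  <= - eps * L + real r * (?h * (2 + eps1 * L) + real CARD('k))"
  using S by (simp add: algebra_simps)
 moreover have "0 <= C" using \<Phi> by (simp add: C_def)
 ultimately show ?thesis using class_weight unfolding d_def[symmetric]
  by (intro order_trans[OF class_weight[folded d_def]] mult_left_mono) (auto simp: d_def)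
qed

end

section \<open>Upper bound: union over all data and the final limit\<close>

section \<open>The upper bound\<close>

definition pivoted :: "real => real => real => nat set => nat set => nat => (nat => nat) => (nat => rat ^ 'k::finite) => bool" where
 "pivoted eps1 L c0 A K r p om \<longleftrightarrow> K = p ` {1..r} & K \<inter> A = {} & finite A & pivots (A \<union> K) om r p & (\<forall>a. om a \<in> cube) &
  (\<Sum>a\<in>A \<union> K. of_nat a *s om a) \<in> vec.span {ones} & (\<forall>i i'. i ~= i' \<longrightarrow> (\<exists>a\<in>A \<union> K. om a $ i ~= om a $ i')) &
  typical eps1 L (A \<union> K) & (\<forall>a\<in>A \<union> K. 1 <= a & c0 * L <= ln (real a) & ln (real a) <= L)"

lemma pivotedD:
 assumes "pivoted eps1 L c0 A K r p om"
 shows "K = p ` {1..r}" "K \<inter> A = {}" "finite A" "pivots (A \<union> K) om r p" "om a \<in> cube"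
  "(\<Sum>a\<in>A \<union> K. of_nat a *s om a) \<in> vec.span {ones}" "i ~= i' ==> \<exists>a\<in>A \<union> K. om a $ i ~= om a $ i'"
  "typical eps1 L (A \<union> K)" "a \<in> A \<union> K ==> 1 <= a & c0 * L <= ln (real a) & ln (real a) <= L" "finite K"
proof -
 note pv = assms[unfolded pivoted_def]
 show K: "K = p ` {1..r}" by (rule pv[THEN conjunct1])
 show "finite K" unfolding K by simp
 note pv = pv[THEN conjunct2]
 show "K \<inter> A = {}" by (rule pv[THEN conjunct1])
 note pv = pv[THEN conjunct2]
 show "finite A" by (rule pv[THEN conjunct1])
 note pv = pv[THEN conjunct2]
 show "pivots (A \<union> K) om r p" by (rule pv[THEN conjunct1])
 note pv = pv[THEN conjunct2]
 show "om a \<in> cube" by (rule pv[THEN conjunct1, THEN spec])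
 note pv = pv[THEN conjunct2]
 show "(\<Sum>a\<in>A \<union> K. of_nat a *s om a) \<in> vec.span {ones}" by (rule pv[THEN conjunct1])
 note pv = pv[THEN conjunct2]
 show "i ~= i' ==> \<exists>a\<in>A \<union> K. om a $ i ~= om a $ i'" by (rule pv[THEN conjunct1, THEN spec, THEN spec, THEN mp])
 note pv = pv[THEN conjunct2]
 show "typical eps1 L (A \<union> K)" by (rule pv[THEN conjunct1])
 show "a \<in> A \<union> K ==> 1 <= a & c0 * L <= ln (real a) & ln (real a) <= L" by (rule pv[THEN conjunct2, THEN bspec])
qed

lemma pivoted_exists:
 assumes "has_equal_sums CARD('k::finite) A" "finite A" "typical eps1 L A"
  and "!!a. a \<in> A ==> 1 <= a & c0 * L <= ln (real a) & ln (real a) <= L"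
 shows "\<exists>K\<subseteq>A. \<exists>r p om. pivoted eps1 L c0 (A - K) K r p (om :: nat => rat ^ 'k)"
proof -
 obtain om :: "nat => rat ^ 'k" where om: "!!a. om a \<in> cube" "(\<Sum>a\<in>A. of_nat a *s om a) \<in> vec.span {ones}"
  "!!i i'. i ~= i' ==> \<exists>a\<in>A. om a $ i ~= om a $ i'" by (rule has_equal_sumsE[OF assms(1,2)]) (rule that)
 obtain r p where p: "pivots A om r p" using pivots_exist[OF assms(2)] by blast
 let ?K = "p ` {1..r}"
 have K: "?K \<subseteq> A" using p by (auto simp: pivots_def)
 then have eq: "(A - ?K) \<union> ?K = A" by auto
 have "pivoted eps1 L c0 (A - ?K) ?K r p om"
  unfolding pivoted_def eq
 proof (intro conjI allI impI)
  show "\<exists>a\<in>A. om a $ i ~= om a $ i'" if "i ~= i'" for i i' by (rule om(3)[OF that])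
  show "\<forall>a\<in>A. 1 <= a & c0 * L <= ln (real a) & ln (real a) <= L" using assms(4) by blast
 qed (use p om(1,2) assms(2,3) in \<open>auto\<close>)
 then show ?thesis using K by blast
qed

context
 fixes eps1 L c0 :: real
 assumes L: "0 < L" and c0: "0 <= c0" "c0 <= 1" and eps1: "0 <= eps1" "eps1 <= 1"
begin

lemma pivoted_system:
 fixes om :: "nat => rat ^ 'k::finite"
 assumes k: "2 <= CARD('k)" and pv: "pivoted eps1 L c0 A K r p om"
 shows "system r (pflag r (om \<circ> p)) (pexp L c0 r (%s. nat \<lfloor>ln (real (p s))\<rfloor>)) (pmeasure (A \<union> K) om r p)"
  and "r <= CARD('k)" "real (card (A \<union> K)) <= 2 * L + 1" "finite K" "card K <= CARD('k)"
proof -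
 note pvD = pivotedD[OF pv]
 show fK: "finite K" by (rule pvD)
 show sys: "system r (pflag r (om \<circ> p)) (pexp L c0 r (%s. nat \<lfloor>ln (real (p s))\<rfloor>)) (pmeasure (A \<union> K) om r p)"
 proof (rule pivots_system[OF k _ pvD(4) L c0])
  show "finite (A \<union> K)" using pvD(3) fK by simp
  show "1 <= a & ln (real a) <= L" if "a \<in> A \<union> K" for a using pvD(9)[OF that] by blast
 qed (rule pvD; assumption?)+
 show r: "r <= CARD('k)" using system_length_le[OF sys] by simp
 have "card (p ` {1..r}) <= card {1..r}" by (rule card_image_le) simp
 then show "card K <= CARD('k)" unfolding pvD(1)[symmetric] using r by simp
 have "A \<union> K \<subseteq> insert 1 ((A \<union> K) \<inter> expint 0 L)"
 proof
  fix a assume a: "a \<in> A \<union> K"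
  have a1: "1 <= a" "ln (real a) <= L" using pvD(9)[OF a] by auto
  then have "exp (ln (real a)) <= exp L" by (simp only: exp_le_cancel_iff)
  then have "real a <= exp L" using a1 by simp
  then show "a \<in> insert 1 ((A \<union> K) \<inter> expint 0 L)" using a a1 by (cases "a = 1") (auto simp: expint_def)
 qed
 then have "card (A \<union> K) <= card (insert 1 ((A \<union> K) \<inter> expint 0 L))" by (intro card_mono) auto
 also have "... <= card ((A \<union> K) \<inter> expint 0 L) + 1" by (simp add: card_insert_if)
 finally have "real (card (A \<union> K)) <= real (card ((A \<union> K) \<inter> expint 0 L)) + 1" by linarith
 moreover have "real (card ((A \<union> K) \<inter> expint 0 L)) <= L - 0 + eps1 * L" using L by (intro pvD(8)[unfolded typical_def, rule_format]) simp
 moreover have "eps1 * L <= 1 * L" using eps1 L by (intro mult_right_mono) auto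
 ultimately show "real (card (A \<union> K)) <= 2 * L + 1" by linarith
qed

text \<open>The pivot sets are split by their discrete data, which take polynomially many values in
  b. Every class in the sum has a member, and this member provides the system to which the gap is
  applied.\<close>

lemma pivot_sets_weight:
 fixes eps \<Phi> :: real
 assumes k: "2 <= CARD('k::finite)" and \<Phi>: "1 <= \<Phi>"
  and functional: "!!U g. U \<in> dspans ==> g \<in> cube ==> g \<notin> (U :: (rat ^ 'k) set) ==>
   \<exists>\<phi>. (\<forall>x y. \<phi> (x + y) = \<phi> x + \<phi> y) & (\<forall>t x. \<phi> (t *s x) = t * \<phi> x) & (\<forall>x\<in>U. \<phi> x = 0) & \<phi> g = (1 :: rat) &
    (\<forall>x\<in>dcube. \<bar>real_of_rat (\<phi> x)\<bar> <= \<Phi>)"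
  and gap: "!!r (V :: nat => (rat ^ 'k) set) c \<mu>. system r V c \<mu> ==> c (r + 1) = c0 ==>
   \<exists>V'. subflag r V' V & (\<forall>j. V' j \<in> dspans) & flag_entropy r V' c \<mu> <= flag_entropy r V c \<mu> - eps"
  and \<K>: "finite \<K>" "!!K. K \<in> \<K> ==> \<exists>r p om. pivoted eps1 L c0 A K r p (om :: nat => rat ^ 'k)"
  and b: "2 * L + 1 <= real b"
 shows "(\<Sum>K\<in>\<K>. \<Prod>a\<in>K. 1 / real a) <=
  real ((CARD('k) + 1) * ((b + 1) ^ CARD('k) * (card (cube :: (rat ^ 'k) set) ^ CARD('k) * ((b + 1) ^ CARD('k) * (b + 1) ^ ((CARD('k) + 1) * card (cube :: (rat ^ 'k) set)))))) *
  ((\<Phi> * exp 1 * (real b + real CARD('k)) + 2) ^ CARD('k) *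
   exp (- eps * L + real CARD('k) * (real (card (cube :: (rat ^ 'k) set)) * (2 + eps1 * L) + real CARD('k))))"
proof -
 let ?k = "CARD('k)" and ?h = "card (cube :: (rat ^ 'k) set)"
 have "\<forall>K\<in>\<K>. \<exists>x. pivoted eps1 L c0 A K (fst x) (fst (snd x)) (snd (snd x) :: nat => rat ^ 'k)" using \<K>(2) by auto
 from bchoice[OF this] obtain X where X: "!!K. K \<in> \<K> ==> pivoted eps1 L c0 A K (fst (X K)) (fst (snd (X K))) (snd (snd (X K)) :: nat => rat ^ 'k)"
  by blast
 define R where "R K = fst (X K)" for K
 define P where "P K = fst (snd (X K))" for K
 define w where "w K = snd (snd (X K))" for K
 have pv: "pivoted eps1 L c0 A K (R K) (P K) (w K)" if "K \<in> \<K>" for K using X[OF that] by (simp add: R_def P_def w_def)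
 note ps = pivoted_system[OF k pv]
 define kap where "kap K s = nat \<lfloor>ln (real (P K s))\<rfloor>" for K s
 define mm where "mm K s = card {a \<in> A. a < P K s}" for K s
 define NN where "NN K j x = card {a \<in> A \<union> K. level (R K) (P K) a = j & w K a = x}" for K j x
 \<comment> \<open>Restriction to the relevant indices leaves finitely many possible values, namely
   elements of the sets \<open>Y r\<close> below.\<close>
 define data where "data K = (R K, restrict (kap K) {1..R K}, restrict (w K \<circ> P K) {1..R K}, restrict (mm K) {1..R K},
  restrict (%z. NN K (fst z) (snd z)) ({0..R K} \<times> cube))" for K
 let ?E = "(\<Phi> * exp 1 * (real b + real ?k) + 2) ^ ?k * exp (- eps * L + real ?k * (real ?h * (2 + eps1 * L) + real ?k))"
 have cls: "(\<Sum>K\<in>{K \<in> \<K>. data K = data K0}. \<Prod>a\<in>K. 1 / real a) <= ?E" if K0: "K0 \<in> \<K>" for K0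
 proof -
  let ?r = "R K0" and ?f = "w K0 \<circ> P K0" and ?KK = "{K \<in> \<K>. data K = data K0}"
  let ?V = "pflag ?r ?f" and ?c = "pexp L c0 ?r (kap K0)" and ?\<mu> = "pmeasure (A \<union> K0) (w K0) ?r (P K0)"
  have sys: "system ?r ?V ?c ?\<mu>" using ps(1)[OF K0] by (simp add: kap_def[abs_def])
  obtain V' where V': "subflag ?r V' ?V" "!!j. V' j \<in> dspans" "flag_entropy ?r V' ?c ?\<mu> <= flag_entropy ?r ?V ?c ?\<mu> - eps"
   using gap[OF sys] by (auto simp: pexp_def)
  have same: "R K = ?r" "!!s. s \<in> {1..?r} ==> kap K s = kap K0 s" "!!s. s \<in> {1..?r} ==> w K (P K s) = ?f s"
   "!!s. s \<in> {1..?r} ==> mm K s = mm K0 s" "!!j x. j \<in> {0..?r} ==> x \<in> cube ==> NN K j x = NN K0 j x"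
   if "K \<in> ?KK" for K
  proof -
   have eq: "data K = data K0" using that by simp
   then show R: "R K = ?r" by (simp add: data_def)
   have e: "restrict (kap K) {1..?r} = restrict (kap K0) {1..?r}" "restrict (w K \<circ> P K) {1..?r} = restrict ?f {1..?r}"
    "restrict (mm K) {1..?r} = restrict (mm K0) {1..?r}"
    "restrict (%z. NN K (fst z) (snd z)) ({0..?r} \<times> cube) = restrict (%z. NN K0 (fst z) (snd z)) ({0..?r} \<times> cube)"
    using eq R by (simp_all add: data_def)
   show "kap K s = kap K0 s" if "s \<in> {1..?r}" for s using fun_cong[OF e(1), of s] that by simp
   show "w K (P K s) = ?f s" if "s \<in> {1..?r}" for s using fun_cong[OF e(2), of s] that by simp
   show "mm K s = mm K0 s" if "s \<in> {1..?r}" for s using fun_cong[OF e(3), of s] that by simp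
   show "NN K j x = NN K0 j x" if "j \<in> {0..?r}" "x \<in> cube" for j x using fun_cong[OF e(4), of "(j, x)"] that by simp
  qed
  have pvK: "pivoted eps1 L c0 A K ?r (P K) (w K)" if "K \<in> ?KK" for K using pv[of K] same(1)[OF that] that by simp
  have K0': "K0 \<in> ?KK" using K0 by simp
  interpret pc: pivot_class A ?r "kap K0" ?f V' "mm K0" "NN K0" \<Phi> ?KK P w
  proof
   show "finite A" by (rule pivotedD[OF pvK[OF K0']])
   show "finite ?KK" using \<K>(1) by simp
   show "1 <= \<Phi>" by (rule \<Phi>)
   show "subflag ?r V' ?V" "V' j \<in> dspans" for j by (rule V')+
   fix K assume K: "K \<in> ?KK"
   note pK = pivotedD[OF pvK[OF K]]
   show "K = P K ` {1..?r}" "K \<inter> A = {}" "pivots (A \<union> K) (w K) ?r (P K)"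
    "(\<Sum>a\<in>A \<union> K. of_nat a *s w K a) \<in> vec.span {ones}" "w K a \<in> cube" for a by (rule pK)+
   show "card {a \<in> A \<union> K. level ?r (P K) a = j & w K a = x} = NN K0 j x" if "j \<in> {0..?r}" "x \<in> cube" for j x
    using same(5)[OF K that] same(1)[OF K] by (simp add: NN_def)
   fix s assume s: "s \<in> {1..?r}"
   show "w K (P K s) = ?f s" by (rule same(3)[OF K s])
   show "nat \<lfloor>ln (real (P K s))\<rfloor> = kap K0 s" using same(2)[OF K s] by (simp only: kap_def)
   show "card {a \<in> A. a < P K s} = mm K0 s" using same(4)[OF K s] by (simp only: mm_def)
   have "P K s \<in> A \<union> K" using pK(1) s by blast
   from pK(9)[OF this] show "1 <= P K s" by blast
  qed (rule functional)
  note p0 = pivotedD[OF pvK[OF K0']]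
  have "(\<Sum>K\<in>?KK. \<Prod>a\<in>K. 1 / real a) <= pc.C ^ ?r * exp (- eps * L + real ?r * (real ?h * (2 + eps1 * L) + real ?k))"
   by (rule pc.class_small[OF K0' p0(8) L c0(1) eps1(1) p0(9) sys V'(3)])
  also have "... <= ?E"
  proof (intro mult_mono)
   have r: "?r <= ?k" by (rule ps(2)[OF K0])
   have fin: "finite (A \<union> K0)" using p0(3,10) by blast
   have "card A <= card (A \<union> K0)" by (rule card_mono[OF fin]) simp
   then have "real (card A) <= real b" using ps(3)[OF K0] b by linarith
   then have C: "pc.C <= \<Phi> * exp 1 * (real b + real ?k) + 2"
    unfolding pc.C_def using r \<Phi> by (intro add_right_mono mult_left_mono) auto
   have "0 <= \<Phi> * exp 1 * (real (card A) + real ?r)" using \<Phi> by simp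
   then have C1: "1 <= pc.C" by (simp add: pc.C_def)
   have "pc.C ^ ?r <= pc.C ^ ?k" by (rule power_increasing[OF r C1])
   also have "... <= (\<Phi> * exp 1 * (real b + real ?k) + 2) ^ ?k" using C C1 by (intro power_mono) auto
   finally show "pc.C ^ ?r <= (\<Phi> * exp 1 * (real b + real ?k) + 2) ^ ?k" .
   have "real ?r * (real ?h * (2 + eps1 * L) + real ?k) <= real ?k * (real ?h * (2 + eps1 * L) + real ?k)"
    using r eps1 L by (intro mult_right_mono) auto
   then show "exp (- eps * L + real ?r * (real ?h * (2 + eps1 * L) + real ?k)) <= exp (- eps * L + real ?k * (real ?h * (2 + eps1 * L) + real ?k))"
    by simp
   show "0 <= (\<Phi> * exp 1 * (real b + real ?k) + 2) ^ ?k" using \<Phi> by simp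
  qed simp
  finally show ?thesis .
 qed
 define Y where "Y r = (Pi\<^sub>E {1..r} (%_. {..b})) \<times> (Pi\<^sub>E {1..r} (%_. cube :: (rat ^ 'k) set)) \<times> (Pi\<^sub>E {1..r} (%_. {..b})) \<times> (Pi\<^sub>E ({0..r} \<times> (cube :: (rat ^ 'k) set)) (%_. {..b}))"
  for r :: nat
 have finY: "finite (Y r)" for r unfolding Y_def by (intro finite_cartesian_product finite_PiE) auto
 have cardY: "card (Y r) <= (b + 1) ^ ?k * (?h ^ ?k * ((b + 1) ^ ?k * (b + 1) ^ ((?k + 1) * ?h)))" if "r <= ?k" for r
 proof -
  have h1: "1 <= ?h" using ones_in_cube card_gt_0_iff[of "cube :: (rat ^ 'k) set"] by (metis Suc_leI One_nat_def empty_iff finite_cube)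
  have "card (Y r) = (b + 1) ^ r * (?h ^ r * ((b + 1) ^ r * (b + 1) ^ ((r + 1) * ?h)))"
   unfolding Y_def by (simp add: card_cartesian_product card_PiE)
  also have "... <= (b + 1) ^ ?k * (?h ^ ?k * ((b + 1) ^ ?k * (b + 1) ^ ((?k + 1) * ?h)))"
   using that h1 by (intro mult_le_mono power_increasing) auto
  finally show ?thesis .
 qed
 have dataY: "data K \<in> Sigma {..?k} Y" if K: "K \<in> \<K>" for K
 proof -
  note pK = pivotedD[OF pv[OF K]]
  have fin: "finite (A \<union> K)" using pK(3,10) by blast
  have card: "card (A \<union> K) <= b" using ps(3)[OF K] b by linarith
  have "kap K s <= b" if s: "s \<in> {1..R K}" for s
  proof -
   have "P K s \<in> A \<union> K" using pK(1) s by blast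
   from pK(9)[OF this] have "ln (real (P K s)) <= real b" using b L by linarith
   then show ?thesis by (simp add: kap_def floor_le_iff nat_le_iff)
  qed
  moreover have "mm K s <= b" for s
  proof -
   have "mm K s <= card (A \<union> K)" unfolding mm_def by (intro card_mono fin) auto
   then show ?thesis using card by simp
  qed
  moreover have "NN K j x <= b" for j x
  proof -
   have "NN K j x <= card (A \<union> K)" unfolding NN_def by (intro card_mono fin) auto
   then show ?thesis using card by simp
  qed
  moreover have "w K a \<in> cube" for a by (rule pK)
  ultimately show ?thesis using ps(2)[OF K] by (auto simp: data_def Y_def)
 qed
 have "card (data ` \<K>) <= card (Sigma {..?k} Y)" 
 proof (rule card_mono)
  show "finite (Sigma {..?k} Y)" by (rule finite_SigmaI) (simp, rule finY)
  show "data ` \<K> \<subseteq> Sigma {..?k} Y" by (rule image_subsetI) (rule dataY)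
 qed
 also have "... = (\<Sum>r\<le>?k. card (Y r))" using finY by (intro card_SigmaI) auto
 also have "... <= (\<Sum>r\<le>?k. (b + 1) ^ ?k * (?h ^ ?k * ((b + 1) ^ ?k * (b + 1) ^ ((?k + 1) * ?h))))"
  using cardY by (intro sum_mono) auto
 finally have cd: "card (data ` \<K>) <= (?k + 1) * ((b + 1) ^ ?k * (?h ^ ?k * ((b + 1) ^ ?k * (b + 1) ^ ((?k + 1) * ?h))))"
  by (simp only: sum_constant of_nat_id card_atMost Suc_eq_plus1)
 have E0: "0 <= ?E" using \<Phi> by simp
 have "(\<Sum>K\<in>\<K>. \<Prod>a\<in>K. 1 / real a) = (\<Sum>d\<in>data ` \<K>. \<Sum>K\<in>{K \<in> \<K>. data K = d}. \<Prod>a\<in>K. 1 / real a)"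
  using \<K>(1) by (rule sum.image_gen)
 also have "... <= (\<Sum>d\<in>data ` \<K>. ?E)"
 proof (rule sum_mono)
  fix d assume "d \<in> data ` \<K>"
  then obtain K0 where K0: "K0 \<in> \<K>" "d = data K0" by blast
  then show "(\<Sum>K\<in>{K \<in> \<K>. data K = d}. \<Prod>a\<in>K. 1 / real a) <= ?E" using cls[OF K0(1)] by simp
 qed
 also have "... = real (card (data ` \<K>)) * ?E" by simp
 also have "... <= real ((?k + 1) * ((b + 1) ^ ?k * (?h ^ ?k * ((b + 1) ^ ?k * (b + 1) ^ ((?k + 1) * ?h))))) * ?E"
  using cd E0 by (intro mult_right_mono) (simp_all only: of_nat_le_iff)
 finally show ?thesis .
qed

text \<open>After \<open>expect_superset\<close> the set K no longer has to lie in the random set B,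
  and only B - K matters. It depends on K through Z, the intersection of K and B, which is a subset
  of B with at most k elements. So polynomially many Z suffice, and for each of them the non-pivot
  part B - Z is fixed while K is summed.\<close>

lemma prb_equal_sums_typical:
 assumes k: "2 <= CARD('k::finite)" and G: "finite G" "!!a. a \<in> G ==> 1 <= a & c0 * L <= ln (real a) & ln (real a) <= L"
  and b: "2 * L + 1 + real CARD('k) <= real b" and Q: "0 <= Q"
  and main: "!!A \<K>. finite \<K> ==> (!!K. K \<in> \<K> ==> \<exists>r p om. pivoted eps1 L c0 A K r p (om :: nat => rat ^ 'k)) ==>
   (\<Sum>K\<in>\<K>. \<Prod>a\<in>K. 1 / real a) <= Q"
 shows "prb G (%A. has_equal_sums CARD('k) A & typical eps1 L A) <= real ((CARD('k) + 1) * (b + 1) ^ CARD('k)) * Q"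
proof -
 let ?k = "CARD('k)"
 define hp where "hp A K \<longleftrightarrow> (\<exists>r p om. pivoted eps1 L c0 A K r p (om :: nat => rat ^ 'k))" for A K
 let ?W = "%K. \<Prod>a\<in>K. 1 / real a"
 have W0: "0 <= ?W K" for K :: "nat set" by (intro prod_nonneg) simp
 have finG: "finite (Pow G)" using G by simp
 have "prb G (%A. has_equal_sums ?k A & typical eps1 L A) <= prb G (%A. \<exists>K\<in>Pow G. K \<subseteq> A & hp (A - K) K)"
 proof (rule prb_mono)
  fix A assume A: "A \<subseteq> G" "has_equal_sums ?k A & typical eps1 L A"
  have "\<exists>K\<subseteq>A. \<exists>r p om. pivoted eps1 L c0 (A - K) K r p (om :: nat => rat ^ 'k)"
   using A G finite_subset by (intro pivoted_exists) blast+
  then show "\<exists>K\<in>Pow G. K \<subseteq> A & hp (A - K) K" unfolding hp_def using A by blast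
 qed
 also have "... <= (\<Sum>K\<in>Pow G. prb G (%A. K \<subseteq> A & hp (A - K) K))" by (rule prb_Bex[OF finG])
 also have "... = (\<Sum>K\<in>Pow G. ?W K * expect G (%B. of_bool (hp (B - K) K)))"
 proof (rule sum.cong[OF refl])
  fix K assume "K \<in> Pow G"
  then have "expect G (%A. of_bool (K \<subseteq> A) * of_bool (hp (A - K) K)) = ?W K * expect G (%B. of_bool (hp (B - K) K))"
   using G by (intro expect_superset) auto
  then show "prb G (%A. K \<subseteq> A & hp (A - K) K) = ?W K * expect G (%B. of_bool (hp (B - K) K))"
   by (simp only: of_bool_conj)
 qed
 also have "... = expect G (%B. \<Sum>K\<in>Pow G. ?W K * of_bool (hp (B - K) K))"
  by (simp only: expect_sum expect_cmult)
 also have "... <= expect G (%B. real ((?k + 1) * (b + 1) ^ ?k) * Q)"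
 proof (rule expect_mono)
  fix B assume B: "B \<subseteq> G"
  have finB: "finite B" using B G finite_subset by blast
  have hpD: "finite K" "card K <= ?k" "card B <= b" if hp0: "hp (B - K) K" for K
  proof -
   obtain r p and om :: "nat => rat ^ 'k" where pv: "pivoted eps1 L c0 (B - K) K r p om" using hp0 unfolding hp_def by blast
   note ps = pivoted_system[OF k pv]
   show "finite K" "card K <= ?k" using ps by auto
   have "card B <= card ((B - K) \<union> K)" using finB ps by (intro card_mono) auto
   then show "card B <= b" using ps(3) b by linarith
  qed
  define Zs where "Zs = {Z \<in> Pow B. card Z <= ?k & card B <= b}"
  have finZ: "finite Zs" unfolding Zs_def using finB by simp
  have cardZ: "card Zs <= (?k + 1) * (b + 1) ^ ?k"
  proof (cases "card B <= b")
   case True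
   have "Zs \<subseteq> set ` {xs. set xs \<subseteq> B & length xs <= ?k}"
   proof
    fix Z assume Z: "Z \<in> Zs"
    then obtain xs where xs: "set xs = Z" "distinct xs" using finite_distinct_list finB finite_subset unfolding Zs_def by blast
    then have "length xs = card Z" using distinct_card by fastforce
    then show "Z \<in> set ` {xs. set xs \<subseteq> B & length xs <= ?k}" using xs Z unfolding Zs_def by auto
   qed
   then have "card Zs <= card (set ` {xs. set xs \<subseteq> B & length xs <= ?k})"
    using finB by (intro card_mono finite_imageI finite_lists_length_le) auto
   also have "... <= card {xs. set xs \<subseteq> B & length xs <= ?k}" using finB by (intro card_image_le finite_lists_length_le)
   also have "... = (\<Sum>i\<le>?k. card B ^ i)" by (rule card_lists_length_le[OF finB])
   also have "... <= (\<Sum>i\<le>?k. (b + 1) ^ ?k)"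
   proof (rule sum_mono)
    fix i assume i: "i \<in> {..?k}"
    have "card B ^ i <= (b + 1) ^ i" using True by (intro power_mono) auto
    also have "... <= (b + 1) ^ ?k" using i by (intro power_increasing) auto
    finally show "card B ^ i <= (b + 1) ^ ?k" .
   qed
   finally show ?thesis by (simp only: sum_constant of_nat_id card_atMost Suc_eq_plus1)
  next
   case False
   then have "Zs = {}" by (auto simp: Zs_def)
   then show ?thesis by simp
  qed
  have "(\<Sum>K\<in>Pow G. ?W K * of_bool (hp (B - K) K)) <= (\<Sum>K\<in>Pow G. \<Sum>Z\<in>Zs. ?W K * of_bool (hp (B - Z) K))"
  proof (rule sum_mono)
   fix K assume K: "K \<in> Pow G"
   show "?W K * of_bool (hp (B - K) K) <= (\<Sum>Z\<in>Zs. ?W K * of_bool (hp (B - Z) K))"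
   proof (cases "hp (B - K) K")
    case True
    note h = hpD[OF True]
    have "card (K \<inter> B) <= card K" using h by (intro card_mono) auto
    then have Z: "K \<inter> B \<in> Zs" unfolding Zs_def using h by auto
    have "B - (K \<inter> B) = B - K" by auto
    then have "?W K * of_bool (hp (B - K) K) = ?W K * of_bool (hp (B - (K \<inter> B)) K)" by simp
    also have "... <= (\<Sum>Z\<in>Zs. ?W K * of_bool (hp (B - Z) K))" using Z finZ W0 by (intro member_le_sum) auto
    finally show ?thesis .
   next
    case False
    then show ?thesis using W0 by (simp add: sum_nonneg)
   qed
  qed
  also have "... = (\<Sum>Z\<in>Zs. \<Sum>K\<in>{K \<in> Pow G. hp (B - Z) K}. ?W K)"
  proof (subst sum.swap, rule sum.cong[OF refl])
   fix Z assume "Z \<in> Zs"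
   show "(\<Sum>K\<in>Pow G. ?W K * of_bool (hp (B - Z) K)) = (\<Sum>K\<in>{K \<in> Pow G. hp (B - Z) K}. ?W K)"
    using finG by (intro sum.mono_neutral_cong_right) auto
  qed
  also have "... <= (\<Sum>Z\<in>Zs. Q)"
   using finG by (intro sum_mono main) (auto simp: hp_def)
  also have "... = real (card Zs) * Q" by simp
  also have "... <= real ((?k + 1) * (b + 1) ^ ?k) * Q" using cardZ Q by (intro mult_right_mono) (simp_all only: of_nat_le_iff)
  finally show "(\<Sum>K\<in>Pow G. ?W K * of_bool (hp (B - K) K)) <= real ((?k + 1) * (b + 1) ^ ?k) * Q" .
 qed
 also have "... = real ((?k + 1) * (b + 1) ^ ?k) * Q" using G by (intro expect_const)
 finally show ?thesis .
qed

end

lemma power_times_exp_tendsto_0: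
 fixes e c :: real
 assumes e: "0 < e" shows "((%L. (2 * L + c) ^ M * exp (- (e * L))) \<longlongrightarrow> 0) at_top"
proof -
 let ?x = "%L. e / 2 * (c + 2 * L)"
 have "filterlim ?x at_top at_top"
  using e by (intro filterlim_tendsto_pos_mult_at_top[OF tendsto_const] filterlim_tendsto_add_at_top[OF tendsto_const] filterlim_ident) auto
 then have "((%L. ?x L ^ M / exp (?x L)) \<longlongrightarrow> 0) at_top"
  by (rule filterlim_compose[OF tendsto_power_div_exp_0])
 then have "((%L. (2 / e) ^ M * exp (e * c / 2) * (?x L ^ M / exp (?x L))) \<longlongrightarrow> (2 / e) ^ M * exp (e * c / 2) * 0) at_top"
  by (intro tendsto_mult tendsto_const)
 moreover have "(2 / e) ^ M * exp (e * c / 2) * (?x L ^ M / exp (?x L)) = (2 * L + c) ^ M * exp (- (e * L))" for L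
 proof -
  have "(2 / e) ^ M * ?x L ^ M = (2 / e * ?x L) ^ M" by (rule power_mult_distrib[symmetric])
  also have "2 / e * ?x L = 2 * L + c" using e by simp
  finally have 1: "(2 / e) ^ M * ?x L ^ M = (2 * L + c) ^ M" .
  have "exp (e * c / 2) / exp (?x L) = exp (e * c / 2 - ?x L)" by (rule exp_diff[symmetric])
  also have "e * c / 2 - ?x L = - (e * L)" by (simp add: field_simps)
  finally have 2: "exp (e * c / 2) / exp (?x L) = exp (- (e * L))" .
  show ?thesis unfolding 1[symmetric] 2[symmetric] by (simp only: times_divide_eq_left times_divide_eq_right mult_ac)
 qed
 ultimately show ?thesis by simp
qed

theorem beta_le_gamma:
 assumes k2: "2 <= CARD('k::finite)" shows "beta CARD('k) <= gamma TYPE('k)"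
 unfolding beta_def
proof (rule Sup_least, elim imageE)
 let ?k = "CARD('k)" and ?h = "card (cube :: (rat ^ 'k) set)"
 let ?m = "%c D. measure log_random_measure (equal_sums_event ?k c D)"
 fix x c assume x: "x = ereal c" and "c \<in> {c. c < 1 & (?m c \<longlongrightarrow> 1) at_top}"
 then have c: "c < 1" "(?m c \<longlongrightarrow> 1) at_top" by auto
 define c0 where "c0 = max c 0"
 have c0: "0 <= c0" "c0 <= 1" "c <= c0" using c by (auto simp: c0_def)
 have lim: "(?m c0 \<longlongrightarrow> 1) at_top"
 proof (cases "0 <= c")
  case True then show ?thesis using c by (simp add: c0_def)
 next
  case False
  \<comment> \<open>For D >= 1 and c < 0 both lower ends are at most 1 and exclude no positive
    integer. A negative c can thus be replaced by 0, as is required because exponents of systems are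
    nonnegative.\<close>
  have "eventually (%D. ?m c D = ?m c0 D) at_top"
   using eventually_ge_at_top[of 1]
  proof eventually_elim
   case (elim D)
   have "D powr c <= D powr 0" using False elim by (intro powr_mono) auto
   then have "{a::nat. 1 <= a & D powr c <= real a & real a <= D} = {a. 1 <= a & D powr c0 <= real a & real a <= D}"
    using False elim by (auto simp: c0_def)
   then show ?case by (simp only: measure_equal_sums_event)
  qed
  then show ?thesis using c(2) by (rule Lim_transform_eventually[rotated])
 qed
 have "\<exists>r V \<mu> c'. system r (V :: nat => (rat ^ 'k) set) c' \<mu> & c' (r + 1) = c0 & entropy_condition r V c' \<mu>"
 proof (rule ccontr)
  assume none: "\<not> ?thesis"
  obtain eps where eps: "0 < eps" and gap: "!!r (V :: nat => (rat ^ 'k) set) c \<mu>. system r V c \<mu> ==> c (r + 1) = c0 ==>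
   \<exists>V'. subflag r V' V & (\<forall>j. V' j \<in> dspans) & flag_entropy r V' c \<mu> <= flag_entropy r V c \<mu> - eps"
  proof (rule entropy_gap)
   show "\<not> entropy_condition r V c \<mu>" if "system r V c \<mu>" "c (r + 1) = c0"
    for r and V :: "nat => (rat ^ 'k) set" and c \<mu> using none that by blast
  qed (rule that)
  obtain \<Phi> :: real where \<Phi>: "1 <= \<Phi>" and functional: "!!U g. U \<in> dspans ==> g \<in> cube ==> g \<notin> (U :: (rat ^ 'k) set) ==>
   \<exists>\<phi>. (\<forall>x y. \<phi> (x + y) = \<phi> x + \<phi> y) & (\<forall>t x. \<phi> (t *s x) = t * \<phi> x) & (\<forall>x\<in>U. \<phi> x = 0) & \<phi> g = (1 :: rat) &
    (\<forall>x\<in>dcube. \<bar>real_of_rat (\<phi> x)\<bar> <= \<Phi>)"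
   by (rule bounded_functionals) (rule that)
  have h1: "1 <= ?h" using ones_in_cube card_gt_0_iff[of "cube :: (rat ^ 'k) set"] by (metis Suc_leI One_nat_def empty_iff finite_cube)
  \<comment> \<open>Half of the gap pays for the typicality error k * h * eps1 * L in the
    exponent.\<close>
  define eps1 where "eps1 = min 1 (eps / (2 * real ?k * real ?h))"
  have kh: "0 < 2 * real ?k * real ?h" using h1 k2 by simp
  have eps1: "0 < eps1" "eps1 <= 1" "real ?k * real ?h * eps1 <= eps / 2"
  proof -
   show "0 < eps1" "eps1 <= 1" using eps kh by (auto simp: eps1_def)
   have "eps1 <= eps / (2 * real ?k * real ?h)" by (simp add: eps1_def)
   then show "real ?k * real ?h * eps1 <= eps / 2" using kh by (simp add: field_simps)
  qed
  define b where "b L = nat \<lceil>2 * L + 1 + real ?k\<rceil>" for L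
  define Q where "Q L = real ((?k + 1) * ((b L + 1) ^ ?k * (?h ^ ?k * ((b L + 1) ^ ?k * (b L + 1) ^ ((?k + 1) * ?h))))) *
   ((\<Phi> * exp 1 * (real (b L) + real ?k) + 2) ^ ?k * exp (- eps * L + real ?k * (real ?h * (2 + eps1 * L) + real ?k)))" for L
  define F where "F L = real ((?k + 1) * (b L + 1) ^ ?k) * Q L" for L
  let ?X = "%L. 2 * L + (real ?k + 3)"
  define C where "C = (real ?k + 1) * ((real ?k + 1) * (real ?h ^ ?k * ((\<Phi> * exp 1 * (real ?k + 1) + 2) ^ ?k * exp (real ?k * (2 * real ?h + real ?k)))))"
  let ?M = "?k + (?k + (?k + (?k + 1) * ?h) + ?k)"
  have FC: "F L <= C * (?X L ^ ?M * exp (- (eps / 2 * L)))" if L: "0 <= L" for L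
  proof -
   let ?n = "real (b L + 1)"
   have nX: "?n <= ?X L"
    using of_int_ceiling_le_add_one[of "2 * L + 1 + real ?k"] L by (simp add: b_def of_nat_nat)
   have X1: "1 <= ?X L" using L by simp
   have p: "?n ^ i <= ?X L ^ i" for i using nX by (intro power_mono) auto
   have 1: "real ((?k + 1) * (b L + 1) ^ ?k) <= (real ?k + 1) * ?X L ^ ?k"
   proof -
    have "real ((?k + 1) * (b L + 1) ^ ?k) = (real ?k + 1) * ?n ^ ?k" by (simp only: of_nat_mult of_nat_power of_nat_add of_nat_1)
    also have "... <= (real ?k + 1) * ?X L ^ ?k" by (intro mult_left_mono p) simp
    finally show ?thesis .
   qed
   have 2: "real ((?k + 1) * ((b L + 1) ^ ?k * (?h ^ ?k * ((b L + 1) ^ ?k * (b L + 1) ^ ((?k + 1) * ?h)))))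
    <= (real ?k + 1) * (?X L ^ ?k * (real ?h ^ ?k * (?X L ^ ?k * ?X L ^ ((?k + 1) * ?h))))"
   proof -
    have "real ((?k + 1) * ((b L + 1) ^ ?k * (?h ^ ?k * ((b L + 1) ^ ?k * (b L + 1) ^ ((?k + 1) * ?h)))))
     = (real ?k + 1) * (?n ^ ?k * (real ?h ^ ?k * (?n ^ ?k * ?n ^ ((?k + 1) * ?h))))"
     by (simp only: of_nat_mult[where 'a = real] of_nat_power of_nat_add[of ?k 1] of_nat_1)
    also have "... <= (real ?k + 1) * (?X L ^ ?k * (real ?h ^ ?k * (?X L ^ ?k * ?X L ^ ((?k + 1) * ?h))))"
     using X1 by (intro mult_left_mono mult_mono p) auto
    finally show ?thesis .
   qed
   have 3: "(\<Phi> * exp 1 * (real (b L) + real ?k) + 2) ^ ?k <= (\<Phi> * exp 1 * (real ?k + 1) + 2) ^ ?k * ?X L ^ ?k"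
    unfolding power_mult_distrib[symmetric]
   proof (rule power_mono)
    have "real ?k * 1 <= real ?k * ?X L" using X1 by (intro mult_left_mono) auto
    then have "real (b L) + real ?k <= (real ?k + 1) * ?X L" using nX by (simp add: algebra_simps)
    then have "\<Phi> * exp 1 * (real (b L) + real ?k) <= \<Phi> * exp 1 * ((real ?k + 1) * ?X L)" using \<Phi> by (intro mult_left_mono) auto
    then show "\<Phi> * exp 1 * (real (b L) + real ?k) + 2 <= (\<Phi> * exp 1 * (real ?k + 1) + 2) * ?X L"
     using X1 by (simp add: distrib_right mult.assoc)
    show "0 <= \<Phi> * exp 1 * (real (b L) + real ?k) + 2" using \<Phi> by simp
   qed
   have 4: "exp (- eps * L + real ?k * (real ?h * (2 + eps1 * L) + real ?k)) <= exp (real ?k * (2 * real ?h + real ?k)) * exp (- (eps / 2 * L))"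
   proof -
    have "real ?k * real ?h * eps1 * L <= eps / 2 * L" by (intro mult_right_mono eps1 L)
    then show ?thesis unfolding exp_add[symmetric] exp_le_cancel_iff by (simp add: algebra_simps)
   qed
   have "F L <= ((real ?k + 1) * ?X L ^ ?k) * (((real ?k + 1) * (?X L ^ ?k * (real ?h ^ ?k * (?X L ^ ?k * ?X L ^ ((?k + 1) * ?h))))) *
    (((\<Phi> * exp 1 * (real ?k + 1) + 2) ^ ?k * ?X L ^ ?k) * (exp (real ?k * (2 * real ?h + real ?k)) * exp (- (eps / 2 * L)))))"
    unfolding F_def Q_def using \<Phi> X1 by (intro mult_mono 1 2 3 4) auto
   also have "... = C * (?X L ^ ?M * exp (- (eps / 2 * L)))" unfolding C_def power_add by (simp only: mult_ac)
   finally show ?thesis .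
  qed
  have "((%L. C * (?X L ^ ?M * exp (- (eps / 2 * L)))) \<longlongrightarrow> C * 0) at_top"
   using eps by (intro tendsto_mult[OF tendsto_const] power_times_exp_tendsto_0) auto
  then have "eventually (%L. C * (?X L ^ ?M * exp (- (eps / 2 * L))) < 1 / 8) at_top"
   by (rule order_tendstoD) simp
  then have "eventually (%L. 0 < L & C * (?X L ^ ?M * exp (- (eps / 2 * L))) < 1 / 8 &
    (\<forall>G. finite G \<longrightarrow> prb G (%A. \<not> typical eps1 L A) <= 1 / 8)) at_top"
   using eps1 by (intro eventually_conj eventually_gt_at_top prb_not_typical) auto
  then have "eventually (%D. 0 < ln D & C * (?X (ln D) ^ ?M * exp (- (eps / 2 * ln D))) < 1 / 8 &
    (\<forall>G. finite G \<longrightarrow> prb G (%A. \<not> typical eps1 (ln D) A) <= 1 / 8)) at_top"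
   by (rule eventually_compose_filterlim[OF _ ln_at_top])
  moreover have "eventually (%D. 1 / 2 < ?m c0 D) at_top" using lim by (rule order_tendstoD) simp
  \<comment> \<open>The absurd predicate expresses that all sufficiently large D lead to a
    contradiction: the success probability would be both above and below 1/2.\<close>
  ultimately have "eventually (%D. D < (D :: real)) at_top"
   using eventually_gt_at_top[of "1 :: real"]
  proof eventually_elim
   case (elim D)
   define L where "L = ln D"
   let ?G = "{a::nat. 1 <= a & D powr c0 <= real a & real a <= D}"
   have L: "0 < L" using elim by (simp add: L_def)
   have finG: "finite ?G" by (rule finite_subset[of _ "{..nat \<lfloor>D\<rfloor>}"]) (auto simp: le_nat_floor)
   have rangeG: "1 <= a & c0 * L <= ln (real a) & ln (real a) <= L" if "a \<in> ?G" for a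
   proof -
    have a: "1 <= a" "D powr c0 <= real a" "real a <= D" using that by auto
    have "ln (D powr c0) <= ln (real a)" using a elim by (subst ln_le_cancel_iff) auto
    moreover have "ln (real a) <= ln D" using a elim by (subst ln_le_cancel_iff) auto
    ultimately show ?thesis using a elim by (simp add: L_def ln_powr)
   qed
   have b: "2 * L + 1 + real ?k <= real (b L)" unfolding b_def by (rule real_nat_ceiling_ge)
   have "prb ?G (%A. has_equal_sums ?k A & typical eps1 L A) <= F L"
    unfolding F_def
   proof (rule prb_equal_sums_typical[OF L c0(1,2) _ eps1(2) k2 finG rangeG b])
    show "0 <= Q L" unfolding Q_def using \<Phi> by (intro mult_nonneg_nonneg) auto
    fix A and \<K> :: "nat set set"
    assume \<K>: "finite \<K>" "!!K. K \<in> \<K> ==> \<exists>r p om. pivoted eps1 L c0 A K r p (om :: nat => rat ^ 'k)"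
    show "(\<Sum>K\<in>\<K>. \<Prod>a\<in>K. 1 / real a) <= Q L"
     unfolding Q_def
    proof (rule pivot_sets_weight[OF L c0(1,2) _ eps1(2) k2 \<Phi> functional gap \<K>])
     show "0 <= eps1" using eps1 by simp
     show "2 * L + 1 <= real (b L)" using b by linarith
    qed
   qed (use eps1 in simp)
   also have "F L < 1 / 8" using FC[of L] elim L by (auto simp: L_def)
   finally have 1: "prb ?G (%A. has_equal_sums ?k A & typical eps1 L A) < 1 / 8" .
   have "prb ?G (has_equal_sums ?k) <= prb ?G (%A. (has_equal_sums ?k A & typical eps1 L A) \<or> \<not> typical eps1 L A)"
    by (rule prb_mono) blast
   also have "... <= prb ?G (%A. has_equal_sums ?k A & typical eps1 L A) + prb ?G (%A. \<not> typical eps1 L A)" by (rule prb_disj)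
   also have "prb ?G (%A. \<not> typical eps1 L A) <= 1 / 8" using elim finG by (simp add: L_def)
   finally have "?m c0 D < 1 / 2" using 1 unfolding measure_equal_sums_event by simp
   then show ?case using elim by simp
  qed
  then show False by (simp add: trivial_limit_at_top_linorder)
 qed
 then obtain r and V :: "nat => (rat ^ 'k) set" and \<mu> c' where
  s: "system r V c' \<mu>" "c' (r + 1) = c0" "entropy_condition r V c' \<mu>" by blast
 have "x <= ereal c0" using c0 x by simp
 also have "ereal c0 <= gamma TYPE('k)" unfolding gamma_def
  by (rule Sup_upper) (use s in blast)
 finally show "x <= gamma TYPE('k)" .
qed

theorem theorem7:
  assumes "CARD('k::finite) \<ge> 2"
  shows "gamma_tilde TYPE('k) \<le> beta CARD('k) \<and> beta CARD('k) \<le> gamma TYPE('k)"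
  using gamma_tilde_le_beta beta_le_gamma[OF assms] by blast

end
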